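(* Consider the following statement (the coisotropic Arnol'd-Givental conjecture): (CAG) Let $(M_i,\omega_i)$, $i=1,2$, be symplectic manifolds, with $M_1$ closed, and let $L\subseteq M_2$ be a closed Lagrangian submanifold. Let $M:=M_1\times M_2$, $\omega:=\omega_1\oplus\omega_2$, and $N:=M_1\times L$. Assume that there exists an anti-symplectic involution $\psi:M_2\to M_2$ such that $\operatorname{Fix}(\psi)=L$. Let $\varphi\in\operatorname{Ham}(M,\omega)$ be such that $(N,\varphi)$ is non-degenerate. Then $|\operatorname{Fix}(\varphi,N)|\geq\sum_{i=0}^{\dim N}b_i(N,\mathbb Z_2)$. Let the Lagrangian Arnol'd-Givental conjecture be the special case of (CAG) in which $M_1$ is a point. If the Lagrangian Arnol'd-Givental conjecture is true (for all data as in its hypotheses), then (CAG) is true (for all data as in its hypotheses).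
   Context: Conventions: manifolds are smooth, Hausdorff, second countable and without boundary; submanifolds are embedded; "closed" means compact without boundary. $b_i(N,\mathbb Z_2)$ is the rank of $H_i(N,\mathbb Z_2)$. An involution is a map whose square is the identity; a diffeomorphism $\psi$ of $(M_2,\omega_2)$ is anti-symplectic iff $\psi^*\omega_2=-\omega_2$; $\operatorname{Fix}(\psi)$ is its fixed point set. Hamiltonian diffeomorphisms: $\operatorname{Ham}(M,\omega)$ is the group of time-1 maps (when they exist) of the flows of $(X_{H_t})_{t\in[0,1]}$, where $H\in C^\infty([0,1]\times M,\mathbb R)$, $H_t:=H(t,\cdot)$ and $dH_t=\omega(X_{H_t},\cdot)$. Coisotropic submanifolds: for a submanifold $N\subseteq M$ and $x\in N$ put $T_xN^\omega:=\{v\in T_xM\mid \omega(v,w)=0\ \forall w\in T_xN\}$. $N$ is coisotropic iff $T_xN^\omega\subseteq T_xN$ for all $x\in N$ (in (CAG) $N=M_1\times L$ is coisotropic). The isotropic leaf through $x\in N$ is $N_x:=\{y(1)\mid y\in C^\infty([0,1],N),\ y(0)=x,\ \dot y(t)\in T_{y(t)}N^\omega\ \forall t\}$. $\operatorname{Fix}(\varphi,N):=\{x\in N\mid\varphi(x)\in N_x\}$. Linear holonomy: for $x_0\in N$ let $\operatorname{pr}_{x_0}:T_{x_0}N\to T_{x_0}N/T_{x_0}N^\omega$ be the canonical projection. Let $F\subseteq N$ be an isotropic leaf and $x\in C^\infty([0,1],F)$ (a smooth path with values in $F$). Put $V:=T_{x(0)}N/T_{x(0)}N^\omega$, choose a linear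 map $T:V\to T_{x(0)}N$ with $\operatorname{pr}_{x(0)}T=\operatorname{id}_V$ and a smooth map $u:[0,1]\times V\to N$ such that $u(t,0)=x(t)$ for all $t$, $u(t,y)$ and $u(0,y)$ lie in the same isotropic leaf for all $t,y$, and $d(u(0,\cdot))(0)=T$. The linear holonomy along $x$ is $\operatorname{hol}^{\omega,N}_x:=\operatorname{pr}_{x(1)}\,d(u(1,\cdot))(0):V\to T_{x(1)}N/T_{x(1)}N^\omega$; it exists and does not depend on the choices. Non-degeneracy: $(N,\varphi)$ is non-degenerate iff for every isotropic leaf $F\subseteq N$, every $x\in C^\infty([0,1],F)$ with $\varphi(x(0))=x(1)$, and every $0\neq v\in T_{x(0)}N\cap T_{x(0)}\varphi^{-1}(N)$ we have $\operatorname{hol}^{\omega,N}_x\operatorname{pr}_{x(0)}v\neq\operatorname{pr}_{x(1)}d\varphi(x(0))v$. *)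

theory Defs
  imports "HOL-Analysis.Analysis" "HOL-Homology.Homology"
begin

section \<open>Smooth functions on subsets of Euclidean space\<close>

text \<open>
  The dimension of a manifold is a natural number over which we quantify inside formulas. Hence
  the \<open>n\<close>-dimensional Euclidean space is the library's \<^const>\<open>Euclidean_space\<close>: its points
  are the functions \<open>x :: nat \<Rightarrow> real\<close> with \<open>x i = 0\<close> for \<open>i \<ge> n\<close>. As this type is not normed,
  smoothness is expressed by iterated partial derivatives.
\<close>

type_synonym vec = "nat \<Rightarrow> real"

definition vec_linear :: "nat \<Rightarrow> (vec \<Rightarrow> vec) \<Rightarrow> bool" where
  "vec_linear n f \<longleftrightarrow>
    (\<forall>v\<in>topspace (Euclidean_space n). \<forall>w\<in>topspace (Euclidean_space n). \<forall>a.
      f (\<lambda>i. a * v i + w i) = (\<lambda>i. a * f v i + f w i))"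

definition partial_deriv :: "nat \<Rightarrow> (vec \<Rightarrow> real) \<Rightarrow> vec \<Rightarrow> real" where
  "partial_deriv i f x = deriv (\<lambda>s. f (x(i := s))) (x i)"

primrec C_diff :: "nat \<Rightarrow> nat \<Rightarrow> vec set \<Rightarrow> (vec \<Rightarrow> real) \<Rightarrow> bool" where
  "C_diff n 0 U f \<longleftrightarrow> continuous_map (subtopology (Euclidean_space n) U) euclideanreal f"
| "C_diff n (Suc r) U f \<longleftrightarrow>
    continuous_map (subtopology (Euclidean_space n) U) euclideanreal f \<and>
    (\<forall>i<n. (\<forall>x\<in>U. (\<lambda>s. f (x(i := s))) differentiable (at (x i))) \<and>
           C_diff n r U (partial_deriv i f))"

text \<open>
  A function on an arbitrary subset \<open>A\<close> of Euclidean space (such as \<open>[0,1] \<times> U\<close>) is smooth iff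
  it locally extends to a smooth function on an open set.
\<close>

definition smooth_fun_on :: "nat \<Rightarrow> vec set \<Rightarrow> (vec \<Rightarrow> real) \<Rightarrow> bool" where
  "smooth_fun_on n A f \<longleftrightarrow>
    (\<forall>x\<in>A. \<exists>U g. openin (Euclidean_space n) U \<and> x \<in> U \<and> (\<forall>r. C_diff n r U g) \<and>
                 (\<forall>y\<in>A \<inter> U. f y = g y))"

definition smooth_vec_on :: "nat \<Rightarrow> nat \<Rightarrow> vec set \<Rightarrow> (vec \<Rightarrow> vec) \<Rightarrow> bool" where
  "smooth_vec_on n m A f \<longleftrightarrow> (\<forall>j<m. smooth_fun_on n A (\<lambda>x. f x j))"


section \<open>Smooth manifolds\<close>

text \<open>
  A chart is a pair of its domain and its coordinate map. The atlas of a manifold need not be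
  maximal; the smooth structure is the one generated by it.
\<close>

type_synonym 'a chart = "'a set \<times> ('a \<Rightarrow> vec)"

record 'a manifold =
  mtop :: "'a topology"
  mdim :: nat
  atlas :: "'a chart set"

abbreviation points :: "'a manifold \<Rightarrow> 'a set" where
  "points M \<equiv> topspace (mtop M)"

definition chart_inv :: "'a chart \<Rightarrow> vec \<Rightarrow> 'a" where
  "chart_inv C = inv_into (fst C) (snd C)"

definition topological_chart :: "'a topology \<Rightarrow> nat \<Rightarrow> 'a chart \<Rightarrow> bool" where
  "topological_chart X n C \<longleftrightarrow>
    openin X (fst C) \<and> openin (Euclidean_space n) (snd C ` fst C) \<and>
    homeomorphic_map (subtopology X (fst C))
      (subtopology (Euclidean_space n) (snd C ` fst C)) (snd C)"

definition smooth_transition :: "nat \<Rightarrow> 'a chart \<Rightarrow> 'a chart \<Rightarrow> bool" where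
  "smooth_transition n C D \<longleftrightarrow>
    smooth_vec_on n n (snd C ` (fst C \<inter> fst D)) (snd D \<circ> chart_inv C)"

definition smooth_manifold :: "'a manifold \<Rightarrow> bool" where
  "smooth_manifold M \<longleftrightarrow>
    Hausdorff_space (mtop M) \<and> second_countable (mtop M) \<and>
    (\<forall>C\<in>atlas M. topological_chart (mtop M) (mdim M) C) \<and>
    (\<Union>C\<in>atlas M. fst C) = points M \<and>
    (\<forall>C\<in>atlas M. \<forall>D\<in>atlas M. smooth_transition (mdim M) C D)"

definition maximal_atlas :: "'a manifold \<Rightarrow> 'a chart set" where
  "maximal_atlas M = {C. topological_chart (mtop M) (mdim M) C \<and>
    (\<forall>D\<in>atlas M. smooth_transition (mdim M) C D \<and> smooth_transition (mdim M) D C)}"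

definition real_line :: "real manifold" where
  "real_line = \<lparr>mtop = euclideanreal, mdim = 1,
     atlas = {(UNIV, \<lambda>t i. if i = 0 then t else 0)}\<rparr>"

definition vec_manifold :: "nat \<Rightarrow> vec manifold" where
  "vec_manifold n = \<lparr>mtop = Euclidean_space n, mdim = n,
     atlas = {(topspace (Euclidean_space n), \<lambda>x. x)}\<rparr>"

definition prod_chart :: "nat \<Rightarrow> 'a chart \<Rightarrow> 'b chart \<Rightarrow> ('a \<times> 'b) chart" where
  "prod_chart m C D =
    (fst C \<times> fst D, \<lambda>p i. if i < m then snd C (fst p) i else snd D (snd p) (i - m))"

definition prod_manifold :: "'a manifold \<Rightarrow> 'b manifold \<Rightarrow> ('a \<times> 'b) manifold" where
  "prod_manifold M M' = \<lparr>mtop = prod_topology (mtop M) (mtop M'), mdim = mdim M + mdim M',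
     atlas = {prod_chart (mdim M) C D | C D. C \<in> atlas M \<and> D \<in> atlas M'}\<rparr>"

definition closed_manifold :: "'a manifold \<Rightarrow> bool" where
  "closed_manifold M \<longleftrightarrow> smooth_manifold M \<and> compact_space (mtop M)"

definition smooth_map_on :: "'a manifold \<Rightarrow> 'a set \<Rightarrow> 'b manifold \<Rightarrow> ('a \<Rightarrow> 'b) \<Rightarrow> bool" where
  "smooth_map_on M A M' f \<longleftrightarrow>
    continuous_map (subtopology (mtop M) A) (mtop M') f \<and>
    (\<forall>C\<in>atlas M. \<forall>D\<in>atlas M'.
      smooth_vec_on (mdim M) (mdim M') (snd C ` (A \<inter> fst C \<inter> f -` fst D))
        (snd D \<circ> f \<circ> chart_inv C))"

definition diffeomorphism :: "'a manifold \<Rightarrow> 'b manifold \<Rightarrow> ('a \<Rightarrow> 'b) \<Rightarrow> bool" where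
  "diffeomorphism M M' f \<longleftrightarrow>
    smooth_map_on M (points M) M' f \<and>
    (\<exists>g. smooth_map_on M' (points M') M g \<and>
         (\<forall>x\<in>points M. g (f x) = x) \<and> (\<forall>y\<in>points M'. f (g y) = y))"


section \<open>Tangent vectors\<close>

text \<open>
  A tangent vector at \<open>x\<close> is given by its coordinates with respect to a chosen chart
  \<open>chart_at M x\<close> around \<open>x\<close>. Thus \<open>T\<^sub>xM\<close> is a copy of Euclidean space for every \<open>x\<close>. The
  derivative of a map at \<open>x\<close> is its Jacobian matrix in the chosen charts around \<open>x\<close> and \<open>f x\<close>.
\<close>

definition chart_at :: "'a manifold \<Rightarrow> 'a \<Rightarrow> 'a chart" where
  "chart_at M x = (SOME C. C \<in> atlas M \<and> x \<in> fst C)"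

definition tangent_space :: "'a manifold \<Rightarrow> 'a \<Rightarrow> vec set" where
  "tangent_space M x = topspace (Euclidean_space (mdim M))"

definition differential :: "'a manifold \<Rightarrow> 'b manifold \<Rightarrow> ('a \<Rightarrow> 'b) \<Rightarrow> 'a \<Rightarrow> vec \<Rightarrow> vec" where
  "differential M M' f x v =
    (\<lambda>j. if j < mdim M'
         then \<Sum>i<mdim M.
           partial_deriv i (\<lambda>y. snd (chart_at M' (f x)) (f (chart_inv (chart_at M x) y)) j)
             (snd (chart_at M x) x) * v i
         else 0)"

text \<open>
  The velocity at time \<open>t\<close> of a curve defined on \<open>I\<close>; it is one-sided at the endpoints of \<open>I\<close>.
\<close>

definition velocity :: "'a manifold \<Rightarrow> real set \<Rightarrow> (real \<Rightarrow> 'a) \<Rightarrow> real \<Rightarrow> vec" where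
  "velocity M I c t =
    (\<lambda>j. if j < mdim M
         then vector_derivative (\<lambda>s. snd (chart_at M (c t)) (c s) j) (at t within I)
         else 0)"

definition embedded_submanifold :: "'a manifold \<Rightarrow> nat \<Rightarrow> 'a set \<Rightarrow> bool" where
  "embedded_submanifold M k N \<longleftrightarrow>
    N \<subseteq> points M \<and> k \<le> mdim M \<and>
    (\<forall>x\<in>N. \<exists>C\<in>maximal_atlas M. x \<in> fst C \<and>
      snd C ` (fst C \<inter> N) = snd C ` fst C \<inter> topspace (Euclidean_space k))"

text \<open>
  The tangent space of a submanifold \<open>N\<close>, as a subspace of \<open>T\<^sub>xM\<close>, consists of the velocities of
  the smooth curves in \<open>N\<close>. (A map into an embedded submanifold of \<open>M\<close> is smooth iff it is smooth
  as a map into \<open>M\<close>.)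
\<close>

definition sub_tangent :: "'a manifold \<Rightarrow> 'a set \<Rightarrow> 'a \<Rightarrow> vec set" where
  "sub_tangent M N x =
    {velocity M UNIV c 0 | c. smooth_map_on real_line UNIV M c \<and> range c \<subseteq> N \<and> c 0 = x}"

definition smooth_path :: "'a manifold \<Rightarrow> 'a set \<Rightarrow> (real \<Rightarrow> 'a) \<Rightarrow> bool" where
  "smooth_path M F c \<longleftrightarrow> smooth_map_on real_line {0..1} M c \<and> c ` {0..1} \<subseteq> F"


section \<open>Symplectic manifolds\<close>

type_synonym 'a two_form = "'a \<Rightarrow> vec \<Rightarrow> vec \<Rightarrow> real"

definition alternating_bilinear :: "'a manifold \<Rightarrow> 'a two_form \<Rightarrow> bool" where
  "alternating_bilinear M \<omega> \<longleftrightarrow>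
    (\<forall>x\<in>points M. \<forall>u\<in>tangent_space M x. \<forall>v\<in>tangent_space M x. \<forall>w\<in>tangent_space M x. \<forall>a.
      \<omega> x (\<lambda>i. a * u i + v i) w = a * \<omega> x u w + \<omega> x v w \<and> \<omega> x v w = - \<omega> x w v)"

definition nondegenerate_form :: "'a manifold \<Rightarrow> 'a two_form \<Rightarrow> bool" where
  "nondegenerate_form M \<omega> \<longleftrightarrow>
    (\<forall>x\<in>points M. \<forall>v\<in>tangent_space M x. (\<forall>w\<in>tangent_space M x. \<omega> x v w = 0) \<longrightarrow> v = (\<lambda>_. 0))"

text \<open>The \<open>i\<close>-th coordinate vector field of a chart, at the point with coordinates \<open>y\<close>.\<close>

definition coord_vec :: "'a manifold \<Rightarrow> 'a chart \<Rightarrow> nat \<Rightarrow> vec \<Rightarrow> vec" where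
  "coord_vec M C i y =
    differential (vec_manifold (mdim M)) M (chart_inv C) y (\<lambda>j. if j = i then 1 else 0)"

definition form_coeff :: "'a manifold \<Rightarrow> 'a two_form \<Rightarrow> 'a chart \<Rightarrow> nat \<Rightarrow> nat \<Rightarrow> vec \<Rightarrow> real" where
  "form_coeff M \<omega> C i j y = \<omega> (chart_inv C y) (coord_vec M C i y) (coord_vec M C j y)"

definition smooth_form :: "'a manifold \<Rightarrow> 'a two_form \<Rightarrow> bool" where
  "smooth_form M \<omega> \<longleftrightarrow>
    (\<forall>C\<in>atlas M. \<forall>i<mdim M. \<forall>j<mdim M. smooth_fun_on (mdim M) (snd C ` fst C) (form_coeff M \<omega> C i j))"

definition closed_form :: "'a manifold \<Rightarrow> 'a two_form \<Rightarrow> bool" where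
  "closed_form M \<omega> \<longleftrightarrow>
    (\<forall>C\<in>atlas M. \<forall>y\<in>snd C ` fst C. \<forall>i<mdim M. \<forall>j<mdim M. \<forall>k<mdim M.
      partial_deriv i (form_coeff M \<omega> C j k) y + partial_deriv j (form_coeff M \<omega> C k i) y
        + partial_deriv k (form_coeff M \<omega> C i j) y = 0)"

definition symplectic_manifold :: "'a manifold \<Rightarrow> 'a two_form \<Rightarrow> bool" where
  "symplectic_manifold M \<omega> \<longleftrightarrow>
    smooth_manifold M \<and> alternating_bilinear M \<omega> \<and> smooth_form M \<omega> \<and> closed_form M \<omega> \<and>
    nondegenerate_form M \<omega>"

definition prod_form ::
  "'a manifold \<Rightarrow> 'a two_form \<Rightarrow> 'b manifold \<Rightarrow> 'b two_form \<Rightarrow> ('a \<times> 'b) two_form" where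
  "prod_form M \<omega> M' \<omega>' = (\<lambda>p v w.
    \<omega> (fst p) (differential (prod_manifold M M') M fst p v)
              (differential (prod_manifold M M') M fst p w) +
    \<omega>' (snd p) (differential (prod_manifold M M') M' snd p v)
               (differential (prod_manifold M M') M' snd p w))"

definition symplectic_complement :: "'a manifold \<Rightarrow> 'a two_form \<Rightarrow> 'a set \<Rightarrow> 'a \<Rightarrow> vec set" where
  "symplectic_complement M \<omega> N x =
    {v\<in>tangent_space M x. \<forall>w\<in>sub_tangent M N x. \<omega> x v w = 0}"

definition lagrangian_submanifold ::
  "'a manifold \<Rightarrow> 'a two_form \<Rightarrow> nat \<Rightarrow> 'a set \<Rightarrow> bool" where
  "lagrangian_submanifold M \<omega> k L \<longleftrightarrow>
    embedded_submanifold M k L \<and>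
    (\<forall>x\<in>L. symplectic_complement M \<omega> L x = sub_tangent M L x)"

definition antisymplectic_involution :: "'a manifold \<Rightarrow> 'a two_form \<Rightarrow> ('a \<Rightarrow> 'a) \<Rightarrow> bool" where
  "antisymplectic_involution M \<omega> \<psi> \<longleftrightarrow>
    diffeomorphism M M \<psi> \<and> (\<forall>x\<in>points M. \<psi> (\<psi> x) = x) \<and>
    (\<forall>x\<in>points M. \<forall>v\<in>tangent_space M x. \<forall>w\<in>tangent_space M x.
      \<omega> (\<psi> x) (differential M M \<psi> x v) (differential M M \<psi> x w) = - \<omega> x v w)"

definition hamiltonian_vector_field ::
  "'a manifold \<Rightarrow> 'a two_form \<Rightarrow> ('a \<Rightarrow> real) \<Rightarrow> ('a \<Rightarrow> vec) \<Rightarrow> bool" where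
  "hamiltonian_vector_field M \<omega> h X \<longleftrightarrow>
    (\<forall>x\<in>points M. X x \<in> tangent_space M x \<and>
      (\<forall>w\<in>tangent_space M x. differential M real_line h x w 0 = \<omega> x (X x) w))"

text \<open>
  The time-1 map of the flow, if defined on all of \<open>M\<close>, is an injective local diffeomorphism, but
  for non-compact \<open>M\<close> it need not be onto. Hence we require it to be a diffeomorphism. Smoothness
  of the flow \<open>\<Phi>\<close> is automatic.
\<close>

definition Ham :: "'a manifold \<Rightarrow> 'a two_form \<Rightarrow> ('a \<Rightarrow> 'a) set" where
  "Ham M \<omega> = {\<phi>. diffeomorphism M M \<phi> \<and>
    (\<exists>H X \<Phi>.
      smooth_map_on (prod_manifold real_line M) ({0..1} \<times> points M) real_line (\<lambda>p. H (fst p) (snd p)) \<and>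
      (\<forall>t\<in>{0..1}. hamiltonian_vector_field M \<omega> (H t) (X t)) \<and>
      smooth_map_on (prod_manifold real_line M) ({0..1} \<times> points M) M (\<lambda>p. \<Phi> (fst p) (snd p)) \<and>
      (\<forall>x\<in>points M. \<Phi> 0 x = x \<and>
        (\<forall>t\<in>{0..1}. velocity M {0..1} (\<lambda>s. \<Phi> s x) t = X t (\<Phi> t x)) \<and>
        \<phi> x = \<Phi> 1 x))}"


section \<open>Isotropic leaves, linear holonomy and non-degeneracy\<close>

definition isotropic_leaf :: "'a manifold \<Rightarrow> 'a two_form \<Rightarrow> 'a set \<Rightarrow> 'a \<Rightarrow> 'a set" where
  "isotropic_leaf M \<omega> N x =
    {y 1 | y. smooth_path M N y \<and> y 0 = x \<and>
      (\<forall>t\<in>{0..1}. velocity M {0..1} y t \<in> symplectic_complement M \<omega> N (y t))}"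

definition leafwise_fixed_points ::
  "'a manifold \<Rightarrow> 'a two_form \<Rightarrow> 'a set \<Rightarrow> ('a \<Rightarrow> 'a) \<Rightarrow> 'a set" where
  "leafwise_fixed_points M \<omega> N \<phi> = {x\<in>N. \<phi> x \<in> isotropic_leaf M \<omega> N x}"

definition normal_proj ::
  "'a manifold \<Rightarrow> 'a two_form \<Rightarrow> 'a set \<Rightarrow> 'a \<Rightarrow> vec \<Rightarrow> vec set" where
  "normal_proj M \<omega> N x v = {\<lambda>i. v i + z i | z. z \<in> symplectic_complement M \<omega> N x}"

definition normal_space :: "'a manifold \<Rightarrow> 'a two_form \<Rightarrow> 'a set \<Rightarrow> 'a \<Rightarrow> vec set set" where
  "normal_space M \<omega> N x = normal_proj M \<omega> N x ` sub_tangent M N x"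

text \<open>
  The linear isomorphism \<open>\<kappa>\<close> from Euclidean space onto the quotient \<open>V\<close> provides coordinates on
  \<open>V\<close>, in terms of which linearity of \<open>T\<close> and smoothness of \<open>u\<close> are expressed. Linearity of \<open>\<kappa>\<close>
  follows from \<open>\<kappa> = pr \<circ> T \<circ> \<kappa>\<close> and linearity of \<open>T \<circ> \<kappa>\<close>. The zero vector of \<open>V\<close> is
  \<open>pr 0\<close>.
\<close>

definition holonomy_data ::
  "'a manifold \<Rightarrow> 'a two_form \<Rightarrow> 'a set \<Rightarrow> (real \<Rightarrow> 'a) \<Rightarrow>
   nat \<Rightarrow> (vec \<Rightarrow> vec set) \<Rightarrow> (vec set \<Rightarrow> vec) \<Rightarrow> (real \<Rightarrow> vec set \<Rightarrow> 'a) \<Rightarrow> bool" where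
  "holonomy_data M \<omega> N x k \<kappa> T u \<longleftrightarrow>
    (let V = normal_space M \<omega> N (x 0); pr = normal_proj M \<omega> N (x 0);
         E = topspace (Euclidean_space k) in
      bij_betw \<kappa> E V \<and>
      (\<forall>W\<in>V. T W \<in> sub_tangent M N (x 0) \<and> pr (T W) = W) \<and>
      vec_linear k (\<lambda>y. T (\<kappa> y)) \<and>
      smooth_map_on (prod_manifold real_line (vec_manifold k)) ({0..1} \<times> E) M
        (\<lambda>p. u (fst p) (\<kappa> (snd p))) \<and>
      (\<forall>t\<in>{0..1}. \<forall>W\<in>V. u t W \<in> N) \<and>
      (\<forall>t\<in>{0..1}. u t (pr (\<lambda>_. 0)) = x t) \<and>
      (\<forall>t\<in>{0..1}. \<forall>W\<in>V. u t W \<in> isotropic_leaf M \<omega> N (u 0 W)) \<and>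
      (\<forall>y\<in>E. differential (vec_manifold k) M (\<lambda>z. u 0 (\<kappa> z)) (\<lambda>_. 0) y = T (\<kappa> y)))"

definition linear_holonomy ::
  "'a manifold \<Rightarrow> 'a two_form \<Rightarrow> 'a set \<Rightarrow> (real \<Rightarrow> 'a) \<Rightarrow> vec set \<Rightarrow> vec set" where
  "linear_holonomy M \<omega> N x W =
    (THE Z. \<exists>k \<kappa> T u. holonomy_data M \<omega> N x k \<kappa> T u \<and>
      (\<exists>y\<in>topspace (Euclidean_space k). \<kappa> y = W \<and>
        Z = normal_proj M \<omega> N (x 1)
              (differential (vec_manifold k) M (\<lambda>z. u 1 (\<kappa> z)) (\<lambda>_. 0) y)))"

definition nondegenerate_pair ::
  "'a manifold \<Rightarrow> 'a two_form \<Rightarrow> 'a set \<Rightarrow> ('a \<Rightarrow> 'a) \<Rightarrow> bool" where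
  "nondegenerate_pair M \<omega> N \<phi> \<longleftrightarrow>
    (\<forall>F\<in>isotropic_leaf M \<omega> N ` N. \<forall>x. smooth_path M F x \<and> \<phi> (x 0) = x 1 \<longrightarrow>
      (\<forall>v\<in>sub_tangent M N (x 0) \<inter> sub_tangent M {z\<in>points M. \<phi> z \<in> N} (x 0). v \<noteq> (\<lambda>_. 0) \<longrightarrow>
        linear_holonomy M \<omega> N x (normal_proj M \<omega> N (x 0) v)
          \<noteq> normal_proj M \<omega> N (x 1) (differential M M \<phi> (x 0) v)))"


section \<open>Betti numbers with coefficients in the field with two elements\<close>

text \<open>
  The complex of singular chains with coefficients in \<open>\<int>/2\<close> is \<open>C/2C\<close>, where \<open>C\<close> is the integral
  singular chain complex. The next two sets are the preimages in \<open>C\<close> of its cycles and boundaries,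
  so that their quotient is the homology of \<open>C/2C\<close>.
\<close>

definition mod2_cycles :: "nat \<Rightarrow> 'a topology \<Rightarrow> 'a chain set" where
  "mod2_cycles p X = {c. singular_chain p X c \<and>
    (\<exists>e. singular_chain (p - 1) X e \<and> chain_boundary p c = frag_cmul 2 e)}"

definition mod2_boundaries :: "nat \<Rightarrow> 'a topology \<Rightarrow> 'a chain set" where
  "mod2_boundaries p X = {chain_boundary (Suc p) d + frag_cmul 2 e | d e.
    singular_chain (Suc p) X d \<and> singular_chain p X e}"

definition mod2_homology_group :: "nat \<Rightarrow> 'a topology \<Rightarrow> 'a chain set monoid" where
  "mod2_homology_group p X =
    subgroup_generated (chain_group p X) (mod2_cycles p X) Mod mod2_boundaries p X"

text \<open>
  In a vector space over \<open>\<int>/2\<close> the linear span of a set is the subgroup generated by it; the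
  dimension is the least size of a spanning set, and it is infinite if no such finite set exists.
\<close>

definition mod2_betti :: "nat \<Rightarrow> 'a topology \<Rightarrow> enat" where
  "mod2_betti p X =
    Inf {enat (card S) | S. finite S \<and> S \<subseteq> carrier (mod2_homology_group p X) \<and>
      generate (mod2_homology_group p X) S = carrier (mod2_homology_group p X)}"


section \<open>The Arnol'd-Givental conjectures\<close>

definition cardinality :: "'a set \<Rightarrow> enat" where
  "cardinality S = (if finite S then enat (card S) else \<infinity>)"

text \<open>
  Here \<open>k\<close> is the dimension of \<open>L\<close>, and hence \<open>mdim M\<^sub>1 + k\<close> is the dimension of
  \<open>N = M\<^sub>1 \<times> L\<close>.
\<close>

definition AG_data ::
  "'a manifold \<Rightarrow> 'a two_form \<Rightarrow> 'b manifold \<Rightarrow> 'b two_form \<Rightarrow> nat \<Rightarrow> 'b set \<Rightarrow>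
   ('b \<Rightarrow> 'b) \<Rightarrow> ('a \<times> 'b \<Rightarrow> 'a \<times> 'b) \<Rightarrow> bool" where
  "AG_data M\<^sub>1 \<omega>\<^sub>1 M\<^sub>2 \<omega>\<^sub>2 k L \<psi> \<phi> \<longleftrightarrow>
    symplectic_manifold M\<^sub>1 \<omega>\<^sub>1 \<and> closed_manifold M\<^sub>1 \<and> symplectic_manifold M\<^sub>2 \<omega>\<^sub>2 \<and>
    lagrangian_submanifold M\<^sub>2 \<omega>\<^sub>2 k L \<and> compactin (mtop M\<^sub>2) L \<and>
    antisymplectic_involution M\<^sub>2 \<omega>\<^sub>2 \<psi> \<and> {x\<in>points M\<^sub>2. \<psi> x = x} = L \<and>
    \<phi> \<in> Ham (prod_manifold M\<^sub>1 M\<^sub>2) (prod_form M\<^sub>1 \<omega>\<^sub>1 M\<^sub>2 \<omega>\<^sub>2) \<and>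
    nondegenerate_pair (prod_manifold M\<^sub>1 M\<^sub>2) (prod_form M\<^sub>1 \<omega>\<^sub>1 M\<^sub>2 \<omega>\<^sub>2) (points M\<^sub>1 \<times> L) \<phi>"

definition AG_inequality ::
  "'a manifold \<Rightarrow> 'a two_form \<Rightarrow> 'b manifold \<Rightarrow> 'b two_form \<Rightarrow> nat \<Rightarrow> 'b set \<Rightarrow>
   ('a \<times> 'b \<Rightarrow> 'a \<times> 'b) \<Rightarrow> bool" where
  "AG_inequality M\<^sub>1 \<omega>\<^sub>1 M\<^sub>2 \<omega>\<^sub>2 k L \<phi> \<longleftrightarrow>
    cardinality (leafwise_fixed_points (prod_manifold M\<^sub>1 M\<^sub>2) (prod_form M\<^sub>1 \<omega>\<^sub>1 M\<^sub>2 \<omega>\<^sub>2)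
        (points M\<^sub>1 \<times> L) \<phi>)
    \<ge> (\<Sum>i\<le>mdim M\<^sub>1 + k.
          mod2_betti i (subtopology (mtop (prod_manifold M\<^sub>1 M\<^sub>2)) (points M\<^sub>1 \<times> L)))"

text \<open>
  The conjectures for manifolds whose points belong to the given types. A Hausdorff second
  countable space has at most continuum many points. Therefore every manifold is diffeomorphic to
  one whose points are real numbers (with an arbitrary topology), and the instance \<open>TYPE(real)\<close>
  covers all manifolds.
\<close>

definition coisotropic_Arnold_Givental :: "'a itself \<Rightarrow> 'b itself \<Rightarrow> bool" where
  "coisotropic_Arnold_Givental _ _ \<longleftrightarrow>
    (\<forall>(M\<^sub>1 :: 'a manifold) \<omega>\<^sub>1 (M\<^sub>2 :: 'b manifold) \<omega>\<^sub>2 k L \<psi> \<phi>.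
      AG_data M\<^sub>1 \<omega>\<^sub>1 M\<^sub>2 \<omega>\<^sub>2 k L \<psi> \<phi> \<longrightarrow> AG_inequality M\<^sub>1 \<omega>\<^sub>1 M\<^sub>2 \<omega>\<^sub>2 k L \<phi>)"

definition Lagrangian_Arnold_Givental :: "'a itself \<Rightarrow> 'b itself \<Rightarrow> bool" where
  "Lagrangian_Arnold_Givental _ _ \<longleftrightarrow>
    (\<forall>(M\<^sub>1 :: 'a manifold) \<omega>\<^sub>1 (M\<^sub>2 :: 'b manifold) \<omega>\<^sub>2 k L \<psi> \<phi>.
      (\<exists>p. points M\<^sub>1 = {p}) \<and> AG_data M\<^sub>1 \<omega>\<^sub>1 M\<^sub>2 \<omega>\<^sub>2 k L \<psi> \<phi> \<longrightarrow>
        AG_inequality M\<^sub>1 \<omega>\<^sub>1 M\<^sub>2 \<omega>\<^sub>2 k L \<phi>)"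

end

theory Submission
  imports Defs
begin

text \<open>
  Replace \<open>M\<^sub>2\<close> by \<open>M\<^sub>1 \<times> M\<^sub>2 \<times> M\<^sub>1\<close> with the form \<open>\<omega>\<^sub>1 \<oplus> \<omega>\<^sub>2 \<oplus> (-\<omega>\<^sub>1)\<close>, the Lagrangian \<open>L\<close> by
  \<open>{(x, l, x)}\<close>, which is a copy of \<open>N = M\<^sub>1 \<times> L\<close>, the involution \<open>\<psi>\<close> by \<open>(x, y, x') \<mapsto> (x', \<psi> y, x)\<close>, and
  \<open>\<phi>\<close> by \<open>\<phi> \<times> id\<close>, which is generated by the Hamiltonian of \<open>\<phi>\<close>. The new leafwise fixed points project
  injectively to those of \<open>\<phi>\<close>, since \<open>\<phi>(x, l) = (x', l')\<close> and \<open>(x', l', x)\<close> in the Lagrangian force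
  \<open>x' = x\<close>. The linear holonomy of \<open>N\<close> is the identity of \<open>TM\<^sub>1\<close>, so a vector \<open>(v, w, v)\<close> that makes the
  Lagrangian pair degenerate projects to a vector \<open>(v, w)\<close> that makes \<open>(N, \<phi>)\<close> degenerate. By second
  countability the points can be moved injectively to real numbers, and a factor that is a
  point turns the situation into an instance of the Lagrangian conjecture.

  All tangent vectors are handled as velocities of curves: velocities satisfy the chain rule, and every
  tangent vector is the velocity of a smooth curve defined on the whole real line.
\<close>

section \<open>Calculus on coordinate spaces\<close>

text \<open>The sign in \<open>-\<omega>\<^sub>1\<close> does double duty: it makes the diagonal of
  \<open>M\<^sub>1 \<times> M\<^sub>1\<close> Lagrangian, and it makes the exchange of the two
  copies anti-symplectic, so that an involution exists although \<open>M\<^sub>1\<close> is given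
  none. The third factor records the first coordinate of the starting point; this is how a
  Lagrangian condition can express that a leafwise fixed point returns to the same fibre
  \<open>{x} \<times> L\<close>. All comparisons go one way: an injection of fixed points, a
  surjection on homology, and the passage of non-degeneracy to the larger product. The delicate
  notion is linear holonomy, a definite description over all choices of data. For \<open>N\<close>
  it is computed completely, existence of the data included. On the new Lagrangian, a common tangent
  vector of the kind tested by non-degeneracy already contradicts non-degeneracy of
  \<open>N\<close>. Tangent vectors are coordinates in arbitrarily chosen charts, and the charts
  chosen for a product or a copy are unrelated to those chosen for the original manifolds. Working
  with curves avoids comparing them.\<close>

abbreviation Espace :: "nat \<Rightarrow> vec set" where
  "Espace n \<equiv> topspace (Euclidean_space n)"

lemma mem_Espace: "x \<in> Espace n \<longleftrightarrow> (\<forall>i\<ge>n. x i = 0)"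
  by (simp add: topspace_Euclidean_space)

lemma EspaceD: "x \<in> Espace n \<Longrightarrow> n \<le> i \<Longrightarrow> x i = 0"
  by (simp add: mem_Espace)

section \<open>Openness and continuity in terms of coordinate boxes\<close>

lemma continuous_map_coord: "continuous_map (Euclidean_space n) euclideanreal (\<lambda>y. y i)"
  unfolding Euclidean_space_def
  by (intro continuous_map_from_subtopology continuous_map_product_projection) auto

lemma open_realD:
  fixes S :: "real set"
  assumes "open S" "x \<in> S"
  shows "\<exists>e>0. \<forall>s. \<bar>s - x\<bar> < e \<longrightarrow> s \<in> S"
proof -
  obtain e where "e > 0" "ball x e \<subseteq> S" using assms open_contains_ball by blast
  then show ?thesis by (intro exI[of _ e]) (auto simp: dist_real_def abs_minus_commute subset_iff)
qed

text \<open>The type \<open>vec\<close> carries no norm, so estimates run over coordinate boxes.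
  Coordinates from \<open>n\<close> on vanish for both points, hence conditions on the first
  \<open>n\<close> coordinates already place \<open>y\<close> in a basic open set of the product
  topology.\<close>

lemma openin_Euclidean_box:
  "openin (Euclidean_space n) U \<longleftrightarrow>
    U \<subseteq> Espace n \<and> (\<forall>a\<in>U. \<exists>e>0. \<forall>y\<in>Espace n. (\<forall>i<n. \<bar>y i - a i\<bar> < e) \<longrightarrow> y \<in> U)"
    (is "?L \<longleftrightarrow> ?R")
proof
  assume L: ?L
  show ?R
  proof (intro conjI ballI)
    show "U \<subseteq> Espace n" by (rule openin_subset[OF L])
    fix a assume a: "a \<in> U"
    from L obtain T where T: "openin (powertop_real UNIV) T" "U = T \<inter> {x. \<forall>i\<ge>n. x i = 0}"
      unfolding Euclidean_space_def openin_subtopology by auto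
    then have "a \<in> T" using a by simp
    with T(1) obtain W where W0: "\<forall>i\<in>UNIV. openin euclideanreal (W i)" and W: "a \<in> Pi\<^sub>E UNIV W" "Pi\<^sub>E UNIV W \<subseteq> T"
      unfolding openin_product_topology_alt by meson
    have W: "open (W i)" "a \<in> Pi\<^sub>E UNIV W" "Pi\<^sub>E UNIV W \<subseteq> T" for i
      using W W0 by auto
    have "\<exists>d>0. \<forall>s. \<bar>s - a i\<bar> < d \<longrightarrow> s \<in> W i" for i
      using W(2) by (intro open_realD[OF W(1)]) auto
    then obtain d where d: "\<And>i. d i > 0" "\<And>i s. \<bar>s - a i\<bar> < d i \<Longrightarrow> s \<in> W i" by metis
    \<comment> \<open>The entry 1 keeps the set nonempty when \<open>n = 0\<close>.\<close>
    let ?e = "Min (insert 1 (d ` {..<n}))"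
    have e: "?e > 0" using d(1) by auto
    have le: "?e \<le> d i" if "i < n" for i using that by simp
    have "y \<in> U" if y: "y \<in> Espace n" "\<forall>i<n. \<bar>y i - a i\<bar> < ?e" for y
    proof -
      have "y i \<in> W i" for i
      proof (cases "i < n")
        case True then show ?thesis using le[OF True] y(2) by (intro d(2)) force
      next
        case False
        then have "y i = 0" "a i = 0" using y(1) a T(2) by (auto simp: mem_Espace)
        then show ?thesis using W(2) by (metis PiE_mem UNIV_I)
      qed
      then have "y \<in> T" using W(3) by blast
      then show ?thesis using T(2) y(1) by (simp add: mem_Espace)
    qed
    then show "\<exists>e>0. \<forall>y\<in>Espace n. (\<forall>i<n. \<bar>y i - a i\<bar> < e) \<longrightarrow> y \<in> U" using e by blast
  qed
next
  assume R: ?R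
  show ?L
  proof (subst openin_subopen, intro ballI)
    fix a assume a: "a \<in> U"
    with R obtain e where e: "e > 0" "\<And>y. y \<in> Espace n \<Longrightarrow> (\<forall>i<n. \<bar>y i - a i\<bar> < e) \<Longrightarrow> y \<in> U"
      by blast
    \<comment> \<open>The box is built one coordinate at a time, each condition being the open
      preimage of an interval.\<close>
    have "openin (Euclidean_space n) {y \<in> Espace n. \<forall>i<m. \<bar>y i - a i\<bar> < e}" for m
    proof (induction m)
      case 0 then show ?case by simp
    next
      case (Suc m)
      have "openin (Euclidean_space n) {y \<in> Espace n. y m \<in> ball (a m) e}"
        by (intro openin_continuous_map_preimage[OF continuous_map_coord]) (simp flip: open_openin)
      from openin_Int[OF Suc this]
      show ?case by (rule back_subst[of "openin _"]) (auto simp: less_Suc_eq dist_real_def)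
    qed
    from this[of n] show "\<exists>T. openin (Euclidean_space n) T \<and> a \<in> T \<and> T \<subseteq> U"
      using a e R by (intro exI[of _ "{y \<in> Espace n. \<forall>i<n. \<bar>y i - a i\<bar> < e}"]) auto
  qed
qed

text \<open>Formulated for arbitrary \<open>U\<close>, because smoothness is also considered on sets
  such as \<open>[0,1]\<close> times a coordinate space.\<close>

lemma continuous_real_box:
  assumes "U \<subseteq> Espace n"
  shows "continuous_map (subtopology (Euclidean_space n) U) euclideanreal f \<longleftrightarrow>
    (\<forall>a\<in>U. \<forall>e>0. \<exists>d>0. \<forall>y\<in>U. (\<forall>i<n. \<bar>y i - a i\<bar> < d) \<longrightarrow> \<bar>f y - f a\<bar> < e)"
    (is "?L \<longleftrightarrow> ?R")
proof
  assume L: ?L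
  show ?R
  proof (intro ballI allI impI)
    fix a and e :: real assume a: "a \<in> U" and e: "e > 0"
    have "openin (subtopology (Euclidean_space n) U) {y \<in> topspace (subtopology (Euclidean_space n) U). f y \<in> ball (f a) e}"
      by (intro openin_continuous_map_preimage[OF L]) (simp flip: open_openin)
    moreover have tU: "topspace (subtopology (Euclidean_space n) U) = U" using assms by auto
    ultimately obtain T where T: "openin (Euclidean_space n) T" "{y \<in> U. f y \<in> ball (f a) e} = T \<inter> U"
      unfolding tU unfolding openin_subtopology by (elim exE conjE) (rule that)
    have "a \<in> {y \<in> U. f y \<in> ball (f a) e}" using a e by simp
    then have aT: "a \<in> T" unfolding T(2) by (rule IntD1)
    have T': "\<bar>f y - f a\<bar> < e" if "y \<in> U" "y \<in> T" for y
    proof -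
      have "y \<in> {y \<in> U. f y \<in> ball (f a) e}" unfolding T(2) using that by (intro IntI)
      then show ?thesis by (simp add: dist_real_def abs_minus_commute)
    qed
    from aT obtain d where "d > 0" "\<And>y. y \<in> Espace n \<Longrightarrow> (\<forall>i<n. \<bar>y i - a i\<bar> < d) \<Longrightarrow> y \<in> T"
      using T(1) unfolding openin_Euclidean_box by blast
    then show "\<exists>d>0. \<forall>y\<in>U. (\<forall>i<n. \<bar>y i - a i\<bar> < d) \<longrightarrow> \<bar>f y - f a\<bar> < e"
      using T' assms by (intro exI[of _ d]) auto
  qed
next
  assume R: ?R
  have "\<exists>T. openin (Euclidean_space n) T \<and> {x \<in> U. f x \<in> S} = T \<inter> U"
    if "openin euclideanreal S" for S
  proof -
    have S: "open S" using that by simp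
    \<comment> \<open>The largest open set whose trace on \<open>U\<close> is mapped into
      \<open>S\<close>; what remains is that it contains the preimage of \<open>S\<close>.\<close>
    let ?T = "\<Union>{V. openin (Euclidean_space n) V \<and> V \<inter> U \<subseteq> f -` S}"
    have "x \<in> ?T" if x: "x \<in> U" "f x \<in> S" for x
    proof -
      obtain e where e: "e > 0" "\<And>s. \<bar>s - f x\<bar> < e \<Longrightarrow> s \<in> S"
        using open_realD[OF S x(2)] by blast
      from R[rule_format, OF x(1) e(1)]
      obtain d where d: "d > 0" "\<And>y. y \<in> U \<Longrightarrow> (\<forall>i<n. \<bar>y i - x i\<bar> < d) \<Longrightarrow> \<bar>f y - f x\<bar> < e"
        by auto
      let ?V = "{y \<in> Espace n. \<forall>i<n. \<bar>y i - x i\<bar> < d}"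
      have "openin (Euclidean_space n) ?V"
        unfolding openin_Euclidean_box
      proof (intro conjI ballI)
        show "?V \<subseteq> Espace n" by blast
        fix a assume "a \<in> ?V"
        then have a: "\<bar>a i - x i\<bar> < d" if "i < n" for i using that by simp
        let ?e = "Min (insert 1 ((\<lambda>i. d - \<bar>a i - x i\<bar>) ` {..<n}))"
        have "?e > 0" using a by auto
        moreover have "?e \<le> d - \<bar>a i - x i\<bar>" if "i < n" for i using that by simp
        moreover have "\<bar>y i - x i\<bar> < d" if "i < n" "\<bar>y i - a i\<bar> < ?e" "?e \<le> d - \<bar>a i - x i\<bar>" for y i
          using that(2,3) by linarith
        ultimately show "\<exists>e>0. \<forall>y\<in>Espace n. (\<forall>i<n. \<bar>y i - a i\<bar> < e) \<longrightarrow> y \<in> ?V"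
          by (intro exI[of _ ?e]) blast
      qed
      moreover have "?V \<inter> U \<subseteq> f -` S" using d(2) e(2) by auto
      moreover have "x \<in> ?V" using x(1) d(1) assms by auto
      ultimately show ?thesis by blast
    qed
    moreover have "openin (Euclidean_space n) ?T" by (rule openin_Union) auto
    ultimately show ?thesis by (intro exI[of _ ?T]) blast
  qed
  moreover have tU: "topspace (subtopology (Euclidean_space n) U) = U" using assms by auto
  ultimately show ?L
    unfolding continuous_map_def tU unfolding openin_subtopology topspace_euclidean by blast
qed

text \<open>Total differentiability with gradient \<open>D\<close>. Partial derivatives alone give
  no chain rule, so this notion mediates between \<open>C_diff\<close> and curves. The remainder is
  compared with the sum norm, neighbourhoods are taken in the maximum norm; on a finite-dimensional
  space this is the usual notion.\<close>

definition frechet_at :: "nat \<Rightarrow> (vec \<Rightarrow> real) \<Rightarrow> vec \<Rightarrow> (nat \<Rightarrow> real) \<Rightarrow> bool" where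
  "frechet_at n f a D \<longleftrightarrow> (\<forall>e>0. \<exists>d>0. \<forall>y\<in>Espace n. (\<forall>i<n. \<bar>y i - a i\<bar> < d) \<longrightarrow>
     \<bar>f y - f a - (\<Sum>i<n. D i * (y i - a i))\<bar> \<le> e * (\<Sum>i<n. \<bar>y i - a i\<bar>))"

text \<open>The coordinate increments to which this is applied have either sign or vanish, hence no
  order between \<open>a\<close> and \<open>b\<close>.\<close>

lemma MVT_symmetric:
  fixes a b :: real
  assumes "\<And>s. \<bar>s - a\<bar> \<le> \<bar>b - a\<bar> \<Longrightarrow> DERIV g s :> g' s"
  shows "\<exists>x. \<bar>x - a\<bar> \<le> \<bar>b - a\<bar> \<and> g b - g a = (b - a) * g' x"
proof -
  consider "a < b" | "a = b" | "b < a" by linarith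
  then show ?thesis
  proof cases
    case 1
    then obtain z where "a < z" "z < b" "g b - g a = (b - a) * g' z"
      using MVT2[OF 1, of g g'] assms by force
    then show ?thesis by (intro exI[of _ z]) auto
  next
    case 3
    then obtain z where "b < z" "z < a" "g a - g b = (a - b) * g' z"
      using MVT2[OF 3, of g g'] assms by force
    then show ?thesis by (intro exI[of _ z]) (auto simp: algebra_simps)
  qed auto
qed

text \<open>Go from \<open>a\<close> to \<open>y\<close> parallel to the coordinate axes, apply the
  mean value theorem on each segment, and compare the partial derivative met there with its value at
  \<open>a\<close> by continuity.\<close>

lemma C1_frechet_at:
  assumes U: "openin (Euclidean_space n) U" and a: "a \<in> U" and f: "C_diff n (Suc 0) U f"
  shows "frechet_at n f a (\<lambda>i. partial_deriv i f a)"
  unfolding frechet_at_def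
proof (intro allI impI)
  fix e :: real assume e: "e > 0"
  have UE: "U \<subseteq> Espace n" using U by (rule openin_subset)
  obtain d0 where d0: "d0 > 0" "\<And>y. y \<in> Espace n \<Longrightarrow> (\<forall>i<n. \<bar>y i - a i\<bar> < d0) \<Longrightarrow> y \<in> U"
    using U a unfolding openin_Euclidean_box by blast
  have "\<exists>d>0. \<forall>y\<in>U. (\<forall>i<n. \<bar>y i - a i\<bar> < d) \<longrightarrow> \<bar>partial_deriv k f y - partial_deriv k f a\<bar> < e" if "k < n" for k
    using f that a e UE by (simp add: continuous_real_box)
  then obtain dd where dd: "\<And>k. k < n \<Longrightarrow> dd k > 0"
    "\<And>k y. k < n \<Longrightarrow> y \<in> U \<Longrightarrow> (\<forall>i<n. \<bar>y i - a i\<bar> < dd k) \<Longrightarrow> \<bar>partial_deriv k f y - partial_deriv k f a\<bar> < e"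
    by metis
  \<comment> \<open>\<open>d0\<close> keeps the staircase inside \<open>U\<close>, and
    \<open>dd k\<close> keeps the partial derivative in direction \<open>k\<close> within
    \<open>e\<close> of its value at \<open>a\<close>.\<close>
  let ?d = "Min (insert d0 (dd ` {..<n}))"
  have d: "?d > 0" using dd(1) d0 by auto
  have d_le: "?d \<le> d0" "\<And>k. k < n \<Longrightarrow> ?d \<le> dd k" by auto
  have "\<bar>f y - f a - (\<Sum>i<n. partial_deriv i f a * (y i - a i))\<bar> \<le> e * (\<Sum>i<n. \<bar>y i - a i\<bar>)"
    if y: "y \<in> Espace n" "\<forall>i<n. \<bar>y i - a i\<bar> < ?d" for y
  proof -
    \<comment> \<open>Corners of the staircase: the first \<open>k\<close> coordinates have already
      been moved to those of \<open>y\<close>.\<close>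
    define z where "z k = (\<lambda>i. if i < k then y i else a i)" for k
    have aE: "a \<in> Espace n" using a UE by auto
    have z0: "z 0 = a" and zn: "z n = y"
      using y(1) aE by (auto simp: z_def mem_Espace fun_eq_iff)
    have step: "\<bar>f (z (Suc k)) - f (z k) - partial_deriv k f a * (y k - a k)\<bar> \<le> e * \<bar>y k - a k\<bar>"
      if k: "k < n" for k
    proof -
      have box: "(z k)(k := s) \<in> Espace n \<and> (\<forall>i<n. \<bar>((z k)(k := s)) i - a i\<bar> < ?d)"
        if s: "\<bar>s - a k\<bar> \<le> \<bar>y k - a k\<bar>" for s
      proof (intro conjI allI impI)
        show "(z k)(k := s) \<in> Espace n" using y(1) k aE by (auto simp: z_def mem_Espace)
        fix i assume "i < n"
        then show "\<bar>((z k)(k := s)) i - a i\<bar> < ?d"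
          using y(2) d le_less_trans[OF s] k by (simp add: z_def del: Min_less_iff Min_gr_iff)
      qed
      have inU: "(z k)(k := s) \<in> U" if s: "\<bar>s - a k\<bar> \<le> \<bar>y k - a k\<bar>" for s
      proof (rule d0(2))
        show "(z k)(k := s) \<in> Espace n" using box[OF s] by simp
        show "\<forall>i<n. \<bar>((z k)(k := s)) i - a i\<bar> < d0" using box[OF s] d_le(1) by (meson less_le_trans)
      qed
      have der: "DERIV (\<lambda>s. f ((z k)(k := s))) s :> partial_deriv k f ((z k)(k := s))"
        if s: "\<bar>s - a k\<bar> \<le> \<bar>y k - a k\<bar>" for s
      proof -
        have "\<forall>x\<in>U. (\<lambda>t. f (x(k := t))) differentiable (at (x k))"
          using f k by simp
        from bspec[OF this inU[OF s]] have "(\<lambda>t. f ((z k)(k := t))) differentiable (at s)" by simp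
        then show ?thesis by (simp add: partial_deriv_def DERIV_deriv_iff_real_differentiable)
      qed
      obtain x where x: "\<bar>x - a k\<bar> \<le> \<bar>y k - a k\<bar>"
        "f ((z k)(k := y k)) - f ((z k)(k := a k)) = (y k - a k) * partial_deriv k f ((z k)(k := x))"
        using MVT_symmetric[of "a k" "y k", OF der] by blast
      have "\<bar>partial_deriv k f ((z k)(k := x)) - partial_deriv k f a\<bar> < e"
      proof (rule dd(2)[OF k inU[OF x(1)]])
        show "\<forall>i<n. \<bar>((z k)(k := x)) i - a i\<bar> < dd k" using box[OF x(1)] d_le(2)[OF k] by (meson less_le_trans)
      qed
      moreover have "(z k)(k := y k) = z (Suc k)" "(z k)(k := a k) = z k"
        by (auto simp: z_def fun_eq_iff less_Suc_eq)
      ultimately have "f (z (Suc k)) - f (z k) - partial_deriv k f a * (y k - a k)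
          = (partial_deriv k f ((z k)(k := x)) - partial_deriv k f a) * (y k - a k)"
        and "\<bar>partial_deriv k f ((z k)(k := x)) - partial_deriv k f a\<bar> \<le> e"
        using x(2) by (auto simp: algebra_simps)
      then show ?thesis by (simp add: abs_mult mult_right_mono)
    qed
    have "f y - f a - (\<Sum>i<n. partial_deriv i f a * (y i - a i))
        = (\<Sum>k<n. f (z (Suc k)) - f (z k) - partial_deriv k f a * (y k - a k))"
      using sum_lessThan_telescope[of "\<lambda>k. f (z k)" n] by (simp add: sum_subtractf z0 zn)
    also have "\<bar>\<dots>\<bar> \<le> (\<Sum>k<n. e * \<bar>y k - a k\<bar>)"
      by (rule order_trans[OF sum_abs]) (auto intro!: sum_mono step)
    finally show ?thesis by (simp add: sum_distrib_left)
  qed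
  then show "\<exists>d>0. \<forall>y\<in>Espace n. (\<forall>i<n. \<bar>y i - a i\<bar> < d) \<longrightarrow>
     \<bar>f y - f a - (\<Sum>i<n. partial_deriv i f a * (y i - a i))\<bar> \<le> e * (\<Sum>i<n. \<bar>y i - a i\<bar>)"
    using d by blast
qed

text \<open>The filter \<open>at t within I\<close> is carried along because velocities at the ends
  of \<open>[0,1]\<close> are one-sided. The difference quotients of \<open>c\<close> converge,
  hence are bounded, and this controls the remainder of \<open>f\<close>.\<close>

lemma frechet_at_curve:
  assumes f: "frechet_at n f (c t) D"
    and cE: "\<forall>\<^sub>F s in at t within I. c s \<in> Espace n"
    and c: "\<And>i. i < n \<Longrightarrow> ((\<lambda>s. c s i) has_real_derivative c' i) (at t within I)"
  shows "((\<lambda>s. f (c s)) has_real_derivative (\<Sum>i<n. D i * c' i)) (at t within I)"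
proof -
  let ?F = "at t within I"
  define q where "q i s = (c s i - c t i) / (s - t)" for i s
  have q: "(q i \<longlongrightarrow> c' i) ?F" if "i < n" for i
    using c[OF that] unfolding has_field_derivative_iff q_def .
  define r where "r s = (f (c s) - f (c t)) / (s - t) - (\<Sum>i<n. D i * q i s)" for s
  define K where "K = (\<Sum>i<n. \<bar>c' i\<bar>)"
  have K: "((\<lambda>s. \<Sum>i<n. \<bar>q i s\<bar>) \<longlongrightarrow> K) ?F"
    unfolding K_def by (intro tendsto_sum tendsto_rabs q) auto
  have "(r \<longlongrightarrow> 0) ?F"
  proof (rule tendstoI)
    fix \<epsilon> :: real assume \<epsilon>: "\<epsilon> > 0"
    have K0: "K \<ge> 0" unfolding K_def by (rule sum_nonneg) auto
    \<comment> \<open>The sum of the absolute difference quotients tends to \<open>K\<close>, so it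
      is eventually below \<open>K + 1\<close>; the factor 1/2 makes the final estimate
      strict.\<close>
    define e where "e = \<epsilon> / (K + 1) / 2"
    have e: "e > 0" using \<epsilon> K0 by (simp add: e_def)
    from f[unfolded frechet_at_def, rule_format, OF e]
    obtain d where d: "d > 0" "\<And>y. y \<in> Espace n \<Longrightarrow> (\<forall>i<n. \<bar>y i - c t i\<bar> < d) \<Longrightarrow>
      \<bar>f y - f (c t) - (\<Sum>i<n. D i * (y i - c t i))\<bar> \<le> e * (\<Sum>i<n. \<bar>y i - c t i\<bar>)"
      by auto
    have "\<forall>\<^sub>F s in ?F. \<forall>i\<in>{..<n}. \<bar>c s i - c t i\<bar> < d"
    proof (intro eventually_ball_finite ballI)
      fix i assume "i \<in> {..<n}"
      then have "((\<lambda>s. c s i) \<longlongrightarrow> c t i) ?F"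
        using DERIV_continuous[OF c] by (simp add: continuous_within)
      then show "\<forall>\<^sub>F s in ?F. \<bar>c s i - c t i\<bar> < d"
        using d(1) by (auto dest: tendstoD simp: dist_real_def)
    qed auto
    moreover have "\<forall>\<^sub>F s in ?F. (\<Sum>i<n. \<bar>q i s\<bar>) < K + 1"
      using K by (rule order_tendstoD) simp
    moreover have "\<forall>\<^sub>F s in ?F. s \<noteq> t" by (simp add: eventually_at_filter)
    ultimately show "\<forall>\<^sub>F s in ?F. dist (r s) 0 < \<epsilon>"
      using cE
    proof eventually_elim
      case (elim s)
      have "r s = (f (c s) - f (c t) - (\<Sum>i<n. D i * (c s i - c t i))) / (s - t)"
        by (simp add: r_def q_def diff_divide_distrib[of "f (c s) - f (c t)"] sum_divide_distrib)
      then have "\<bar>r s\<bar> \<le> e * (\<Sum>i<n. \<bar>c s i - c t i\<bar>) / \<bar>s - t\<bar>"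
        using d(2)[of "c s"] elim by (simp add: divide_right_mono)
      also have "\<dots> = e * (\<Sum>i<n. \<bar>q i s\<bar>)"
        by (simp add: q_def sum_divide_distrib flip: times_divide_eq_right)
      also have "\<dots> \<le> e * (K + 1)" using elim e by (intro mult_left_mono) auto
      also have "\<dots> = \<epsilon> / 2" using K0 by (simp add: e_def field_split_simps)
      also have "\<dots> < \<epsilon>" using \<epsilon> by simp
      finally show ?case by simp
    qed
  qed
  moreover have "((\<lambda>s. \<Sum>i<n. D i * q i s) \<longlongrightarrow> (\<Sum>i<n. D i * c' i)) ?F"
    by (intro tendsto_sum tendsto_mult tendsto_const q) auto
  ultimately have "((\<lambda>s. r s + (\<Sum>i<n. D i * q i s)) \<longlongrightarrow> 0 + (\<Sum>i<n. D i * c' i)) ?F"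
    by (rule tendsto_add)
  then show ?thesis by (simp add: has_field_derivative_iff r_def)
qed

section \<open>Locality of the differentiability classes\<close>

lemma eventually_fun_upd:
  assumes "openin (Euclidean_space n) U" "x \<in> U" "i < n"
  shows "\<forall>\<^sub>F s in nhds (x i). x(i := s) \<in> U"
proof -
  obtain e where e: "e > 0" "\<And>y. y \<in> Espace n \<Longrightarrow> (\<forall>i<n. \<bar>y i - x i\<bar> < e) \<Longrightarrow> y \<in> U"
    using assms unfolding openin_Euclidean_box by blast
  have "x(i := s) \<in> U" if "dist s (x i) < e" for s
    using that assms openin_subset[OF assms(1)] e(1) by (intro e(2)) (auto simp: mem_Espace dist_real_def)
  then show ?thesis using e(1) unfolding eventually_nhds_metric by blast
qed

lemma partial_deriv_cong:
  assumes "openin (Euclidean_space n) U" "x \<in> U" "i < n" "\<And>y. y \<in> U \<Longrightarrow> f y = g y"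
  shows "partial_deriv i f x = partial_deriv i g x"
  unfolding partial_deriv_def
  by (rule deriv_cong_ev[OF eventually_mono[OF eventually_fun_upd[OF assms(1-3)]]]) (simp_all add: assms)

lemma C_diff_continuous:
  "C_diff n r U f \<Longrightarrow> continuous_map (subtopology (Euclidean_space n) U) euclideanreal f"
  by (cases r) auto

lemma C_diff_SucD: "C_diff n (Suc r) U f \<Longrightarrow> C_diff n r U f"
proof (induction r arbitrary: f)
  case (Suc r)
  have "C_diff n (Suc r) U (partial_deriv i f)" if "i < n" for i using Suc.prems that by simp
  with Suc show ?case by simp
qed simp

lemma C_diff_Suc0: "C_diff n (Suc r) U f \<Longrightarrow> C_diff n (Suc 0) U f"
  by (induction r) (auto dest: C_diff_SucD)

lemma C_diff_subset: "C_diff n r U f \<Longrightarrow> V \<subseteq> U \<Longrightarrow> C_diff n r V f"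
  by (induction r arbitrary: f) (auto intro: continuous_map_from_subtopology_mono)

lemma differentiable_cong_ev:
  fixes f g :: "real \<Rightarrow> real"
  assumes "f differentiable (at x)" "\<forall>\<^sub>F s in nhds x. f s = g s"
  shows "g differentiable (at x)"
proof -
  obtain D where "DERIV f x :> D" using assms(1) real_differentiable_def by blast
  then have "DERIV g x :> D" using DERIV_cong_ev[OF refl assms(2) refl] by simp
  then show ?thesis using real_differentiable_def by blast
qed

text \<open>Since \<open>deriv\<close> sees only nearby values, agreement on an open set passes to
  the partial derivatives of every order.\<close>

lemma C_diff_cong:
  assumes U: "openin (Euclidean_space n) U"
  shows "C_diff n r U f \<Longrightarrow> (\<And>x. x \<in> U \<Longrightarrow> f x = g x) \<Longrightarrow> C_diff n r U g"
proof (induction r arbitrary: f g)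
  case 0
  then show ?case using openin_subset[OF U] by (simp add: continuous_real_box)
next
  case (Suc r)
  have "C_diff n 0 U g"
    using Suc.prems openin_subset[OF U] by (simp add: continuous_real_box)
  moreover have "(\<lambda>s. g (x(i := s))) differentiable (at (x i))" if "i < n" "x \<in> U" for i x
  proof (rule differentiable_cong_ev)
    show "(\<lambda>s. f (x(i := s))) differentiable (at (x i))" using Suc.prems(1) that by simp
    show "\<forall>\<^sub>F s in nhds (x i). f (x(i := s)) = g (x(i := s))"
      using eventually_fun_upd[OF U that(2,1)] by eventually_elim (rule Suc.prems(2))
  qed
  moreover have "C_diff n r U (partial_deriv i g)" if i: "i < n" for i
  proof (rule Suc.IH)
    show "C_diff n r U (partial_deriv i f)" using Suc.prems(1) i by simp
    show "partial_deriv i f x = partial_deriv i g x" if "x \<in> U" for x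
      by (rule partial_deriv_cong[OF U that i Suc.prems(2)])
  qed
  ultimately show ?case by simp
qed

text \<open>Glues differentiability from a cover of \<open>U\<close> by open subsets; this is what
  extracts global information from the local extensions in \<open>smooth_fun_on\<close>.\<close>

lemma C_diff_local:
  assumes "\<And>x. x \<in> U \<Longrightarrow> \<exists>V. openin (Euclidean_space n) V \<and> x \<in> V \<and> V \<subseteq> U \<and> C_diff n r V f"
  shows "C_diff n r U f"
  using assms
proof (induction r arbitrary: f)
  have UE: "U \<subseteq> Espace n" if "\<And>x. x \<in> U \<Longrightarrow> \<exists>V. openin (Euclidean_space n) V \<and> x \<in> V \<and> V \<subseteq> U \<and> P V" for P
    using that openin_subset by blast
  \<comment> \<open>Established for every order at once, as both the base case and the induction
    step call for it.\<close>
  have cont: "continuous_map (subtopology (Euclidean_space n) U) euclideanreal f"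
    if *: "\<And>x. x \<in> U \<Longrightarrow> \<exists>V. openin (Euclidean_space n) V \<and> x \<in> V \<and> V \<subseteq> U \<and> C_diff n r V f" for r f
    unfolding continuous_real_box[OF UE[OF *, simplified]]
  proof (intro ballI allI impI)
    fix a and e :: real assume a: "a \<in> U" and e: "e > 0"
    obtain V where V: "openin (Euclidean_space n) V" "a \<in> V" "V \<subseteq> U" "C_diff n r V f" using *[OF a] by blast
    have "\<forall>a\<in>V. \<forall>e>0. \<exists>d>0. \<forall>y\<in>V. (\<forall>i<n. \<bar>y i - a i\<bar> < d) \<longrightarrow> \<bar>f y - f a\<bar> < e"
      using C_diff_continuous[OF V(4)] unfolding continuous_real_box[OF openin_subset[OF V(1)]] .
    from this[rule_format, OF V(2) e]
    obtain d where d: "d > 0" "\<And>y. y \<in> V \<Longrightarrow> (\<forall>i<n. \<bar>y i - a i\<bar> < d) \<Longrightarrow> \<bar>f y - f a\<bar> < e" by auto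
    obtain d' where d': "d' > 0" "\<And>y. y \<in> Espace n \<Longrightarrow> (\<forall>i<n. \<bar>y i - a i\<bar> < d') \<Longrightarrow> y \<in> V"
      using V(1,2) unfolding openin_Euclidean_box by blast
    show "\<exists>d>0. \<forall>y\<in>U. (\<forall>i<n. \<bar>y i - a i\<bar> < d) \<longrightarrow> \<bar>f y - f a\<bar> < e"
      using d d' UE[OF *, simplified] by (intro exI[of _ "min d d'"]) auto
  qed
  {
    case 0
    then show ?case using cont[of 0 f] by simp
  next
    case (Suc r)
    have "C_diff n r U (partial_deriv i f)" if "i < n" for i
      using Suc.prems that by (intro Suc.IH) (metis C_diff.simps(2))
    moreover have "(\<lambda>s. f (x(i := s))) differentiable (at (x i))" if "i < n" "x \<in> U" for i x
      using Suc.prems[OF that(2)] that by auto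
    ultimately show ?case using cont[of "Suc r" f] Suc.prems by simp
  }
qed

text \<open>A local extension coincides with \<open>f\<close> on an open neighbourhood inside
  \<open>U\<close>, so it carries the same derivatives as \<open>f\<close>.\<close>

lemma smooth_fun_on_open:
  assumes U: "openin (Euclidean_space n) U"
  shows "smooth_fun_on n U f \<longleftrightarrow> (\<forall>r. C_diff n r U f)"
proof
  assume L: "smooth_fun_on n U f"
  show "\<forall>r. C_diff n r U f"
  proof
    fix r show "C_diff n r U f"
    proof (rule C_diff_local)
      fix x assume "x \<in> U"
      from L[unfolded smooth_fun_on_def, rule_format, OF this]
      obtain V g where V: "openin (Euclidean_space n) V" "x \<in> V" "C_diff n r V g" "\<And>y. y \<in> U \<inter> V \<Longrightarrow> f y = g y"
        by metis
      have "C_diff n r (U \<inter> V) f"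
        using V by (intro C_diff_cong[OF openin_Int[OF U V(1)] C_diff_subset[OF V(3)]]) auto
      then show "\<exists>V. openin (Euclidean_space n) V \<and> x \<in> V \<and> V \<subseteq> U \<and> C_diff n r V f"
        using U V(1,2) \<open>x \<in> U\<close> by (intro exI[of _ "U \<inter> V"]) auto
    qed
  qed
qed (use U in \<open>auto simp: smooth_fun_on_def\<close>)

lemma partial_derivI: "DERIV (\<lambda>s. f (x(i := s))) (x i) :> D \<Longrightarrow> partial_deriv i f x = D"
  unfolding partial_deriv_def by (rule DERIV_imp_deriv)

lemma C_diff_DERIV:
  assumes "C_diff n (Suc r) U f" "i < n" "x \<in> U"
  shows "DERIV (\<lambda>s. f (x(i := s))) (x i) :> partial_deriv i f x"
  using assms by (simp add: partial_deriv_def DERIV_deriv_iff_real_differentiable)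

text \<open>Allows derivatives to be guessed: the given \<open>f'\<close> agrees with
  \<open>partial_deriv\<close> on the open set \<open>U\<close>, and \<open>C_diff_cong\<close>
  transfers its differentiability.\<close>

lemma C_diff_SucI:
  assumes U: "openin (Euclidean_space n) U"
    and "continuous_map (subtopology (Euclidean_space n) U) euclideanreal f"
    and der: "\<And>i x. i < n \<Longrightarrow> x \<in> U \<Longrightarrow> DERIV (\<lambda>s. f (x(i := s))) (x i) :> f' i x"
    and "\<And>i. i < n \<Longrightarrow> C_diff n r U (f' i)"
  shows "C_diff n (Suc r) U f"
proof -
  have "C_diff n r U (partial_deriv i f)" if "i < n" for i
  proof (rule C_diff_cong[OF U assms(4)[OF that]])
    show "f' i x = partial_deriv i f x" if "x \<in> U" for x
      by (rule partial_derivI[OF der, symmetric]) fact+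
  qed
  moreover have "(\<lambda>s. f (x(i := s))) differentiable (at (x i))" if "i < n" "x \<in> U" for i x
    using der[OF that] real_differentiable_def by blast
  ultimately show ?thesis using assms(2) by simp
qed

section \<open>Algebra of smooth functions and the chain rule\<close>

lemma C_diff_const: "openin (Euclidean_space n) U \<Longrightarrow> C_diff n r U (\<lambda>x. c)"
  by (induction r arbitrary: c) (auto intro!: C_diff_SucI[where f' = "\<lambda>i x. 0"] simp del: C_diff.simps(2))

lemma C_diff_add:
  assumes U: "openin (Euclidean_space n) U"
  shows "C_diff n r U f \<Longrightarrow> C_diff n r U g \<Longrightarrow> C_diff n r U (\<lambda>x. f x + g x)"
proof (induction r arbitrary: f g)
  case (Suc r)
  show ?case
  proof (rule C_diff_SucI[OF U, where f' = "\<lambda>i x. partial_deriv i f x + partial_deriv i g x"])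
    show "C_diff n r U (\<lambda>x. partial_deriv i f x + partial_deriv i g x)" if "i < n" for i
      using that Suc.prems by (intro Suc.IH) auto
    show "DERIV (\<lambda>s. f (x(i := s)) + g (x(i := s))) (x i) :> partial_deriv i f x + partial_deriv i g x"
      if "i < n" "x \<in> U" for i x
      using DERIV_add[OF C_diff_DERIV[OF Suc.prems(1) that] C_diff_DERIV[OF Suc.prems(2) that]] .
  qed (use Suc.prems in \<open>auto intro!: continuous_map_add simp del: C_diff.simps(2) dest: C_diff_continuous\<close>)
qed (auto intro: continuous_map_add)

lemma C_diff_mult:
  assumes U: "openin (Euclidean_space n) U"
  shows "C_diff n r U f \<Longrightarrow> C_diff n r U g \<Longrightarrow> C_diff n r U (\<lambda>x. f x * g x)"
proof (induction r arbitrary: f g)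
  case (Suc r)
  show ?case
  proof (rule C_diff_SucI[OF U, where f' = "\<lambda>i x. partial_deriv i f x * g x + partial_deriv i g x * f x"])
    show "C_diff n r U (\<lambda>x. partial_deriv i f x * g x + partial_deriv i g x * f x)" if "i < n" for i
      using that Suc.prems C_diff_SucD[OF Suc.prems(1)] C_diff_SucD[OF Suc.prems(2)]
      by (intro C_diff_add[OF U] Suc.IH) auto
    show "DERIV (\<lambda>s. f (x(i := s)) * g (x(i := s))) (x i) :> partial_deriv i f x * g x + partial_deriv i g x * f x"
      if "i < n" "x \<in> U" for i x
      using DERIV_mult[OF C_diff_DERIV[OF Suc.prems(1) that] C_diff_DERIV[OF Suc.prems(2) that]]
      by (simp only: fun_upd_triv)
  qed (use Suc.prems in \<open>auto intro!: continuous_map_real_mult simp del: C_diff.simps(2) dest: C_diff_continuous\<close>)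
qed (auto intro: continuous_map_real_mult)

lemma C_diff_sum:
  assumes U: "openin (Euclidean_space n) U"
  shows "finite A \<Longrightarrow> (\<And>j. j \<in> A \<Longrightarrow> C_diff n r U (f j)) \<Longrightarrow> C_diff n r U (\<lambda>x. \<Sum>j\<in>A. f j x)"
  by (induction A rule: finite_induct) (auto intro: C_diff_const[OF U] C_diff_add[OF U])

lemma C_diff_coord:
  assumes U: "openin (Euclidean_space n) U"
  shows "C_diff n r U (\<lambda>x. x j)"
proof (cases r)
  case 0
  then show ?thesis by (simp add: continuous_map_from_subtopology continuous_map_coord)
next
  case (Suc r')
  show ?thesis unfolding Suc
  proof (rule C_diff_SucI[OF U, where f' = "\<lambda>i x. if i = j then 1 else 0"])
    show "DERIV (\<lambda>s. (x(i := s)) j) (x i) :> (if i = j then 1 else 0)" for i x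
      by (cases "i = j") auto
    show "C_diff n r' U (\<lambda>x. if i = j then 1 else 0)" for i
      by (rule C_diff_const[OF U])
  qed (auto intro: continuous_map_from_subtopology continuous_map_coord)
qed

text \<open>The four parameters make the family closed under differentiation: the cosine is a sine
  shifted by \<open>pi / 2\<close>, and the summand 0 in the derivative keeps the shape of the
  induction hypothesis.\<close>

lemma C_diff_sin:
  assumes U: "openin (Euclidean_space n) U"
  shows "C_diff n r U (\<lambda>x. a + b * sin (c * x j + d))"
proof (induction r arbitrary: a b c d)
  have cont: "continuous_map (subtopology (Euclidean_space n) U) euclideanreal (\<lambda>x. a + b * sin (c * x j + d))" for a b c d
  proof -
    have "continuous_map euclideanreal euclideanreal (\<lambda>s. a + b * sin (c * s + d))"
      by (auto intro!: continuous_intros)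
    from continuous_map_compose[OF continuous_map_from_subtopology[OF continuous_map_coord] this]
    show ?thesis by (simp add: o_def)
  qed
  {
    case 0
    then show ?case using cont by simp
  next
    case (Suc r)
    show ?case
    proof (rule C_diff_SucI[OF U cont, where f' = "\<lambda>i x. if i = j then 0 + (b * c) * sin (c * x j + (d + pi / 2)) else 0"])
      show "DERIV (\<lambda>s. a + b * sin (c * (x(i := s)) j + d)) (x i) :>
          (if i = j then 0 + (b * c) * sin (c * x j + (d + pi / 2)) else 0)" for i x
        by (cases "i = j") (auto intro!: derivative_eq_intros simp: sin_add cos_add algebra_simps)
      show "C_diff n r U (\<lambda>x. if i = j then 0 + (b * c) * sin (c * x j + (d + pi / 2)) else 0)" for i
        using Suc.IH[of 0 "b * c" c "d + pi / 2"] C_diff_const[OF U] by (cases "i = j") auto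
    qed
  }
qed

lemma continuous_map_into_Euclidean:
  assumes "\<And>x. x \<in> topspace X \<Longrightarrow> f x \<in> Espace n"
    and "\<And>i. i < n \<Longrightarrow> continuous_map X euclideanreal (\<lambda>x. f x i)"
  shows "continuous_map X (Euclidean_space n) f"
proof -
  have "continuous_map X (Euclidean_space n) (\<lambda>x i. if i < n then f x i else 0)"
    using assms(2) by (simp add: continuous_map_componentwise_Euclidean_space)
  then show ?thesis
    by (rule continuous_map_eq) (use assms(1) in \<open>auto simp: mem_Espace fun_eq_iff\<close>)
qed

lemma continuous_map_Euclidean_component:
  "continuous_map X (Euclidean_space n) f \<Longrightarrow> continuous_map X euclideanreal (\<lambda>x. f x i)"
  using continuous_map_compose[OF _ continuous_map_coord, of X n f i] by (simp add: o_def)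

text \<open>Induction on the order of \<open>g\<close>, with \<open>f\<close> smooth of every order:
  a partial derivative of the composite is a sum of products of \<open>partial_deriv j g\<close>
  after \<open>f\<close>, covered by the induction hypothesis, with partial derivatives of the
  components of \<open>f\<close>.\<close>

lemma C_diff_compose:
  assumes U: "openin (Euclidean_space n) U" and V: "openin (Euclidean_space m) V"
    and f: "\<And>r j. j < m \<Longrightarrow> C_diff n r U (\<lambda>x. f x j)" and fV: "\<And>x. x \<in> U \<Longrightarrow> f x \<in> V"
  shows "C_diff m r V g \<Longrightarrow> C_diff n r U (\<lambda>x. g (f x))"
proof (induction r arbitrary: g)
  have fE: "f x \<in> Espace m" if "x \<in> U" for x using fV[OF that] openin_subset[OF V] by auto
  have "continuous_map (subtopology (Euclidean_space n) U) (Euclidean_space m) f"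
    using f[of _ 0] fE by (intro continuous_map_into_Euclidean) auto
  then have fc: "continuous_map (subtopology (Euclidean_space n) U) (subtopology (Euclidean_space m) V) f"
    using fV by (auto simp: continuous_map_in_subtopology)
  have cont: "continuous_map (subtopology (Euclidean_space n) U) euclideanreal (\<lambda>x. g (f x))" if "C_diff m r V g" for r g
    using continuous_map_compose[OF fc C_diff_continuous[OF that]] by (simp add: o_def)
  {
    case 0
    then show ?case using cont[of 0] by simp
  next
    case (Suc r)
    show ?case
    proof (rule C_diff_SucI[OF U cont[OF Suc.prems],
          where f' = "\<lambda>i x. \<Sum>j<m. partial_deriv j g (f x) * partial_deriv i (\<lambda>x. f x j) x"])
      fix i x assume i: "i < n" and x: "x \<in> U"
      have "frechet_at m g (f x) (\<lambda>j. partial_deriv j g (f x))"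
        by (rule C1_frechet_at[OF V fV[OF x] C_diff_Suc0[OF Suc.prems]])
      \<comment> \<open>The line through \<open>x\<close> in direction \<open>i\<close> is regarded
        as a curve; this is its base point, written as the value at time \<open>x i\<close>.\<close>
      then have fr: "frechet_at m g (f (x(i := x i))) (\<lambda>j. partial_deriv j g (f x))" by simp
      show "DERIV (\<lambda>s. g (f (x(i := s)))) (x i) :> (\<Sum>j<m. partial_deriv j g (f x) * partial_deriv i (\<lambda>x. f x j) x)"
      proof (rule frechet_at_curve[where c = "\<lambda>s. f (x(i := s))" and t = "x i", OF fr])
        show "\<forall>\<^sub>F s in at (x i). f (x(i := s)) \<in> Espace m"
          using eventually_fun_upd[OF U x i] fE
          by (auto simp: eventually_at_filter elim: eventually_mono)
        show "DERIV (\<lambda>s. f (x(i := s)) j) (x i) :> partial_deriv i (\<lambda>x. f x j) x" if "j < m" for j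
          by (rule C_diff_DERIV[OF f[OF that] i x])
      qed
    next
      fix i assume i: "i < n"
      show "C_diff n r U (\<lambda>x. \<Sum>j<m. partial_deriv j g (f x) * partial_deriv i (\<lambda>x. f x j) x)"
      proof (intro C_diff_sum[OF U] C_diff_mult[OF U])
        fix j assume "j \<in> {..<m}"
        then have j: "j < m" by simp
        show "C_diff n r U (\<lambda>x. partial_deriv j g (f x))"
          using Suc.prems j by (intro Suc.IH) simp
        show "C_diff n r U (partial_deriv i (\<lambda>x. f x j))"
          using f[OF j, of "Suc r"] i by simp
      qed simp
    qed
  }
qed

section \<open>Charts and smooth maps\<close>

text \<open>The predicate on which the calculus rests; the Hausdorff property and second
  countability travel separately, as \<open>smooth_manifold_iff\<close> shows.\<close>

definition smooth_atlas :: "'a manifold \<Rightarrow> bool" where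
  "smooth_atlas M \<longleftrightarrow>
    (\<forall>C\<in>atlas M. topological_chart (mtop M) (mdim M) C) \<and>
    (\<Union>C\<in>atlas M. fst C) = points M \<and>
    (\<forall>C\<in>atlas M. \<forall>D\<in>atlas M. smooth_transition (mdim M) C D)"

lemma smooth_manifold_iff:
  "smooth_manifold M \<longleftrightarrow> Hausdorff_space (mtop M) \<and> second_countable (mtop M) \<and> smooth_atlas M"
  by (auto simp: smooth_manifold_def smooth_atlas_def)

context
  fixes X n C
  assumes C: "topological_chart X n C"
begin

lemma chart_inj: "inj_on (snd C) (fst C)"
  using C unfolding topological_chart_def homeomorphic_eq_everything_map
  by (auto simp: Int_absorb1 openin_subset)

lemma chart_inv_left: "x \<in> fst C \<Longrightarrow> chart_inv C (snd C x) = x"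
  by (simp add: chart_inv_def inv_into_f_f[OF chart_inj])

lemma chart_inv_right: "y \<in> snd C ` fst C \<Longrightarrow> snd C (chart_inv C y) = y"
  by (simp add: chart_inv_def f_inv_into_f)

lemma chart_inv_into: "y \<in> snd C ` fst C \<Longrightarrow> chart_inv C y \<in> fst C"
  by (simp add: chart_inv_def inv_into_into)

lemma chart_open: "openin X (fst C)" "openin (Euclidean_space n) (snd C ` fst C)"
  using C by (auto simp: topological_chart_def)

lemma chart_in_Espace: "x \<in> fst C \<Longrightarrow> snd C x \<in> Espace n"
  using openin_subset[OF chart_open(2)] by auto

lemma chart_in_points: "x \<in> fst C \<Longrightarrow> x \<in> topspace X"
  using openin_subset[OF chart_open(1)] by auto

lemma chart_image_open: "openin X T \<Longrightarrow> openin (Euclidean_space n) (snd C ` (fst C \<inter> T))"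
proof -
  assume T: "openin X T"
  have "open_map (subtopology X (fst C)) (subtopology (Euclidean_space n) (snd C ` fst C)) (snd C)"
    using C homeomorphic_imp_open_map unfolding topological_chart_def by blast
  moreover have "openin (subtopology X (fst C)) (fst C \<inter> T)"
    using T by (auto simp: openin_subtopology)
  ultimately have "openin (subtopology (Euclidean_space n) (snd C ` fst C)) (snd C ` (fst C \<inter> T))"
    by (auto simp: open_map_def)
  then show ?thesis using chart_open(2) openin_trans_full by blast
qed

lemma chart_continuous: "continuous_map (subtopology X (fst C)) (Euclidean_space n) (snd C)"
proof -
  have "continuous_map (subtopology X (fst C)) (subtopology (Euclidean_space n) (snd C ` fst C)) (snd C)"
    using C homeomorphic_imp_continuous_map unfolding topological_chart_def by blast
  then show ?thesis by (simp add: continuous_map_in_subtopology)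
qed

text \<open>\<open>chart_inv\<close> is a choice function; on the image of the chart it agrees with
  the continuous inverse of the homeomorphism.\<close>

lemma chart_inv_continuous:
  "continuous_map (subtopology (Euclidean_space n) (snd C ` fst C)) X (chart_inv C)"
proof -
  obtain g where g: "homeomorphic_maps (subtopology X (fst C)) (subtopology (Euclidean_space n) (snd C ` fst C)) (snd C) g"
    using C homeomorphic_map_maps unfolding topological_chart_def by blast
  then have "continuous_map (subtopology (Euclidean_space n) (snd C ` fst C)) X g"
    by (simp add: homeomorphic_maps_def continuous_map_in_subtopology)
  then show ?thesis
  proof (rule continuous_map_eq)
    fix y assume "y \<in> topspace (subtopology (Euclidean_space n) (snd C ` fst C))"
    then obtain x where x: "x \<in> fst C" "y = snd C x" by auto
    then have "g y = x" using g chart_in_points[OF x(1)] by (auto simp: homeomorphic_maps_def)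
    then show "g y = chart_inv C y" using x chart_inv_left by simp
  qed
qed

end

lemma topological_chartI:
  assumes "openin X (fst C)" "openin (Euclidean_space n) (snd C ` fst C)"
    and "continuous_map (subtopology X (fst C)) (Euclidean_space n) (snd C)"
    and "continuous_map (subtopology (Euclidean_space n) (snd C ` fst C)) X h"
    and "\<And>x. x \<in> fst C \<Longrightarrow> h (snd C x) = x"
  shows "topological_chart X n C"
  unfolding topological_chart_def homeomorphic_map_maps
proof (intro conjI exI)
  show "homeomorphic_maps (subtopology X (fst C)) (subtopology (Euclidean_space n) (snd C ` fst C)) (snd C) h"
    using assms by (auto simp: homeomorphic_maps_def continuous_map_in_subtopology)
qed (use assms in auto)

lemma chart_inv_eqI: "inj_on (snd C) (fst C) \<Longrightarrow> x \<in> fst C \<Longrightarrow> snd C x = y \<Longrightarrow> chart_inv C y = x"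
  by (auto simp: chart_inv_def inv_into_f_f)

section \<open>Smoothness on arbitrary subsets of coordinate space\<close>

lemma smooth_fun_on_cong: "smooth_fun_on n A f \<Longrightarrow> (\<And>x. x \<in> A \<Longrightarrow> f x = g x) \<Longrightarrow> smooth_fun_on n A g"
  unfolding smooth_fun_on_def by (metis Int_iff)

lemma smooth_fun_on_subset: "smooth_fun_on n A f \<Longrightarrow> B \<subseteq> A \<Longrightarrow> smooth_fun_on n B f"
  unfolding smooth_fun_on_def
proof (intro ballI)
  fix x assume *: "\<forall>x\<in>A. \<exists>U g. openin (Euclidean_space n) U \<and> x \<in> U \<and> (\<forall>r. C_diff n r U g) \<and> (\<forall>y\<in>A \<inter> U. f y = g y)"
    and B: "B \<subseteq> A" and x: "x \<in> B"
  then have "x \<in> A" by auto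
  from *[rule_format, OF this] B
  show "\<exists>U g. openin (Euclidean_space n) U \<and> x \<in> U \<and> (\<forall>r. C_diff n r U g) \<and> (\<forall>y\<in>B \<inter> U. f y = g y)"
    by (elim exE conjE) (intro exI conjI, assumption+, auto)
qed

lemma smooth_fun_on_local:
  assumes "\<And>x. x \<in> A \<Longrightarrow> \<exists>W. openin (Euclidean_space n) W \<and> x \<in> W \<and> smooth_fun_on n (A \<inter> W) f"
  shows "smooth_fun_on n A f"
  unfolding smooth_fun_on_def
proof
  fix x assume x: "x \<in> A"
  obtain W where W: "openin (Euclidean_space n) W" "x \<in> W" "smooth_fun_on n (A \<inter> W) f"
    using assms[OF x] by blast
  from W(3)[unfolded smooth_fun_on_def, rule_format, of x] x W(2)
  obtain U g where U: "openin (Euclidean_space n) U" "x \<in> U" "\<forall>r. C_diff n r U g" "\<forall>y\<in>A \<inter> W \<inter> U. f y = g y"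
    by blast
  have "\<forall>r. C_diff n r (U \<inter> W) g" using U(3) C_diff_subset by blast
  then show "\<exists>U g. openin (Euclidean_space n) U \<and> x \<in> U \<and> (\<forall>r. C_diff n r U g) \<and> (\<forall>y\<in>A \<inter> U. f y = g y)"
    using U W by (intro exI[of _ "U \<inter> W"] exI[of _ g]) auto
qed

lemma smooth_fun_on_C_diff:
  assumes "\<And>r. C_diff n r (Espace n) f" "A \<subseteq> Espace n"
  shows "smooth_fun_on n A f"
  using assms unfolding smooth_fun_on_def by (intro ballI exI[of _ "Espace n"] exI[of _ f]) auto

text \<open>The local extensions of the components of \<open>f\<close> live on different open sets.
  They are restricted to a common one and bundled into a map \<open>F\<close>, whose domain is then
  shrunk until \<open>F\<close> lands where \<open>g\<close> has an extension.\<close>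

lemma smooth_fun_on_compose:
  assumes g: "smooth_fun_on m B g" and f: "\<And>j. j < m \<Longrightarrow> smooth_fun_on n A (\<lambda>x. f x j)"
    and fB: "\<And>x. x \<in> A \<Longrightarrow> f x \<in> B" and B: "B \<subseteq> Espace m" and A: "A \<subseteq> Espace n"
  shows "smooth_fun_on n A (\<lambda>x. g (f x))"
  unfolding smooth_fun_on_def
proof
  fix x assume x: "x \<in> A"
  from g[unfolded smooth_fun_on_def, rule_format, OF fB[OF x]]
  obtain V h where V: "openin (Euclidean_space m) V" "f x \<in> V" "\<And>r. C_diff m r V h" "\<And>y. y \<in> B \<inter> V \<Longrightarrow> g y = h y"
    by metis
  have "\<exists>U k. openin (Euclidean_space n) U \<and> x \<in> U \<and> (\<forall>r. C_diff n r U k) \<and> (\<forall>y\<in>A \<inter> U. f y j = k y)" if "j < m" for j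
    using f[OF that, unfolded smooth_fun_on_def, rule_format, OF x] .
  then obtain U k where U: "\<And>j. j < m \<Longrightarrow> openin (Euclidean_space n) (U j)" "\<And>j. j < m \<Longrightarrow> x \<in> U j"
    "\<And>j r. j < m \<Longrightarrow> C_diff n r (U j) (k j)" "\<And>j y. j < m \<Longrightarrow> y \<in> A \<inter> U j \<Longrightarrow> f y j = k j y"
    by metis
  \<comment> \<open>For \<open>m = 0\<close> the indexed intersection is the whole type;
    intersecting with \<open>Espace n\<close> keeps the set open.\<close>
  define U0 where "U0 = Espace n \<inter> (\<Inter>j\<in>{..<m}. U j)"
  have U0: "openin (Euclidean_space n) U0"
    unfolding U0_def using U(1)
    by (cases "m = 0") (auto intro!: openin_Int openin_Inter)
  have sub: "U0 \<subseteq> U j" if "j < m" for j using that by (auto simp: U0_def)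
  \<comment> \<open>Filling up with 0 puts \<open>F\<close> into \<open>Espace m\<close> also off
    \<open>A\<close>, where nothing is known about \<open>f\<close>.\<close>
  define F where "F y = (\<lambda>j. if j < m then k j y else 0)" for y
  have FE: "F y \<in> Espace m" for y by (simp add: F_def mem_Espace)
  have Fs: "C_diff n r U0 (\<lambda>y. F y j)" if "j < m" for j r
    using C_diff_subset[OF U(3)[OF that] sub[OF that]] that by (simp add: F_def)
  have eq: "F y = f y" if "y \<in> A \<inter> U0" for y
  proof
    fix j show "F y j = f y j"
      using that U(4)[of j y] sub[of j] fB[of y] B by (cases "j < m") (auto simp: F_def mem_Espace)
  qed
  have xU0: "x \<in> U0" using x A U(2) by (auto simp: U0_def)
  have Fc: "continuous_map (subtopology (Euclidean_space n) U0) (Euclidean_space m) F"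
    using FE Fs C_diff_continuous by (intro continuous_map_into_Euclidean) blast+
  define W where "W = {y \<in> U0. F y \<in> V}"
  have "openin (subtopology (Euclidean_space n) U0) {y \<in> topspace (subtopology (Euclidean_space n) U0). F y \<in> V}"
    by (rule openin_continuous_map_preimage[OF Fc V(1)])
  moreover have "topspace (subtopology (Euclidean_space n) U0) = U0"
    using openin_subset[OF U0] by auto
  ultimately have W: "openin (Euclidean_space n) W"
    using openin_trans_full[OF _ U0] by (simp only: W_def)
  have "C_diff n r W (\<lambda>y. h (F y))" for r
  proof (rule C_diff_compose[OF W V(1) _ _ V(3)])
    show "C_diff n r W (\<lambda>y. F y j)" if "j < m" for r j
      by (rule C_diff_subset[OF Fs[OF that]]) (auto simp: W_def)
  qed (simp add: W_def)
  moreover have "g (f y) = h (F y)" if "y \<in> A \<inter> W" for y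
    using that eq[of y] V(4)[of "F y"] fB[of y] by (auto simp: W_def)
  moreover have "x \<in> W" using xU0 eq[of x] V(2) x by (auto simp: W_def)
  ultimately show "\<exists>U h. openin (Euclidean_space n) U \<and> x \<in> U \<and> (\<forall>r. C_diff n r U h) \<and> (\<forall>y\<in>A \<inter> U. g (f y) = h y)"
    using W by (intro exI[of _ W] exI[of _ "\<lambda>y. h (F y)"]) auto
qed

lemma smooth_fun_on_continuous:
  assumes f: "smooth_fun_on n A f" and A: "A \<subseteq> Espace n"
  shows "continuous_map (subtopology (Euclidean_space n) A) euclideanreal f"
  unfolding continuous_real_box[OF A]
proof (intro ballI allI impI)
  fix a and e :: real assume a: "a \<in> A" and e: "e > 0"
  from f[unfolded smooth_fun_on_def, rule_format, OF a]
  obtain U g where U: "openin (Euclidean_space n) U" "a \<in> U" "\<And>r. C_diff n r U g" "\<And>y. y \<in> A \<inter> U \<Longrightarrow> f y = g y"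
    by metis
  from C_diff_continuous[OF U(3), unfolded continuous_real_box[OF openin_subset[OF U(1)]], rule_format, OF U(2) e]
  obtain d where d: "d > 0" "\<And>y. y \<in> U \<Longrightarrow> (\<forall>i<n. \<bar>y i - a i\<bar> < d) \<Longrightarrow> \<bar>g y - g a\<bar> < e" by auto
  from U(1)[unfolded openin_Euclidean_box, THEN conjunct2, rule_format, OF U(2)]
  obtain d' where d': "d' > 0" "\<And>y. y \<in> Espace n \<Longrightarrow> (\<forall>i<n. \<bar>y i - a i\<bar> < d') \<Longrightarrow> y \<in> U" by auto
  have "\<bar>f y - f a\<bar> < e" if "y \<in> A" "\<forall>i<n. \<bar>y i - a i\<bar> < min d d'" for y
    using that A d(2)[of y] d'(2)[of y] U(4)[of y] U(4)[of a] a U(2) by auto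
  then show "\<exists>d>0. \<forall>y\<in>A. (\<forall>i<n. \<bar>y i - a i\<bar> < d) \<longrightarrow> \<bar>f y - f a\<bar> < e"
    using d(1) d'(1) by (intro exI[of _ "min d d'"]) auto
qed

context
  fixes M :: "'a manifold"
  assumes M: "smooth_atlas M"
begin

lemma atlas_chart: "C \<in> atlas M \<Longrightarrow> topological_chart (mtop M) (mdim M) C"
  using M by (auto simp: smooth_atlas_def)

lemma atlas_cover: "x \<in> points M \<Longrightarrow> \<exists>C\<in>atlas M. x \<in> fst C"
  using M by (auto simp: smooth_atlas_def)

lemma chart_at: "x \<in> points M \<Longrightarrow> chart_at M x \<in> atlas M \<and> x \<in> fst (chart_at M x)"
  unfolding chart_at_def using someI_ex[of "\<lambda>C. C \<in> atlas M \<and> x \<in> fst C"] atlas_cover by blast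

end

section \<open>Smooth maps between manifolds\<close>

lemma smooth_map_onD_points:
  "smooth_map_on M A M' f \<Longrightarrow> x \<in> A \<Longrightarrow> x \<in> points M \<Longrightarrow> f x \<in> points M'"
  by (auto simp: smooth_map_on_def continuous_map_def)

lemma smooth_map_on_subset: "smooth_map_on M A M' f \<Longrightarrow> B \<subseteq> A \<Longrightarrow> smooth_map_on M B M' f"
  unfolding smooth_map_on_def smooth_vec_on_def
proof (elim conjE, intro conjI ballI allI impI)
  assume "continuous_map (subtopology (mtop M) A) (mtop M') f" "B \<subseteq> A"
  then show "continuous_map (subtopology (mtop M) B) (mtop M') f"
    by (rule continuous_map_from_subtopology_mono)
next
  fix C D j
  assume *: "\<forall>C\<in>atlas M. \<forall>D\<in>atlas M'. \<forall>j<mdim M'.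
      smooth_fun_on (mdim M) (snd C ` (A \<inter> fst C \<inter> f -` fst D)) (\<lambda>x. (snd D \<circ> f \<circ> chart_inv C) x j)"
    and B: "B \<subseteq> A" and CD: "C \<in> atlas M" "D \<in> atlas M'" "j < mdim M'"
  show "smooth_fun_on (mdim M) (snd C ` (B \<inter> fst C \<inter> f -` fst D)) (\<lambda>x. (snd D \<circ> f \<circ> chart_inv C) x j)"
    by (rule smooth_fun_on_subset[OF *[rule_format, OF CD]]) (use B in blast)
qed

lemma smooth_map_on_cong:
  assumes f: "smooth_map_on M A M' f" and eq: "\<And>x. x \<in> A \<Longrightarrow> f x = g x" and M: "smooth_atlas M"
  shows "smooth_map_on M A M' g"
  unfolding smooth_map_on_def smooth_vec_on_def
proof (intro conjI ballI allI impI)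
  show "continuous_map (subtopology (mtop M) A) (mtop M') g"
    using f eq by (auto simp: smooth_map_on_def intro: continuous_map_eq)
  fix C D j assume C: "C \<in> atlas M" and D: "D \<in> atlas M'" and j: "j < mdim M'"
  have "A \<inter> fst C \<inter> f -` fst D = A \<inter> fst C \<inter> g -` fst D" using eq by auto
  moreover have "smooth_fun_on (mdim M) (snd C ` (A \<inter> fst C \<inter> f -` fst D)) (\<lambda>x. (snd D \<circ> f \<circ> chart_inv C) x j)"
    using f C D j by (simp add: smooth_map_on_def smooth_vec_on_def)
  ultimately have "smooth_fun_on (mdim M) (snd C ` (A \<inter> fst C \<inter> g -` fst D)) (\<lambda>x. (snd D \<circ> f \<circ> chart_inv C) x j)"
    by simp
  then show "smooth_fun_on (mdim M) (snd C ` (A \<inter> fst C \<inter> g -` fst D)) (\<lambda>x. (snd D \<circ> g \<circ> chart_inv C) x j)"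
    by (rule smooth_fun_on_cong) (auto simp: chart_inv_left[OF atlas_chart[OF M C]] eq)
qed

text \<open>The chart expression of the composite has to pass through a chart of \<open>M'\<close>,
  and no single one serves all of \<open>A\<close>. So the claim is localised: near \<open>x\<close>
  the map \<open>f\<close> takes values in one chart \<open>D\<close> around \<open>f x\<close>, and
  there the expression factors.\<close>

lemma smooth_map_on_compose:
  assumes M: "smooth_atlas M" and M': "smooth_atlas M'"
    and f: "smooth_map_on M A M' f" and g: "smooth_map_on M' B M'' g"
    and fB: "\<And>x. x \<in> A \<Longrightarrow> x \<in> points M \<Longrightarrow> f x \<in> B"
  shows "smooth_map_on M A M'' (\<lambda>x. g (f x))"
  unfolding smooth_map_on_def smooth_vec_on_def
proof (intro conjI ballI allI impI)
  have fc: "continuous_map (subtopology (mtop M) A) (mtop M') f" using f by (simp add: smooth_map_on_def)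
  then have "continuous_map (subtopology (mtop M) A) (subtopology (mtop M') B) f"
    using fB by (auto simp: continuous_map_in_subtopology)
  from continuous_map_compose[OF this] g
  show "continuous_map (subtopology (mtop M) A) (mtop M'') (\<lambda>x. g (f x))"
    by (auto simp: smooth_map_on_def o_def)
  fix C E j assume C: "C \<in> atlas M" and E: "E \<in> atlas M''" and j: "j < mdim M''"
  note tC = atlas_chart[OF M C]
  let ?S = "snd C ` (A \<inter> fst C \<inter> (\<lambda>x. g (f x)) -` fst E)"
  have SE: "?S \<subseteq> Espace (mdim M)" using chart_in_Espace[OF tC] by auto
  show "smooth_fun_on (mdim M) ?S (\<lambda>x. (snd E \<circ> (\<lambda>x. g (f x)) \<circ> chart_inv C) x j)"
  proof (rule smooth_fun_on_local)
    fix y assume "y \<in> ?S"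
    then obtain x where x: "x \<in> A" "x \<in> fst C" "g (f x) \<in> fst E" "y = snd C x" by auto
    have xM: "x \<in> points M" by (rule chart_in_points[OF tC x(2)])
    obtain D where D: "D \<in> atlas M'" "f x \<in> fst D"
      using atlas_cover[OF M'] smooth_map_onD_points[OF f x(1) xM] by blast
    note tD = atlas_chart[OF M' D(1)]
    obtain T where T: "openin (mtop M) T" "{z \<in> topspace (subtopology (mtop M) A). f z \<in> fst D} = T \<inter> A"
      using openin_continuous_map_preimage[OF fc chart_open(1)[OF tD]] unfolding openin_subtopology by (elim exE conjE) (rule that)
    have "x \<in> T \<inter> A" unfolding T(2)[symmetric] using x xM D(2) by simp
    then have xT: "x \<in> T" by simp
    have TD: "f z \<in> fst D" if "z \<in> A" "z \<in> T" for z
    proof -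
      have "z \<in> T \<inter> A" using that by simp
      then show ?thesis unfolding T(2)[symmetric] by simp
    qed
    let ?W = "snd C ` (fst C \<inter> T)"
    have W: "openin (Euclidean_space (mdim M)) ?W" by (rule chart_image_open[OF tC T(1)])
    \<comment> \<open>Membership in the two images provides two points with equal coordinates;
      injectivity of the chart identifies them, so all conditions hold at a single point.\<close>
    have SW: "\<exists>z. z \<in> A \<and> z \<in> fst C \<and> z \<in> T \<and> g (f z) \<in> fst E \<and> w = snd C z" if w: "w \<in> ?S \<inter> ?W" for w
    proof -
      from w obtain z z' where z: "z \<in> A" "z \<in> fst C" "g (f z) \<in> fst E" "w = snd C z" "z' \<in> fst C" "z' \<in> T" "w = snd C z'"
        by auto
      then have "z = z'" using chart_inj[OF tC] by (auto dest: inj_onD)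
      then show ?thesis using z by blast
    qed
    have "smooth_fun_on (mdim M) (?S \<inter> ?W) (\<lambda>w. (snd E \<circ> g \<circ> chart_inv D) ((snd D \<circ> f \<circ> chart_inv C) w) j)"
    proof (rule smooth_fun_on_compose[where g = "\<lambda>x. (snd E \<circ> g \<circ> chart_inv D) x j"])
      show "smooth_fun_on (mdim M') (snd D ` (B \<inter> fst D \<inter> g -` fst E)) (\<lambda>x. (snd E \<circ> g \<circ> chart_inv D) x j)"
        using g D E j by (simp add: smooth_map_on_def smooth_vec_on_def)
      show "smooth_fun_on (mdim M) (?S \<inter> ?W) (\<lambda>w. (snd D \<circ> f \<circ> chart_inv C) w i)" if i: "i < mdim M'" for i
      proof (rule smooth_fun_on_subset)
        show "smooth_fun_on (mdim M) (snd C ` (A \<inter> fst C \<inter> f -` fst D)) (\<lambda>w. (snd D \<circ> f \<circ> chart_inv C) w i)"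
          using f C D i by (simp add: smooth_map_on_def smooth_vec_on_def)
        show "?S \<inter> ?W \<subseteq> snd C ` (A \<inter> fst C \<inter> f -` fst D)"
          using SW TD by blast
      qed
      show "(snd D \<circ> f \<circ> chart_inv C) w \<in> snd D ` (B \<inter> fst D \<inter> g -` fst E)" if "w \<in> ?S \<inter> ?W" for w
        using SW[OF that] TD fB chart_in_points[OF tC] by (auto simp: chart_inv_left[OF tC])
      show "snd D ` (B \<inter> fst D \<inter> g -` fst E) \<subseteq> Espace (mdim M')" using chart_in_Espace[OF tD] by auto
      show "?S \<inter> ?W \<subseteq> Espace (mdim M)" using SE by blast
    qed
    then have "smooth_fun_on (mdim M) (?S \<inter> ?W) (\<lambda>x. (snd E \<circ> (\<lambda>x. g (f x)) \<circ> chart_inv C) x j)"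
    proof (rule smooth_fun_on_cong)
      fix w assume w: "w \<in> ?S \<inter> ?W"
      from SW[OF this] obtain z where "z \<in> A" "z \<in> fst C" "z \<in> T" "w = snd C z" by blast
      then show "(snd E \<circ> g \<circ> chart_inv D) ((snd D \<circ> f \<circ> chart_inv C) w) j = (snd E \<circ> (\<lambda>x. g (f x)) \<circ> chart_inv C) w j"
        using TD[of z] by (simp add: chart_inv_left[OF tC] chart_inv_left[OF tD])
    qed
    then show "\<exists>W. openin (Euclidean_space (mdim M)) W \<and> y \<in> W \<and>
        smooth_fun_on (mdim M) (?S \<inter> W) (\<lambda>x. (snd E \<circ> (\<lambda>x. g (f x)) \<circ> chart_inv C) x j)"
      using W x xT by (intro exI[of _ ?W]) auto
  qed
qed

lemma smooth_map_on_id: "smooth_atlas M \<Longrightarrow> smooth_map_on M A M (\<lambda>x. x)"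
  unfolding smooth_map_on_def smooth_vec_on_def
proof (intro conjI ballI allI impI)
  assume M: "smooth_atlas M"
  show "continuous_map (subtopology (mtop M) A) (mtop M) (\<lambda>x. x)"
    by (simp add: continuous_map_from_subtopology)
  fix C D j assume C: "C \<in> atlas M" and D: "D \<in> atlas M" and j: "j < mdim M"
  have "smooth_fun_on (mdim M) (snd C ` (fst C \<inter> fst D)) (\<lambda>x. (snd D \<circ> (\<lambda>x. x) \<circ> chart_inv C) x j)"
    using M C D j by (auto simp: smooth_atlas_def smooth_transition_def smooth_vec_on_def o_def)
  then show "smooth_fun_on (mdim M) (snd C ` (A \<inter> fst C \<inter> (\<lambda>x. x) -` fst D)) (\<lambda>x. (snd D \<circ> (\<lambda>x. x) \<circ> chart_inv C) x j)"
    by (rule smooth_fun_on_subset) auto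
qed

lemma smooth_map_on_const:
  "smooth_atlas M \<Longrightarrow> c \<in> points M' \<Longrightarrow> smooth_map_on M A M' (\<lambda>x. c)"
  unfolding smooth_map_on_def smooth_vec_on_def
proof (intro conjI ballI allI impI)
  assume M: "smooth_atlas M" and c: "c \<in> points M'"
  show "continuous_map (subtopology (mtop M) A) (mtop M') (\<lambda>x. c)" using c by simp
  fix C D j assume C: "C \<in> atlas M"
  show "smooth_fun_on (mdim M) (snd C ` (A \<inter> fst C \<inter> (\<lambda>x. c) -` fst D)) (\<lambda>x. (snd D \<circ> (\<lambda>x. c) \<circ> chart_inv C) x j)"
    using chart_in_Espace[OF atlas_chart[OF M C]]
    by (auto simp: o_def intro!: smooth_fun_on_C_diff C_diff_const)
qed

section \<open>Smooth functions with values in coordinate spaces\<close>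

definition real_vec :: "real \<Rightarrow> vec" where
  "real_vec t = (\<lambda>i. if i = 0 then t else 0)"

lemma real_vec_Espace [simp]: "real_vec t \<in> Espace (Suc 0)"
  by (simp add: real_vec_def mem_Espace)

lemma real_vec_0 [simp]: "real_vec t 0 = t"
  by (simp add: real_vec_def)

lemma real_vec_eq: "y \<in> Espace 1 \<Longrightarrow> real_vec (y 0) = y"
  by (auto simp: real_vec_def mem_Espace fun_eq_iff)

lemma real_line_simps [simp]:
  "mtop real_line = euclideanreal" "mdim real_line = 1" "atlas real_line = {(UNIV, real_vec)}"
  by (auto simp: real_line_def real_vec_def fun_eq_iff)

lemma vec_manifold_simps [simp]:
  "mtop (vec_manifold n) = Euclidean_space n" "mdim (vec_manifold n) = n"
  "atlas (vec_manifold n) = {(Espace n, \<lambda>x. x)}"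
  by (auto simp: vec_manifold_def)

lemma real_vec_image: "range real_vec = Espace 1"
proof
  show "Espace 1 \<subseteq> range real_vec" using real_vec_eq by (metis rangeI subsetI)
qed auto

lemma chart_inv_real_line [simp]: "y \<in> Espace 1 \<Longrightarrow> chart_inv (UNIV, real_vec) y = y 0"
  by (rule chart_inv_eqI) (auto simp: real_vec_eq inj_on_def dest: arg_cong[of _ _ "\<lambda>v. v 0"])

lemma chart_inv_vec_manifold [simp]: "y \<in> Espace n \<Longrightarrow> chart_inv (Espace n, \<lambda>x. x) y = y"
  by (rule chart_inv_eqI) auto

lemma smooth_vec_on_id: "A \<subseteq> Espace n \<Longrightarrow> (\<And>x. x \<in> A \<Longrightarrow> f x = x) \<Longrightarrow> smooth_vec_on n m A f"
  unfolding smooth_vec_on_def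
proof (intro allI impI)
  fix j assume A: "A \<subseteq> Espace n" and f: "\<And>x. x \<in> A \<Longrightarrow> f x = x"
  have "smooth_fun_on n A (\<lambda>x. x j)" using A by (intro smooth_fun_on_C_diff C_diff_coord) auto
  then show "smooth_fun_on n A (\<lambda>x. f x j)" by (rule smooth_fun_on_cong) (simp add: f)
qed

lemma smooth_atlas_real_line: "smooth_atlas real_line"
proof -
  have "topological_chart euclideanreal 1 (UNIV, real_vec)"
  proof (rule topological_chartI[where h = "\<lambda>y. y 0"])
    show "continuous_map (subtopology euclideanreal (fst (UNIV, real_vec))) (Euclidean_space 1) (snd (UNIV, real_vec))"
      by (rule continuous_map_into_Euclidean) auto
  qed (auto simp: real_vec_image continuous_map_from_subtopology continuous_map_coord)
  moreover have "smooth_transition 1 (UNIV, real_vec) (UNIV, real_vec)"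
    unfolding smooth_transition_def by (rule smooth_vec_on_id) (auto simp: real_vec_image real_vec_eq)
  ultimately show ?thesis by (simp add: smooth_atlas_def)
qed

lemma smooth_atlas_vec_manifold: "smooth_atlas (vec_manifold n)"
proof -
  have "topological_chart (Euclidean_space n) n (Espace n, \<lambda>x. x)"
    by (rule topological_chartI[where h = "\<lambda>y. y"]) (auto simp: continuous_map_from_subtopology)
  moreover have "smooth_transition n (Espace n, \<lambda>x. x) (Espace n, \<lambda>x. x)"
    unfolding smooth_transition_def by (rule smooth_vec_on_id) auto
  ultimately show ?thesis by (simp add: smooth_atlas_def)
qed

lemma smooth_real_iff:
  "smooth_map_on M A real_line h \<longleftrightarrow>
    continuous_map (subtopology (mtop M) A) euclideanreal h \<and>
    (\<forall>C\<in>atlas M. smooth_fun_on (mdim M) (snd C ` (A \<inter> fst C)) (\<lambda>y. h (chart_inv C y)))"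
  by (simp add: smooth_map_on_def smooth_vec_on_def o_def real_vec_def)

text \<open>Obtained by composing the pair of functions, as a map into \<open>Espace 2\<close>, with
  addition of coordinates; the local extensions are thus merged by the composition lemma.\<close>

lemma smooth_fun_on_add:
  assumes "smooth_fun_on n A f" "smooth_fun_on n A g" "A \<subseteq> Espace n"
  shows "smooth_fun_on n A (\<lambda>x. f x + g x)"
proof -
  have "smooth_fun_on n A (\<lambda>x. (if 0 = (0::nat) then f x else if 0 = (1::nat) then g x else 0)
      + (if 1 = (0::nat) then f x else if 1 = (1::nat) then g x else 0))"
  proof (rule smooth_fun_on_compose[where m = 2 and B = "Espace 2" and g = "\<lambda>v. v 0 + v 1"
      and f = "\<lambda>x i. if i = 0 then f x else if i = 1 then g x else 0"])
    show "smooth_fun_on 2 (Espace 2) (\<lambda>v. v 0 + v 1)"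
      by (intro smooth_fun_on_C_diff C_diff_add C_diff_coord) auto
    show "smooth_fun_on n A (\<lambda>x. if j = 0 then f x else if j = 1 then g x else 0)" if "j < 2" for j :: nat
      using that assms by (cases "j = 0") (auto simp: less_2_cases_iff)
  qed (use assms in \<open>auto simp: mem_Espace\<close>)
  then show ?thesis by simp
qed

lemma smooth_fun_on_mult:
  assumes "smooth_fun_on n A f" "smooth_fun_on n A g" "A \<subseteq> Espace n"
  shows "smooth_fun_on n A (\<lambda>x. f x * g x)"
proof -
  have "smooth_fun_on n A (\<lambda>x. (if 0 = (0::nat) then f x else if 0 = (1::nat) then g x else 0)
      * (if 1 = (0::nat) then f x else if 1 = (1::nat) then g x else 0))"
  proof (rule smooth_fun_on_compose[where m = 2 and B = "Espace 2" and g = "\<lambda>v. v 0 * v 1"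
      and f = "\<lambda>x i. if i = 0 then f x else if i = 1 then g x else 0"])
    show "smooth_fun_on 2 (Espace 2) (\<lambda>v. v 0 * v 1)"
      by (intro smooth_fun_on_C_diff C_diff_mult C_diff_coord) auto
    show "smooth_fun_on n A (\<lambda>x. if j = 0 then f x else if j = 1 then g x else 0)" if "j < 2" for j :: nat
      using that assms by (cases "j = 0") (auto simp: less_2_cases_iff)
  qed (use assms in \<open>auto simp: mem_Espace\<close>)
  then show ?thesis by simp
qed

context
  fixes M :: "'a manifold"
  assumes M: "smooth_atlas M"
begin

lemma smooth_real_const: "smooth_map_on M A real_line (\<lambda>x. c)"
  by (rule smooth_map_on_const[OF M]) simp

lemma smooth_real_add:
  assumes "smooth_map_on M A real_line f" "smooth_map_on M A real_line g"
  shows "smooth_map_on M A real_line (\<lambda>x. f x + g x)"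
  using assms unfolding smooth_real_iff
  by (auto intro!: continuous_map_add smooth_fun_on_add chart_in_Espace[OF atlas_chart[OF M]])

lemma smooth_real_mult:
  assumes "smooth_map_on M A real_line f" "smooth_map_on M A real_line g"
  shows "smooth_map_on M A real_line (\<lambda>x. f x * g x)"
  using assms unfolding smooth_real_iff
  by (auto intro!: continuous_map_real_mult smooth_fun_on_mult chart_in_Espace[OF atlas_chart[OF M]])

lemma smooth_real_minus:
  assumes "smooth_map_on M A real_line f"
  shows "smooth_map_on M A real_line (\<lambda>x. - f x)"
  using smooth_real_mult[OF smooth_real_const[of A "-1"] assms] by simp

lemma smooth_vecI:
  assumes E: "\<And>x. x \<in> A \<Longrightarrow> F x \<in> Espace n"
    and s: "\<And>i. i < n \<Longrightarrow> smooth_map_on M A real_line (\<lambda>x. F x i)"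
  shows "smooth_map_on M A (vec_manifold n) F"
  unfolding smooth_map_on_def
proof (intro conjI ballI)
  show "continuous_map (subtopology (mtop M) A) (mtop (vec_manifold n)) F"
    using E s by (auto intro!: continuous_map_into_Euclidean simp: smooth_real_iff)
  fix C D assume C: "C \<in> atlas M" and "D \<in> atlas (vec_manifold n)"
  then have D: "D = (Espace n, \<lambda>x. x)" by simp
  show "smooth_vec_on (mdim M) (mdim (vec_manifold n)) (snd C ` (A \<inter> fst C \<inter> F -` fst D)) (snd D \<circ> F \<circ> chart_inv C)"
    unfolding smooth_vec_on_def D
  proof (intro allI impI)
    fix j assume "j < mdim (vec_manifold n)"
    then have "smooth_fun_on (mdim M) (snd C ` (A \<inter> fst C)) (\<lambda>y. F (chart_inv C y) j)"
      using s[of j] C by (simp add: smooth_real_iff)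
    then have "smooth_fun_on (mdim M) (snd C ` (A \<inter> fst C \<inter> F -` fst (Espace n, \<lambda>x. x))) (\<lambda>y. F (chart_inv C y) j)"
      by (rule smooth_fun_on_subset) auto
    then show "smooth_fun_on (mdim M) (snd C ` (A \<inter> fst C \<inter> F -` fst (Espace n, \<lambda>x. x)))
        (\<lambda>x. (snd (Espace n, \<lambda>x. x) \<circ> F \<circ> chart_inv C) x j)"
      by (simp add: o_def)
  qed
qed

lemma smooth_vec_component:
  assumes F: "smooth_map_on M A (vec_manifold n) F" and A: "A \<subseteq> points M"
  shows "smooth_map_on M A real_line (\<lambda>x. F x i)"
proof -
  have FE: "F x \<in> Espace n" if "x \<in> A" for x
    using smooth_map_onD_points[OF F that] that A by auto
  have "smooth_fun_on (mdim M) (snd C ` (A \<inter> fst C)) (\<lambda>y. F (chart_inv C y) i)" if C: "C \<in> atlas M" for C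
  proof (cases "i < n")
    case True
    have "A \<inter> fst C \<inter> F -` Espace n = A \<inter> fst C" using FE by auto
    then show ?thesis using F C True by (auto simp: smooth_map_on_def smooth_vec_on_def o_def)
  next
    case False
    have "smooth_fun_on (mdim M) (snd C ` (A \<inter> fst C)) (\<lambda>y. 0)"
      using chart_in_Espace[OF atlas_chart[OF M C]] by (auto intro!: smooth_fun_on_C_diff C_diff_const)
    then show ?thesis
    proof (rule smooth_fun_on_cong)
      fix y assume "y \<in> snd C ` (A \<inter> fst C)"
      then have "chart_inv C y \<in> A" by (auto simp: chart_inv_left[OF atlas_chart[OF M C]])
      then show "0 = F (chart_inv C y) i" using FE False by (simp add: mem_Espace)
    qed
  qed
  moreover have "continuous_map (subtopology (mtop M) A) euclideanreal (\<lambda>x. F x i)"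
    using F by (auto simp: smooth_map_on_def intro: continuous_map_Euclidean_component)
  ultimately show ?thesis by (simp add: smooth_real_iff)
qed

end

lemma smooth_real_vecI:
  assumes "smooth_fun_on n A h" "A \<subseteq> Espace n"
  shows "smooth_map_on (vec_manifold n) A real_line h"
proof -
  have "smooth_fun_on n A (\<lambda>y. h (chart_inv (Espace n, \<lambda>x. x) y))"
    using assms by (rule_tac smooth_fun_on_cong[OF assms(1)]) auto
  moreover have "A \<inter> Espace n = A" using assms by auto
  ultimately show ?thesis
    using assms by (simp add: smooth_real_iff smooth_fun_on_continuous)
qed

lemma smooth_coord: "A \<subseteq> Espace n \<Longrightarrow> smooth_map_on (vec_manifold n) A real_line (\<lambda>y. y i)"
  by (intro smooth_real_vecI smooth_fun_on_C_diff C_diff_coord) auto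

lemma smooth_real_vec: "smooth_map_on real_line A (vec_manifold 1) real_vec"
proof (rule smooth_vecI[OF smooth_atlas_real_line])
  show "smooth_map_on real_line A real_line (\<lambda>x. real_vec x i)" if "i < 1" for i
    using that smooth_map_on_id[OF smooth_atlas_real_line, of A] by simp
qed auto

lemma smooth_sin: "smooth_map_on real_line A real_line (\<lambda>s. a + b * sin (c * s + d))"
proof -
  have "smooth_map_on (vec_manifold 1) (Espace 1) real_line (\<lambda>y. a + b * sin (c * y 0 + d))"
    by (intro smooth_real_vecI smooth_fun_on_C_diff C_diff_sin) auto
  from smooth_map_on_compose[OF smooth_atlas_real_line smooth_atlas_vec_manifold smooth_real_vec this, of A]
  show ?thesis by simp
qed

context
  fixes M :: "'a manifold"
  assumes M: "smooth_atlas M"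
begin

text \<open>Reduces compatibility with all charts to smoothness of the chart and of its inverse as
  maps. The adapted charts of the graph can then be checked by composing smooth maps.\<close>

lemma maximal_atlasI:
  assumes K: "topological_chart (mtop M) (mdim M) K"
    and s: "smooth_map_on M (fst K) (vec_manifold (mdim M)) (snd K)"
    and si: "smooth_map_on (vec_manifold (mdim M)) (snd K ` fst K) M (chart_inv K)"
  shows "K \<in> maximal_atlas M"
  unfolding maximal_atlas_def
proof (intro CollectI conjI ballI K)
  fix D assume D: "D \<in> atlas M"
  note tD = atlas_chart[OF M D]
  let ?n = "mdim M"
  have KE: "snd K ` fst K \<subseteq> Espace ?n" using chart_in_Espace[OF K] by auto
  show "smooth_transition ?n K D"
    unfolding smooth_transition_def smooth_vec_on_def
  proof (intro allI impI)
    fix j assume j: "j < ?n"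
    have "smooth_fun_on ?n ((\<lambda>x. x) ` (snd K ` fst K \<inter> Espace ?n \<inter> chart_inv K -` fst D))
       (\<lambda>x. (snd D \<circ> chart_inv K \<circ> chart_inv (Espace ?n, \<lambda>x. x)) x j)"
      using si D j by (simp add: smooth_map_on_def smooth_vec_on_def)
    then have "smooth_fun_on ?n (snd K ` (fst K \<inter> fst D)) (\<lambda>x. (snd D \<circ> chart_inv K \<circ> chart_inv (Espace ?n, \<lambda>x. x)) x j)"
      by (rule smooth_fun_on_subset) (use KE in \<open>auto simp: chart_inv_left[OF K]\<close>)
    then show "smooth_fun_on ?n (snd K ` (fst K \<inter> fst D)) (\<lambda>x. (snd D \<circ> chart_inv K) x j)"
      by (rule smooth_fun_on_cong) (use KE in auto)
  qed
  show "smooth_transition ?n D K"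
    unfolding smooth_transition_def smooth_vec_on_def
  proof (intro allI impI)
    fix j assume j: "j < ?n"
    have "smooth_fun_on ?n (snd D ` (fst K \<inter> fst D \<inter> snd K -` Espace ?n)) (\<lambda>x. (snd K \<circ> chart_inv D) x j)"
      using s D j by (simp add: smooth_map_on_def smooth_vec_on_def o_def)
    then show "smooth_fun_on ?n (snd D ` (fst D \<inter> fst K)) (\<lambda>x. (snd K \<circ> chart_inv D) x j)"
      by (rule smooth_fun_on_subset) (use KE in auto)
  qed
qed

lemma maximal_atlasD:
  assumes K: "K \<in> maximal_atlas M"
  shows "topological_chart (mtop M) (mdim M) K"
    and "smooth_map_on M (fst K) (vec_manifold (mdim M)) (snd K)"
    and "smooth_map_on (vec_manifold (mdim M)) (snd K ` fst K) M (chart_inv K)"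
proof -
  show t: "topological_chart (mtop M) (mdim M) K" using K by (simp add: maximal_atlas_def)
  let ?n = "mdim M"
  have KE: "snd K ` fst K \<subseteq> Espace ?n" using chart_in_Espace[OF t] by auto
  have KE': "fst K \<inter> S \<inter> snd K -` Espace ?n = S \<inter> fst K" for S using KE by auto
  show "smooth_map_on M (fst K) (vec_manifold ?n) (snd K)"
    unfolding smooth_map_on_def
    using K chart_continuous[OF t]
    by (auto simp: maximal_atlas_def smooth_transition_def KE' o_def)
  show "smooth_map_on (vec_manifold ?n) (snd K ` fst K) M (chart_inv K)"
    unfolding smooth_map_on_def
  proof (intro conjI ballI)
    show "continuous_map (subtopology (mtop (vec_manifold ?n)) (snd K ` fst K)) (mtop M) (chart_inv K)"
      using chart_inv_continuous[OF t] by simp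
    fix C D assume C: "C \<in> atlas (vec_manifold ?n)" and D: "D \<in> atlas M"
    have C: "C = (Espace ?n, \<lambda>x. x)" using C by simp
    show "smooth_vec_on (mdim (vec_manifold ?n)) ?n (snd C ` (snd K ` fst K \<inter> fst C \<inter> chart_inv K -` fst D))
        (snd D \<circ> chart_inv K \<circ> chart_inv C)"
      unfolding smooth_vec_on_def
    proof (intro allI impI)
      fix j assume j: "j < ?n"
      have "smooth_fun_on ?n (snd K ` (fst K \<inter> fst D)) (\<lambda>x. (snd D \<circ> chart_inv K) x j)"
        using K D j by (auto simp: maximal_atlas_def smooth_transition_def smooth_vec_on_def)
      then have "smooth_fun_on ?n (snd C ` (snd K ` fst K \<inter> fst C \<inter> chart_inv K -` fst D)) (\<lambda>x. (snd D \<circ> chart_inv K) x j)"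
        by (rule smooth_fun_on_subset) (auto simp: C chart_inv_left[OF t])
      then show "smooth_fun_on (mdim (vec_manifold ?n)) (snd C ` (snd K ` fst K \<inter> fst C \<inter> chart_inv K -` fst D))
          (\<lambda>x. (snd D \<circ> chart_inv K \<circ> chart_inv C) x j)"
        by (simp only: vec_manifold_simps, rule_tac smooth_fun_on_cong) (auto simp: C)
    qed
  qed
qed

lemma atlas_maximal: "C \<in> atlas M \<Longrightarrow> C \<in> maximal_atlas M"
  using M by (auto simp: maximal_atlas_def smooth_atlas_def)

end

section \<open>Differentials and velocities\<close>

lemma differential_tangent: "differential M M' f x v \<in> Espace (mdim M')"
  by (simp add: differential_def mem_Espace)

lemma velocity_tangent: "velocity M I c t \<in> Espace (mdim M)"
  by (simp add: velocity_def mem_Espace)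

lemma differential_linear:
  "differential M M' f x (\<lambda>i. a * v i + w i) = (\<lambda>j. a * differential M M' f x v j + differential M M' f x w j)"
  by (auto simp: differential_def fun_eq_iff sum.distrib sum_distrib_left algebra_simps)

lemma differential_zero [simp]: "differential M M' f x (\<lambda>_. 0) = (\<lambda>_. 0)"
  by (simp add: differential_def fun_eq_iff)

lemma differential_diff:
  "differential M M' f x (\<lambda>i. v i - w i) = (\<lambda>j. differential M M' f x v j - differential M M' f x w j)"
  using differential_linear[of M M' f x "-1" w v] by (simp add: fun_eq_iff)

lemma chart_at_real_line [simp]: "chart_at real_line t = (UNIV, real_vec)"
  by (auto simp: chart_at_def)

lemma chart_at_vec_manifold [simp]: "y \<in> Espace n \<Longrightarrow> chart_at (vec_manifold n) y = (Espace n, \<lambda>x. x)"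
  by (auto simp: chart_at_def)

lemma at_within_unit_interval: "t \<in> {0..1::real} \<Longrightarrow> at t within {0..1} \<noteq> bot"
  by (simp add: trivial_limit_within)

section \<open>Derivatives and velocities of curves\<close>

lemma continuous_real_curve_eventually:
  assumes c: "continuous_map (subtopology euclideanreal I) X c" and t: "t \<in> I"
    and A: "openin X A" "c t \<in> A"
  shows "\<forall>\<^sub>F s in nhds t. s \<in> I \<longrightarrow> c s \<in> A"
proof -
  obtain T where T: "openin euclideanreal T" "{s \<in> topspace (subtopology euclideanreal I). c s \<in> A} = T \<inter> I"
    using openin_continuous_map_preimage[OF c A(1)] unfolding openin_subtopology by (elim exE conjE) (rule that)
  have "t \<in> T \<inter> I" unfolding T(2)[symmetric] using t A(2) by simp
  moreover have "open T" using T(1) by simp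
  ultimately have "\<forall>\<^sub>F s in nhds t. s \<in> T" by (intro eventually_nhds_in_open) auto
  then show ?thesis
  proof eventually_elim
    case (elim s)
    have "c s \<in> A" if "s \<in> I"
    proof -
      have "s \<in> T \<inter> I" using elim that by simp
      then show ?thesis unfolding T(2)[symmetric] by simp
    qed
    then show ?case by simp
  qed
qed

text \<open>The local extension is differentiable on both sides of \<open>t\<close>, and its
  derivative restricts to one within \<open>J\<close>; in particular end points of intervals are
  covered.\<close>

lemma smooth_fun_on_real_derivative:
  assumes h: "smooth_fun_on 1 (real_vec ` J) h" and t: "t \<in> J"
  shows "\<exists>d. ((\<lambda>s. h (real_vec s)) has_real_derivative d) (at t within J)"
proof -
  from h[unfolded smooth_fun_on_def, rule_format, of "real_vec t"] t
  obtain U g where U: "openin (Euclidean_space 1) U" "real_vec t \<in> U" "\<And>r. C_diff 1 r U g"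
    "\<And>y. y \<in> real_vec ` J \<inter> U \<Longrightarrow> h y = g y"
    by blast
  have upd: "(real_vec t)(0 := s) = real_vec s" for s by (auto simp: real_vec_def)
  have "DERIV (\<lambda>s. g ((real_vec t)(0 := s))) (real_vec t 0) :> partial_deriv 0 g (real_vec t)"
    by (rule C_diff_DERIV[OF U(3) _ U(2)]) simp
  then have "((\<lambda>s. g (real_vec s)) has_real_derivative partial_deriv 0 g (real_vec t)) (at t within J)"
    by (auto simp: upd intro: has_field_derivative_at_within)
  moreover have "\<forall>\<^sub>F s in nhds t. real_vec s \<in> U"
    using eventually_fun_upd[OF U(1,2), of 0] by (simp add: upd)
  then have "\<forall>\<^sub>F s in nhds t. s \<in> J \<longrightarrow> g (real_vec s) = h (real_vec s)"
    by eventually_elim (use U(4) in auto)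
  note has_field_derivative_cong_ev[OF refl this refl refl t]
  ultimately show ?thesis by blast
qed

context
  fixes M :: "'a manifold"
  assumes M: "smooth_atlas M"
begin

lemma smooth_curve_eventually:
  assumes "smooth_map_on real_line I M c" "t \<in> I" "openin (mtop M) A" "c t \<in> A"
  shows "\<forall>\<^sub>F s in nhds t. s \<in> I \<longrightarrow> c s \<in> A"
  using assms by (intro continuous_real_curve_eventually) (auto simp: smooth_map_on_def)

lemma smooth_curve_derivative:
  assumes c: "smooth_map_on real_line I M c" and t: "t \<in> I" and D: "D \<in> atlas M" "c t \<in> fst D"
    and j: "j < mdim M"
  shows "\<exists>d. ((\<lambda>s. snd D (c s) j) has_real_derivative d) (at t within I)"
proof -
  let ?J = "I \<inter> c -` fst D"
  have "smooth_fun_on 1 (real_vec ` ?J) (\<lambda>y. snd D (c (chart_inv (UNIV, real_vec) y)) j)"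
    using c D j by (simp add: smooth_map_on_def smooth_vec_on_def o_def)
  from smooth_fun_on_real_derivative[OF this, of t] t D
  obtain d where "((\<lambda>s. snd D (c s) j) has_real_derivative d) (at t within ?J)" by auto
  \<comment> \<open>Near \<open>t\<close> the curve stays in the chart, so discarding the times
    outside it does not affect the limit.\<close>
  moreover have "at t within ?J = at t within I"
  proof -
    have "\<forall>\<^sub>F s in nhds t. s \<in> I \<longrightarrow> c s \<in> fst D"
      by (rule smooth_curve_eventually[OF c t chart_open(1)[OF atlas_chart[OF M D(1)]] D(2)])
    then obtain S where S: "open S" "t \<in> S" "\<And>s. s \<in> S \<Longrightarrow> s \<in> I \<longrightarrow> c s \<in> fst D"
      unfolding eventually_nhds by blast
    then show ?thesis by (intro at_within_nhd[of t S]) auto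
  qed
  ultimately show ?thesis by auto
qed

text \<open>\<open>vector_derivative\<close> is a choice; a filter different from \<open>bot\<close>
  makes the derivative unique, so the chosen value is the right one.\<close>

lemma velocity_has_derivative:
  assumes c: "smooth_map_on real_line I M c" and t: "t \<in> I" and nt: "at t within I \<noteq> bot"
    and j: "j < mdim M"
  shows "((\<lambda>s. snd (chart_at M (c t)) (c s) j) has_real_derivative velocity M I c t j) (at t within I)"
proof -
  have ct: "c t \<in> points M" using smooth_map_onD_points[OF c t] by simp
  obtain d where d: "((\<lambda>s. snd (chart_at M (c t)) (c s) j) has_real_derivative d) (at t within I)"
    using smooth_curve_derivative[OF c t _ _ j] chart_at[OF M ct] by blast
  then have "velocity M I c t j = d"
    using j vector_derivative_within[OF nt]
    by (simp add: velocity_def has_real_derivative_iff_has_vector_derivative)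
  then show ?thesis using d by simp
qed

end

lemma velocity_eqI:
  assumes "\<And>j. j < mdim M \<Longrightarrow>
      ((\<lambda>s. snd (chart_at M (c t)) (c s) j) has_real_derivative v j) (at t within I)"
    and "v \<in> Espace (mdim M)" and "at t within I \<noteq> bot"
  shows "velocity M I c t = v"
  using assms vector_derivative_within[OF assms(3)]
  by (auto simp: velocity_def fun_eq_iff mem_Espace has_real_derivative_iff_has_vector_derivative)

lemma velocity_const: "at t within I \<noteq> bot \<Longrightarrow> velocity M I (\<lambda>s. x) t = (\<lambda>_. 0)"
  by (rule velocity_eqI) (auto simp: mem_Espace)

lemma velocity_subset:
  assumes M: "smooth_atlas M" and c: "smooth_map_on real_line I M c" and t: "t \<in> J" and J: "J \<subseteq> I"
    and nt: "at t within J \<noteq> bot"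
  shows "velocity M J c t = velocity M I c t"
proof -
  have "at t within I \<noteq> bot" using nt at_le[OF J, of t] by (metis bot.extremum_uniqueI)
  then show ?thesis
    using t J by (intro velocity_eqI[OF _ velocity_tangent nt] has_field_derivative_subset[OF velocity_has_derivative[OF M c]]) auto
qed

lemma velocity_cong:
  assumes M: "smooth_atlas M" and c: "smooth_map_on real_line I M c" and t: "t \<in> I"
    and nt: "at t within I \<noteq> bot" and eq: "\<And>s. s \<in> I \<Longrightarrow> c s = c' s"
  shows "velocity M I c' t = velocity M I c t"
proof (rule velocity_eqI[OF _ velocity_tangent nt])
  fix j assume j: "j < mdim M"
  have "\<forall>\<^sub>F s in nhds t. s \<in> I \<longrightarrow> snd (chart_at M (c t)) (c s) j = snd (chart_at M (c t)) (c' s) j"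
    using eq by simp
  from has_field_derivative_cong_ev[OF refl this refl refl t] velocity_has_derivative[OF M c t nt j]
  show "((\<lambda>s. snd (chart_at M (c' t)) (c' s) j) has_real_derivative velocity M I c t j) (at t within I)"
    using eq[OF t] by simp
qed

lemma velocity_reparam:
  assumes M: "smooth_atlas M" and c: "smooth_map_on real_line I M c" and t: "t \<in> J"
    and h: "(h has_real_derivative h') (at t within J)" and hJ: "h ` J \<subseteq> I"
    and nt: "at t within J \<noteq> bot" "at (h t) within I \<noteq> bot"
  shows "velocity M J (\<lambda>s. c (h s)) t = (\<lambda>j. h' * velocity M I c (h t) j)"
proof (rule velocity_eqI[OF _ _ nt(1)])
  fix j assume j: "j < mdim M"
  have "((\<lambda>s. snd (chart_at M (c (h t))) (c s) j) has_real_derivative velocity M I c (h t) j) (at (h t) within I)"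
    using t hJ by (intro velocity_has_derivative[OF M c _ nt(2) j]) auto
  from DERIV_image_chain[OF has_field_derivative_subset[OF this hJ] h]
  show "((\<lambda>s. snd (chart_at M (c (h t))) (c (h s)) j) has_real_derivative h' * velocity M I c (h t) j) (at t within J)"
    by (simp add: o_def mult.commute)
qed (use velocity_tangent[of M I c "h t"] in \<open>auto simp: mem_Espace\<close>)

lemma coordinate_rep_open:
  assumes M: "smooth_atlas M" and f: "smooth_map_on M A M' f" and A: "openin (mtop M) A"
    and C: "C \<in> atlas M" and D: "D \<in> atlas M'" "openin (mtop M') (fst D)"
  shows "openin (Euclidean_space (mdim M)) (snd C ` (A \<inter> fst C \<inter> f -` fst D))"
proof -
  have fc: "continuous_map (subtopology (mtop M) A) (mtop M') f" using f by (simp add: smooth_map_on_def)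
  have "openin (subtopology (mtop M) A) {x \<in> topspace (subtopology (mtop M) A). f x \<in> fst D}"
    by (rule openin_continuous_map_preimage[OF fc D(2)])
  moreover have "{x \<in> topspace (subtopology (mtop M) A). f x \<in> fst D} = A \<inter> f -` fst D"
    using openin_subset[OF A] by auto
  ultimately have "openin (mtop M) (A \<inter> f -` fst D)" using openin_trans_full[OF _ A] by simp
  from chart_image_open[OF atlas_chart[OF M C] this]
  show ?thesis by (simp add: Int_commute Int_left_commute Int_assoc)
qed

lemma coordinate_rep_C_diff:
  assumes M: "smooth_atlas M" and M': "smooth_atlas M'" and f: "smooth_map_on M A M' f" and A: "openin (mtop M) A"
    and C: "C \<in> atlas M" and D: "D \<in> atlas M'" and j: "j < mdim M'"
  shows "C_diff (mdim M) r (snd C ` (A \<inter> fst C \<inter> f -` fst D)) (\<lambda>y. snd D (f (chart_inv C y)) j)"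
proof -
  have "smooth_fun_on (mdim M) (snd C ` (A \<inter> fst C \<inter> f -` fst D)) (\<lambda>y. snd D (f (chart_inv C y)) j)"
    using f C D j by (simp add: smooth_map_on_def smooth_vec_on_def o_def)
  then show ?thesis
    using smooth_fun_on_open[OF coordinate_rep_open[OF M f A C D chart_open(1)[OF atlas_chart[OF M' D]]]] by blast
qed

text \<open>Stated coordinatewise as a derivative and not merely as an equation of velocities: with
  \<open>real_line\<close> as target it also differentiates coordinate functions of charts other
  than the one selected by \<open>chart_at\<close>.\<close>

lemma chain_derivative:
  assumes M: "smooth_atlas M" and M': "smooth_atlas M'"
    and c: "smooth_map_on real_line I M c" and t: "t \<in> I" and nt: "at t within I \<noteq> bot"
    and f: "smooth_map_on M A M' f" and A: "openin (mtop M) A" and ct: "c t \<in> A" and j: "j < mdim M'"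
  shows "((\<lambda>s. snd (chart_at M' (f (c t))) (f (c s)) j) has_real_derivative
           differential M M' f (c t) (velocity M I c t) j) (at t within I)"
proof -
  have ctM: "c t \<in> points M" using openin_subset[OF A] ct by auto
  define C where "C = chart_at M (c t)"
  define D where "D = chart_at M' (f (c t))"
  have C: "C \<in> atlas M" "c t \<in> fst C" using chart_at[OF M ctM] by (auto simp: C_def)
  have D: "D \<in> atlas M'" "f (c t) \<in> fst D"
    using chart_at[OF M' smooth_map_onD_points[OF f ct ctM]] by (auto simp: D_def)
  note tC = atlas_chart[OF M C(1)] and tD = atlas_chart[OF M' D(1)]
  let ?S = "A \<inter> fst C \<inter> f -` fst D"
  define F where "F = (\<lambda>y. snd D (f (chart_inv C y)) j)"
  have op: "openin (Euclidean_space (mdim M)) (snd C ` ?S)"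
    by (rule coordinate_rep_open[OF M f A C(1) D(1) chart_open(1)[OF tD]])
  have F: "C_diff (mdim M) r (snd C ` ?S) F" for r
    unfolding F_def by (rule coordinate_rep_C_diff[OF M M' f A C(1) D(1) j])
  have "frechet_at (mdim M) F (snd C (c t)) (\<lambda>i. partial_deriv i F (snd C (c t)))"
    using C D ct by (intro C1_frechet_at[OF op _ F]) auto
  then have der: "((\<lambda>s. F (snd C (c s))) has_real_derivative
      (\<Sum>i<mdim M. partial_deriv i F (snd C (c t)) * velocity M I c t i)) (at t within I)"
  proof (rule frechet_at_curve[where c = "\<lambda>s. snd C (c s)"])
    have "\<forall>\<^sub>F s in nhds t. s \<in> I \<longrightarrow> c s \<in> fst C"
      by (rule smooth_curve_eventually[OF M c t chart_open(1)[OF tC] C(2)])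
    then show "\<forall>\<^sub>F s in at t within I. snd C (c s) \<in> Espace (mdim M)"
      unfolding eventually_at_filter by eventually_elim (use chart_in_Espace[OF tC] in auto)
    show "((\<lambda>s. snd C (c s) i) has_real_derivative velocity M I c t i) (at t within I)" if "i < mdim M" for i
      using velocity_has_derivative[OF M c t nt that] by (simp add: C_def)
  qed
  have "(\<Sum>i<mdim M. partial_deriv i F (snd C (c t)) * velocity M I c t i) = differential M M' f (c t) (velocity M I c t) j"
    using j by (simp add: differential_def C_def D_def F_def)
  moreover have "\<forall>\<^sub>F s in nhds t. s \<in> I \<longrightarrow> F (snd C (c s)) = snd D (f (c s)) j"
  proof -
    have "\<forall>\<^sub>F s in nhds t. s \<in> I \<longrightarrow> c s \<in> fst C"
      by (rule smooth_curve_eventually[OF M c t chart_open(1)[OF tC] C(2)])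
    then show ?thesis
      by eventually_elim (auto simp: F_def chart_inv_left[OF tC])
  qed
  ultimately show ?thesis
    using der has_field_derivative_cong_ev[OF refl _ refl refl t] by (simp add: D_def)
qed

lemma velocity_chain:
  assumes M: "smooth_atlas M" and M': "smooth_atlas M'"
    and c: "smooth_map_on real_line I M c" and t: "t \<in> I" and nt: "at t within I \<noteq> bot"
    and f: "smooth_map_on M A M' f" and A: "openin (mtop M) A" and ct: "c t \<in> A"
  shows "velocity M' I (\<lambda>s. f (c s)) t = differential M M' f (c t) (velocity M I c t)"
  by (rule velocity_eqI[OF chain_derivative[OF assms] differential_tangent nt])

section \<open>Curves with prescribed velocity and rules for differentials\<close>

lemma differential_vec_manifold:
  assumes "x \<in> Espace n" "j < mdim M'"
  shows "differential (vec_manifold n) M' f x v j = (\<Sum>i<n. partial_deriv i (\<lambda>y. snd (chart_at M' (f x)) (f y) j) x * v i)"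
proof -
  have "partial_deriv i (\<lambda>y. snd (chart_at M' (f x)) (f (chart_inv (Espace n, \<lambda>x. x) y)) j) x
      = partial_deriv i (\<lambda>y. snd (chart_at M' (f x)) (f y) j) x" if "i < n" for i
    by (rule partial_deriv_cong[OF openin_topspace assms(1) that]) simp
  then show ?thesis using assms by (simp add: differential_def)
qed

lemma sum_delta_mult: "finite A \<Longrightarrow> (\<Sum>i\<in>A. (if i = j then a else 0) * v i) = (if j \<in> A then a * v j else (0::real))"
  by (simp add: if_distrib[of "\<lambda>x. x * _"] cong: if_cong)

text \<open>A box in a chart is parametrised by all of Euclidean space with the help of the sine.\<close>

lemma exists_box_map:
  assumes M: "smooth_atlas M" and A: "openin (mtop M) A" and x: "x \<in> A"
  obtains g where "smooth_map_on (vec_manifold (mdim M)) (Espace (mdim M)) M g"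
    "\<And>y. y \<in> Espace (mdim M) \<Longrightarrow> g y \<in> A" "g (\<lambda>_. 0) = x"
    "\<And>v. v \<in> Espace (mdim M) \<Longrightarrow> differential (vec_manifold (mdim M)) M g (\<lambda>_. 0) v = v"
proof -
  let ?n = "mdim M"
  have xM: "x \<in> points M" using openin_subset[OF A] x by auto
  define C where "C = chart_at M x"
  have C: "C \<in> atlas M" "x \<in> fst C" using chart_at[OF M xM] by (auto simp: C_def)
  note tC = atlas_chart[OF M C(1)]
  define a where "a = snd C x"
  have aE: "a \<in> Espace ?n" unfolding a_def by (rule chart_in_Espace[OF tC C(2)])
  have "openin (Euclidean_space ?n) (snd C ` (fst C \<inter> A))" by (rule chart_image_open[OF tC A])
  moreover have "a \<in> snd C ` (fst C \<inter> A)" using C x by (auto simp: a_def)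
  ultimately obtain e0 where e0: "e0 > 0"
    "\<And>y. y \<in> Espace ?n \<Longrightarrow> (\<forall>i<?n. \<bar>y i - a i\<bar> < e0) \<Longrightarrow> y \<in> snd C ` (fst C \<inter> A)"
    unfolding openin_Euclidean_box by meson
  define e where "e = e0 / 2"
  have e: "e > 0" "e < e0" using e0 by (auto simp: e_def)
  \<comment> \<open>The sine is bounded by 1, so the image stays within \<open>e < e0\<close> of
    \<open>a\<close> in each coordinate; the inner factor \<open>1 / e\<close> makes the derivative
    at the origin the identity. The summand 0 fits \<open>C_diff_sin\<close>.\<close>
  define b where "b y = (\<lambda>i. if i < ?n then a i + e * sin (1 / e * y i + 0) else 0)" for y :: vec
  have bE: "b y \<in> Espace ?n" for y by (simp add: b_def mem_Espace)
  have bA: "b y \<in> snd C ` (fst C \<inter> A)" for y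
  proof (rule e0(2)[OF bE], intro allI impI)
    fix i assume "i < ?n"
    then have "\<bar>b y i - a i\<bar> = e * \<bar>sin (1 / e * y i)\<bar>" using e by (simp add: b_def abs_mult)
    also have "\<dots> \<le> e * 1" using e by (intro mult_left_mono) auto
    finally show "\<bar>b y i - a i\<bar> < e0" using e by simp
  qed
  have bs: "smooth_map_on (vec_manifold ?n) (Espace ?n) (vec_manifold ?n) b"
  proof (rule smooth_vecI[OF smooth_atlas_vec_manifold bE])
    fix i assume i: "i < ?n"
    have "smooth_fun_on ?n (Espace ?n) (\<lambda>y. a i + e * sin (1 / e * y i + 0))"
      by (intro smooth_fun_on_C_diff C_diff_sin) auto
    then show "smooth_map_on (vec_manifold ?n) (Espace ?n) real_line (\<lambda>y. b y i)"
      using i by (intro smooth_real_vecI) (auto simp: b_def)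
  qed
  define g where "g y = chart_inv C (b y)" for y
  have gA: "g y \<in> A \<inter> fst C" for y using bA[of y] by (auto simp: g_def chart_inv_left[OF tC])
  have Cg: "snd C (g y) = b y" for y
    unfolding g_def using bA[of y] by (intro chart_inv_right[OF tC]) auto
  show ?thesis
  proof (rule that[of g])
    show "smooth_map_on (vec_manifold ?n) (Espace ?n) M g"
      unfolding g_def
      using bA by (intro smooth_map_on_compose[OF smooth_atlas_vec_manifold smooth_atlas_vec_manifold bs
          maximal_atlasD(3)[OF M atlas_maximal[OF M C(1)]]]) auto
    show "g y \<in> A" for y using gA by auto
    have "b (\<lambda>_. 0) = a" using aE by (auto simp: b_def mem_Espace fun_eq_iff)
    then show g0: "g (\<lambda>_. 0) = x" by (simp add: g_def a_def chart_inv_left[OF tC C(2)])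
    fix v assume v: "v \<in> Espace ?n"
    show "differential (vec_manifold ?n) M g (\<lambda>_. 0) v = v"
    proof
      fix j
      show "differential (vec_manifold ?n) M g (\<lambda>_. 0) v j = v j"
      proof (cases "j < ?n")
        case True
        have "partial_deriv i (\<lambda>y. snd (chart_at M (g (\<lambda>_. 0))) (g y) j) (\<lambda>_. 0) = (if i = j then 1 else 0)" for i
        proof (rule partial_derivI)
          have "DERIV (\<lambda>s. a j + e * sin (1 / e * ((\<lambda>_. 0)(i := s)) j + 0)) 0 :> (if i = j then 1 else 0)"
            using e by (cases "i = j") (auto intro!: derivative_eq_intros)
          then show "DERIV (\<lambda>s. snd (chart_at M (g (\<lambda>_. 0))) (g ((\<lambda>_. 0)(i := s))) j) 0 :> (if i = j then 1 else 0)"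
            unfolding g0 C_def[symmetric] Cg using True by (simp add: b_def)
        qed
        then show ?thesis
          using True by (subst differential_vec_manifold) (auto simp: mem_Espace sum_delta_mult)
      next
        case False
        then show ?thesis using v differential_tangent[of "vec_manifold ?n" M g "\<lambda>_. 0" v] by (simp add: mem_Espace)
      qed
    qed
  qed
qed

lemma smooth_line:
  assumes "v \<in> Espace n"
  shows "smooth_map_on real_line A (vec_manifold n) (\<lambda>s i. s * v i)"
  using assms
  by (intro smooth_vecI[OF smooth_atlas_real_line] smooth_real_mult smooth_real_const smooth_map_on_id smooth_atlas_real_line)
    (auto simp: mem_Espace)

lemma velocity_line:
  assumes "v \<in> Espace n"
  shows "velocity (vec_manifold n) UNIV (\<lambda>s i. s * v i) 0 = v"
  using assms by (intro velocity_eqI) (auto simp: mem_Espace intro!: derivative_eq_intros)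

text \<open>A straight line in a chart may leave the chart. Composed with the box map, the whole
  line stays in \<open>A\<close>, which gives the curves on \<open>UNIV\<close> that
  \<open>sub_tangent\<close> asks for.\<close>

lemma exists_curve:
  assumes M: "smooth_atlas M" and A: "openin (mtop M) A" and x: "x \<in> A" and v: "v \<in> Espace (mdim M)"
  obtains c where "smooth_map_on real_line UNIV M c" "\<And>s. c s \<in> A" "c 0 = x" "velocity M UNIV c 0 = v"
proof -
  let ?n = "mdim M"
  obtain g where g: "smooth_map_on (vec_manifold ?n) (Espace ?n) M g"
    "\<And>y. y \<in> Espace ?n \<Longrightarrow> g y \<in> A" "g (\<lambda>_. 0) = x"
    "\<And>v. v \<in> Espace ?n \<Longrightarrow> differential (vec_manifold ?n) M g (\<lambda>_. 0) v = v"
    by (rule exists_box_map[OF M A x]) (rule that)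
  have E: "(\<lambda>i. s * v i) \<in> Espace ?n" for s using v by (simp add: mem_Espace)
  show ?thesis
  proof (rule that[of "\<lambda>s. g (\<lambda>i. s * v i)"])
    show "smooth_map_on real_line UNIV M (\<lambda>s. g (\<lambda>i. s * v i))"
      using E by (intro smooth_map_on_compose[OF smooth_atlas_real_line smooth_atlas_vec_manifold smooth_line[OF v] g(1)])
    have "velocity M UNIV (\<lambda>s. g (\<lambda>i. s * v i)) 0 =
        differential (vec_manifold ?n) M g (\<lambda>i. 0 * v i) (velocity (vec_manifold ?n) UNIV (\<lambda>s i. s * v i) 0)"
      using E by (intro velocity_chain[OF smooth_atlas_vec_manifold M smooth_line[OF v] _ _ g(1)]) (auto simp: mem_Espace)
    then show "velocity M UNIV (\<lambda>s. g (\<lambda>i. s * v i)) 0 = v"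
      using g(4) v by (simp add: velocity_line[OF v])
  qed (use g E in auto)
qed

lemma differential_velocity:
  assumes M: "smooth_atlas M" and M': "smooth_atlas M'"
    and f: "smooth_map_on M A M' f" and A: "openin (mtop M) A"
    and c: "smooth_map_on real_line UNIV M c" "c 0 \<in> A"
  shows "velocity M' UNIV (\<lambda>s. f (c s)) 0 = differential M M' f (c 0) (velocity M UNIV c 0)"
  using assms by (intro velocity_chain[OF M M' c(1) _ _ f A c(2)]) auto

text \<open>No matrices are multiplied: along a curve with velocity \<open>v\<close>, both sides are
  the velocity of the image curve in \<open>M''\<close>.\<close>

lemma differential_chain:
  assumes M: "smooth_atlas M" and M': "smooth_atlas M'" and M'': "smooth_atlas M''"
    and f: "smooth_map_on M A M' f" and A: "openin (mtop M) A"
    and g: "smooth_map_on M' B M'' g" and B: "openin (mtop M') B"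
    and fAB: "\<And>x. x \<in> A \<Longrightarrow> f x \<in> B" and x: "x \<in> A" and v: "v \<in> Espace (mdim M)"
  shows "differential M M'' (\<lambda>x. g (f x)) x v = differential M' M'' g (f x) (differential M M' f x v)"
proof -
  obtain c where c: "smooth_map_on real_line UNIV M c" "\<And>s. c s \<in> A" "c 0 = x" "velocity M UNIV c 0 = v"
    by (rule exists_curve[OF M A x v]) blast
  have fc: "smooth_map_on real_line UNIV M' (\<lambda>s. f (c s))"
    using c by (intro smooth_map_on_compose[OF smooth_atlas_real_line M _ f]) auto
  have gf: "smooth_map_on M A M'' (\<lambda>x. g (f x))"
    using fAB by (intro smooth_map_on_compose[OF M M' f g]) auto
  have "differential M M'' (\<lambda>x. g (f x)) x v = velocity M'' UNIV (\<lambda>s. g (f (c s))) 0"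
    using differential_velocity[OF M M'' gf A c(1)] c x by simp
  also have "\<dots> = differential M' M'' g (f x) (velocity M' UNIV (\<lambda>s. f (c s)) 0)"
    using differential_velocity[OF M' M'' g B fc] c fAB[OF x] by simp
  also have "velocity M' UNIV (\<lambda>s. f (c s)) 0 = differential M M' f x v"
    using differential_velocity[OF M M' f A c(1)] c x by simp
  finally show ?thesis .
qed

text \<open>Agreement is required on an open set only, which suits inverse charts, as they are
  meaningful only on the images of charts.\<close>

lemma differential_cong:
  assumes M: "smooth_atlas M" and M': "smooth_atlas M'"
    and f: "smooth_map_on M A M' f" and A: "openin (mtop M) A" and eq: "\<And>x. x \<in> A \<Longrightarrow> f x = g x"
    and x: "x \<in> A" and v: "v \<in> Espace (mdim M)"
  shows "differential M M' g x v = differential M M' f x v"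
proof -
  obtain c where c: "smooth_map_on real_line UNIV M c" "\<And>s. c s \<in> A" "c 0 = x" "velocity M UNIV c 0 = v"
    by (rule exists_curve[OF M A x v]) blast
  have "smooth_map_on M A M' g" by (rule smooth_map_on_cong[OF f eq M])
  from differential_velocity[OF M M' this A c(1)] differential_velocity[OF M M' f A c(1)] c eq x
  show ?thesis by simp
qed

lemma differential_id:
  assumes M: "smooth_atlas M" and x: "x \<in> points M" and v: "v \<in> Espace (mdim M)"
  shows "differential M M (\<lambda>x. x) x v = v"
proof -
  obtain c where c: "smooth_map_on real_line UNIV M c" "\<And>s. c s \<in> points M" "c 0 = x" "velocity M UNIV c 0 = v"
    by (rule exists_curve[OF M openin_topspace x v]) blast
  have "velocity M UNIV c 0 = differential M M (\<lambda>x. x) (c 0) (velocity M UNIV c 0)"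
    using differential_velocity[OF M M smooth_map_on_id[OF M] openin_topspace c(1)] c(2) by blast
  then show ?thesis unfolding c(3,4) by (rule sym)
qed

lemma differential_const:
  assumes M: "smooth_atlas M" and M': "smooth_atlas M'" and x: "x \<in> points M" and v: "v \<in> Espace (mdim M)"
    and y: "y \<in> points M'"
  shows "differential M M' (\<lambda>x. y) x v = (\<lambda>_. 0)"
proof -
  obtain c where c: "smooth_map_on real_line UNIV M c" "\<And>s. c s \<in> points M" "c 0 = x" "velocity M UNIV c 0 = v"
    by (rule exists_curve[OF M openin_topspace x v]) blast
  have "velocity M' UNIV (\<lambda>s. y) 0 = differential M M' (\<lambda>x. y) (c 0) (velocity M UNIV c 0)"
    using differential_velocity[OF M M' smooth_map_on_const[OF M y] openin_topspace c(1)] c(2) by blast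
  then show ?thesis by (simp add: c(3,4) velocity_const)
qed

text \<open>Velocities are expressed in charts that vary with time. In a fixed chart the chain rule
  shows that all coordinates have derivative zero, so the curve is locally constant, and the
  interval is connected.\<close>

lemma zero_velocity_constant:
  assumes M: "smooth_atlas M" and c: "smooth_map_on real_line {0..1} M c"
    and zero: "\<And>t. t \<in> {0..1} \<Longrightarrow> velocity M {0..1} c t = (\<lambda>_. 0)"
    and t: "t \<in> {0..1}"
  shows "c t = c 0"
proof -
  have "\<forall>\<^sub>F s in at t within {0..1}. c t = c s" if t: "t \<in> {0..1}" for t
  proof -
    have ct: "c t \<in> points M" using smooth_map_onD_points[OF c t] by simp
    obtain D where D: "D \<in> atlas M" "c t \<in> fst D" using atlas_cover[OF M ct] by blast
    note tD = atlas_chart[OF M D(1)]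
    have "\<forall>\<^sub>F s in nhds t. s \<in> {0..1} \<longrightarrow> c s \<in> fst D"
      by (rule smooth_curve_eventually[OF M c t chart_open(1)[OF tD] D(2)])
    then obtain d where d: "d > 0" "\<And>s. dist s t < d \<Longrightarrow> s \<in> {0..1} \<Longrightarrow> c s \<in> fst D"
      unfolding eventually_nhds_metric by blast
    define S where "S = {0..1} \<inter> ball t d"
    have S: "convex S" "S \<subseteq> {0..1}" "t \<in> S" using t d(1) by (auto simp: S_def intro: convex_Int)
    have SD: "c s \<in> fst D" if "s \<in> S" for s using that d(2) by (auto simp: S_def dist_commute)
    have "snd D (c s) j = snd D (c t) j" if s: "s \<in> S" and j: "j < mdim M" for s j
    proof -
      have h: "smooth_map_on M (fst D) real_line (\<lambda>x. snd D x j)"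
        by (rule smooth_vec_component[OF M maximal_atlasD(2)[OF M atlas_maximal[OF M D(1)]]])
          (rule openin_subset[OF chart_open(1)[OF tD]])
      have "((\<lambda>s. snd D (c s) j) has_field_derivative 0) (at r within S)" if r: "r \<in> S" for r
      proof -
        have r01: "r \<in> {0..1}" using r S by auto
        have "((\<lambda>s. snd (chart_at real_line (snd D (c r) j)) (snd D (c s) j) 0) has_real_derivative
           differential M real_line (\<lambda>x. snd D x j) (c r) (velocity M {0..1} c r) 0) (at r within {0..1})"
          by (rule chain_derivative[OF M smooth_atlas_real_line c r01 at_within_unit_interval[OF r01] h
                chart_open(1)[OF tD] SD[OF r]]) simp
        then show ?thesis using zero[OF r01] S(2) by (auto intro: has_field_derivative_subset)
      qed
      from has_field_derivative_zero_constant[OF S(1) this] s S(3) show ?thesis by auto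
    qed
    then have "snd D (c s) = snd D (c t)" if "s \<in> S" for s
      using chart_in_Espace[OF tD SD[OF that]] chart_in_Espace[OF tD D(2)] that
      by (metis (no_types) EspaceD ext not_less)
    then have "c t = c s" if "s \<in> S" for s
      using chart_inj[OF tD] SD[OF that] D(2) that by (metis inj_onD)
    then show ?thesis
      unfolding eventually_at using d(1) by (intro exI[of _ d]) (auto simp: S_def dist_commute)
  qed
  then show ?thesis using t by (intro connected_local_const[of "{0..1}" t 0 c]) auto
qed

section \<open>Products\<close>

definition vec_take :: "nat \<Rightarrow> vec \<Rightarrow> vec" where
  "vec_take m y = (\<lambda>i. if i < m then y i else 0)"

definition vec_drop :: "nat \<Rightarrow> vec \<Rightarrow> vec" where
  "vec_drop m y = (\<lambda>i. y (i + m))"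

definition vec_append :: "nat \<Rightarrow> vec \<Rightarrow> vec \<Rightarrow> vec" where
  "vec_append m a b = (\<lambda>i. if i < m then a i else b (i - m))"

lemma vec_take_Espace [simp]: "vec_take m y \<in> Espace m"
  by (simp add: vec_take_def mem_Espace)

lemma vec_drop_Espace: "y \<in> Espace (m + n) \<Longrightarrow> vec_drop m y \<in> Espace n"
  by (simp add: vec_drop_def mem_Espace)

lemma vec_append_Espace: "b \<in> Espace n \<Longrightarrow> vec_append m a b \<in> Espace (m + n)"
  by (auto simp: vec_append_def mem_Espace)

lemma vec_take_append: "a \<in> Espace m \<Longrightarrow> vec_take m (vec_append m a b) = a"
  by (auto simp: vec_append_def vec_take_def mem_Espace fun_eq_iff)

lemma vec_drop_append [simp]: "vec_drop m (vec_append m a b) = b"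
  by (auto simp: vec_append_def vec_drop_def fun_eq_iff)

lemma vec_append_take_drop [simp]: "vec_append m (vec_take m y) (vec_drop m y) = y"
  by (auto simp: vec_append_def vec_drop_def vec_take_def fun_eq_iff)

lemma smooth_vec_take: "A \<subseteq> Espace (m + n) \<Longrightarrow> smooth_map_on (vec_manifold (m + n)) A (vec_manifold m) (vec_take m)"
  by (rule smooth_vecI[OF smooth_atlas_vec_manifold]) (auto simp: vec_take_def mem_Espace intro: smooth_coord)

lemma smooth_vec_drop: "A \<subseteq> Espace (m + n) \<Longrightarrow> smooth_map_on (vec_manifold (m + n)) A (vec_manifold n) (vec_drop m)"
  by (rule smooth_vecI[OF smooth_atlas_vec_manifold]) (auto simp: vec_drop_def mem_Espace subset_iff intro: smooth_coord)

lemma prod_manifold_simps [simp]: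
  "mtop (prod_manifold M M') = prod_topology (mtop M) (mtop M')"
  "mdim (prod_manifold M M') = mdim M + mdim M'"
  "atlas (prod_manifold M M') = {prod_chart (mdim M) C D | C D. C \<in> atlas M \<and> D \<in> atlas M'}"
  by (simp_all add: prod_manifold_def)

lemma prod_chart_atlas:
  "C \<in> atlas M \<Longrightarrow> D \<in> atlas M' \<Longrightarrow> prod_chart (mdim M) C D \<in> atlas (prod_manifold M M')"
  unfolding prod_manifold_simps by blast

lemma fst_prod_chart [simp]: "fst (prod_chart m C D) = fst C \<times> fst D"
  by (simp add: prod_chart_def)

lemma snd_prod_chart: "snd (prod_chart m C D) p = vec_append m (snd C (fst p)) (snd D (snd p))"
  by (simp add: prod_chart_def vec_append_def)

context
  fixes X Y m n C D
  assumes C: "topological_chart X m C" and D: "topological_chart Y n D"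
begin

lemma prod_chart_take: "p \<in> fst C \<times> fst D \<Longrightarrow> vec_take m (snd (prod_chart m C D) p) = snd C (fst p)"
  using chart_in_Espace[OF C] by (auto simp: snd_prod_chart vec_take_append)

lemma prod_chart_drop: "vec_drop m (snd (prod_chart m C D) p) = snd D (snd p)"
  by (simp add: snd_prod_chart)

lemma prod_chart_image:
  "snd (prod_chart m C D) ` (S \<times> T) = {y \<in> Espace (m + n). vec_take m y \<in> snd C ` S \<and> vec_drop m y \<in> snd D ` T}"
    if "S \<subseteq> fst C" "T \<subseteq> fst D"
proof (intro equalityI subsetI)
  fix y assume "y \<in> snd (prod_chart m C D) ` (S \<times> T)"
  then obtain p where p: "p \<in> S \<times> T" "y = snd (prod_chart m C D) p" by auto
  then have "p \<in> fst C \<times> fst D" using that by auto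
  then show "y \<in> {y \<in> Espace (m + n). vec_take m y \<in> snd C ` S \<and> vec_drop m y \<in> snd D ` T}"
    using p prod_chart_take[of p] chart_in_Espace[OF D] vec_append_Espace
    by (auto simp: prod_chart_drop) (simp add: snd_prod_chart)
next
  fix y assume "y \<in> {y \<in> Espace (m + n). vec_take m y \<in> snd C ` S \<and> vec_drop m y \<in> snd D ` T}"
  then obtain a b where ab: "a \<in> S" "vec_take m y = snd C a" "b \<in> T" "vec_drop m y = snd D b" by auto
  have "snd (prod_chart m C D) (a, b) = y"
    using vec_append_take_drop[of m y] ab by (simp add: snd_prod_chart)
  then show "y \<in> snd (prod_chart m C D) ` (S \<times> T)" using ab by (metis image_eqI mem_Sigma_iff)
qed

lemma chart_inv_prod_chart:
  assumes "y \<in> snd (prod_chart m C D) ` (fst C \<times> fst D)"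
  shows "chart_inv (prod_chart m C D) y = (chart_inv C (vec_take m y), chart_inv D (vec_drop m y))"
proof (rule chart_inv_eqI)
  show "inj_on (snd (prod_chart m C D)) (fst (prod_chart m C D))"
  proof (rule inj_onI)
    fix p q assume p: "p \<in> fst (prod_chart m C D)" and q: "q \<in> fst (prod_chart m C D)"
      and eq: "snd (prod_chart m C D) p = snd (prod_chart m C D) q"
    then have "snd C (fst p) = snd C (fst q)" "snd D (snd p) = snd D (snd q)"
      using prod_chart_take[of p] prod_chart_take[of q] prod_chart_drop[of p] prod_chart_drop[of q] by auto
    then show "p = q"
      using p q chart_inj[OF C] chart_inj[OF D] by (auto simp: prod_eq_iff dest: inj_onD)
  qed
  obtain p where p: "p \<in> fst C \<times> fst D" "y = snd (prod_chart m C D) p" using assms by auto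
  have eq: "(chart_inv C (vec_take m y), chart_inv D (vec_drop m y)) = p"
    using p prod_chart_take[OF p(1)] prod_chart_drop[of p] chart_inv_left[OF C] chart_inv_left[OF D] by (auto simp: prod_eq_iff)
  show "(chart_inv C (vec_take m y), chart_inv D (vec_drop m y)) \<in> fst (prod_chart m C D)"
    "snd (prod_chart m C D) (chart_inv C (vec_take m y), chart_inv D (vec_drop m y)) = y"
    unfolding eq using p by auto
qed

lemma topological_prod_chart: "topological_chart (prod_topology X Y) (m + n) (prod_chart m C D)"
proof (rule topological_chartI)
  let ?K = "prod_chart m C D"
  show "openin (prod_topology X Y) (fst ?K)"
    using chart_open[OF C] chart_open[OF D] by (simp add: openin_prod_Times_iff)
  have ct: "continuous_map (Euclidean_space (m + n)) (Euclidean_space m) (vec_take m)"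
    by (rule continuous_map_into_Euclidean) (auto simp: continuous_map_coord vec_take_def mem_Espace)
  have cd: "continuous_map (Euclidean_space (m + n)) (Euclidean_space n) (vec_drop m)"
    by (rule continuous_map_into_Euclidean) (auto simp: continuous_map_coord vec_drop_def mem_Espace)
  have im: "snd ?K ` fst ?K = {y \<in> Espace (m + n). vec_take m y \<in> snd C ` fst C} \<inter> {y \<in> Espace (m + n). vec_drop m y \<in> snd D ` fst D}"
    using prod_chart_image[of "fst C" "fst D"] by auto
  show op: "openin (Euclidean_space (m + n)) (snd ?K ` fst ?K)"
    unfolding im using chart_open(2)[OF C] chart_open(2)[OF D]
    by (intro openin_Int openin_continuous_map_preimage[OF ct] openin_continuous_map_preimage[OF cd])
  have c1: "continuous_map (subtopology (prod_topology X Y) (fst C \<times> fst D)) (Euclidean_space m) (\<lambda>p. snd C (fst p))"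
    using continuous_map_compose[OF continuous_map_fst chart_continuous[OF C], of "subtopology Y (fst D)"]
    by (simp add: subtopology_Times o_def)
  have c2: "continuous_map (subtopology (prod_topology X Y) (fst C \<times> fst D)) (Euclidean_space n) (\<lambda>p. snd D (snd p))"
    using continuous_map_compose[OF continuous_map_snd chart_continuous[OF D], of "subtopology X (fst C)"]
    by (simp add: subtopology_Times o_def)
  show "continuous_map (subtopology (prod_topology X Y) (fst ?K)) (Euclidean_space (m + n)) (snd ?K)"
  proof (rule continuous_map_into_Euclidean)
    show "snd ?K p \<in> Espace (m + n)" if "p \<in> topspace (subtopology (prod_topology X Y) (fst ?K))" for p
      using that openin_subset[OF op] by auto
    fix i
    show "continuous_map (subtopology (prod_topology X Y) (fst ?K)) euclideanreal (\<lambda>x. snd ?K x i)"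
      using continuous_map_Euclidean_component[OF c1, of i] continuous_map_Euclidean_component[OF c2, of "i - m"]
      by (cases "i < m") (simp_all add: snd_prod_chart vec_append_def)
  qed
  show "continuous_map (subtopology (Euclidean_space (m + n)) (snd ?K ` fst ?K)) (prod_topology X Y)
      (\<lambda>y. (chart_inv C (vec_take m y), chart_inv D (vec_drop m y)))"
  proof (rule continuous_map_pairedI)
    have "continuous_map (subtopology (Euclidean_space (m + n)) (snd ?K ` fst ?K)) (subtopology (Euclidean_space m) (snd C ` fst C)) (vec_take m)"
      unfolding continuous_map_in_subtopology using continuous_map_from_subtopology[OF ct] im by auto
    from continuous_map_compose[OF this chart_inv_continuous[OF C]]
    show "continuous_map (subtopology (Euclidean_space (m + n)) (snd ?K ` fst ?K)) X (\<lambda>y. chart_inv C (vec_take m y))"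
      by (simp add: o_def)
    have "continuous_map (subtopology (Euclidean_space (m + n)) (snd ?K ` fst ?K)) (subtopology (Euclidean_space n) (snd D ` fst D)) (vec_drop m)"
      unfolding continuous_map_in_subtopology using continuous_map_from_subtopology[OF cd] im by auto
    from continuous_map_compose[OF this chart_inv_continuous[OF D]]
    show "continuous_map (subtopology (Euclidean_space (m + n)) (snd ?K ` fst ?K)) Y (\<lambda>y. chart_inv D (vec_drop m y))"
      by (simp add: o_def)
  qed
  show "(chart_inv C (vec_take m (snd ?K p)), chart_inv D (vec_drop m (snd ?K p))) = p" if "p \<in> fst ?K" for p
    using that prod_chart_take[of p] prod_chart_drop[of p] chart_inv_left[OF C] chart_inv_left[OF D] by (auto simp: prod_eq_iff)
qed

end

lemma smooth_fun_vec_take: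
  assumes "smooth_fun_on m B f" "B \<subseteq> Espace m" "A \<subseteq> Espace k" "\<And>y. y \<in> A \<Longrightarrow> vec_take m y \<in> B"
  shows "smooth_fun_on k A (\<lambda>y. f (vec_take m y))"
proof (rule smooth_fun_on_compose[OF assms(1)])
  show "smooth_fun_on k A (\<lambda>x. vec_take m x j)" if "j < m" for j
    using that assms(3) by (intro smooth_fun_on_C_diff) (simp_all add: vec_take_def C_diff_coord)
qed (use assms in auto)

lemma smooth_fun_vec_drop:
  assumes "smooth_fun_on n B f" "B \<subseteq> Espace n" "A \<subseteq> Espace k" "\<And>y. y \<in> A \<Longrightarrow> vec_drop m y \<in> B"
  shows "smooth_fun_on k A (\<lambda>y. f (vec_drop m y))"
proof (rule smooth_fun_on_compose[OF assms(1)])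
  show "smooth_fun_on k A (\<lambda>x. vec_drop m x j)" if "j < n" for j
    using that assms(3) by (intro smooth_fun_on_C_diff) (simp_all add: vec_drop_def C_diff_coord)
qed (use assms in auto)

lemma smooth_transitionD:
  "smooth_transition n C D \<Longrightarrow> j < n \<Longrightarrow> smooth_fun_on n (snd C ` (fst C \<inter> fst D)) (\<lambda>y. snd D (chart_inv C y) j)"
  by (simp add: smooth_transition_def smooth_vec_on_def o_def)

lemma atlas_transition:
  "smooth_atlas M \<Longrightarrow> C \<in> atlas M \<Longrightarrow> D \<in> atlas M \<Longrightarrow> smooth_transition (mdim M) C D"
  by (simp add: smooth_atlas_def)

section \<open>Smooth structure and tangent spaces of a product\<close>

context
  fixes M :: "'a manifold" and M' :: "'b manifold"
  assumes M: "smooth_atlas M" and M': "smooth_atlas M'"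
begin

text \<open>The set \<open>A\<close> is left free so that the statement serves both the transitions
  between product charts and the smoothness of \<open>fst\<close>.\<close>

lemma prod_transition_take:
  assumes C: "C \<in> atlas M" "C' \<in> atlas M" and D: "D \<in> atlas M'" and j: "j < mdim M"
    and A: "A \<subseteq> (fst C \<inter> fst C') \<times> fst D"
  shows "smooth_fun_on (mdim M + mdim M') (snd (prod_chart (mdim M) C D) ` A)
    (\<lambda>y. snd C' (fst (chart_inv (prod_chart (mdim M) C D) y)) j)"
proof -
  note tC = atlas_chart[OF M C(1)] and tD = atlas_chart[OF M' D]
  note tK = topological_prod_chart[OF tC tD]
  have "smooth_fun_on (mdim M + mdim M') (snd (prod_chart (mdim M) C D) ` A)
    (\<lambda>y. snd C' (chart_inv C (vec_take (mdim M) y)) j)"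
  proof (rule smooth_fun_vec_take[OF smooth_transitionD[OF atlas_transition[OF M C] j]])
    show "snd C ` (fst C \<inter> fst C') \<subseteq> Espace (mdim M)" using chart_in_Espace[OF tC] by auto
    show "snd (prod_chart (mdim M) C D) ` A \<subseteq> Espace (mdim M + mdim M')"
      using chart_in_Espace[OF tK] A by fastforce
    show "vec_take (mdim M) y \<in> snd C ` (fst C \<inter> fst C')" if "y \<in> snd (prod_chart (mdim M) C D) ` A" for y
      using that A prod_chart_take[OF tC tD] by fastforce
  qed
  then show ?thesis
  proof (rule smooth_fun_on_cong)
    fix y assume "y \<in> snd (prod_chart (mdim M) C D) ` A"
    then have "y \<in> snd (prod_chart (mdim M) C D) ` (fst C \<times> fst D)" using A by blast
    from chart_inv_prod_chart[OF tC tD this]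
    show "snd C' (chart_inv C (vec_take (mdim M) y)) j = snd C' (fst (chart_inv (prod_chart (mdim M) C D) y)) j"
      by simp
  qed
qed

lemma prod_transition_drop:
  assumes C: "C \<in> atlas M" and D: "D \<in> atlas M'" "D' \<in> atlas M'" and j: "j < mdim M'"
    and A: "A \<subseteq> fst C \<times> (fst D \<inter> fst D')"
  shows "smooth_fun_on (mdim M + mdim M') (snd (prod_chart (mdim M) C D) ` A)
    (\<lambda>y. snd D' (snd (chart_inv (prod_chart (mdim M) C D) y)) j)"
proof -
  note tC = atlas_chart[OF M C] and tD = atlas_chart[OF M' D(1)]
  note tK = topological_prod_chart[OF tC tD]
  have "smooth_fun_on (mdim M + mdim M') (snd (prod_chart (mdim M) C D) ` A)
    (\<lambda>y. snd D' (chart_inv D (vec_drop (mdim M) y)) j)"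
  proof (rule smooth_fun_vec_drop[OF smooth_transitionD[OF atlas_transition[OF M' D] j]])
    show "snd D ` (fst D \<inter> fst D') \<subseteq> Espace (mdim M')" using chart_in_Espace[OF tD] by auto
    show "snd (prod_chart (mdim M) C D) ` A \<subseteq> Espace (mdim M + mdim M')"
      using chart_in_Espace[OF tK] A by fastforce
    show "vec_drop (mdim M) y \<in> snd D ` (fst D \<inter> fst D')" if "y \<in> snd (prod_chart (mdim M) C D) ` A" for y
      using that A prod_chart_drop[OF tC tD] by fastforce
  qed
  then show ?thesis
  proof (rule smooth_fun_on_cong)
    fix y assume "y \<in> snd (prod_chart (mdim M) C D) ` A"
    then have "y \<in> snd (prod_chart (mdim M) C D) ` (fst C \<times> fst D)" using A by blast
    from chart_inv_prod_chart[OF tC tD this]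
    show "snd D' (chart_inv D (vec_drop (mdim M) y)) j = snd D' (snd (chart_inv (prod_chart (mdim M) C D) y)) j"
      by simp
  qed
qed

lemma smooth_atlas_prod: "smooth_atlas (prod_manifold M M')"
  unfolding smooth_atlas_def
proof (intro conjI ballI)
  fix K assume "K \<in> atlas (prod_manifold M M')"
  then obtain C D where K: "C \<in> atlas M" "D \<in> atlas M'" "K = prod_chart (mdim M) C D" by auto
  note tC = atlas_chart[OF M K(1)] and tD = atlas_chart[OF M' K(2)]
  show "topological_chart (mtop (prod_manifold M M')) (mdim (prod_manifold M M')) K"
    using topological_prod_chart[OF tC tD] K(3) by simp
  fix K' assume "K' \<in> atlas (prod_manifold M M')"
  then obtain C' D' where K': "C' \<in> atlas M" "D' \<in> atlas M'" "K' = prod_chart (mdim M) C' D'" by auto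
  have A: "fst K \<inter> fst K' \<subseteq> (fst C \<inter> fst C') \<times> fst D" "fst K \<inter> fst K' \<subseteq> fst C \<times> (fst D \<inter> fst D')"
    using K K' by auto
  show "smooth_transition (mdim (prod_manifold M M')) K K'"
    unfolding smooth_transition_def smooth_vec_on_def
  proof (intro allI impI)
    fix j assume "j < mdim (prod_manifold M M')"
    then have j: "j < mdim M + mdim M'" by simp
    have "smooth_fun_on (mdim M + mdim M') (snd K ` (fst K \<inter> fst K')) (\<lambda>y. snd K' (chart_inv K y) j)"
    proof (cases "j < mdim M")
      case True
      then show ?thesis
        using prod_transition_take[OF K(1) K'(1) K(2) True A(1)] K(3) K'(3)
        by (simp add: snd_prod_chart vec_append_def)
    next
      case False
      then have "j - mdim M < mdim M'" using j by simp
      then show ?thesis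
        using prod_transition_drop[OF K(1) K(2) K'(2) _ A(2), of "j - mdim M"] K(3) K'(3) False
        by (simp add: snd_prod_chart vec_append_def)
    qed
    then show "smooth_fun_on (mdim (prod_manifold M M')) (snd K ` (fst K \<inter> fst K')) (\<lambda>x. (snd K' \<circ> chart_inv K) x j)"
      by (simp add: o_def)
  qed
next
  show "(\<Union>K\<in>atlas (prod_manifold M M'). fst K) = points (prod_manifold M M')"
  proof (intro equalityI subsetI)
    fix p assume "p \<in> (\<Union>K\<in>atlas (prod_manifold M M'). fst K)"
    then obtain C D where "C \<in> atlas M" "D \<in> atlas M'" "p \<in> fst (prod_chart (mdim M) C D)"
      unfolding prod_manifold_simps by blast
    then have "C \<in> atlas M" "D \<in> atlas M'" "fst p \<in> fst C" "snd p \<in> fst D" by auto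
    then show "p \<in> points (prod_manifold M M')"
      using chart_in_points[OF atlas_chart[OF M]] chart_in_points[OF atlas_chart[OF M']] by (simp add: mem_Times_iff)
  next
    fix p assume "p \<in> points (prod_manifold M M')"
    then have p: "fst p \<in> points M" "snd p \<in> points M'" by auto
    obtain C D where "C \<in> atlas M" "fst p \<in> fst C" "D \<in> atlas M'" "snd p \<in> fst D"
      using atlas_cover[OF M p(1)] atlas_cover[OF M' p(2)] by blast
    then have "prod_chart (mdim M) C D \<in> atlas (prod_manifold M M')" "p \<in> fst (prod_chart (mdim M) C D)"
      by (auto simp: mem_Times_iff prod_chart_atlas simp del: prod_manifold_simps)
    then show "p \<in> (\<Union>K\<in>atlas (prod_manifold M M'). fst K)" by blast
  qed
qed

lemma smooth_fst: "smooth_map_on (prod_manifold M M') A M fst"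
  unfolding smooth_map_on_def smooth_vec_on_def
proof (intro conjI ballI allI impI)
  show "continuous_map (subtopology (mtop (prod_manifold M M')) A) (mtop M) fst"
    by (simp add: continuous_map_from_subtopology continuous_map_fst)
  fix K E j assume "K \<in> atlas (prod_manifold M M')" and E: "E \<in> atlas M" and j: "j < mdim M"
  then obtain C D where K: "C \<in> atlas M" "D \<in> atlas M'" "K = prod_chart (mdim M) C D" by auto
  have A: "A \<inter> fst K \<inter> fst -` fst E \<subseteq> (fst C \<inter> fst E) \<times> fst D" using K(3) by auto
  show "smooth_fun_on (mdim (prod_manifold M M')) (snd K ` (A \<inter> fst K \<inter> fst -` fst E)) (\<lambda>x. (snd E \<circ> fst \<circ> chart_inv K) x j)"
    using prod_transition_take[OF K(1) E K(2) j A] K(3) by (simp add: o_def)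
qed

lemma smooth_snd: "smooth_map_on (prod_manifold M M') A M' snd"
  unfolding smooth_map_on_def smooth_vec_on_def
proof (intro conjI ballI allI impI)
  show "continuous_map (subtopology (mtop (prod_manifold M M')) A) (mtop M') snd"
    by (simp add: continuous_map_from_subtopology continuous_map_snd)
  fix K E j assume "K \<in> atlas (prod_manifold M M')" and E: "E \<in> atlas M'" and j: "j < mdim M'"
  then obtain C D where K: "C \<in> atlas M" "D \<in> atlas M'" "K = prod_chart (mdim M) C D" by auto
  have A: "A \<inter> fst K \<inter> snd -` fst E \<subseteq> fst C \<times> (fst D \<inter> fst E)" using K(3) by auto
  show "smooth_fun_on (mdim (prod_manifold M M')) (snd K ` (A \<inter> fst K \<inter> snd -` fst E)) (\<lambda>x. (snd E \<circ> snd \<circ> chart_inv K) x j)"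
    using prod_transition_drop[OF K(1) K(2) E j A] K(3) by (simp add: o_def)
qed

lemma smooth_pair:
  assumes f: "smooth_map_on K A M f" and g: "smooth_map_on K A M' g"
  shows "smooth_map_on K A (prod_manifold M M') (\<lambda>x. (f x, g x))"
  unfolding smooth_map_on_def smooth_vec_on_def
proof (intro conjI ballI allI impI)
  show "continuous_map (subtopology (mtop K) A) (mtop (prod_manifold M M')) (\<lambda>x. (f x, g x))"
    using f g by (auto simp: smooth_map_on_def intro: continuous_map_pairedI)
  fix B E j assume B: "B \<in> atlas K" and "E \<in> atlas (prod_manifold M M')" and j: "j < mdim (prod_manifold M M')"
  then obtain C D where E: "C \<in> atlas M" "D \<in> atlas M'" "E = prod_chart (mdim M) C D" by auto
  let ?A = "A \<inter> fst B \<inter> (\<lambda>x. (f x, g x)) -` fst E"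
  show "smooth_fun_on (mdim K) (snd B ` ?A) (\<lambda>x. (snd E \<circ> (\<lambda>x. (f x, g x)) \<circ> chart_inv B) x j)"
  proof (cases "j < mdim M")
    case True
    have "smooth_fun_on (mdim K) (snd B ` (A \<inter> fst B \<inter> f -` fst C)) (\<lambda>x. (snd C \<circ> f \<circ> chart_inv B) x j)"
      using f B E True by (simp add: smooth_map_on_def smooth_vec_on_def)
    from smooth_fun_on_subset[OF this, of "snd B ` ?A"] show ?thesis
      using E(3) True by (auto simp: snd_prod_chart vec_append_def o_def)
  next
    case False
    have "smooth_fun_on (mdim K) (snd B ` (A \<inter> fst B \<inter> g -` fst D)) (\<lambda>x. (snd D \<circ> g \<circ> chart_inv B) x (j - mdim M))"
      using g B E False j by (simp add: smooth_map_on_def smooth_vec_on_def)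
    from smooth_fun_on_subset[OF this, of "snd B ` ?A"] show ?thesis
      using E(3) False by (auto simp: snd_prod_chart vec_append_def o_def)
  qed
qed

text \<open>Not a matter of splitting a coordinate vector: the chart chosen at \<open>p\<close> is a
  product of some \<open>C\<close> and \<open>D\<close>, but these may differ from the charts chosen
  at \<open>fst p\<close> and \<open>snd p\<close>. A curve with velocity \<open>v\<close> is
  therefore differentiated in the coordinates of \<open>C\<close> and \<open>D\<close>.\<close>

lemma prod_tangent_zero:
  assumes p: "p \<in> points (prod_manifold M M')" and v: "v \<in> Espace (mdim M + mdim M')"
    and v1: "differential (prod_manifold M M') M fst p v = (\<lambda>_. 0)"
    and v2: "differential (prod_manifold M M') M' snd p v = (\<lambda>_. 0)"
  shows "v = (\<lambda>_. 0)"
proof -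
  let ?P = "prod_manifold M M'"
  note P = smooth_atlas_prod
  have "v \<in> Espace (mdim ?P)" using v by simp
  then obtain c where c: "smooth_map_on real_line UNIV ?P c" "\<And>s. c s \<in> points ?P" "c 0 = p" "velocity ?P UNIV c 0 = v"
    by (rule exists_curve[OF P openin_topspace p]) blast
  obtain C D where CD: "C \<in> atlas M" "D \<in> atlas M'" "chart_at ?P p = prod_chart (mdim M) C D"
    "fst p \<in> fst C" "snd p \<in> fst D"
    using chart_at[OF P p] by (auto simp: mem_Times_iff)
  have c1: "smooth_map_on real_line UNIV M (\<lambda>s. fst (c s))"
    by (rule smooth_map_on_compose[OF smooth_atlas_real_line P c(1) smooth_fst]) auto
  have c2: "smooth_map_on real_line UNIV M' (\<lambda>s. snd (c s))"
    by (rule smooth_map_on_compose[OF smooth_atlas_real_line P c(1) smooth_snd]) auto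
  have w1: "velocity M UNIV (\<lambda>s. fst (c s)) 0 = (\<lambda>_. 0)"
    using differential_velocity[OF P M smooth_fst openin_topspace c(1)] c p v1 by simp
  have w2: "velocity M' UNIV (\<lambda>s. snd (c s)) 0 = (\<lambda>_. 0)"
    using differential_velocity[OF P M' smooth_snd openin_topspace c(1)] c p v2 by simp
  have "v i = 0" if i: "i < mdim M + mdim M'" for i
  proof -
    have d: "((\<lambda>s. snd (prod_chart (mdim M) C D) (c s) i) has_real_derivative v i) (at 0)"
      using velocity_has_derivative[OF P c(1), of 0 i] i c CD(3) by simp
    show ?thesis
    proof (cases "i < mdim M")
      case True
      note C = atlas_chart[OF M CD(1)]
      have "((\<lambda>s. snd (chart_at real_line (snd C (fst (c 0)) i)) (snd C (fst (c s)) i) 0) has_real_derivative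
          differential M real_line (\<lambda>x. snd C x i) (fst (c 0)) (velocity M UNIV (\<lambda>s. fst (c s)) 0) 0) (at 0)"
        using CD c
        by (intro chain_derivative[OF M smooth_atlas_real_line c1 _ _
            smooth_vec_component[OF M maximal_atlasD(2)[OF M atlas_maximal[OF M CD(1)]] openin_subset[OF chart_open(1)[OF C]]]
            chart_open(1)[OF C]]) auto
      then have "((\<lambda>s. snd C (fst (c s)) i) has_real_derivative 0) (at 0)" using w1 by simp
      then show ?thesis using d True DERIV_unique by (auto simp: snd_prod_chart vec_append_def)
    next
      case False
      note D = atlas_chart[OF M' CD(2)]
      let ?i = "i - mdim M"
      have "((\<lambda>s. snd (chart_at real_line (snd D (snd (c 0)) ?i)) (snd D (snd (c s)) ?i) 0) has_real_derivative
          differential M' real_line (\<lambda>x. snd D x ?i) (snd (c 0)) (velocity M' UNIV (\<lambda>s. snd (c s)) 0) 0) (at 0)"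
        using CD c
        by (intro chain_derivative[OF M' smooth_atlas_real_line c2 _ _
            smooth_vec_component[OF M' maximal_atlasD(2)[OF M' atlas_maximal[OF M' CD(2)]] openin_subset[OF chart_open(1)[OF D]]]
            chart_open(1)[OF D]]) auto
      then have "((\<lambda>s. snd D (snd (c s)) ?i) has_real_derivative 0) (at 0)" using w2 by simp
      then show ?thesis using d False DERIV_unique by (auto simp: snd_prod_chart vec_append_def)
    qed
  qed
  then show ?thesis using v by (auto simp: mem_Espace fun_eq_iff) (metis not_le)
qed

lemma prod_tangent_eqI:
  assumes p: "p \<in> points (prod_manifold M M')"
    and v: "v \<in> Espace (mdim M + mdim M')" and w: "w \<in> Espace (mdim M + mdim M')"
    and 1: "differential (prod_manifold M M') M fst p v = differential (prod_manifold M M') M fst p w"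
    and 2: "differential (prod_manifold M M') M' snd p v = differential (prod_manifold M M') M' snd p w"
  shows "v = w"
proof -
  have "(\<lambda>i. v i - w i) = (\<lambda>_. 0)"
    by (rule prod_tangent_zero[OF p]) (use v w 1 2 in \<open>auto simp: differential_diff mem_Espace\<close>)
  then show ?thesis by (simp add: fun_eq_iff)
qed

lemma prod_tangent_exists:
  assumes p: "p \<in> points (prod_manifold M M')" and a: "a \<in> Espace (mdim M)" and b: "b \<in> Espace (mdim M')"
  obtains v where "v \<in> Espace (mdim M + mdim M')"
    "differential (prod_manifold M M') M fst p v = a"
    "differential (prod_manifold M M') M' snd p v = b"
proof -
  let ?P = "prod_manifold M M'"
  note P = smooth_atlas_prod
  have p': "fst p \<in> points M" "snd p \<in> points M'" using p by auto
  obtain c where c: "smooth_map_on real_line UNIV M c" "\<And>s. c s \<in> points M" "c 0 = fst p" "velocity M UNIV c 0 = a"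
    by (rule exists_curve[OF M openin_topspace p'(1) a]) blast
  obtain d where d: "smooth_map_on real_line UNIV M' d" "\<And>s. d s \<in> points M'" "d 0 = snd p" "velocity M' UNIV d 0 = b"
    by (rule exists_curve[OF M' openin_topspace p'(2) b]) blast
  have e: "smooth_map_on real_line UNIV ?P (\<lambda>s. (c s, d s))" by (rule smooth_pair[OF c(1) d(1)])
  show ?thesis
  proof (rule that[of "velocity ?P UNIV (\<lambda>s. (c s, d s)) 0"])
    show "velocity ?P UNIV (\<lambda>s. (c s, d s)) 0 \<in> Espace (mdim M + mdim M')"
      using velocity_tangent[of ?P] by simp
    show "differential ?P M fst p (velocity ?P UNIV (\<lambda>s. (c s, d s)) 0) = a"
      using differential_velocity[OF P M smooth_fst openin_topspace e] c d p by simp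
    show "differential ?P M' snd p (velocity ?P UNIV (\<lambda>s. (c s, d s)) 0) = b"
      using differential_velocity[OF P M' smooth_snd openin_topspace e] c d p by simp
  qed
qed

end

lemma second_countable_prod_topology:
  assumes "second_countable X" "second_countable Y"
  shows "second_countable (prod_topology X Y)"
proof -
  obtain B where B: "countable B" "\<And>V. V \<in> B \<Longrightarrow> openin X V" "\<And>U x. openin X U \<Longrightarrow> x \<in> U \<Longrightarrow> \<exists>V\<in>B. x \<in> V \<and> V \<subseteq> U"
    using assms(1) unfolding second_countable_def by metis
  obtain B' where B': "countable B'" "\<And>V. V \<in> B' \<Longrightarrow> openin Y V" "\<And>U x. openin Y U \<Longrightarrow> x \<in> U \<Longrightarrow> \<exists>V\<in>B'. x \<in> V \<and> V \<subseteq> U"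
    using assms(2) unfolding second_countable_def by metis
  show ?thesis
    unfolding second_countable_def
  proof (intro exI[of _ "(\<lambda>(V, W). V \<times> W) ` (B \<times> B')"] conjI ballI allI impI)
    show "countable ((\<lambda>(V, W). V \<times> W) ` (B \<times> B'))" using B(1) B'(1) by auto
    show "openin (prod_topology X Y) V" if "V \<in> (\<lambda>(V, W). V \<times> W) ` (B \<times> B')" for V
      using that B(2) B'(2) by (auto simp: openin_prod_Times_iff)
    fix U p assume U: "openin (prod_topology X Y) U \<and> p \<in> U"
    obtain x y where p: "p = (x, y)" by (cases p)
    obtain S T where ST: "openin X S" "openin Y T" "x \<in> S" "y \<in> T" "S \<times> T \<subseteq> U"
      using U[unfolded openin_prod_topology_alt] p by metis
    obtain V W where "V \<in> B" "x \<in> V" "V \<subseteq> S" "W \<in> B'" "y \<in> W" "W \<subseteq> T"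
      using B(3)[OF ST(1,3)] B'(3)[OF ST(2,4)] by blast
    then show "\<exists>V\<in>(\<lambda>(V, W). V \<times> W) ` (B \<times> B'). p \<in> V \<and> V \<subseteq> U"
      using ST(5) p by (intro bexI[of _ "V \<times> W"]) auto
  qed
qed

lemma smooth_manifold_prod:
  "smooth_manifold M \<Longrightarrow> smooth_manifold M' \<Longrightarrow> smooth_manifold (prod_manifold M M')"
  by (auto simp: smooth_manifold_iff smooth_atlas_prod Hausdorff_space_prod_topology
      intro: second_countable_prod_topology)

section \<open>Constructions of symplectic manifolds\<close>

lemma zero_Espace [simp]: "(\<lambda>_. 0) \<in> Espace n"
  by (simp add: mem_Espace)

context
  fixes M :: "'a manifold" and \<omega> x
  assumes \<omega>: "alternating_bilinear M \<omega>" and x: "x \<in> points M"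
begin

lemma form_antisym: "v \<in> Espace (mdim M) \<Longrightarrow> w \<in> Espace (mdim M) \<Longrightarrow> \<omega> x v w = - \<omega> x w v"
  using \<omega> x unfolding alternating_bilinear_def tangent_space_def by blast

lemma form_linear:
  "u \<in> Espace (mdim M) \<Longrightarrow> v \<in> Espace (mdim M) \<Longrightarrow> w \<in> Espace (mdim M) \<Longrightarrow>
    \<omega> x (\<lambda>i. a * u i + v i) w = a * \<omega> x u w + \<omega> x v w"
  using \<omega> x unfolding alternating_bilinear_def tangent_space_def by blast

lemma form_zero_left: "w \<in> Espace (mdim M) \<Longrightarrow> \<omega> x (\<lambda>_. 0) w = 0"
  using form_linear[of "\<lambda>_. 0" "\<lambda>_. 0" w 1] by (simp add: mem_Espace)

lemma form_zero_right: "w \<in> Espace (mdim M) \<Longrightarrow> \<omega> x w (\<lambda>_. 0) = 0"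
  using form_antisym[of w "\<lambda>_. 0"] form_zero_left[of w] by (simp add: mem_Espace)

lemma form_diff_left:
  "u \<in> Espace (mdim M) \<Longrightarrow> v \<in> Espace (mdim M) \<Longrightarrow> w \<in> Espace (mdim M) \<Longrightarrow>
    \<omega> x (\<lambda>i. u i - v i) w = \<omega> x u w - \<omega> x v w"
  using form_linear[of v u w "-1"] by (simp add: algebra_simps)

end

definition unit_vec :: "nat \<Rightarrow> vec" where
  "unit_vec i = (\<lambda>j. if j = i then 1 else 0)"

lemma coord_vec_eq: "coord_vec M C i y = differential (vec_manifold (mdim M)) M (chart_inv C) y (unit_vec i)"
  by (simp add: coord_vec_def unit_vec_def)

lemma unit_vec_Espace: "i < n \<Longrightarrow> unit_vec i \<in> Espace n"
  by (simp add: unit_vec_def mem_Espace)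

lemma coord_vec_tangent: "coord_vec M C i y \<in> Espace (mdim M)"
  unfolding coord_vec_eq by (rule differential_tangent)

text \<open>A coordinate field is the image of a unit vector under the derivative of the inverse
  chart, so the chain rule moves the computation to coordinate space.\<close>

lemma differential_coord_vec:
  assumes M: "smooth_atlas M" and M': "smooth_atlas M'" and f: "smooth_map_on M (points M) M' f"
    and C: "C \<in> atlas M" and y: "y \<in> snd C ` fst C" and i: "i < mdim M"
  shows "differential M M' f (chart_inv C y) (coord_vec M C i y)
    = differential (vec_manifold (mdim M)) M' (\<lambda>y. f (chart_inv C y)) y (unit_vec i)"
  unfolding coord_vec_eq
proof (rule differential_chain[symmetric, OF smooth_atlas_vec_manifold M M'
      maximal_atlasD(3)[OF M atlas_maximal[OF M C]] _ f openin_topspace _ y])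
  note tC = atlas_chart[OF M C]
  show "openin (mtop (vec_manifold (mdim M))) (snd C ` fst C)" using chart_open(2)[OF tC] by simp
  show "chart_inv C z \<in> points M" if "z \<in> snd C ` fst C" for z
    by (rule chart_in_points[OF tC chart_inv_into[OF tC that]])
  show "unit_vec i \<in> Espace (mdim (vec_manifold (mdim M)))" using i by (simp add: unit_vec_Espace)
qed

text \<open>Each block of a product form depends on one group of coordinates; this and the next
  lemma make the derivatives in the other directions vanish.\<close>

lemma partial_deriv_take:
  "partial_deriv l (\<lambda>y. F (vec_take m y)) y = (if l < m then partial_deriv l F (vec_take m y) else 0)"
proof -
  have "vec_take m (y(l := s)) = (if l < m then (vec_take m y)(l := s) else vec_take m y)" for s
    by (auto simp: vec_take_def)
  then show ?thesis by (auto simp: partial_deriv_def vec_take_def)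
qed

lemma partial_deriv_drop:
  "partial_deriv l (\<lambda>y. F (vec_drop m y)) y = (if l < m then 0 else partial_deriv (l - m) F (vec_drop m y))"
proof -
  have "vec_drop m (y(l := s)) = (if l < m then vec_drop m y else (vec_drop m y)(l - m := s))" for s
    by (auto simp: vec_drop_def fun_eq_iff)
  then show ?thesis by (auto simp: partial_deriv_def vec_drop_def)
qed

lemma partial_deriv_const [simp]: "partial_deriv l (\<lambda>y. c) y = 0"
  by (simp add: partial_deriv_def)

lemma partial_deriv_coord: "partial_deriv l (\<lambda>y. y j) y = (if l = j then 1 else 0)"
  by (rule partial_derivI) (cases "l = j"; simp)

lemma differential_take:
  assumes "y \<in> Espace (m + n)"
  shows "differential (vec_manifold (m + n)) (vec_manifold m) (vec_take m) y (unit_vec i)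
    = (if i < m then unit_vec i else (\<lambda>_. 0))"
proof
  fix j
  show "differential (vec_manifold (m + n)) (vec_manifold m) (vec_take m) y (unit_vec i) j
    = (if i < m then unit_vec i else (\<lambda>_. 0)) j"
  proof (cases "j < m")
    case True
    then have "(\<lambda>y. vec_take m y j) = (\<lambda>y. y j)" by (auto simp: vec_take_def)
    then show ?thesis
      using True assms by (simp add: differential_vec_manifold partial_deriv_coord sum_delta_mult unit_vec_def)
  next
    case False
    then show ?thesis by (auto simp: differential_def unit_vec_def)
  qed
qed

lemma differential_drop:
  assumes "y \<in> Espace (m + n)" "i < m + n"
  shows "differential (vec_manifold (m + n)) (vec_manifold n) (vec_drop m) y (unit_vec i)
    = (if i < m then (\<lambda>_. 0) else unit_vec (i - m))"
proof
  fix j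
  show "differential (vec_manifold (m + n)) (vec_manifold n) (vec_drop m) y (unit_vec i) j
    = (if i < m then (\<lambda>_. 0) else unit_vec (i - m)) j"
  proof (cases "j < n")
    case True
    have "(\<lambda>y. vec_drop m y j) = (\<lambda>y. y (j + m))" by (auto simp: vec_drop_def)
    then show ?thesis
      using True assms vec_drop_Espace[OF assms(1)]
      by (auto simp: differential_vec_manifold partial_deriv_coord sum_delta_mult unit_vec_def)
  next
    case False
    then show ?thesis using assms(2) by (auto simp: differential_def unit_vec_def)
  qed
qed

section \<open>Coefficients of a product form\<close>

context
  fixes M :: "'a manifold" and M' :: "'b manifold" and C D
  assumes M: "smooth_atlas M" and M': "smooth_atlas M'" and C: "C \<in> atlas M" and D: "D \<in> atlas M'"
begin

lemma differential_fst_coord_vec: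
  assumes y: "y \<in> snd (prod_chart (mdim M) C D) ` fst (prod_chart (mdim M) C D)" and i: "i < mdim M + mdim M'"
  shows "differential (prod_manifold M M') M fst (chart_inv (prod_chart (mdim M) C D) y)
      (coord_vec (prod_manifold M M') (prod_chart (mdim M) C D) i y)
    = (if i < mdim M then coord_vec M C i (vec_take (mdim M) y) else (\<lambda>_. 0))"
proof -
  let ?P = "prod_manifold M M'" and ?K = "prod_chart (mdim M) C D" and ?m = "mdim M" and ?n = "mdim M'"
  note tC = atlas_chart[OF M C] and tD = atlas_chart[OF M' D]
  note tK = topological_prod_chart[OF tC tD]
  note P = smooth_atlas_prod[OF M M']
  let ?A = "snd ?K ` fst ?K"
  have A: "openin (mtop (vec_manifold (?m + ?n))) ?A" using chart_open(2)[OF tK] by simp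
  have AE: "?A \<subseteq> Espace (?m + ?n)" using openin_subset[OF A] by simp
  have tk: "vec_take ?m z \<in> snd C ` fst C" if "z \<in> ?A" for z
    using that prod_chart_take[OF tC tD] by fastforce
  have B: "openin (mtop (vec_manifold ?m)) (snd C ` fst C)" using chart_open(2)[OF tC] by simp
  note ci = maximal_atlasD(3)[OF M atlas_maximal[OF M C]]
  have ti: "smooth_map_on (vec_manifold (?m + ?n)) ?A M (\<lambda>z. chart_inv C (vec_take ?m z))"
    by (rule smooth_map_on_compose[OF smooth_atlas_vec_manifold smooth_atlas_vec_manifold smooth_vec_take[OF AE] ci tk])
  have "differential ?P M fst (chart_inv ?K y) (coord_vec ?P ?K i y)
      = differential (vec_manifold (?m + ?n)) M (\<lambda>z. fst (chart_inv ?K z)) y (unit_vec i)"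
    using differential_coord_vec[OF P M smooth_fst[OF M M'], of ?K y i] prod_chart_atlas[OF C D] y i by simp
  also have "\<dots> = differential (vec_manifold (?m + ?n)) M (\<lambda>z. chart_inv C (vec_take ?m z)) y (unit_vec i)"
    using i chart_inv_prod_chart[OF tC tD]
    by (intro differential_cong[OF smooth_atlas_vec_manifold M ti A _ y]) (auto simp: unit_vec_Espace)
  also have "\<dots> = differential (vec_manifold ?m) M (chart_inv C) (vec_take ?m y)
      (differential (vec_manifold (?m + ?n)) (vec_manifold ?m) (vec_take ?m) y (unit_vec i))"
    by (rule differential_chain[OF smooth_atlas_vec_manifold smooth_atlas_vec_manifold M smooth_vec_take[OF AE] A ci B tk y])
      (use i in \<open>auto simp: unit_vec_Espace\<close>)
  also have "\<dots> = (if i < ?m then coord_vec M C i (vec_take ?m y) else (\<lambda>_. 0))"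
    using AE y by (subst differential_take) (auto simp: coord_vec_eq)
  finally show ?thesis .
qed

lemma differential_snd_coord_vec:
  assumes y: "y \<in> snd (prod_chart (mdim M) C D) ` fst (prod_chart (mdim M) C D)" and i: "i < mdim M + mdim M'"
  shows "differential (prod_manifold M M') M' snd (chart_inv (prod_chart (mdim M) C D) y)
      (coord_vec (prod_manifold M M') (prod_chart (mdim M) C D) i y)
    = (if i < mdim M then (\<lambda>_. 0) else coord_vec M' D (i - mdim M) (vec_drop (mdim M) y))"
proof -
  let ?P = "prod_manifold M M'" and ?K = "prod_chart (mdim M) C D" and ?m = "mdim M" and ?n = "mdim M'"
  note tC = atlas_chart[OF M C] and tD = atlas_chart[OF M' D]
  note tK = topological_prod_chart[OF tC tD]
  note P = smooth_atlas_prod[OF M M']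
  let ?A = "snd ?K ` fst ?K"
  have A: "openin (mtop (vec_manifold (?m + ?n))) ?A" using chart_open(2)[OF tK] by simp
  have AE: "?A \<subseteq> Espace (?m + ?n)" using openin_subset[OF A] by simp
  have dr: "vec_drop ?m z \<in> snd D ` fst D" if "z \<in> ?A" for z
    using that prod_chart_drop[OF tC tD] by fastforce
  have B: "openin (mtop (vec_manifold ?n)) (snd D ` fst D)" using chart_open(2)[OF tD] by simp
  note ci = maximal_atlasD(3)[OF M' atlas_maximal[OF M' D]]
  have ti: "smooth_map_on (vec_manifold (?m + ?n)) ?A M' (\<lambda>z. chart_inv D (vec_drop ?m z))"
    by (rule smooth_map_on_compose[OF smooth_atlas_vec_manifold smooth_atlas_vec_manifold smooth_vec_drop[OF AE] ci dr])
  have "differential ?P M' snd (chart_inv ?K y) (coord_vec ?P ?K i y)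
      = differential (vec_manifold (?m + ?n)) M' (\<lambda>z. snd (chart_inv ?K z)) y (unit_vec i)"
    using differential_coord_vec[OF P M' smooth_snd[OF M M'], of ?K y i] prod_chart_atlas[OF C D] y i by simp
  also have "\<dots> = differential (vec_manifold (?m + ?n)) M' (\<lambda>z. chart_inv D (vec_drop ?m z)) y (unit_vec i)"
    using i chart_inv_prod_chart[OF tC tD]
    by (intro differential_cong[OF smooth_atlas_vec_manifold M' ti A _ y]) (auto simp: unit_vec_Espace)
  also have "\<dots> = differential (vec_manifold ?n) M' (chart_inv D) (vec_drop ?m y)
      (differential (vec_manifold (?m + ?n)) (vec_manifold ?n) (vec_drop ?m) y (unit_vec i))"
    by (rule differential_chain[OF smooth_atlas_vec_manifold smooth_atlas_vec_manifold M' smooth_vec_drop[OF AE] A ci B dr y])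
      (use i in \<open>auto simp: unit_vec_Espace\<close>)
  also have "\<dots> = (if i < ?m then (\<lambda>_. 0) else coord_vec M' D (i - ?m) (vec_drop ?m y))"
    using AE y i by (subst differential_drop) (auto simp: coord_vec_eq)
  finally show ?thesis .
qed

text \<open>The coefficient matrix is block diagonal in product charts, since one of the two
  projections annihilates each coordinate field. Smoothness and closedness can then be checked block
  by block.\<close>

lemma form_coeff_prod:
  assumes \<omega>: "alternating_bilinear M \<omega>" and \<omega>': "alternating_bilinear M' \<omega>'"
    and y: "y \<in> snd (prod_chart (mdim M) C D) ` fst (prod_chart (mdim M) C D)"
    and i: "i < mdim M + mdim M'" and j: "j < mdim M + mdim M'"
  shows "form_coeff (prod_manifold M M') (prod_form M \<omega> M' \<omega>') (prod_chart (mdim M) C D) i j y =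
    (if i < mdim M \<and> j < mdim M then form_coeff M \<omega> C i j (vec_take (mdim M) y)
     else if \<not> i < mdim M \<and> \<not> j < mdim M then form_coeff M' \<omega>' D (i - mdim M) (j - mdim M) (vec_drop (mdim M) y)
     else 0)"
proof -
  note tC = atlas_chart[OF M C] and tD = atlas_chart[OF M' D]
  have ci: "chart_inv (prod_chart (mdim M) C D) y = (chart_inv C (vec_take (mdim M) y), chart_inv D (vec_drop (mdim M) y))"
    using chart_inv_prod_chart[OF tC tD] y by simp
  have "vec_take (mdim M) y \<in> snd C ` fst C" "vec_drop (mdim M) y \<in> snd D ` fst D"
    using y prod_chart_take[OF tC tD] prod_chart_drop[OF tC tD] by fastforce+
  then have "chart_inv C (vec_take (mdim M) y) \<in> points M" "chart_inv D (vec_drop (mdim M) y) \<in> points M'"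
    using chart_in_points[OF tC chart_inv_into[OF tC]] chart_in_points[OF tD chart_inv_into[OF tD]] by auto
  note z = form_zero_left[OF \<omega> this(1)] form_zero_right[OF \<omega> this(1)]
    form_zero_left[OF \<omega>' this(2)] form_zero_right[OF \<omega>' this(2)]
  show ?thesis
    unfolding form_coeff_def prod_form_def
      differential_fst_coord_vec[OF y i] differential_fst_coord_vec[OF y j]
      differential_snd_coord_vec[OF y i] differential_snd_coord_vec[OF y j]
    unfolding ci
    by (simp add: z coord_vec_tangent)
qed

end

lemma symplectic_manifold_prod:
  assumes S: "symplectic_manifold M \<omega>" and S': "symplectic_manifold M' \<omega>'"
  shows "symplectic_manifold (prod_manifold M M') (prod_form M \<omega> M' \<omega>')"
proof -
  let ?P = "prod_manifold M M'" and ?\<Omega> = "prod_form M \<omega> M' \<omega>'" and ?m = "mdim M" and ?n = "mdim M'"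
  have M: "smooth_atlas M" and M': "smooth_atlas M'" and \<omega>: "alternating_bilinear M \<omega>" and \<omega>': "alternating_bilinear M' \<omega>'"
    and nd: "nondegenerate_form M \<omega>" and nd': "nondegenerate_form M' \<omega>'"
    and s: "smooth_form M \<omega>" and s': "smooth_form M' \<omega>'" and cl: "closed_form M \<omega>" and cl': "closed_form M' \<omega>'"
    using S S' by (auto simp: symplectic_manifold_def smooth_manifold_iff)
  have "smooth_manifold ?P"
    using S S' by (simp add: symplectic_manifold_def smooth_manifold_prod)
  moreover have "alternating_bilinear ?P ?\<Omega>"
    unfolding alternating_bilinear_def
  proof (intro ballI allI conjI)
    fix x u v w a
    assume x: "x \<in> points ?P"
    then have x1: "fst x \<in> points M" and x2: "snd x \<in> points M'" by auto
    show "?\<Omega> x (\<lambda>i. a * u i + v i) w = a * ?\<Omega> x u w + ?\<Omega> x v w"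
      by (simp add: prod_form_def differential_linear form_linear[OF \<omega> x1] form_linear[OF \<omega>' x2]
          differential_tangent distrib_left)
    show "?\<Omega> x v w = - ?\<Omega> x w v"
      using form_antisym[OF \<omega> x1 differential_tangent differential_tangent, of ?P fst x v ?P fst x w]
        form_antisym[OF \<omega>' x2 differential_tangent differential_tangent, of ?P snd x v ?P snd x w]
      unfolding prod_form_def by linarith
  qed
  moreover have "nondegenerate_form ?P ?\<Omega>"
    unfolding nondegenerate_form_def tangent_space_def
  proof (intro ballI impI)
    fix x v assume x: "x \<in> points ?P" and v: "v \<in> Espace (mdim ?P)" and 0: "\<forall>w\<in>Espace (mdim ?P). ?\<Omega> x v w = 0"
    then have x1: "fst x \<in> points M" and x2: "snd x \<in> points M'" by auto
    \<comment> \<open>Test vectors with vanishing second part leave only the first summand of the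
      form.\<close>
    have "\<omega> (fst x) (differential ?P M fst x v) a = 0" if a: "a \<in> Espace ?m" for a
    proof -
      obtain w where w: "w \<in> Espace (?m + ?n)" "differential ?P M fst x w = a" "differential ?P M' snd x w = (\<lambda>_. 0)"
        by (rule prod_tangent_exists[OF M M' x a zero_Espace]) (rule that)
      then have "?\<Omega> x v w = 0" using 0 by simp
      then show ?thesis using w by (simp add: prod_form_def form_zero_right[OF \<omega>' x2 differential_tangent])
    qed
    then have v1: "differential ?P M fst x v = (\<lambda>_. 0)"
      using nd x1 differential_tangent[of ?P M] unfolding nondegenerate_form_def tangent_space_def by blast
    have "\<omega>' (snd x) (differential ?P M' snd x v) b = 0" if b: "b \<in> Espace ?n" for b
    proof -
      obtain w where w: "w \<in> Espace (?m + ?n)" "differential ?P M fst x w = (\<lambda>_. 0)" "differential ?P M' snd x w = b"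
        by (rule prod_tangent_exists[OF M M' x zero_Espace b]) (rule that)
      then have "?\<Omega> x v w = 0" using 0 by simp
      then show ?thesis using w by (simp add: prod_form_def form_zero_right[OF \<omega> x1 differential_tangent])
    qed
    then have v2: "differential ?P M' snd x v = (\<lambda>_. 0)"
      using nd' x2 differential_tangent[of ?P M'] unfolding nondegenerate_form_def tangent_space_def by blast
    show "v = (\<lambda>_. 0)" using prod_tangent_zero[OF M M' x _ v1 v2] v by simp
  qed
  moreover have "smooth_form ?P ?\<Omega>"
    unfolding smooth_form_def
  proof (intro ballI allI impI)
    fix K i j assume "K \<in> atlas ?P" and "i < mdim ?P" and "j < mdim ?P"
    then obtain C D where K: "C \<in> atlas M" "D \<in> atlas M'" "K = prod_chart ?m C D"
      and i: "i < ?m + ?n" and j: "j < ?m + ?n" by auto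
    note tC = atlas_chart[OF M K(1)] and tD = atlas_chart[OF M' K(2)]
    note tK = topological_prod_chart[OF tC tD]
    let ?A = "snd K ` fst K"
    have AE: "?A \<subseteq> Espace (?m + ?n)" using openin_subset[OF chart_open(2)[OF tK]] K(3) by simp
    have tk: "vec_take ?m y \<in> snd C ` fst C" and dr: "vec_drop ?m y \<in> snd D ` fst D" if "y \<in> ?A" for y
      using that K(3) prod_chart_take[OF tC tD] prod_chart_drop[OF tC tD] by fastforce+
    have CE: "snd C ` fst C \<subseteq> Espace ?m" and DE: "snd D ` fst D \<subseteq> Espace ?n"
      using chart_in_Espace[OF tC] chart_in_Espace[OF tD] by auto
    have "smooth_fun_on (?m + ?n) ?A (\<lambda>y. if i < ?m \<and> j < ?m then form_coeff M \<omega> C i j (vec_take ?m y)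
     else if \<not> i < ?m \<and> \<not> j < ?m then form_coeff M' \<omega>' D (i - ?m) (j - ?m) (vec_drop ?m y) else 0)"
    proof -
      consider "i < ?m \<and> j < ?m" | "\<not> i < ?m \<and> \<not> j < ?m" | "i < ?m \<longleftrightarrow> \<not> j < ?m" by blast
      then show ?thesis
      proof cases
        case 1
        then have "smooth_fun_on ?m (snd C ` fst C) (form_coeff M \<omega> C i j)"
          using s K(1) by (simp add: smooth_form_def)
        from smooth_fun_vec_take[OF this CE AE tk] 1 show ?thesis by simp
      next
        case 2
        then have ij: "i - ?m < ?n" "j - ?m < ?n" using i j by auto
        then have "smooth_fun_on ?n (snd D ` fst D) (form_coeff M' \<omega>' D (i - ?m) (j - ?m))"
          by (rule s'[unfolded smooth_form_def, rule_format, OF K(2)])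
        from smooth_fun_vec_drop[OF this DE AE dr] 2 show ?thesis by simp
      next
        case 3
        have "smooth_fun_on (?m + ?n) ?A (\<lambda>y. 0)"
          by (rule smooth_fun_on_C_diff[OF C_diff_const[OF openin_topspace] AE])
        then show ?thesis using 3 by auto
      qed
    qed
    then have "smooth_fun_on (?m + ?n) ?A (form_coeff ?P ?\<Omega> K i j)"
      by (rule smooth_fun_on_cong) (use form_coeff_prod[OF M M' K(1,2) \<omega> \<omega>' _ i j] K(3) in simp)
    then show "smooth_fun_on (mdim ?P) (snd K ` fst K) (form_coeff ?P ?\<Omega> K i j)" by simp
  qed
  moreover have "closed_form ?P ?\<Omega>"
    unfolding closed_form_def
  proof (intro ballI allI impI)
    fix K y i j k assume "K \<in> atlas ?P" and y: "y \<in> snd K ` fst K" and "i < mdim ?P" and "j < mdim ?P" and "k < mdim ?P"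
    then obtain C D where K: "C \<in> atlas M" "D \<in> atlas M'" "K = prod_chart ?m C D"
      and i: "i < ?m + ?n" and j: "j < ?m + ?n" and k: "k < ?m + ?n" by auto
    note tC = atlas_chart[OF M K(1)] and tD = atlas_chart[OF M' K(2)]
    note tK = topological_prod_chart[OF tC tD]
    have A: "openin (Euclidean_space (?m + ?n)) (snd K ` fst K)" using chart_open(2)[OF tK] K(3) by simp
    have tk: "vec_take ?m y \<in> snd C ` fst C" and dr: "vec_drop ?m y \<in> snd D ` fst D"
      using y K(3) prod_chart_take[OF tC tD] prod_chart_drop[OF tC tD] by fastforce+
    \<comment> \<open>Only derivatives with all three indices in the same factor survive; in the
      mixed cases every term of the cyclic sum is therefore zero.\<close>
    have pd: "partial_deriv l (form_coeff ?P ?\<Omega> K a b) y =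
      (if a < ?m \<and> b < ?m \<and> l < ?m then partial_deriv l (form_coeff M \<omega> C a b) (vec_take ?m y)
       else if \<not> a < ?m \<and> \<not> b < ?m \<and> \<not> l < ?m then
         partial_deriv (l - ?m) (form_coeff M' \<omega>' D (a - ?m) (b - ?m)) (vec_drop ?m y)
       else 0)" if l: "l < ?m + ?n" and a: "a < ?m + ?n" and b: "b < ?m + ?n" for l a b
    proof -
      have "partial_deriv l (form_coeff ?P ?\<Omega> K a b) y = partial_deriv l (\<lambda>y.
        if a < ?m \<and> b < ?m then form_coeff M \<omega> C a b (vec_take ?m y)
        else if \<not> a < ?m \<and> \<not> b < ?m then form_coeff M' \<omega>' D (a - ?m) (b - ?m) (vec_drop ?m y) else 0) y"
        by (rule partial_deriv_cong[OF A y l]) (use form_coeff_prod[OF M M' K(1,2) \<omega> \<omega>' _ a b] K(3) in simp)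
      then show ?thesis
        by (cases "a < ?m"; cases "b < ?m"; simp add: partial_deriv_take[of l "form_coeff M \<omega> C a b"]
            partial_deriv_drop[of l "form_coeff M' \<omega>' D (a - ?m) (b - ?m)"])
    qed
    show "partial_deriv i (form_coeff ?P ?\<Omega> K j k) y + partial_deriv j (form_coeff ?P ?\<Omega> K k i) y
        + partial_deriv k (form_coeff ?P ?\<Omega> K i j) y = 0"
    proof -
      consider "i < ?m \<and> j < ?m \<and> k < ?m" | "\<not> i < ?m \<and> \<not> j < ?m \<and> \<not> k < ?m"
        | "(i < ?m \<or> j < ?m \<or> k < ?m) \<and> (\<not> i < ?m \<or> \<not> j < ?m \<or> \<not> k < ?m)" by blast
      then show ?thesis
      proof cases
        case 1
        then show ?thesis
          using cl[unfolded closed_form_def, rule_format, OF K(1) tk, of i j k]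
          by (simp add: pd[OF i j k] pd[OF j k i] pd[OF k i j])
      next
        case 2
        moreover have "i - ?m < ?n" "j - ?m < ?n" "k - ?m < ?n" using 2 i j k by auto
        ultimately show ?thesis
          using cl'[unfolded closed_form_def, rule_format, OF K(2) dr, of "i - ?m" "j - ?m" "k - ?m"]
          by (simp add: pd[OF i j k] pd[OF j k i] pd[OF k i j])
      next
        case 3
        then show ?thesis
          unfolding pd[OF i j k] pd[OF j k i] pd[OF k i j]
          by (cases "i < ?m"; cases "j < ?m"; cases "k < ?m"; simp)
      qed
    qed
  qed
  ultimately show ?thesis by (simp add: symplectic_manifold_def)
qed

lemma symplectic_manifold_uminus:
  assumes S: "symplectic_manifold M \<omega>"
  shows "symplectic_manifold M (\<lambda>x v w. - \<omega> x v w)"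
proof -
  have M: "smooth_atlas M" and s: "smooth_form M \<omega>" and cl: "closed_form M \<omega>" and \<omega>: "alternating_bilinear M \<omega>"
    using S by (auto simp: symplectic_manifold_def smooth_manifold_iff)
  have fc: "form_coeff M (\<lambda>x v w. - \<omega> x v w) C i j = (\<lambda>y. - form_coeff M \<omega> C i j y)" for C i j
    by (simp add: form_coeff_def fun_eq_iff)
  have "alternating_bilinear M (\<lambda>x v w. - \<omega> x v w)"
    unfolding alternating_bilinear_def tangent_space_def
  proof (intro ballI allI conjI)
    fix x u v w a
    assume x: "x \<in> points M" and u: "u \<in> Espace (mdim M)" "v \<in> Espace (mdim M)" "w \<in> Espace (mdim M)"
    show "- \<omega> x (\<lambda>i. a * u i + v i) w = a * - \<omega> x u w + - \<omega> x v w"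
      by (simp add: form_linear[OF \<omega> x u])
    show "- \<omega> x v w = - (- \<omega> x w v)"
      using form_antisym[OF \<omega> x u(2,3)] by linarith
  qed
  moreover have "nondegenerate_form M (\<lambda>x v w. - \<omega> x v w)"
    using S unfolding symplectic_manifold_def nondegenerate_form_def by simp
  moreover have "smooth_form M (\<lambda>x v w. - \<omega> x v w)"
    unfolding smooth_form_def fc
  proof (intro ballI allI impI)
    fix C i j assume C: "C \<in> atlas M" and ij: "i < mdim M" "j < mdim M"
    have E: "snd C ` fst C \<subseteq> Espace (mdim M)" using chart_in_Espace[OF atlas_chart[OF M C]] by auto
    have "smooth_fun_on (mdim M) (snd C ` fst C) (\<lambda>y. (-1) * form_coeff M \<omega> C i j y)"
      using s C ij E
      by (intro smooth_fun_on_mult smooth_fun_on_C_diff[OF C_diff_const[OF openin_topspace] E]) (auto simp: smooth_form_def)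
    then show "smooth_fun_on (mdim M) (snd C ` fst C) (\<lambda>y. - form_coeff M \<omega> C i j y)" by simp
  qed
  moreover have "closed_form M (\<lambda>x v w. - \<omega> x v w)"
    unfolding closed_form_def fc
  proof (intro ballI allI impI)
    fix C y i j k assume C: "C \<in> atlas M" and y: "y \<in> snd C ` fst C" and ijk: "i < mdim M" "j < mdim M" "k < mdim M"
    have "partial_deriv l (\<lambda>y. - form_coeff M \<omega> C a b y) y = - partial_deriv l (form_coeff M \<omega> C a b) y"
      if "l < mdim M" "a < mdim M" "b < mdim M" for l a b
    proof -
      \<comment> \<open>Smoothness provides the differentiability with which the sign is pulled out
        of \<open>partial_deriv\<close>.\<close>
      have "smooth_fun_on (mdim M) (snd C ` fst C) (form_coeff M \<omega> C a b)"
        using s C that by (simp add: smooth_form_def)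
      then have "C_diff (mdim M) (Suc 0) (snd C ` fst C) (form_coeff M \<omega> C a b)"
        unfolding smooth_fun_on_open[OF chart_open(2)[OF atlas_chart[OF M C]]] by (rule spec)
      from DERIV_minus[OF C_diff_DERIV[OF this that(1) y]] show ?thesis
        by (rule partial_derivI)
    qed
    moreover have "partial_deriv i (form_coeff M \<omega> C j k) y + partial_deriv j (form_coeff M \<omega> C k i) y
        + partial_deriv k (form_coeff M \<omega> C i j) y = 0"
      by (rule cl[unfolded closed_form_def, rule_format, OF C y ijk])
    ultimately show "partial_deriv i (\<lambda>y. - form_coeff M \<omega> C j k y) y + partial_deriv j (\<lambda>y. - form_coeff M \<omega> C k i y) y
        + partial_deriv k (\<lambda>y. - form_coeff M \<omega> C i j y) y = 0"
      using ijk by simp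
  qed
  ultimately show ?thesis using S by (simp add: symplectic_manifold_def)
qed

section \<open>Transport along an injective map\<close>

definition transport_chart :: "('a \<Rightarrow> 'c) \<Rightarrow> 'a manifold \<Rightarrow> 'a chart \<Rightarrow> 'c chart" where
  "transport_chart e M C = (e ` fst C, \<lambda>z. snd C (inv_into (points M) e z))"

definition transport :: "('a \<Rightarrow> 'c) \<Rightarrow> 'a manifold \<Rightarrow> 'c manifold" where
  "transport e M = \<lparr>mtop = pullback_topology (e ` points M) (inv_into (points M) e) (mtop M),
     mdim = mdim M, atlas = transport_chart e M ` atlas M\<rparr>"

text \<open>Pullback along the inverse map. Its differential has to be inserted, because the chart
  that \<open>chart_at\<close> selects in the copy need not come from the chart selected in
  \<open>M\<close>.\<close>

definition transport_form :: "('a \<Rightarrow> 'c) \<Rightarrow> 'a manifold \<Rightarrow> 'a two_form \<Rightarrow> 'c two_form" where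
  "transport_form e M \<omega> = (\<lambda>z v w. \<omega> (inv_into (points M) e z)
     (differential (transport e M) M (inv_into (points M) e) z v)
     (differential (transport e M) M (inv_into (points M) e) z w))"

context
  fixes e :: "'a \<Rightarrow> 'c" and M :: "'a manifold"
  assumes e: "inj_on e (points M)"
begin

abbreviation (input) "e_inv \<equiv> inv_into (points M) e"

lemma e_inv_left: "x \<in> points M \<Longrightarrow> e_inv (e x) = x"
  by (rule inv_into_f_f[OF e])

lemma transport_simps:
  "mdim (transport e M) = mdim M" "atlas (transport e M) = transport_chart e M ` atlas M"
  by (simp_all add: transport_def)

lemma openin_transport: "openin (mtop (transport e M)) S \<longleftrightarrow> (\<exists>U. openin (mtop M) U \<and> S = e ` U)"
proof -
  have "e_inv -` U \<inter> e ` points M = e ` U" if "openin (mtop M) U" for U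
    using openin_subset[OF that] by (auto simp: e_inv_left image_iff)
  then show ?thesis by (simp add: transport_def openin_pullback_topology cong: conj_cong)
qed

lemma points_transport: "points (transport e M) = e ` points M"
  by (auto simp: transport_def topspace_pullback_topology e_inv_left)

lemma transport_homeomorphic_maps: "homeomorphic_maps (mtop M) (mtop (transport e M)) e e_inv"
  unfolding homeomorphic_maps_def continuous_map_def
proof (intro conjI ballI allI impI)
  show "e \<in> points M \<rightarrow> points (transport e M)" by (auto simp: points_transport)
  show "e_inv \<in> points (transport e M) \<rightarrow> points M" by (auto simp: points_transport e_inv_left)
  fix S assume "openin (mtop (transport e M)) S"
  then obtain U where U: "openin (mtop M) U" "S = e ` U" by (auto simp: openin_transport)
  have "{x \<in> points M. e x \<in> S} = U"
    using openin_subset[OF U(1)] by (auto simp: U(2) dest: inj_onD[OF e])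
  then show "openin (mtop M) {x \<in> points M. e x \<in> S}" using U by simp
next
  fix U assume U: "openin (mtop M) U"
  have "{z \<in> points (transport e M). e_inv z \<in> U} = e ` U"
    using openin_subset[OF U] by (auto simp: points_transport e_inv_left)
  then show "openin (mtop (transport e M)) {z \<in> points (transport e M). e_inv z \<in> U}"
    using U by (auto simp: openin_transport)
qed (auto simp: points_transport e_inv_left)

lemma transport_chart_image:
  "A \<subseteq> points M \<Longrightarrow> snd (transport_chart e M C) ` (e ` A) = snd C ` A"
  by (auto simp: transport_chart_def image_image e_inv_left subset_iff)

context
  assumes M: "smooth_atlas M"
begin

lemma chart_sub_points: "C \<in> atlas M \<Longrightarrow> fst C \<subseteq> points M"
  using openin_subset[OF chart_open(1)[OF atlas_chart[OF M]]] by blast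

lemma transport_chart_range: "C \<in> atlas M \<Longrightarrow> snd (transport_chart e M C) ` fst (transport_chart e M C) = snd C ` fst C"
  using transport_chart_image[OF chart_sub_points] by (simp add: transport_chart_def)

lemma topological_transport_chart:
  assumes C: "C \<in> atlas M"
  shows "topological_chart (mtop (transport e M)) (mdim M) (transport_chart e M C)"
proof (rule topological_chartI)
  note tC = atlas_chart[OF M C]
  let ?K = "transport_chart e M C"
  have h: "continuous_map (mtop M) (mtop (transport e M)) e" "continuous_map (mtop (transport e M)) (mtop M) e_inv"
    using transport_homeomorphic_maps by (auto simp: homeomorphic_maps_def)
  show "openin (mtop (transport e M)) (fst ?K)"
    using chart_open(1)[OF tC] by (auto simp: openin_transport transport_chart_def)
  show "openin (Euclidean_space (mdim M)) (snd ?K ` fst ?K)"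
    using chart_open(2)[OF tC] by (simp add: transport_chart_range[OF C])
  have "continuous_map (subtopology (mtop (transport e M)) (fst ?K)) (subtopology (mtop M) (fst C)) e_inv"
    unfolding continuous_map_in_subtopology
    using continuous_map_from_subtopology[OF h(2)] chart_sub_points[OF C]
    by (auto simp: transport_chart_def e_inv_left subset_iff)
  from continuous_map_compose[OF this chart_continuous[OF tC]]
  show "continuous_map (subtopology (mtop (transport e M)) (fst ?K)) (Euclidean_space (mdim M)) (snd ?K)"
    by (simp add: transport_chart_def o_def)
  show "continuous_map (subtopology (Euclidean_space (mdim M)) (snd ?K ` fst ?K)) (mtop (transport e M)) (\<lambda>y. e (chart_inv C y))"
    using continuous_map_compose[OF chart_inv_continuous[OF tC] h(1)] by (simp add: transport_chart_range[OF C] o_def)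
  show "e (chart_inv C (snd ?K z)) = z" if "z \<in> fst ?K" for z
    using that chart_sub_points[OF C] by (auto simp: transport_chart_def e_inv_left subset_iff chart_inv_left[OF tC])
qed

lemma chart_inv_transport:
  assumes C: "C \<in> atlas M" and y: "y \<in> snd C ` fst C"
  shows "chart_inv (transport_chart e M C) y = e (chart_inv C y)"
proof -
  note tC = atlas_chart[OF M C]
  obtain x where x: "x \<in> fst C" "y = snd C x" using y by auto
  show ?thesis
    using x chart_sub_points[OF C]
    by (intro chart_inv_eqI[OF chart_inj[OF topological_transport_chart[OF C]]])
      (auto simp: transport_chart_def chart_inv_left[OF tC] e_inv_left subset_iff)
qed

text \<open>In transported charts, the copy's transitions and the coordinate expressions of
  \<open>e\<close> and of its inverse all reduce to transitions of the original atlas.\<close>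

lemma transport_coordinates:
  assumes C: "C \<in> atlas M" and D: "D \<in> atlas M" and j: "j < mdim M" and A: "A \<subseteq> fst C \<inter> fst D"
    and eq: "\<And>x. x \<in> A \<Longrightarrow> F (snd C x) = snd D x j"
  shows "smooth_fun_on (mdim M) (snd C ` A) F"
proof -
  note tC = atlas_chart[OF M C]
  have "smooth_fun_on (mdim M) (snd C ` A) (\<lambda>y. snd D (chart_inv C y) j)"
    using A by (intro smooth_fun_on_subset[OF smooth_transitionD[OF atlas_transition[OF M C D] j]]) auto
  then show ?thesis
    by (rule smooth_fun_on_cong) (use A eq in \<open>auto simp: chart_inv_left[OF tC] subset_iff\<close>)
qed

lemma smooth_atlas_transport: "smooth_atlas (transport e M)"
  unfolding smooth_atlas_def
proof (intro conjI ballI)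
  fix K assume "K \<in> atlas (transport e M)"
  then obtain C where C: "C \<in> atlas M" "K = transport_chart e M C" by (auto simp: transport_simps)
  note tC = atlas_chart[OF M C(1)]
  show "topological_chart (mtop (transport e M)) (mdim (transport e M)) K"
    using topological_transport_chart[OF C(1)] C(2) by (simp add: transport_simps)
  fix K' assume "K' \<in> atlas (transport e M)"
  then obtain D where D: "D \<in> atlas M" "K' = transport_chart e M D" by (auto simp: transport_simps)
  have int: "fst K \<inter> fst K' = e ` (fst C \<inter> fst D)"
    using C D e chart_sub_points by (simp add: transport_chart_def inj_on_image_Int)
  have im: "snd K ` (fst K \<inter> fst K') = snd C ` (fst C \<inter> fst D)"
    unfolding int unfolding C(2) by (rule transport_chart_image) (use chart_sub_points[OF C(1)] in auto)
  show "smooth_transition (mdim (transport e M)) K K'"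
    unfolding smooth_transition_def smooth_vec_on_def im unfolding transport_simps
  proof (intro allI impI)
    fix j assume j: "j < mdim M"
    show "smooth_fun_on (mdim M) (snd C ` (fst C \<inter> fst D)) (\<lambda>x. (snd K' \<circ> chart_inv K) x j)"
    proof (rule transport_coordinates[OF C(1) D(1) j subset_refl])
      fix x assume "x \<in> fst C \<inter> fst D"
      then show "(snd K' \<circ> chart_inv K) (snd C x) j = snd D x j"
        using chart_inv_transport[OF C(1), of "snd C x"] chart_sub_points[OF C(1)] C(2) D(2)
        by (auto simp: chart_inv_left[OF tC] transport_chart_def e_inv_left subset_iff)
    qed
  qed
next
  have "(\<Union>K\<in>atlas (transport e M). fst K) = e ` (\<Union>C\<in>atlas M. fst C)"
    by (auto simp: transport_simps transport_chart_def)
  then show "(\<Union>K\<in>atlas (transport e M). fst K) = points (transport e M)"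
    using M by (simp add: smooth_atlas_def points_transport)
qed

lemma smooth_transport: "A \<subseteq> points M \<Longrightarrow> smooth_map_on M A (transport e M) e"
  unfolding smooth_map_on_def smooth_vec_on_def
proof (intro conjI ballI allI impI)
  assume A: "A \<subseteq> points M"
  show "continuous_map (subtopology (mtop M) A) (mtop (transport e M)) e"
    using transport_homeomorphic_maps by (auto simp: homeomorphic_maps_def intro: continuous_map_from_subtopology)
  fix C K j assume C: "C \<in> atlas M" and "K \<in> atlas (transport e M)" and "j < mdim (transport e M)"
  then obtain D where D: "D \<in> atlas M" "K = transport_chart e M D" and j: "j < mdim M" by (auto simp: transport_simps)
  have sub: "A \<inter> fst C \<inter> e -` fst K \<subseteq> fst C \<inter> fst D"
    using A D chart_sub_points[OF D(1)] e by (auto simp: transport_chart_def dest: inj_onD)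
  then show "smooth_fun_on (mdim M) (snd C ` (A \<inter> fst C \<inter> e -` fst K)) (\<lambda>x. (snd K \<circ> e \<circ> chart_inv C) x j)"
  proof (rule transport_coordinates[OF C D(1) j])
    fix x assume "x \<in> A \<inter> fst C \<inter> e -` fst K"
    then show "(snd K \<circ> e \<circ> chart_inv C) (snd C x) j = snd D x j"
      using A D by (auto simp: chart_inv_left[OF atlas_chart[OF M C]] transport_chart_def e_inv_left subset_iff)
  qed
qed

lemma smooth_transport_inv: "smooth_map_on (transport e M) A M e_inv"
  unfolding smooth_map_on_def smooth_vec_on_def
proof (intro conjI ballI allI impI)
  show "continuous_map (subtopology (mtop (transport e M)) A) (mtop M) e_inv"
    using transport_homeomorphic_maps by (auto simp: homeomorphic_maps_def intro: continuous_map_from_subtopology)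
  fix K D j assume "K \<in> atlas (transport e M)" and D: "D \<in> atlas M" and j: "j < mdim M"
  then obtain C where C: "C \<in> atlas M" "K = transport_chart e M C" by (auto simp: transport_simps)
  let ?A = "{x \<in> fst C \<inter> fst D. e x \<in> A}"
  have im: "A \<inter> fst K \<inter> e_inv -` fst D = e ` ?A"
    using C chart_sub_points[OF C(1)] by (auto simp: transport_chart_def e_inv_left subset_iff)
  have "snd K ` (A \<inter> fst K \<inter> e_inv -` fst D) = snd C ` ?A"
    unfolding im unfolding C(2) by (rule transport_chart_image) (use chart_sub_points[OF C(1)] in auto)
  moreover have "smooth_fun_on (mdim M) (snd C ` ?A) (\<lambda>x. (snd D \<circ> e_inv \<circ> chart_inv K) x j)"
  proof (rule transport_coordinates[OF C(1) D j])
    show "?A \<subseteq> fst C \<inter> fst D" by auto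
    fix x assume "x \<in> ?A"
    then show "(snd D \<circ> e_inv \<circ> chart_inv K) (snd C x) j = snd D x j"
      using chart_inv_transport[OF C(1), of "snd C x"] chart_sub_points[OF C(1)] C(2)
      by (auto simp: chart_inv_left[OF atlas_chart[OF M C(1)]] e_inv_left subset_iff)
  qed
  ultimately show "smooth_fun_on (mdim (transport e M)) (snd K ` (A \<inter> fst K \<inter> e_inv -` fst D))
      (\<lambda>x. (snd D \<circ> e_inv \<circ> chart_inv K) x j)" by (simp add: transport_simps)
qed

end

lemma smooth_manifold_transport:
  assumes "smooth_manifold M"
  shows "smooth_manifold (transport e M)"
proof -
  have "mtop M homeomorphic_space mtop (transport e M)"
    using transport_homeomorphic_maps by (auto simp: homeomorphic_space_def)
  then show ?thesis
    using assms smooth_atlas_transport homeomorphic_Hausdorff_space homeomorphic_space_second_countability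
    by (auto simp: smooth_manifold_iff)
qed

lemma symplectic_manifold_transport:
  assumes S: "symplectic_manifold M \<omega>"
  shows "symplectic_manifold (transport e M) (transport_form e M \<omega>)"
proof -
  let ?T = "transport e M" and ?\<tau> = "transport_form e M \<omega>"
  have M: "smooth_atlas M" and \<omega>: "alternating_bilinear M \<omega>" and nd: "nondegenerate_form M \<omega>"
    and s: "smooth_form M \<omega>" and cl: "closed_form M \<omega>" and sm: "smooth_manifold M"
    using S by (auto simp: symplectic_manifold_def smooth_manifold_iff)
  note T = smooth_atlas_transport[OF M]
  have inv_in: "e_inv z \<in> points M" if "z \<in> points ?T" for z
    using that by (auto simp: points_transport e_inv_left)
  \<comment> \<open>A transported chart shows the same coefficients as the original chart, so
    smoothness and closedness carry over unchanged.\<close>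
  have fc: "form_coeff ?T ?\<tau> (transport_chart e M C) i j y = form_coeff M \<omega> C i j y"
    if C: "C \<in> atlas M" and y: "y \<in> snd C ` fst C" and ij: "i < mdim M" "j < mdim M" for C i j y
  proof -
    note tC = atlas_chart[OF M C]
    have K: "transport_chart e M C \<in> atlas ?T" using C by (simp add: transport_simps)
    have inv: "e_inv (chart_inv (transport_chart e M C) z) = chart_inv C z" if "z \<in> snd C ` fst C" for z
      using chart_in_points[OF tC chart_inv_into[OF tC that]] by (simp add: chart_inv_transport[OF M C that] e_inv_left)
    have "differential ?T M e_inv (chart_inv (transport_chart e M C) y) (coord_vec ?T (transport_chart e M C) i y)
        = coord_vec M C i y" if i: "i < mdim M" for i
    proof -
      have "differential ?T M e_inv (chart_inv (transport_chart e M C) y) (coord_vec ?T (transport_chart e M C) i y)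
        = differential (vec_manifold (mdim M)) M (\<lambda>z. e_inv (chart_inv (transport_chart e M C) z)) y (unit_vec i)"
        using differential_coord_vec[OF T M smooth_transport_inv[OF M] K, of y i] i y
        by (simp add: transport_simps transport_chart_range[OF M C])
      also have "\<dots> = differential (vec_manifold (mdim M)) M (chart_inv C) y (unit_vec i)"
        using i inv chart_open(2)[OF tC]
        by (intro differential_cong[OF smooth_atlas_vec_manifold M maximal_atlasD(3)[OF M atlas_maximal[OF M C]] _ _ y])
          (auto simp: unit_vec_Espace)
      finally show ?thesis by (simp add: coord_vec_eq)
    qed
    then show ?thesis using ij by (simp add: form_coeff_def transport_form_def inv[OF y])
  qed
  have "alternating_bilinear ?T ?\<tau>"
    unfolding alternating_bilinear_def
  proof (intro ballI allI conjI)
    fix x u v w a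
    assume x: "x \<in> points ?T"
    note x' = inv_in[OF x]
    show "?\<tau> x (\<lambda>i. a * u i + v i) w = a * ?\<tau> x u w + ?\<tau> x v w"
      by (simp add: transport_form_def differential_linear form_linear[OF \<omega> x'] differential_tangent)
    show "?\<tau> x v w = - ?\<tau> x w v"
      using form_antisym[OF \<omega> x' differential_tangent differential_tangent] by (simp add: transport_form_def)
  qed
  moreover have "nondegenerate_form ?T ?\<tau>"
    unfolding nondegenerate_form_def tangent_space_def
  proof (intro ballI impI)
    fix x v assume x: "x \<in> points ?T" and v: "v \<in> Espace (mdim ?T)" and 0: "\<forall>w\<in>Espace (mdim ?T). ?\<tau> x v w = 0"
    note x' = inv_in[OF x]
    have ex: "e (e_inv x) = x" using x by (auto simp: points_transport e_inv_left)
    have es: "smooth_map_on M (points M) ?T e" by (rule smooth_transport[OF M subset_refl])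
    \<comment> \<open>The differentials of \<open>e\<close> and of its inverse are inverse to each
      other by the chain rule; thus test vectors, and with them nondegeneracy, pass between the two
      tangent spaces.\<close>
    have 1: "differential ?T M e_inv x (differential M ?T e (e_inv x) a) = a" if a: "a \<in> Espace (mdim M)" for a
    proof -
      have "differential ?T M e_inv (e (e_inv x)) (differential M ?T e (e_inv x) a) = differential M M (\<lambda>x. e_inv (e x)) (e_inv x) a"
        using x' by (intro differential_chain[symmetric, OF M T M es openin_topspace smooth_transport_inv[OF M] openin_topspace _ _ a])
          (auto simp: points_transport)
      also have "\<dots> = differential M M (\<lambda>x. x) (e_inv x) a"
        by (intro differential_cong[OF M M smooth_map_on_id[OF M] openin_topspace _ x' a]) (simp add: e_inv_left)
      finally show ?thesis using differential_id[OF M x' a] ex by simp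
    qed
    have 2: "differential M ?T e (e_inv x) (differential ?T M e_inv x v) = v"
    proof -
      have "differential M ?T e (e_inv x) (differential ?T M e_inv x v) = differential ?T ?T (\<lambda>x. e (e_inv x)) x v"
        using x inv_in by (intro differential_chain[symmetric, OF T M T smooth_transport_inv[OF M] openin_topspace es openin_topspace _ _ v]) auto
      also have "\<dots> = differential ?T ?T (\<lambda>x. x) x v"
        by (intro differential_cong[OF T T smooth_map_on_id[OF T] openin_topspace _ x v]) (auto simp: points_transport e_inv_left)
      finally show ?thesis using differential_id[OF T x v] by simp
    qed
    have "\<omega> (e_inv x) (differential ?T M e_inv x v) a = 0" if a: "a \<in> Espace (mdim M)" for a
      using bspec[OF 0 differential_tangent, of M e "e_inv x" a] 1[OF a] by (simp add: transport_form_def)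
    then have "differential ?T M e_inv x v = (\<lambda>_. 0)"
      using nd x' differential_tangent[of ?T M] unfolding nondegenerate_form_def tangent_space_def by blast
    then show "v = (\<lambda>_. 0)" using 2 by simp
  qed
  moreover have "smooth_form ?T ?\<tau>"
    unfolding smooth_form_def
  proof (intro ballI allI impI)
    fix K i j assume "K \<in> atlas ?T" "i < mdim ?T" "j < mdim ?T"
    then obtain C where C: "C \<in> atlas M" "K = transport_chart e M C" and ij: "i < mdim M" "j < mdim M" by (auto simp: transport_simps)
    have "smooth_fun_on (mdim M) (snd C ` fst C) (form_coeff M \<omega> C i j)" using s C ij by (simp add: smooth_form_def)
    then have "smooth_fun_on (mdim M) (snd C ` fst C) (form_coeff ?T ?\<tau> K i j)"
      by (rule smooth_fun_on_cong) (simp add: C(2) fc[OF C(1) _ ij])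
    then show "smooth_fun_on (mdim ?T) (snd K ` fst K) (form_coeff ?T ?\<tau> K i j)"
      by (simp add: C(2) transport_chart_range[OF M C(1)] transport_simps)
  qed
  moreover have "closed_form ?T ?\<tau>"
    unfolding closed_form_def
  proof (intro ballI allI impI)
    fix K y i j k assume "K \<in> atlas ?T" and y: "y \<in> snd K ` fst K" and "i < mdim ?T" "j < mdim ?T" "k < mdim ?T"
    then obtain C where C: "C \<in> atlas M" "K = transport_chart e M C"
      and ijk: "i < mdim M" "j < mdim M" "k < mdim M" by (auto simp: transport_simps)
    have y: "y \<in> snd C ` fst C" using y by (simp add: C(2) transport_chart_range[OF M C(1)])
    have "partial_deriv l (form_coeff ?T ?\<tau> K a b) y = partial_deriv l (form_coeff M \<omega> C a b) y"
      if "l < mdim M" "a < mdim M" "b < mdim M" for l a b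
      using that by (intro partial_deriv_cong[OF chart_open(2)[OF atlas_chart[OF M C(1)]] y]) (simp_all add: C(2) fc[OF C(1)])
    then show "partial_deriv i (form_coeff ?T ?\<tau> K j k) y + partial_deriv j (form_coeff ?T ?\<tau> K k i) y
        + partial_deriv k (form_coeff ?T ?\<tau> K i j) y = 0"
      using cl[unfolded closed_form_def, rule_format, OF C(1) y ijk] ijk by simp
  qed
  ultimately show ?thesis using smooth_manifold_transport[OF sm] by (simp add: symplectic_manifold_def)
qed

end

text \<open>In a Hausdorff space a point is determined by the members of a countable base that
  contain it. Numbering the base codes the point as a set of natural numbers, and such sets are
  equinumerous with the reals.\<close>

lemma second_countable_Hausdorff_inj_real:
  assumes "second_countable X" "Hausdorff_space X"
  obtains e :: "'a \<Rightarrow> real" where "inj_on e (topspace X)"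
proof -
  obtain B where B: "countable B" "\<And>V. V \<in> B \<Longrightarrow> openin X V" "\<And>U x. openin X U \<Longrightarrow> x \<in> U \<Longrightarrow> \<exists>V\<in>B. x \<in> V \<and> V \<subseteq> U"
    using assms(1) unfolding second_countable_def by metis
  obtain b :: "nat set \<Rightarrow> real" where b: "inj b"
    using nat_sets_eqpoll_reals unfolding eqpoll_def bij_betw_def by blast
  define N where "N x = to_nat_on B ` {V \<in> B. x \<in> V}" for x
  have "inj_on N (topspace X)"
  proof (rule inj_onI, rule ccontr)
    fix x y assume xy: "x \<in> topspace X" "y \<in> topspace X" "N x = N y" "x \<noteq> y"
    then obtain U U' where "openin X U" "x \<in> U" "y \<in> U'" "disjnt U U'"
      using assms(2) unfolding Hausdorff_space_def by metis
    then obtain V where V: "V \<in> B" "x \<in> V" "y \<notin> V"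
      using B(3)[of U x] by (auto simp: disjnt_def)
    have "{V \<in> B. x \<in> V} = {V \<in> B. y \<in> V}"
      using xy(3) inj_on_image_eq_iff[OF inj_on_to_nat_on[OF B(1)], of "{V \<in> B. x \<in> V}" "{V \<in> B. y \<in> V}"]
      by (auto simp: N_def)
    then show False using V by blast
  qed
  then have "inj_on (b \<circ> N) (topspace X)" using b by (auto intro: comp_inj_on inj_on_subset)
  then show ?thesis by (rule that)
qed

section \<open>The point\<close>

text \<open>Its single point is a real number, so that it can serve as first factor in the instance
  of the Lagrangian conjecture for \<open>TYPE(real)\<close>.\<close>

definition point_manifold :: "real manifold" where
  "point_manifold = \<lparr>mtop = discrete_topology {0}, mdim = 0, atlas = {({0}, \<lambda>_ _. 0)}\<rparr>"

lemma Espace_0: "Espace 0 = {\<lambda>_. 0}"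
  by (auto simp: mem_Espace)

lemma point_manifold_simps [simp]:
  "mtop point_manifold = discrete_topology {0}" "mdim point_manifold = 0" "atlas point_manifold = {({0}, \<lambda>_ _. 0)}"
  by (simp_all add: point_manifold_def)

lemma symplectic_point_manifold: "symplectic_manifold point_manifold (\<lambda>_ _ _. 0)"
proof -
  have op: "openin (Euclidean_space 0) {\<lambda>_. 0}" using openin_topspace[of "Euclidean_space 0"] by (simp add: Espace_0)
  have "topological_chart (discrete_topology {0::real}) 0 ({0}, \<lambda>_ _. 0)"
    by (rule topological_chartI[where h = "\<lambda>_. 0"]) (auto simp: op Espace_0)
  then have "smooth_atlas point_manifold"
    by (auto simp: smooth_atlas_def smooth_transition_def smooth_vec_on_def)
  then show ?thesis
    by (auto simp: symplectic_manifold_def smooth_manifold_iff second_countable_discrete_topology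
        alternating_bilinear_def smooth_form_def closed_form_def nondegenerate_form_def tangent_space_def Espace_0)
qed

section \<open>Betti numbers and homeomorphisms\<close>

lemma frag_cmul_uminus: "frag_cmul k (- c) = frag_cmul (- k) c"
  by (rule poly_mapping_eqI) simp

lemma mod2_cyclesD: "c \<in> mod2_cycles p X \<Longrightarrow> singular_chain p X c"
  by (simp add: mod2_cycles_def)

lemma subgroup_mod2_cycles: "subgroup (mod2_cycles p X) (chain_group p X)"
proof
  show "mod2_cycles p X \<subseteq> carrier (chain_group p X)" by (auto simp: mod2_cycles_def)
  show "\<one>\<^bsub>chain_group p X\<^esub> \<in> mod2_cycles p X"
    by (auto simp: mod2_cycles_def intro!: exI[of _ 0])
  fix x assume "x \<in> mod2_cycles p X"
  then obtain e where x: "singular_chain p X x" "singular_chain (p - 1) X e" "chain_boundary p x = frag_cmul 2 e"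
    by (auto simp: mod2_cycles_def)
  have "inv\<^bsub>chain_group p X\<^esub> x = - x" using x(1) by (simp add: singular_chain_def)
  then show "inv\<^bsub>chain_group p X\<^esub> x \<in> mod2_cycles p X"
    using x by (auto simp: mod2_cycles_def singular_chain_minus chain_boundary_minus frag_cmul_uminus intro!: exI[of _ "- e"])
  fix y assume "y \<in> mod2_cycles p X"
  then obtain e' where y: "singular_chain p X y" "singular_chain (p - 1) X e'" "chain_boundary p y = frag_cmul 2 e'"
    by (auto simp: mod2_cycles_def)
  show "x \<otimes>\<^bsub>chain_group p X\<^esub> y \<in> mod2_cycles p X"
    using x y by (auto simp: mod2_cycles_def singular_chain_add chain_boundary_add frag_cmul_distrib2 intro!: exI[of _ "e + e'"])
qed

definition mod2_cycle_group :: "nat \<Rightarrow> 'a topology \<Rightarrow> 'a chain monoid" where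
  "mod2_cycle_group p X = subgroup_generated (chain_group p X) (mod2_cycles p X)"

lemma mod2_cycle_group_simps [simp]:
  "carrier (mod2_cycle_group p X) = mod2_cycles p X"
  "mult (mod2_cycle_group p X) = (+)" "one (mod2_cycle_group p X) = 0"
  by (simp_all add: mod2_cycle_group_def subgroup.carrier_subgroup_generated_subgroup[OF subgroup_mod2_cycles])

lemma comm_group_mod2_cycle_group: "comm_group (mod2_cycle_group p X)"
  unfolding mod2_cycle_group_def
  by (intro group.abelian_subgroup_generated group_chain_group abelian_chain_group)

text \<open>The boundary of a boundary vanishes, and the boundary of \<open>2 e\<close> is twice the
  boundary of \<open>e\<close>.\<close>

lemma mod2_boundaries_subset: "mod2_boundaries p X \<subseteq> mod2_cycles p X"
proof
  fix c assume "c \<in> mod2_boundaries p X"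
  then obtain d e where c: "c = chain_boundary (Suc p) d + frag_cmul 2 e" "singular_chain (Suc p) X d" "singular_chain p X e"
    by (auto simp: mod2_boundaries_def)
  have "chain_boundary p c = frag_cmul 2 (chain_boundary p e)"
    using chain_boundary_boundary_alt[OF c(2)] by (simp add: c(1) chain_boundary_add chain_boundary_cmul)
  moreover have "singular_chain (p - 1) X (chain_boundary p e)"
    using singular_chain_boundary[OF c(3)] by simp
  moreover have "singular_chain p X c"
    using c singular_chain_boundary[OF c(2)] by (simp add: singular_chain_add singular_chain_cmul)
  ultimately show "c \<in> mod2_cycles p X" by (auto simp: mod2_cycles_def)
qed

lemma subgroup_mod2_boundaries: "subgroup (mod2_boundaries p X) (mod2_cycle_group p X)"
proof -
  interpret comm_group "mod2_cycle_group p X" by (rule comm_group_mod2_cycle_group)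
  show ?thesis
  proof (rule subgroupI)
    show "mod2_boundaries p X \<subseteq> carrier (mod2_cycle_group p X)" using mod2_boundaries_subset by simp
    have "0 \<in> mod2_boundaries p X"
      unfolding mod2_boundaries_def by (intro CollectI exI[of _ 0]) simp
    then show "mod2_boundaries p X \<noteq> {}" by blast
    fix x assume x: "x \<in> mod2_boundaries p X"
    then obtain d e where c: "x = chain_boundary (Suc p) d + frag_cmul 2 e" "singular_chain (Suc p) X d" "singular_chain p X e"
      by (auto simp: mod2_boundaries_def)
    have "- x = chain_boundary (Suc p) (- d) + frag_cmul 2 (- e)"
      by (simp add: c(1) chain_boundary_minus frag_cmul_uminus)
    then have mx: "- x \<in> mod2_boundaries p X"
      using c singular_chain_minus unfolding mod2_boundaries_def by blast
    then have "inv\<^bsub>mod2_cycle_group p X\<^esub> x = - x"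
      using x mod2_boundaries_subset by (intro inv_equality) auto
    then show "inv\<^bsub>mod2_cycle_group p X\<^esub> x \<in> mod2_boundaries p X" using mx by simp
    fix y assume "y \<in> mod2_boundaries p X"
    then obtain d' e' where c': "y = chain_boundary (Suc p) d' + frag_cmul 2 e'" "singular_chain (Suc p) X d'" "singular_chain p X e'"
      by (auto simp: mod2_boundaries_def)
    have "x + y = chain_boundary (Suc p) (d + d') + frag_cmul 2 (e + e')"
      by (simp add: c(1) c'(1) chain_boundary_add frag_cmul_distrib2)
    moreover have "singular_chain (Suc p) X (d + d')" "singular_chain p X (e + e')"
      using c c' by (auto intro: singular_chain_add)
    ultimately have "x + y \<in> mod2_boundaries p X"
      unfolding mod2_boundaries_def by blast
    then show "x \<otimes>\<^bsub>mod2_cycle_group p X\<^esub> y \<in> mod2_boundaries p X" by simp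
  qed
qed

lemma mod2_homology_group_eq: "mod2_homology_group p X = mod2_cycle_group p X Mod mod2_boundaries p X"
  by (simp add: mod2_homology_group_def mod2_cycle_group_def)

lemma group_mod2_homology_group: "group (mod2_homology_group p X)"
  unfolding mod2_homology_group_eq
  by (intro normal.factorgroup_is_group comm_group.subgroup_imp_normal comm_group_mod2_cycle_group subgroup_mod2_boundaries)

lemma carrier_mod2_homology_group:
  "carrier (mod2_homology_group p X) = (\<lambda>c. (\<lambda>b. b + c) ` mod2_boundaries p X) ` mod2_cycles p X"
  by (auto simp: mod2_homology_group_eq FactGroup_def RCOSETS_def r_coset_def)

lemma mult_mod2_homology_group: "S \<otimes>\<^bsub>mod2_homology_group p X\<^esub> T = (\<Union>a\<in>S. \<Union>b\<in>T. {a + b})"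
  by (simp add: mod2_homology_group_eq FactGroup_def set_mult_def)

context
  fixes X :: "'a topology" and Y :: "'b topology" and f g
  assumes fg: "homeomorphic_maps X Y f g"
begin

lemma chain_map_inverse: "singular_chain p X c \<Longrightarrow> chain_map p g (chain_map p f c) = c"
  using chain_map_id_gen[of p X c "g \<circ> f"] fg
  by (simp add: chain_map_compose homeomorphic_maps_def)

lemma chain_map_mod2_cycles: "c \<in> mod2_cycles p X \<Longrightarrow> chain_map p f c \<in> mod2_cycles p Y"
proof -
  assume "c \<in> mod2_cycles p X"
  then obtain e where c: "singular_chain p X c" "singular_chain (p - 1) X e" "chain_boundary p c = frag_cmul 2 e"
    by (auto simp: mod2_cycles_def)
  have f: "continuous_map X Y f" using fg by (simp add: homeomorphic_maps_def)
  have "chain_boundary p (chain_map p f c) = frag_cmul 2 (chain_map (p - 1) f e)"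
    using chain_boundary_chain_map[OF c(1), of f] c(3) by simp
  then show ?thesis
    using singular_chain_chain_map[OF c(1) f] singular_chain_chain_map[OF c(2) f] by (auto simp: mod2_cycles_def)
qed

lemma chain_map_mod2_boundaries: "c \<in> mod2_boundaries p X \<Longrightarrow> chain_map p f c \<in> mod2_boundaries p Y"
proof -
  assume "c \<in> mod2_boundaries p X"
  then obtain d e where c: "c = chain_boundary (Suc p) d + frag_cmul 2 e" "singular_chain (Suc p) X d" "singular_chain p X e"
    by (auto simp: mod2_boundaries_def)
  have f: "continuous_map X Y f" using fg by (simp add: homeomorphic_maps_def)
  have "chain_map p f c = chain_boundary (Suc p) (chain_map (Suc p) f d) + frag_cmul 2 (chain_map p f e)"
    using chain_boundary_chain_map[OF c(2), of f] by (simp add: c(1) chain_map_add)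
  then show ?thesis
    using singular_chain_chain_map[OF c(2) f] singular_chain_chain_map[OF c(3) f]
    unfolding mod2_boundaries_def by blast
qed

end

lemma chain_map_mod2_boundaries_image:
  assumes fg: "homeomorphic_maps X Y f g"
  shows "chain_map p f ` mod2_boundaries p X = mod2_boundaries p Y"
proof (intro equalityI subsetI)
  have gf: "homeomorphic_maps Y X g f" by (subst homeomorphic_maps_sym) (rule fg)
  fix c assume c: "c \<in> mod2_boundaries p Y"
  then have "singular_chain p Y c" using mod2_boundaries_subset mod2_cyclesD by blast
  then have "chain_map p f (chain_map p g c) = c" by (rule chain_map_inverse[OF gf])
  then show "c \<in> chain_map p f ` mod2_boundaries p X"
    using chain_map_mod2_boundaries[OF gf c] by (intro image_eqI[of c]) (rule sym)
qed (use chain_map_mod2_boundaries[OF fg] in auto)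

text \<open>The induced homomorphism on homology is onto, so it carries a spanning set to a spanning
  set that is no larger. It is applied from the graph to \<open>N\<close>, the direction in which
  the final estimate runs.\<close>

lemma mod2_betti_le:
  assumes fg: "homeomorphic_maps X Y f g"
  shows "mod2_betti p Y \<le> mod2_betti p X"
proof -
  let ?G = "mod2_homology_group p X" and ?H = "mod2_homology_group p Y" and ?\<Phi> = "(`) (chain_map p f)"
  have gf: "homeomorphic_maps Y X g f" by (subst homeomorphic_maps_sym) (rule fg)
  \<comment> \<open>Taking images of cosets is well behaved because the boundaries of
    \<open>X\<close> are mapped onto those of \<open>Y\<close>.\<close>
  have coset: "?\<Phi> ((\<lambda>b. b + c) ` mod2_boundaries p X) = (\<lambda>b. b + chain_map p f c) ` mod2_boundaries p Y" for c
    unfolding chain_map_mod2_boundaries_image[OF fg, symmetric] image_image chain_map_add ..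
  have "?\<Phi> ` carrier ?G = carrier ?H"
  proof (intro equalityI subsetI)
    fix S assume "S \<in> carrier ?H"
    then obtain c where c: "c \<in> mod2_cycles p Y" "S = (\<lambda>b. b + c) ` mod2_boundaries p Y"
      by (auto simp: carrier_mod2_homology_group)
    have "chain_map p f (chain_map p g c) = c" by (rule chain_map_inverse[OF gf mod2_cyclesD[OF c(1)]])
    then have "S = ?\<Phi> ((\<lambda>b. b + chain_map p g c) ` mod2_boundaries p X)" by (simp only: coset c(2))
    then show "S \<in> ?\<Phi> ` carrier ?G"
      using chain_map_mod2_cycles[OF gf c(1)] by (auto simp: carrier_mod2_homology_group)
  next
    fix S assume "S \<in> ?\<Phi> ` carrier ?G"
    then obtain c where c: "c \<in> mod2_cycles p X" "S = (\<lambda>b. b + chain_map p f c) ` mod2_boundaries p Y"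
      unfolding carrier_mod2_homology_group using coset by blast
    then show "S \<in> carrier ?H"
      using chain_map_mod2_cycles[OF fg c(1)] by (auto simp: carrier_mod2_homology_group)
  qed
  moreover have "?\<Phi> (S \<otimes>\<^bsub>?G\<^esub> T) = ?\<Phi> S \<otimes>\<^bsub>?H\<^esub> ?\<Phi> T" for S T
    unfolding mult_mod2_homology_group by (simp add: image_UN chain_map_add)
  ultimately have im: "?\<Phi> ` carrier ?G = carrier ?H" and hom: "?\<Phi> \<in> hom ?G ?H"
    by (auto simp: hom_def)
  interpret group_hom ?G ?H ?\<Phi>
    using hom by (simp add: group_hom_def group_hom_axioms_def group_mod2_homology_group)
  show ?thesis
    unfolding mod2_betti_def
  proof (rule Inf_mono)
    fix b assume "b \<in> {enat (card S) |S. finite S \<and> S \<subseteq> carrier ?G \<and> generate ?G S = carrier ?G}"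
    then obtain S where S: "b = enat (card S)" "finite S" "S \<subseteq> carrier ?G" "generate ?G S = carrier ?G" by blast
    have "generate ?H (?\<Phi> ` S) = carrier ?H"
      using generate_img[OF S(3)] S(4) im by simp
    moreover have "?\<Phi> ` S \<subseteq> carrier ?H" using S(3) im by blast
    moreover have "card (?\<Phi> ` S) \<le> card S" by (rule card_image_le[OF S(2)])
    ultimately show "\<exists>a\<in>{enat (card S) |S. finite S \<and> S \<subseteq> carrier ?H \<and> generate ?H S = carrier ?H}. a \<le> b"
      using S(1,2) by (intro bexI[of _ "enat (card (?\<Phi> ` S))"]) auto
  qed
qed

section \<open>Leaves and linear holonomy of a product with a Lagrangian factor\<close>

lemma sub_tangentI:
  "smooth_map_on real_line UNIV M c \<Longrightarrow> (\<And>s. c s \<in> N) \<Longrightarrow> velocity M UNIV c 0 \<in> sub_tangent M N (c 0)"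
  unfolding sub_tangent_def by blast

lemma sub_tangentE:
  assumes "v \<in> sub_tangent M N x"
  obtains c where "smooth_map_on real_line UNIV M c" "\<And>s. c s \<in> N" "c 0 = x" "velocity M UNIV c 0 = v"
  using assms unfolding sub_tangent_def by blast

lemma sub_tangent_Espace: "v \<in> sub_tangent M N x \<Longrightarrow> v \<in> Espace (mdim M)"
  unfolding sub_tangent_def using velocity_tangent by blast

lemma zero_sub_tangent: "x \<in> N \<Longrightarrow> x \<in> points M \<Longrightarrow> (\<lambda>_. 0) \<in> sub_tangent M N x"
  using sub_tangentI[of M "\<lambda>s. x" N] smooth_map_on_const[OF smooth_atlas_real_line, of x M UNIV]
  by (simp add: velocity_const)

lemma smooth_path_subset:
  "smooth_map_on real_line UNIV M c \<Longrightarrow> (\<And>s. c s \<in> N) \<Longrightarrow> smooth_path M N c"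
  unfolding smooth_path_def by (auto intro: smooth_map_on_subset)

context
  fixes M :: "'a manifold" and \<omega> x N
  assumes \<omega>: "alternating_bilinear M \<omega>" and x: "x \<in> points M"
    and N: "\<And>w. w \<in> sub_tangent M N x \<Longrightarrow> w \<in> Espace (mdim M)"
begin

lemma symplectic_complement_linear:
  assumes "u \<in> symplectic_complement M \<omega> N x" "v \<in> symplectic_complement M \<omega> N x"
  shows "(\<lambda>i. a * u i + v i) \<in> symplectic_complement M \<omega> N x"
  using assms N form_linear[OF \<omega> x, of u v _ a]
  by (auto simp: symplectic_complement_def tangent_space_def mem_Espace)

lemma symplectic_complement_zero: "(\<lambda>_. 0) \<in> symplectic_complement M \<omega> N x"
  using N form_zero_left[OF \<omega> x] by (simp add: symplectic_complement_def tangent_space_def)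

lemma symplectic_complement_diff:
  "u \<in> symplectic_complement M \<omega> N x \<Longrightarrow> v \<in> symplectic_complement M \<omega> N x \<Longrightarrow>
    (\<lambda>i. u i - v i) \<in> symplectic_complement M \<omega> N x"
  using symplectic_complement_linear[of v u "-1"] by simp

lemma normal_proj_eq_iff:
  "normal_proj M \<omega> N x v = normal_proj M \<omega> N x w \<longleftrightarrow> (\<lambda>i. v i - w i) \<in> symplectic_complement M \<omega> N x"
    (is "?L \<longleftrightarrow> ?R")
proof
  assume ?L
  have "v \<in> normal_proj M \<omega> N x v"
    using symplectic_complement_zero unfolding normal_proj_def by force
  then have "v \<in> normal_proj M \<omega> N x w" using \<open>?L\<close> by simp
  then obtain z where "v = (\<lambda>i. w i + z i)" "z \<in> symplectic_complement M \<omega> N x"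
    by (auto simp: normal_proj_def)
  then show ?R by simp
next
  assume R: ?R
  have *: "normal_proj M \<omega> N x v \<subseteq> normal_proj M \<omega> N x w"
    if "(\<lambda>i. v i - w i) \<in> symplectic_complement M \<omega> N x" for v w
  proof
    fix y assume "y \<in> normal_proj M \<omega> N x v"
    then obtain z where z: "y = (\<lambda>i. v i + z i)" "z \<in> symplectic_complement M \<omega> N x"
      by (auto simp: normal_proj_def)
    have "(\<lambda>i. 1 * (v i - w i) + z i) \<in> symplectic_complement M \<omega> N x"
      by (rule symplectic_complement_linear[OF that z(2)])
    moreover have "y = (\<lambda>i. w i + (1 * (v i - w i) + z i))" by (simp add: z(1))
    ultimately show "y \<in> normal_proj M \<omega> N x w"
      unfolding normal_proj_def by (intro CollectI exI[of _ "\<lambda>i. 1 * (v i - w i) + z i"] conjI)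
  qed
  have "(\<lambda>i. w i - v i) \<in> symplectic_complement M \<omega> N x"
    using symplectic_complement_diff[OF symplectic_complement_zero R] by simp
  then show ?L using *[OF R] *[of w v] by blast
qed

end

locale lagrangian_factor =
  fixes M\<^sub>1 :: "'a manifold" and \<omega>\<^sub>1 and M\<^sub>2 :: "'b manifold" and \<omega>\<^sub>2 and k L
  assumes symplectic1: "symplectic_manifold M\<^sub>1 \<omega>\<^sub>1" and symplectic2: "symplectic_manifold M\<^sub>2 \<omega>\<^sub>2"
    and lagrangian_L: "lagrangian_submanifold M\<^sub>2 \<omega>\<^sub>2 k L"
begin

abbreviation "M \<equiv> prod_manifold M\<^sub>1 M\<^sub>2"
abbreviation "\<Omega> \<equiv> prod_form M\<^sub>1 \<omega>\<^sub>1 M\<^sub>2 \<omega>\<^sub>2"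
abbreviation "N \<equiv> points M\<^sub>1 \<times> L"
abbreviation "dfst \<equiv> differential M M\<^sub>1 fst"
abbreviation "dsnd \<equiv> differential M M\<^sub>2 snd"

lemma atlas1: "smooth_atlas M\<^sub>1" and atlas2: "smooth_atlas M\<^sub>2"
  using symplectic1 symplectic2 by (auto simp: symplectic_manifold_def smooth_manifold_iff)

lemma form1: "alternating_bilinear M\<^sub>1 \<omega>\<^sub>1" and form2: "alternating_bilinear M\<^sub>2 \<omega>\<^sub>2"
  using symplectic1 symplectic2 by (auto simp: symplectic_manifold_def)

lemma atlas_M: "smooth_atlas M"
  by (rule smooth_atlas_prod[OF atlas1 atlas2])

lemma symplectic_M: "symplectic_manifold M \<Omega>"
  by (rule symplectic_manifold_prod[OF symplectic1 symplectic2])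

lemma form_M: "alternating_bilinear M \<Omega>"
  using symplectic_M by (simp add: symplectic_manifold_def)

lemma nondegenerate1:
  assumes "x \<in> points M\<^sub>1" "v \<in> Espace (mdim M\<^sub>1)" "\<And>w. w \<in> Espace (mdim M\<^sub>1) \<Longrightarrow> \<omega>\<^sub>1 x v w = 0"
  shows "v = (\<lambda>_. 0)"
  using symplectic1 assms unfolding symplectic_manifold_def nondegenerate_form_def tangent_space_def by blast

lemma L_points: "l \<in> L \<Longrightarrow> l \<in> points M\<^sub>2"
  using lagrangian_L by (auto simp: lagrangian_submanifold_def embedded_submanifold_def)

lemma N_points: "p \<in> N \<Longrightarrow> p \<in> points M"
  using L_points by auto

lemma complement_L: "l \<in> L \<Longrightarrow> symplectic_complement M\<^sub>2 \<omega>\<^sub>2 L l = sub_tangent M\<^sub>2 L l"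
  using lagrangian_L by (simp add: lagrangian_submanifold_def)

text \<open>Tangent vectors of a submanifold are defined by curves, which leaves linearity open. For
  a Lagrangian they form a symplectic complement, and that is a linear condition.\<close>

lemma sub_tangent_L_diff:
  assumes l: "l \<in> L" and "u \<in> sub_tangent M\<^sub>2 L l" "v \<in> sub_tangent M\<^sub>2 L l"
  shows "(\<lambda>i. u i - v i) \<in> sub_tangent M\<^sub>2 L l"
  using symplectic_complement_diff[OF form2 L_points[OF l] sub_tangent_Espace, where u = u and v = v and N = L] assms
  by (simp add: complement_L)

lemma zero_sub_tangent_L: "l \<in> L \<Longrightarrow> (\<lambda>_. 0) \<in> sub_tangent M\<^sub>2 L l"
  by (intro zero_sub_tangent L_points)

lemma isotropic_L:
  "l \<in> L \<Longrightarrow> u \<in> sub_tangent M\<^sub>2 L l \<Longrightarrow> v \<in> sub_tangent M\<^sub>2 L l \<Longrightarrow> \<omega>\<^sub>2 l u v = 0"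
  using complement_L by (auto simp: symplectic_complement_def)

lemma coisotropic_L:
  "l \<in> L \<Longrightarrow> u \<in> Espace (mdim M\<^sub>2) \<Longrightarrow> (\<And>v. v \<in> sub_tangent M\<^sub>2 L l \<Longrightarrow> \<omega>\<^sub>2 l u v = 0) \<Longrightarrow>
    u \<in> sub_tangent M\<^sub>2 L l"
  using complement_L by (auto simp: symplectic_complement_def tangent_space_def)

lemma velocity_fst:
  assumes c: "smooth_map_on real_line I M c" and t: "t \<in> I" and nt: "at t within I \<noteq> bot"
  shows "velocity M\<^sub>1 I (\<lambda>s. fst (c s)) t = dfst (c t) (velocity M I c t)"
  using smooth_map_onD_points[OF c t]
  by (intro velocity_chain[OF atlas_M atlas1 c t nt smooth_fst[OF atlas1 atlas2] openin_topspace]) simp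

lemma velocity_snd:
  assumes c: "smooth_map_on real_line I M c" and t: "t \<in> I" and nt: "at t within I \<noteq> bot"
  shows "velocity M\<^sub>2 I (\<lambda>s. snd (c s)) t = dsnd (c t) (velocity M I c t)"
  using smooth_map_onD_points[OF c t]
  by (intro velocity_chain[OF atlas_M atlas2 c t nt smooth_snd[OF atlas1 atlas2] openin_topspace]) simp

lemma smooth_fst_comp: "smooth_atlas K \<Longrightarrow> smooth_map_on K U M c \<Longrightarrow> smooth_map_on K U M\<^sub>1 (\<lambda>s. fst (c s))"
  by (rule smooth_map_on_compose[OF _ atlas_M _ smooth_fst[OF atlas1 atlas2, of UNIV]]) auto

lemma smooth_snd_comp: "smooth_atlas K \<Longrightarrow> smooth_map_on K U M c \<Longrightarrow> smooth_map_on K U M\<^sub>2 (\<lambda>s. snd (c s))"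
  by (rule smooth_map_on_compose[OF _ atlas_M _ smooth_snd[OF atlas1 atlas2, of UNIV]]) auto

lemma tangent_eqI:
  assumes "p \<in> points M" "v \<in> Espace (mdim M)" "w \<in> Espace (mdim M)" "dfst p v = dfst p w" "dsnd p v = dsnd p w"
  shows "v = w"
  using prod_tangent_eqI[OF atlas1 atlas2, of p v w] assms by simp

lemma tangent_exists:
  assumes "p \<in> points M" "a \<in> Espace (mdim M\<^sub>1)" "b \<in> Espace (mdim M\<^sub>2)"
  obtains v where "v \<in> Espace (mdim M)" "dfst p v = a" "dsnd p v = b"
  by (rule prod_tangent_exists[OF atlas1 atlas2 assms]) (rule that, simp)

text \<open>Tangency to \<open>N\<close> constrains the \<open>L\<close> part alone. Conversely, a
  curve in \<open>M\<^sub>1\<close> and a curve in \<open>L\<close> with the two prescribed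
  velocities are paired.\<close>

lemma sub_tangent_N:
  assumes p: "p \<in> N"
  shows "v \<in> sub_tangent M N p \<longleftrightarrow> v \<in> Espace (mdim M) \<and> dsnd p v \<in> sub_tangent M\<^sub>2 L (snd p)"
proof
  assume v: "v \<in> sub_tangent M N p"
  then obtain c where c: "smooth_map_on real_line UNIV M c" "\<And>s. c s \<in> N" "c 0 = p" "velocity M UNIV c 0 = v"
    by (rule sub_tangentE) (rule that)
  have "velocity M\<^sub>2 UNIV (\<lambda>s. snd (c s)) 0 \<in> sub_tangent M\<^sub>2 L (snd (c 0))"
    using c(2) by (intro sub_tangentI smooth_snd_comp[OF smooth_atlas_real_line c(1)]) (auto simp: mem_Times_iff)
  then show "v \<in> Espace (mdim M) \<and> dsnd p v \<in> sub_tangent M\<^sub>2 L (snd p)"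
    using sub_tangent_Espace[OF v] velocity_snd[OF c(1), of 0] c by simp
next
  assume v: "v \<in> Espace (mdim M) \<and> dsnd p v \<in> sub_tangent M\<^sub>2 L (snd p)"
  then have "dsnd p v \<in> sub_tangent M\<^sub>2 L (snd p)" by simp
  then obtain d where d: "smooth_map_on real_line UNIV M\<^sub>2 d" "\<And>s. d s \<in> L" "d 0 = snd p" "velocity M\<^sub>2 UNIV d 0 = dsnd p v"
    by (rule sub_tangentE) (rule that)
  have p1: "fst p \<in> points M\<^sub>1" using p by auto
  obtain c where c: "smooth_map_on real_line UNIV M\<^sub>1 c" "\<And>s. c s \<in> points M\<^sub>1" "c 0 = fst p" "velocity M\<^sub>1 UNIV c 0 = dfst p v"
    by (rule exists_curve[OF atlas1 openin_topspace p1 differential_tangent]) (rule that)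
  have e: "smooth_map_on real_line UNIV M (\<lambda>s. (c s, d s))" by (rule smooth_pair[OF atlas1 atlas2 c(1) d(1)])
  have "velocity M UNIV (\<lambda>s. (c s, d s)) 0 \<in> sub_tangent M N (c 0, d 0)"
    by (rule sub_tangentI[OF e]) (use c d in auto)
  moreover have "velocity M UNIV (\<lambda>s. (c s, d s)) 0 = v"
    using velocity_fst[OF e, of 0] velocity_snd[OF e, of 0] c d v
    by (intro tangent_eqI[OF N_points[OF p] velocity_tangent]) auto
  ultimately show "v \<in> sub_tangent M N p" using c d by simp
qed

text \<open>Nondegeneracy of \<open>\<omega>\<^sub>1\<close> removes the \<open>M\<^sub>1\<close>
  directions, and the Lagrangian \<open>L\<close> keeps its whole tangent space. Tangent vectors
  with one vanishing component separate the two summands of the form.\<close>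

lemma complement_N:
  assumes p: "p \<in> N"
  shows "v \<in> symplectic_complement M \<Omega> N p \<longleftrightarrow>
    v \<in> Espace (mdim M) \<and> dfst p v = (\<lambda>_. 0) \<and> dsnd p v \<in> sub_tangent M\<^sub>2 L (snd p)"
proof
  have p1: "fst p \<in> points M\<^sub>1" and p2: "snd p \<in> L" using p by auto
  assume v: "v \<in> symplectic_complement M \<Omega> N p"
  then have vE: "v \<in> Espace (mdim M)" and v0: "\<And>w. w \<in> sub_tangent M N p \<Longrightarrow> \<Omega> p v w = 0"
    by (auto simp: symplectic_complement_def tangent_space_def)
  have "\<omega>\<^sub>1 (fst p) (dfst p v) a = 0" if a: "a \<in> Espace (mdim M\<^sub>1)" for a
  proof -
    obtain w where w: "w \<in> Espace (mdim M)" "dfst p w = a" "dsnd p w = (\<lambda>_. 0)"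
      by (rule tangent_exists[OF N_points[OF p] a zero_Espace]) (rule that)
    then have "w \<in> sub_tangent M N p" using zero_sub_tangent_L[OF p2] by (simp add: sub_tangent_N[OF p])
    from v0[OF this] show ?thesis
      using w by (simp add: prod_form_def form_zero_right[OF form2 L_points[OF p2] differential_tangent])
  qed
  then have 1: "dfst p v = (\<lambda>_. 0)" by (rule nondegenerate1[OF p1 differential_tangent])
  have "dsnd p v \<in> sub_tangent M\<^sub>2 L (snd p)"
  proof (rule coisotropic_L[OF p2 differential_tangent])
    fix b assume b: "b \<in> sub_tangent M\<^sub>2 L (snd p)"
    obtain w where w: "w \<in> Espace (mdim M)" "dfst p w = (\<lambda>_. 0)" "dsnd p w = b"
      by (rule tangent_exists[OF N_points[OF p] zero_Espace sub_tangent_Espace[OF b]]) (rule that)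
    then have "w \<in> sub_tangent M N p" using b by (simp add: sub_tangent_N[OF p])
    from v0[OF this] show "\<omega>\<^sub>2 (snd p) (dsnd p v) b = 0"
      using w by (simp add: prod_form_def form_zero_right[OF form1 p1 differential_tangent])
  qed
  then show "v \<in> Espace (mdim M) \<and> dfst p v = (\<lambda>_. 0) \<and> dsnd p v \<in> sub_tangent M\<^sub>2 L (snd p)"
    using vE 1 by simp
next
  have p1: "fst p \<in> points M\<^sub>1" and p2: "snd p \<in> L" using p by auto
  assume v: "v \<in> Espace (mdim M) \<and> dfst p v = (\<lambda>_. 0) \<and> dsnd p v \<in> sub_tangent M\<^sub>2 L (snd p)"
  then show "v \<in> symplectic_complement M \<Omega> N p"
    by (auto simp: symplectic_complement_def tangent_space_def sub_tangent_N[OF p] prod_form_def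
        form_zero_left[OF form1 p1 differential_tangent] isotropic_L[OF p2])
qed

text \<open>Two vectors tangent to \<open>N\<close> differ by an isotropic vector as soon as their
  \<open>M\<^sub>1\<close> parts agree, since their \<open>L\<close> parts always differ by a vector
  tangent to \<open>L\<close>. Classes are compared through \<open>dfst\<close> from here
  on.\<close>

lemma normal_proj_N_eq_iff:
  assumes p: "p \<in> N" and v: "v \<in> sub_tangent M N p" and w: "w \<in> sub_tangent M N p"
  shows "normal_proj M \<Omega> N p v = normal_proj M \<Omega> N p w \<longleftrightarrow> dfst p v = dfst p w"
proof -
  have p2: "snd p \<in> L" using p by auto
  have E: "v \<in> Espace (mdim M)" "w \<in> Espace (mdim M)" using sub_tangent_Espace[OF v] sub_tangent_Espace[OF w] by auto
  have "dsnd p (\<lambda>i. v i - w i) \<in> sub_tangent M\<^sub>2 L (snd p)"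
    using v w sub_tangent_L_diff[OF p2] by (simp add: sub_tangent_N[OF p] differential_diff)
  moreover have "(\<lambda>i. v i - w i) \<in> Espace (mdim M)" using E by (simp add: mem_Espace)
  ultimately have "(\<lambda>i. v i - w i) \<in> symplectic_complement M \<Omega> N p \<longleftrightarrow> dfst p (\<lambda>i. v i - w i) = (\<lambda>_. 0)"
    by (simp add: complement_N[OF p])
  moreover have "normal_proj M \<Omega> N p v = normal_proj M \<Omega> N p w \<longleftrightarrow> (\<lambda>i. v i - w i) \<in> symplectic_complement M \<Omega> N p"
    by (rule normal_proj_eq_iff[OF form_M N_points[OF p] sub_tangent_Espace])
  ultimately show ?thesis by (simp add: differential_diff fun_eq_iff)
qed

text \<open>Along an isotropic path the first component has zero velocity.\<close>

lemma isotropic_leaf_N_fst: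
  assumes q: "q \<in> isotropic_leaf M \<Omega> N p"
  shows "fst q = fst p"
proof -
  obtain y where y: "q = y 1" "smooth_path M N y" "y 0 = p"
    "\<forall>t\<in>{0..1}. velocity M {0..1} y t \<in> symplectic_complement M \<Omega> N (y t)"
    using q by (auto simp: isotropic_leaf_def)
  have ys: "smooth_map_on real_line {0..1} M y" and yN: "\<And>t. t \<in> {0..1} \<Longrightarrow> y t \<in> N"
    using y(2) unfolding smooth_path_def by blast+
  have "fst (y 1) = fst (y 0)"
  proof (rule zero_velocity_constant[OF atlas1 smooth_fst_comp[OF smooth_atlas_real_line ys]])
    show "velocity M\<^sub>1 {0..1} (\<lambda>s. fst (y s)) t = (\<lambda>_. 0)" if t: "t \<in> {0..1}" for t
      using bspec[OF y(4) t, unfolded complement_N[OF yN[OF t]]] velocity_fst[OF ys t at_within_unit_interval[OF t]]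
      by simp
  qed simp
  then show ?thesis using y by simp
qed

text \<open>An isotropic path in \<open>L\<close>, paired with a constant, is isotropic in
  \<open>N\<close>: its velocity has no \<open>M\<^sub>1\<close> part and is tangent to
  \<open>L\<close>.\<close>

lemma isotropic_leaf_N_I:
  assumes x: "x \<in> points M\<^sub>1" and q: "q \<in> isotropic_leaf M\<^sub>2 \<omega>\<^sub>2 L l"
  shows "(x, q) \<in> isotropic_leaf M \<Omega> N (x, l)"
proof -
  obtain y where y: "q = y 1" "smooth_path M\<^sub>2 L y" "y 0 = l"
    "\<forall>t\<in>{0..1}. velocity M\<^sub>2 {0..1} y t \<in> symplectic_complement M\<^sub>2 \<omega>\<^sub>2 L (y t)"
    using q by (auto simp: isotropic_leaf_def)
  have ys: "smooth_map_on real_line {0..1} M\<^sub>2 y" and yL: "\<And>t. t \<in> {0..1} \<Longrightarrow> y t \<in> L"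
    using y(2) unfolding smooth_path_def by blast+
  let ?c = "\<lambda>t. (x, y t)"
  have cs: "smooth_map_on real_line {0..1} M ?c"
    by (rule smooth_pair[OF atlas1 atlas2 smooth_map_on_const[OF smooth_atlas_real_line x] ys])
  have "smooth_path M N ?c" using cs x yL by (auto simp: smooth_path_def)
  moreover have "velocity M {0..1} ?c t \<in> symplectic_complement M \<Omega> N (?c t)" if t: "t \<in> {0..1}" for t
  proof -
    have p: "?c t \<in> N" using x yL[OF t] by simp
    note nt = at_within_unit_interval[OF t]
    have "dfst (?c t) (velocity M {0..1} ?c t) = (\<lambda>_. 0)"
      using velocity_fst[OF cs t nt, symmetric] velocity_const[OF nt, of M\<^sub>1 x] by simp
    moreover have "dsnd (?c t) (velocity M {0..1} ?c t) \<in> sub_tangent M\<^sub>2 L (snd (?c t))"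
      using velocity_snd[OF cs t nt, symmetric] bspec[OF y(4) t] complement_L[OF yL[OF t]] by simp
    ultimately show ?thesis
      unfolding complement_N[OF p] by (intro conjI velocity_tangent)
  qed
  ultimately show ?thesis unfolding isotropic_leaf_def using y by (intro CollectI exI[of _ ?c]) auto
qed

text \<open>The path from \<open>x 0\<close> to \<open>x t\<close> is reparametrised by \<open>t (1 - cos (\<pi> s)) / 2\<close>, so that it becomes
  the restriction of a curve in \<open>L\<close> defined on the whole line. Hence its one-sided velocities at the
  end points are tangent to \<open>L\<close>, too.\<close>

lemma smooth_path_isotropic_leaf_L:
  assumes x: "smooth_path M\<^sub>2 L x" and t: "t \<in> {0..1}"
  shows "x t \<in> isotropic_leaf M\<^sub>2 \<omega>\<^sub>2 L (x 0)"
proof -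
  have xs: "smooth_map_on real_line {0..1} M\<^sub>2 x" and xL: "\<And>t. t \<in> {0..1} \<Longrightarrow> x t \<in> L"
    using x unfolding smooth_path_def by blast+
  define \<beta> where "\<beta> s = t / 2 + (t / 2) * sin (pi * s + (- pi / 2))" for s
  have \<beta>s: "smooth_map_on real_line UNIV real_line \<beta>"
    unfolding \<beta>_def by (rule smooth_sin)
  have \<beta>01: "\<beta> s \<in> {0..1}" for s
  proof -
    have "0 \<le> 1 + sin (pi * s + (- pi / 2))" "1 + sin (pi * s + (- pi / 2)) \<le> 2"
      using sin_ge_minus_one[of "pi * s + (- pi / 2)"] sin_le_one[of "pi * s + (- pi / 2)"] by linarith+
    then have "0 \<le> t / 2 * (1 + sin (pi * s + (- pi / 2)))" "t / 2 * (1 + sin (pi * s + (- pi / 2))) \<le> t / 2 * 2"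
      using t by (auto intro!: mult_nonneg_nonneg mult_left_mono)
    moreover have "\<beta> s = t / 2 * (1 + sin (pi * s + (- pi / 2)))" by (simp add: \<beta>_def algebra_simps)
    ultimately show ?thesis using t by simp
  qed
  have \<beta>0: "\<beta> 0 = 0" "\<beta> 1 = t" by (simp_all add: \<beta>_def)
  have ys: "smooth_map_on real_line UNIV M\<^sub>2 (\<lambda>s. x (\<beta> s))"
    using \<beta>01 by (intro smooth_map_on_compose[OF smooth_atlas_real_line smooth_atlas_real_line \<beta>s xs])
  have yL: "x (\<beta> s) \<in> L" for s using \<beta>01 xL by blast
  have "velocity M\<^sub>2 {0..1} (\<lambda>s. x (\<beta> s)) r \<in> sub_tangent M\<^sub>2 L (x (\<beta> r))" if r: "r \<in> {0..1}" for r
  proof -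
    \<comment> \<open>\<open>sub_tangent\<close> refers to velocities at time 0, so the curve is
      shifted by \<open>r\<close>.\<close>
    have sh: "smooth_map_on real_line UNIV real_line (\<lambda>s. s + r)"
      by (intro smooth_real_add smooth_real_const smooth_map_on_id smooth_atlas_real_line)
    have zs: "smooth_map_on real_line UNIV M\<^sub>2 (\<lambda>s. x (\<beta> (s + r)))"
      by (rule smooth_map_on_compose[OF smooth_atlas_real_line smooth_atlas_real_line sh ys]) simp
    have "velocity M\<^sub>2 UNIV (\<lambda>s. x (\<beta> (s + r))) 0 = (\<lambda>j. 1 * velocity M\<^sub>2 UNIV (\<lambda>s. x (\<beta> s)) (0 + r) j)"
      by (rule velocity_reparam[OF atlas2 ys]) (auto intro!: derivative_eq_intros)
    moreover have "velocity M\<^sub>2 UNIV (\<lambda>s. x (\<beta> (s + r))) 0 \<in> sub_tangent M\<^sub>2 L (x (\<beta> (0 + r)))"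
      by (rule sub_tangentI[OF zs yL])
    moreover have "velocity M\<^sub>2 {0..1} (\<lambda>s. x (\<beta> s)) r = velocity M\<^sub>2 UNIV (\<lambda>s. x (\<beta> s)) r"
      by (rule velocity_subset[OF atlas2 ys r _ at_within_unit_interval[OF r]]) simp
    ultimately show ?thesis by simp
  qed
  then have "\<forall>r\<in>{0..1}. velocity M\<^sub>2 {0..1} (\<lambda>s. x (\<beta> s)) r \<in> symplectic_complement M\<^sub>2 \<omega>\<^sub>2 L (x (\<beta> r))"
    using yL complement_L by simp
  moreover have "smooth_path M\<^sub>2 L (\<lambda>s. x (\<beta> s))" by (rule smooth_path_subset[OF ys yL])
  ultimately show ?thesis
    unfolding isotropic_leaf_def using \<beta>0 by (intro CollectI exI[of _ "\<lambda>s. x (\<beta> s)"]) auto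
qed

lemma normal_proj_eq_parts:
  assumes p: "p \<in> N" and v: "v \<in> sub_tangent M N p" and w: "w \<in> sub_tangent M N p"
    and eq: "normal_proj M \<Omega> N p v = normal_proj M \<Omega> N p w"
  shows "dfst p v = dfst p w"
  using normal_proj_N_eq_iff[OF p v w] eq by simp

text \<open>The quotient of \<open>TN\<close> by its symplectic complement is identified with \<open>TM\<^sub>1\<close>; under this
  identification the linear holonomy along a path in \<open>{a} \<times> L\<close> is the identity, because leaves are
  contained in the fibres of \<open>fst\<close>.\<close>

lemma linear_holonomy_N:
  assumes a: "a \<in> points M\<^sub>1" and b: "smooth_path M\<^sub>2 L b"
    and v: "v \<in> sub_tangent M N (a, b 0)" and w: "w \<in> sub_tangent M N (a, b 1)"
    and vw: "dfst (a, b 1) w = dfst (a, b 0) v"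
  shows "linear_holonomy M \<Omega> N (\<lambda>t. (a, b t)) (normal_proj M \<Omega> N (a, b 0) v) = normal_proj M \<Omega> N (a, b 1) w"
proof -
  let ?x = "\<lambda>t. (a, b t)" and ?m = "mdim M\<^sub>1"
  let ?p = "(a, b 0)" and ?q = "(a, b 1)"
  have bs: "smooth_map_on real_line {0..1} M\<^sub>2 b" and bL: "\<And>t. t \<in> {0..1} \<Longrightarrow> b t \<in> L"
    using b unfolding smooth_path_def by blast+
  have b0: "b 0 \<in> L" and b1: "b 1 \<in> L" using bL by auto
  have p: "?p \<in> N" and q: "?q \<in> N" using a b0 b1 by auto
  let ?V = "normal_space M \<Omega> N ?p" and ?pr = "normal_proj M \<Omega> N ?p"
  have unique: "normal_proj M \<Omega> N ?q (differential (vec_manifold n) M (\<lambda>z. u 1 (\<kappa> z)) (\<lambda>_. 0) y) = normal_proj M \<Omega> N ?q w"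
    if h: "holonomy_data M \<Omega> N ?x n \<kappa> T u" and y: "y \<in> Espace n" "\<kappa> y = ?pr v" for n \<kappa> T u y
  proof -
    have \<kappa>: "bij_betw \<kappa> (Espace n) ?V"
      and T: "\<And>W. W \<in> ?V \<Longrightarrow> T W \<in> sub_tangent M N ?p \<and> ?pr (T W) = W"
      and us: "smooth_map_on (prod_manifold real_line (vec_manifold n)) ({0..1} \<times> Espace n) M (\<lambda>p. u (fst p) (\<kappa> (snd p)))"
      and uN: "\<And>t W. t \<in> {0..1} \<Longrightarrow> W \<in> ?V \<Longrightarrow> u t W \<in> N"
      and u0: "\<And>t. t \<in> {0..1} \<Longrightarrow> u t (?pr (\<lambda>_. 0)) = ?x t"
      and ul: "\<And>t W. t \<in> {0..1} \<Longrightarrow> W \<in> ?V \<Longrightarrow> u t W \<in> isotropic_leaf M \<Omega> N (u 0 W)"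
      and du: "\<And>y. y \<in> Espace n \<Longrightarrow> differential (vec_manifold n) M (\<lambda>z. u 0 (\<kappa> z)) (\<lambda>_. 0) y = T (\<kappa> y)"
      using h unfolding holonomy_data_def Let_def by blast+
    have \<kappa>V: "\<kappa> z \<in> ?V" if "z \<in> Espace n" for z using \<kappa> that by (auto simp: bij_betw_def)
    have vec: "smooth_map_on (vec_manifold n) (Espace n) M (\<lambda>z. u t (\<kappa> z))" if t: "t \<in> {0..1}" for t
    proof -
      have "smooth_map_on (vec_manifold n) (Espace n) (prod_manifold real_line (vec_manifold n)) (\<lambda>z. (t, z))"
        by (intro smooth_pair smooth_map_on_const smooth_map_on_id smooth_atlas_vec_manifold smooth_atlas_real_line) simp
      from smooth_map_on_compose[OF smooth_atlas_vec_manifold smooth_atlas_prod[OF smooth_atlas_real_line smooth_atlas_vec_manifold] this us]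
      show ?thesis using t by simp
    qed
    \<comment> \<open>Linearity of \<open>\<kappa>\<close> is not among the data. That it sends 0 to
      the zero class is deduced from the differential of \<open>u 0\<close> in direction 0; only
      then is \<open>u t (\<kappa> (\<lambda>_. 0))\<close> known to be the given path.\<close>
    have T0: "T (\<kappa> (\<lambda>_. 0)) = (\<lambda>_. 0)"
      using du[of "\<lambda>_. 0"] by simp
    then have k0: "\<kappa> (\<lambda>_. 0) = ?pr (\<lambda>_. 0)" using T[OF \<kappa>V[of "\<lambda>_. 0"]] by simp
    have ut0: "u t (\<kappa> (\<lambda>_. 0)) = ?x t" if "t \<in> {0..1}" for t using u0[OF that] k0 by simp
    let ?d = "differential (vec_manifold n) M (\<lambda>z. u 1 (\<kappa> z)) (\<lambda>_. 0) y"
    \<comment> \<open>Straight lines are mapped by \<open>u 1\<close> to curves in \<open>N\<close>.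
      Tangency is what permits comparing classes through \<open>dfst\<close>.\<close>
    have d_tangent: "?d \<in> sub_tangent M N ?q"
    proof -
      have line: "smooth_map_on real_line UNIV M (\<lambda>s. u 1 (\<kappa> (\<lambda>i. s * y i)))"
        using y(1) by (intro smooth_map_on_compose[OF smooth_atlas_real_line smooth_atlas_vec_manifold smooth_line[OF y(1)] vec[of 1]])
          (auto simp: mem_Espace)
      have E: "(\<lambda>i. s * y i) \<in> Espace n" for s using y(1) by (simp add: mem_Espace)
      have "velocity M UNIV (\<lambda>s. u 1 (\<kappa> (\<lambda>i. s * y i))) 0 \<in> sub_tangent M N (u 1 (\<kappa> (\<lambda>i. 0 * y i)))"
        using E \<kappa>V uN by (intro sub_tangentI[OF line]) auto
      moreover have "velocity M UNIV (\<lambda>s. u 1 (\<kappa> (\<lambda>i. s * y i))) 0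
          = differential (vec_manifold n) M (\<lambda>z. u 1 (\<kappa> z)) (\<lambda>i. 0 * y i) (velocity (vec_manifold n) UNIV (\<lambda>s i. s * y i) 0)"
        using E by (intro velocity_chain[OF smooth_atlas_vec_manifold atlas_M smooth_line[OF y(1)] _ _ vec[of 1]]) (auto simp: mem_Espace)
      ultimately show ?thesis using ut0[of 1] by (simp add: velocity_line[OF y(1)])
    qed
    have dt: "dfst (?x t) (differential (vec_manifold n) M (\<lambda>z. u t (\<kappa> z)) (\<lambda>_. 0) y)
        = differential (vec_manifold n) M\<^sub>1 (\<lambda>z. fst (u t (\<kappa> z))) (\<lambda>_. 0) y" if t: "t \<in> {0..1}" for t
    proof -
      have "u t (\<kappa> z) \<in> points M" if "z \<in> Espace n" for z using uN[OF t \<kappa>V[OF that]] by (rule N_points)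
      then have "differential (vec_manifold n) M\<^sub>1 (\<lambda>z. fst (u t (\<kappa> z))) (\<lambda>_. 0) y
          = dfst (u t (\<kappa> (\<lambda>_. 0))) (differential (vec_manifold n) M (\<lambda>z. u t (\<kappa> z)) (\<lambda>_. 0) y)"
        using y(1)
        by (intro differential_chain[OF smooth_atlas_vec_manifold atlas_M atlas1 vec[OF t] _ smooth_fst[OF atlas1 atlas2] openin_topspace]) auto
      then show ?thesis using ut0[OF t] by simp
    qed
    have "dfst ?q ?d = differential (vec_manifold n) M\<^sub>1 (\<lambda>z. fst (u 1 (\<kappa> z))) (\<lambda>_. 0) y"
      using dt[of 1] by simp
    also have "\<dots> = differential (vec_manifold n) M\<^sub>1 (\<lambda>z. fst (u 0 (\<kappa> z))) (\<lambda>_. 0) y"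
    proof (rule differential_cong[OF smooth_atlas_vec_manifold atlas1 smooth_fst_comp[OF smooth_atlas_vec_manifold vec[of 0]]])
      show "fst (u 0 (\<kappa> z)) = fst (u 1 (\<kappa> z))" if "z \<in> Espace n" for z
        using isotropic_leaf_N_fst[OF ul[OF _ \<kappa>V[OF that], of 1]] by simp
    qed (use y(1) in auto)
    also have "\<dots> = dfst ?p (T (\<kappa> y))" using dt[of 0] du[OF y(1)] by simp
    also have "\<dots> = dfst ?p v"
      using T[OF \<kappa>V[OF y(1)]] y(2) by (intro normal_proj_eq_parts[OF p _ v]) auto
    finally have "dfst ?q ?d = dfst ?q w" using vw by simp
    then show ?thesis using normal_proj_N_eq_iff[OF q d_tangent w] by simp
  qed
  \<comment> \<open>The definite description yields the computed class only if some choice of data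
    exists, so one is constructed.\<close>
  have exists: "\<exists>n \<kappa> T u. holonomy_data M \<Omega> N ?x n \<kappa> T u \<and> (\<exists>y\<in>Espace n. \<kappa> y = ?pr v)"
  proof -
    obtain g where g: "smooth_map_on (vec_manifold ?m) (Espace ?m) M\<^sub>1 g"
      "\<And>y. y \<in> Espace ?m \<Longrightarrow> g y \<in> points M\<^sub>1" "g (\<lambda>_. 0) = a"
      "\<And>v. v \<in> Espace ?m \<Longrightarrow> differential (vec_manifold ?m) M\<^sub>1 g (\<lambda>_. 0) v = v"
      by (rule exists_box_map[OF atlas1 openin_topspace a]) (rule that)
    \<comment> \<open>Horizontal lifts of vectors of \<open>M\<^sub>1\<close>: the representatives
      with vanishing \<open>L\<close> part. They make \<open>\<kappa>\<close> a linear
      parametrisation of the quotient and supply the section \<open>T\<close>.\<close>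
    define \<iota> where "\<iota> y = differential M\<^sub>1 M (\<lambda>x. (x, b 0)) a y" for y
    define \<kappa> where "\<kappa> y = ?pr (\<iota> y)" for y
    have b0p: "b 0 \<in> points M\<^sub>2" by (rule L_points[OF b0])
    have ins: "smooth_map_on M\<^sub>1 (points M\<^sub>1) M (\<lambda>x. (x, b 0))"
      by (intro smooth_pair smooth_map_on_id smooth_map_on_const atlas1 atlas2 b0p)
    have \<iota>1: "dfst ?p (\<iota> y) = y" and \<iota>2: "dsnd ?p (\<iota> y) = (\<lambda>_. 0)" if y: "y \<in> Espace ?m" for y
    proof -
      have "dfst ?p (\<iota> y) = differential M\<^sub>1 M\<^sub>1 (\<lambda>x. fst (x, b 0)) a y"
        unfolding \<iota>_def using b0p
        by (intro differential_chain[symmetric, OF atlas1 atlas_M atlas1 ins openin_topspace smooth_fst[OF atlas1 atlas2] openin_topspace _ a y]) auto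
      then show "dfst ?p (\<iota> y) = y" using differential_id[OF atlas1 a y] by simp
      have "dsnd ?p (\<iota> y) = differential M\<^sub>1 M\<^sub>2 (\<lambda>x. snd (x, b 0)) a y"
        unfolding \<iota>_def using b0p
        by (intro differential_chain[symmetric, OF atlas1 atlas_M atlas2 ins openin_topspace smooth_snd[OF atlas1 atlas2] openin_topspace _ a y]) auto
      then show "dsnd ?p (\<iota> y) = (\<lambda>_. 0)" using differential_const[OF atlas1 atlas2 a y b0p] by simp
    qed
    have \<iota>T: "\<iota> y \<in> sub_tangent M N ?p" if y: "y \<in> Espace ?m" for y
      using zero_sub_tangent_L[OF b0] \<iota>2[OF y] differential_tangent[of M\<^sub>1 M]
      by (simp add: sub_tangent_N[OF p] \<iota>_def)
    \<comment> \<open>Every class contains the horizontal vector with the same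
      \<open>M\<^sub>1\<close> part.\<close>
    have \<kappa>_surj: "\<kappa> (dfst ?p v) = ?pr v" if v: "v \<in> sub_tangent M N ?p" for v
      unfolding \<kappa>_def
      by (subst normal_proj_N_eq_iff[OF p \<iota>T[OF differential_tangent] v]) (rule \<iota>1[OF differential_tangent])
    have \<kappa>_inj: "inj_on \<kappa> (Espace ?m)"
    proof (rule inj_onI)
      fix y z assume y: "y \<in> Espace ?m" and z: "z \<in> Espace ?m" and eq: "\<kappa> y = \<kappa> z"
      then show "y = z"
        using normal_proj_eq_parts[OF p \<iota>T[OF y] \<iota>T[OF z]] \<iota>1[OF y] \<iota>1[OF z] by (simp add: \<kappa>_def)
    qed
    have \<kappa>_bij: "bij_betw \<kappa> (Espace ?m) ?V"
    proof -
      have "\<kappa> ` Espace ?m \<subseteq> ?V" using \<iota>T by (auto simp: normal_space_def \<kappa>_def)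
      moreover have "?V \<subseteq> \<kappa> ` Espace ?m"
      proof
        fix W assume "W \<in> ?V"
        then obtain v where "v \<in> sub_tangent M N ?p" "W = ?pr v" unfolding normal_space_def by blast
        then have "W = \<kappa> (dfst ?p v)" using \<kappa>_surj by simp
        then show "W \<in> \<kappa> ` Espace ?m"
          using imageI[OF differential_tangent, of \<kappa> M M\<^sub>1 fst ?p v] by simp
      qed
      ultimately show ?thesis using \<kappa>_inj by (auto simp: bij_betw_def)
    qed
    define h where "h = inv_into (Espace ?m) \<kappa>"
    have h\<kappa>: "h (\<kappa> y) = y" if "y \<in> Espace ?m" for y unfolding h_def by (rule inv_into_f_f[OF \<kappa>_inj that])
    have hE: "h W \<in> Espace ?m" and \<kappa>h: "\<kappa> (h W) = W" if "W \<in> ?V" for W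
      using that bij_betw_imp_surj_on[OF \<kappa>_bij] inv_into_into[of W \<kappa> "Espace ?m"] f_inv_into_f[of W \<kappa> "Espace ?m"]
      by (simp_all add: h_def)
    \<comment> \<open>Transversally to the leaves \<open>u\<close> follows a box map of
      \<open>M\<^sub>1\<close>, and along them it follows \<open>b\<close> without twisting.\<close>
    define u where "u t W = (g (h W), b t)" for t W
    have h0: "h (?pr (\<lambda>_. 0)) = (\<lambda>_. 0)"
      using h\<kappa>[of "\<lambda>_. 0"] by (simp add: \<kappa>_def \<iota>_def)
    have "holonomy_data M \<Omega> N ?x ?m \<kappa> (\<lambda>W. \<iota> (h W)) u"
      unfolding holonomy_data_def Let_def
    proof (intro conjI ballI)
      show "bij_betw \<kappa> (Espace ?m) (normal_space M \<Omega> N (?x 0))" by (rule \<kappa>_bij)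
      show "\<iota> (h W) \<in> sub_tangent M N (?x 0)" if "W \<in> normal_space M \<Omega> N (?x 0)" for W
        by (rule \<iota>T[OF hE[OF that]])
      show "normal_proj M \<Omega> N (?x 0) (\<iota> (h W)) = W" if "W \<in> normal_space M \<Omega> N (?x 0)" for W
        using \<kappa>h[OF that] by (simp add: \<kappa>_def)
      show "vec_linear ?m (\<lambda>y. \<iota> (h (\<kappa> y)))"
        unfolding vec_linear_def
      proof (intro ballI allI)
        fix v w c assume v: "v \<in> Espace ?m" and w: "w \<in> Espace ?m"
        then have "(\<lambda>i. c * v i + w i) \<in> Espace ?m" by (simp add: mem_Espace)
        then show "\<iota> (h (\<kappa> (\<lambda>i. c * v i + w i))) = (\<lambda>i. c * \<iota> (h (\<kappa> v)) i + \<iota> (h (\<kappa> w)) i)"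
          by (simp add: h\<kappa> v w \<iota>_def differential_linear)
      qed
      let ?RV = "prod_manifold real_line (vec_manifold ?m)"
      note RV = smooth_atlas_prod[OF smooth_atlas_real_line smooth_atlas_vec_manifold, of ?m]
      have "smooth_map_on ?RV ({0..1} \<times> Espace ?m) M (\<lambda>p. (g (snd p), b (fst p)))"
        by (intro smooth_pair[OF atlas1 atlas2]
            smooth_map_on_compose[OF RV smooth_atlas_vec_manifold smooth_snd[OF smooth_atlas_real_line smooth_atlas_vec_manifold] g(1)]
            smooth_map_on_compose[OF RV smooth_atlas_real_line smooth_fst[OF smooth_atlas_real_line smooth_atlas_vec_manifold] bs]) auto
      then show "smooth_map_on ?RV ({0..1} \<times> Espace ?m) M (\<lambda>p. u (fst p) (\<kappa> (snd p)))"
        by (rule smooth_map_on_cong[OF _ _ RV]) (auto simp: u_def h\<kappa>)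
      show "u t W \<in> N" if "t \<in> {0..1}" "W \<in> normal_space M \<Omega> N (?x 0)" for t W
        using g(2)[OF hE[OF that(2)]] bL[OF that(1)] by (simp add: u_def)
      show "u t (normal_proj M \<Omega> N (?x 0) (\<lambda>_. 0)) = ?x t" for t
        by (simp add: u_def h0 g(3))
      show "u t W \<in> isotropic_leaf M \<Omega> N (u 0 W)" if "t \<in> {0..1}" "W \<in> normal_space M \<Omega> N (?x 0)" for t W
        unfolding u_def by (rule isotropic_leaf_N_I[OF g(2)[OF hE[OF that(2)]] smooth_path_isotropic_leaf_L[OF b that(1)]])
      fix y assume y: "y \<in> Espace ?m"
      have gb: "smooth_map_on (vec_manifold ?m) (Espace ?m) M (\<lambda>z. (g z, b 0))"
        by (rule smooth_pair[OF atlas1 atlas2 g(1) smooth_map_on_const[OF smooth_atlas_vec_manifold b0p]])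
      have "differential (vec_manifold ?m) M (\<lambda>z. u 0 (\<kappa> z)) (\<lambda>_. 0) y = differential (vec_manifold ?m) M (\<lambda>z. (g z, b 0)) (\<lambda>_. 0) y"
        by (rule differential_cong[OF smooth_atlas_vec_manifold atlas_M gb]) (auto simp: u_def h\<kappa> y)
      also have "\<dots> = differential M\<^sub>1 M (\<lambda>x. (x, b 0)) (g (\<lambda>_. 0)) (differential (vec_manifold ?m) M\<^sub>1 g (\<lambda>_. 0) y)"
        using g(2) y by (intro differential_chain[OF smooth_atlas_vec_manifold atlas1 atlas_M g(1) _ ins openin_topspace]) auto
      also have "\<dots> = \<iota> y" using g(3) g(4)[OF y] by (simp add: \<iota>_def)
      finally show "differential (vec_manifold ?m) M (\<lambda>z. u 0 (\<kappa> z)) (\<lambda>_. 0) y = \<iota> (h (\<kappa> y))"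
        by (simp add: h\<kappa>[OF y])
    qed
    moreover have "\<exists>y\<in>Espace ?m. \<kappa> y = ?pr v" using \<kappa>_surj[OF v] differential_tangent[of M M\<^sub>1] by blast
    ultimately show ?thesis by blast
  qed
  show ?thesis
    unfolding linear_holonomy_def
  proof (rule the_equality)
    show "\<exists>n \<kappa> T u. holonomy_data M \<Omega> N ?x n \<kappa> T u \<and> (\<exists>y\<in>Espace n. \<kappa> y = ?pr v \<and>
        normal_proj M \<Omega> N ?q w = normal_proj M \<Omega> N ?q (differential (vec_manifold n) M (\<lambda>z. u 1 (\<kappa> z)) (\<lambda>_. 0) y))"
      using exists unique by metis
    show "Z = normal_proj M \<Omega> N ?q w" if "\<exists>n \<kappa> T u. holonomy_data M \<Omega> N ?x n \<kappa> T u \<and> (\<exists>y\<in>Espace n. \<kappa> y = ?pr v \<and>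
        Z = normal_proj M \<Omega> N ?q (differential (vec_manifold n) M (\<lambda>z. u 1 (\<kappa> z)) (\<lambda>_. 0) y))" for Z
      using that unique by blast
  qed
qed

end

section \<open>The graph construction\<close>

lemma smooth_map_continuous: "smooth_map_on K (points K) K' h \<Longrightarrow> continuous_map (mtop K) (mtop K') h"
  unfolding smooth_map_on_def subtopology_topspace by (rule conjunct1)

text \<open>The manifold \<open>P\<close> is a copy of \<open>(M\<^sub>1 \<times> M\<^sub>2) \<times> M\<^sub>1\<close> with the form \<open>\<omega>\<^sub>1 \<oplus> \<omega>\<^sub>2 \<oplus> (-\<omega>\<^sub>1)\<close>; the projections
  are \<open>f\<close> and \<open>g\<close>, and \<open>J\<close> is the inverse of \<open>(f, g)\<close>. The locale is interpreted twice: for a copy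
  with real numbers as points and for the product of a point with that copy.\<close>

locale graph_construction = lagrangian_factor M\<^sub>1 \<omega>\<^sub>1 M\<^sub>2 \<omega>\<^sub>2 k L
  for M\<^sub>1 :: "'a manifold" and \<omega>\<^sub>1 and M\<^sub>2 :: "'b manifold" and \<omega>\<^sub>2 and k L +
  fixes P :: "'p manifold" and \<omega>\<^sub>P :: "'p two_form" and f :: "'p \<Rightarrow> 'a \<times> 'b" and g :: "'p \<Rightarrow> 'a"
    and J :: "('a \<times> 'b) \<times> 'a \<Rightarrow> 'p"
  assumes atlas_P: "smooth_atlas P"
    and fs: "smooth_map_on P (points P) (prod_manifold M\<^sub>1 M\<^sub>2) f"
    and gs: "smooth_map_on P (points P) M\<^sub>1 g"
    and Js: "smooth_map_on (prod_manifold (prod_manifold M\<^sub>1 M\<^sub>2) M\<^sub>1)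
               (points (prod_manifold (prod_manifold M\<^sub>1 M\<^sub>2) M\<^sub>1)) P J"
    and fJ: "\<And>x y. x \<in> points (prod_manifold M\<^sub>1 M\<^sub>2) \<Longrightarrow> y \<in> points M\<^sub>1 \<Longrightarrow> f (J (x, y)) = x"
    and gJ: "\<And>x y. x \<in> points (prod_manifold M\<^sub>1 M\<^sub>2) \<Longrightarrow> y \<in> points M\<^sub>1 \<Longrightarrow> g (J (x, y)) = y"
    and Jfg: "\<And>z. z \<in> points P \<Longrightarrow> J (f z, g z) = z"
    and form_P: "\<And>z v w. z \<in> points P \<Longrightarrow> v \<in> Espace (mdim P) \<Longrightarrow> w \<in> Espace (mdim P) \<Longrightarrow>
      \<omega>\<^sub>P z v w = prod_form M\<^sub>1 \<omega>\<^sub>1 M\<^sub>2 \<omega>\<^sub>2 (f z) (differential P (prod_manifold M\<^sub>1 M\<^sub>2) f z v) (differential P (prod_manifold M\<^sub>1 M\<^sub>2) f z w)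
        - \<omega>\<^sub>1 (g z) (differential P M\<^sub>1 g z v) (differential P M\<^sub>1 g z w)"
begin

abbreviation "Q \<equiv> prod_manifold M M\<^sub>1"
abbreviation "df \<equiv> differential P M f"
abbreviation "dg \<equiv> differential P M\<^sub>1 g"

text \<open>Under \<open>(f, g)\<close> this is the graph of the projection \<open>fst\<close> from
  \<open>N\<close> to \<open>M\<^sub>1\<close>.\<close>

definition graph :: "'p set" where
  "graph = {z \<in> points P. snd (f z) \<in> L \<and> fst (f z) = g z}"

definition d1 :: "'p \<Rightarrow> vec \<Rightarrow> vec" where "d1 z v = dfst (f z) (df z v)"
definition d2 :: "'p \<Rightarrow> vec \<Rightarrow> vec" where "d2 z v = dsnd (f z) (df z v)"

definition lift :: "('a \<times> 'b \<Rightarrow> 'a \<times> 'b) \<Rightarrow> 'p \<Rightarrow> 'p" where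
  "lift \<phi> z = J (\<phi> (f z), g z)"

lemma atlas_Q: "smooth_atlas Q"
  by (rule smooth_atlas_prod[OF atlas_M atlas1])

lemma f_points: "z \<in> points P \<Longrightarrow> f z \<in> points M"
  using smooth_map_onD_points[OF fs] .

lemma f1_points: "z \<in> points P \<Longrightarrow> fst (f z) \<in> points M\<^sub>1"
  using f_points[of z] by auto

lemma f2_points: "z \<in> points P \<Longrightarrow> snd (f z) \<in> points M\<^sub>2"
  using f_points[of z] by auto

lemma g_points: "z \<in> points P \<Longrightarrow> g z \<in> points M\<^sub>1"
  using smooth_map_onD_points[OF gs] .

lemma J_points: "x \<in> points M \<Longrightarrow> y \<in> points M\<^sub>1 \<Longrightarrow> J (x, y) \<in> points P"
  using smooth_map_onD_points[OF Js, of "(x, y)"] by simp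

lemma J_eqI: "z \<in> points P \<Longrightarrow> z' \<in> points P \<Longrightarrow> f z = f z' \<Longrightarrow> g z = g z' \<Longrightarrow> z = z'"
  using Jfg by metis

lemma graph_points: "z \<in> graph \<Longrightarrow> z \<in> points P"
  by (simp add: graph_def)

lemma graph_f: "z \<in> graph \<Longrightarrow> f z \<in> N"
  using g_points by (auto simp: graph_def mem_Times_iff)

lemma J_graph: "x \<in> points M\<^sub>1 \<Longrightarrow> l \<in> L \<Longrightarrow> J ((x, l), x) \<in> graph"
  using fJ[of "(x, l)" x] gJ[of "(x, l)" x] J_points[of "(x, l)" x] L_points by (simp add: graph_def)

lemma smooth_f_comp: "smooth_atlas K \<Longrightarrow> U \<subseteq> points K \<Longrightarrow> smooth_map_on K U P c \<Longrightarrow> smooth_map_on K U M (\<lambda>s. f (c s))"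
  using smooth_map_onD_points by (intro smooth_map_on_compose[OF _ atlas_P _ fs]) auto

lemma smooth_g_comp: "smooth_atlas K \<Longrightarrow> U \<subseteq> points K \<Longrightarrow> smooth_map_on K U P c \<Longrightarrow> smooth_map_on K U M\<^sub>1 (\<lambda>s. g (c s))"
  using smooth_map_onD_points by (intro smooth_map_on_compose[OF _ atlas_P _ gs]) auto

lemma smooth_J_comp:
  assumes K: "smooth_atlas K" and U: "U \<subseteq> points K"
    and a: "smooth_map_on K U M a" and b: "smooth_map_on K U M\<^sub>1 b"
  shows "smooth_map_on K U P (\<lambda>s. J (a s, b s))"
  using U smooth_map_onD_points[OF a] smooth_map_onD_points[OF b]
  by (intro smooth_map_on_compose[OF K atlas_Q smooth_pair[OF atlas_M atlas1 a b] Js]) auto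

lemma velocity_f:
  assumes c: "smooth_map_on real_line I P c" and t: "t \<in> I" and nt: "at t within I \<noteq> bot"
  shows "velocity M I (\<lambda>s. f (c s)) t = df (c t) (velocity P I c t)"
  using smooth_map_onD_points[OF c t]
  by (intro velocity_chain[OF atlas_P atlas_M c t nt fs openin_topspace]) simp

lemma velocity_g:
  assumes c: "smooth_map_on real_line I P c" and t: "t \<in> I" and nt: "at t within I \<noteq> bot"
  shows "velocity M\<^sub>1 I (\<lambda>s. g (c s)) t = dg (c t) (velocity P I c t)"
  using smooth_map_onD_points[OF c t]
  by (intro velocity_chain[OF atlas_P atlas1 c t nt gs openin_topspace]) simp

lemma velocity_f1:
  assumes c: "smooth_map_on real_line I P c" and t: "t \<in> I" and nt: "at t within I \<noteq> bot"
  shows "velocity M\<^sub>1 I (\<lambda>s. fst (f (c s))) t = d1 (c t) (velocity P I c t)"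
  unfolding d1_def velocity_f[OF c t nt, symmetric]
  by (rule velocity_fst[OF smooth_f_comp[OF smooth_atlas_real_line _ c] t nt]) simp

lemma velocity_f2:
  assumes c: "smooth_map_on real_line I P c" and t: "t \<in> I" and nt: "at t within I \<noteq> bot"
  shows "velocity M\<^sub>2 I (\<lambda>s. snd (f (c s))) t = d2 (c t) (velocity P I c t)"
  unfolding d2_def velocity_f[OF c t nt, symmetric]
  by (rule velocity_snd[OF smooth_f_comp[OF smooth_atlas_real_line _ c] t nt]) simp

text \<open>\<open>P\<close> is given only through \<open>f\<close>, \<open>g\<close> and
  \<open>J\<close>. As \<open>J\<close> is a left inverse of \<open>(f, g)\<close>, the chain rule
  recovers \<open>v\<close> from its two images.\<close>

lemma tangent_P_zero:
  assumes z: "z \<in> points P" and v: "v \<in> Espace (mdim P)" and v1: "df z v = (\<lambda>_. 0)" and v2: "dg z v = (\<lambda>_. 0)"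
  shows "v = (\<lambda>_. 0)"
proof -
  obtain c where c: "smooth_map_on real_line UNIV P c" "\<And>s. c s \<in> points P" "c 0 = z" "velocity P UNIV c 0 = v"
    by (rule exists_curve[OF atlas_P openin_topspace z v]) (rule that)
  have fc: "smooth_map_on real_line UNIV M (\<lambda>s. f (c s))" and gc: "smooth_map_on real_line UNIV M\<^sub>1 (\<lambda>s. g (c s))"
    by (intro smooth_f_comp smooth_g_comp smooth_atlas_real_line c(1), simp)+
  let ?e = "\<lambda>s. (f (c s), g (c s))"
  have e: "smooth_map_on real_line UNIV Q ?e" by (rule smooth_pair[OF atlas_M atlas1 fc gc])
  have e0: "?e 0 \<in> points Q" using f_points[OF z] g_points[OF z] c(3) by simp
  have "velocity Q UNIV ?e 0 = (\<lambda>_. 0)"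
  proof (rule prod_tangent_zero[OF atlas_M atlas1 e0])
    show "velocity Q UNIV ?e 0 \<in> Espace (mdim M + mdim M\<^sub>1)" using velocity_tangent[of Q] by simp
    show "differential Q M fst (?e 0) (velocity Q UNIV ?e 0) = (\<lambda>_. 0)"
      using differential_velocity[OF atlas_Q atlas_M smooth_fst[OF atlas_M atlas1] openin_topspace e e0] velocity_f[OF c(1), of 0] c v1 by simp
    show "differential Q M\<^sub>1 snd (?e 0) (velocity Q UNIV ?e 0) = (\<lambda>_. 0)"
      using differential_velocity[OF atlas_Q atlas1 smooth_snd[OF atlas_M atlas1] openin_topspace e e0] velocity_g[OF c(1), of 0] c v2 by simp
  qed
  moreover have "velocity P UNIV (\<lambda>s. J (?e s)) 0 = differential Q P J (?e 0) (velocity Q UNIV ?e 0)"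
    by (rule differential_velocity[OF atlas_Q atlas_P Js openin_topspace e e0])
  moreover have "(\<lambda>s. J (?e s)) = c" using Jfg c(2) by auto
  ultimately show ?thesis using c by simp
qed

lemma tangent_P_eqI:
  assumes z: "z \<in> points P" and v: "v \<in> Espace (mdim P)" and w: "w \<in> Espace (mdim P)"
    and 1: "df z v = df z w" and 2: "dg z v = dg z w"
  shows "v = w"
proof -
  have "(\<lambda>i. v i - w i) = (\<lambda>_. 0)"
    by (rule tangent_P_zero[OF z]) (use v w 1 2 in \<open>auto simp: differential_diff mem_Espace\<close>)
  then show ?thesis by (simp add: fun_eq_iff)
qed

text \<open>Here \<open>J\<close> acts as a right inverse: a pair of curves with the prescribed
  velocities is sent to \<open>P\<close> by \<open>J\<close>.\<close>

lemma tangent_P_exists: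
  assumes z: "z \<in> points P" and a: "a \<in> Espace (mdim M)" and b: "b \<in> Espace (mdim M\<^sub>1)"
  obtains v where "v \<in> Espace (mdim P)" "df z v = a" "dg z v = b"
proof -
  obtain c where c: "smooth_map_on real_line UNIV M c" "\<And>s. c s \<in> points M" "c 0 = f z" "velocity M UNIV c 0 = a"
    by (rule exists_curve[OF atlas_M openin_topspace f_points[OF z] a]) (rule that)
  obtain d where d: "smooth_map_on real_line UNIV M\<^sub>1 d" "\<And>s. d s \<in> points M\<^sub>1" "d 0 = g z" "velocity M\<^sub>1 UNIV d 0 = b"
    by (rule exists_curve[OF atlas1 openin_topspace g_points[OF z] b]) (rule that)
  let ?e = "\<lambda>s. J (c s, d s)"
  have e: "smooth_map_on real_line UNIV P ?e" by (rule smooth_J_comp[OF smooth_atlas_real_line _ c(1) d(1)]) simp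
  have e0: "?e 0 = z" using c(3) d(3) Jfg[OF z] by simp
  have "(\<lambda>s. f (?e s)) = c" "(\<lambda>s. g (?e s)) = d" using fJ[OF c(2) d(2)] gJ[OF c(2) d(2)] by auto
  then show ?thesis
    using velocity_f[OF e, of 0] velocity_g[OF e, of 0] e0 c d
    by (intro that[of "velocity P UNIV ?e 0"] velocity_tangent) simp_all
qed

lemma tangent_P_exists3:
  assumes z: "z \<in> points P" and a: "a \<in> Espace (mdim M\<^sub>1)" and b: "b \<in> Espace (mdim M\<^sub>2)" and c: "c \<in> Espace (mdim M\<^sub>1)"
  obtains v where "v \<in> Espace (mdim P)" "d1 z v = a" "d2 z v = b" "dg z v = c"
proof -
  obtain u where u: "u \<in> Espace (mdim M)" "dfst (f z) u = a" "dsnd (f z) u = b"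
    by (rule tangent_exists[OF f_points[OF z] a b]) (rule that)
  obtain v where "v \<in> Espace (mdim P)" "df z v = u" "dg z v = c"
    by (rule tangent_P_exists[OF z u(1) c]) (rule that)
  then show ?thesis using u by (intro that[of v]) (simp_all add: d1_def d2_def)
qed

lemma form_P_eq:
  assumes "z \<in> points P" "v \<in> Espace (mdim P)" "w \<in> Espace (mdim P)"
  shows "\<omega>\<^sub>P z v w = \<omega>\<^sub>1 (fst (f z)) (d1 z v) (d1 z w) + \<omega>\<^sub>2 (snd (f z)) (d2 z v) (d2 z w) - \<omega>\<^sub>1 (g z) (dg z v) (dg z w)"
  by (simp add: form_P[OF assms] prod_form_def d1_def d2_def)

lemma d1_tangent: "d1 z v \<in> Espace (mdim M\<^sub>1)" and d2_tangent: "d2 z v \<in> Espace (mdim M\<^sub>2)"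
  by (simp_all add: d1_def d2_def differential_tangent)

text \<open>In components, the tangent vectors are \<open>(v, w, v)\<close> with \<open>w\<close>
  tangent to \<open>L\<close>. The converse inserts one curve of \<open>M\<^sub>1\<close> into both
  copies.\<close>

lemma sub_tangent_graph:
  assumes z: "z \<in> graph"
  shows "v \<in> sub_tangent P graph z \<longleftrightarrow>
    v \<in> Espace (mdim P) \<and> d1 z v = dg z v \<and> d2 z v \<in> sub_tangent M\<^sub>2 L (snd (f z))"
proof
  note zP = graph_points[OF z]
  assume v: "v \<in> sub_tangent P graph z"
  then obtain c where c: "smooth_map_on real_line UNIV P c" "\<And>s. c s \<in> graph" "c 0 = z" "velocity P UNIV c 0 = v"
    by (rule sub_tangentE) (rule that)
  have fc: "smooth_map_on real_line UNIV M (\<lambda>s. f (c s))"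
    by (rule smooth_f_comp[OF smooth_atlas_real_line _ c(1)]) simp
  have "(\<lambda>s. fst (f (c s))) = (\<lambda>s. g (c s))" using c(2) by (auto simp: graph_def)
  then have "d1 z v = dg z v" using velocity_f1[OF c(1), of 0] velocity_g[OF c(1), of 0] c by simp
  moreover have "velocity M\<^sub>2 UNIV (\<lambda>s. snd (f (c s))) 0 \<in> sub_tangent M\<^sub>2 L (snd (f (c 0)))"
    using c(2) by (intro sub_tangentI smooth_snd_comp[OF smooth_atlas_real_line fc]) (auto simp: graph_def)
  ultimately show "v \<in> Espace (mdim P) \<and> d1 z v = dg z v \<and> d2 z v \<in> sub_tangent M\<^sub>2 L (snd (f z))"
    using velocity_f2[OF c(1), of 0] c sub_tangent_Espace[OF v] by simp
next
  note zP = graph_points[OF z]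
  assume v: "v \<in> Espace (mdim P) \<and> d1 z v = dg z v \<and> d2 z v \<in> sub_tangent M\<^sub>2 L (snd (f z))"
  then have v2: "d2 z v \<in> sub_tangent M\<^sub>2 L (snd (f z))" by simp
  obtain d where d: "smooth_map_on real_line UNIV M\<^sub>2 d" "\<And>s. d s \<in> L" "d 0 = snd (f z)" "velocity M\<^sub>2 UNIV d 0 = d2 z v"
    using v2 by (rule sub_tangentE) (rule that)
  obtain c where c: "smooth_map_on real_line UNIV M\<^sub>1 c" "\<And>s. c s \<in> points M\<^sub>1" "c 0 = g z" "velocity M\<^sub>1 UNIV c 0 = dg z v"
    by (rule exists_curve[OF atlas1 openin_topspace g_points[OF zP] differential_tangent]) (rule that)
  let ?e = "\<lambda>s. J ((c s, d s), c s)"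
  have cd: "smooth_map_on real_line UNIV M (\<lambda>s. (c s, d s))" by (rule smooth_pair[OF atlas1 atlas2 c(1) d(1)])
  have e: "smooth_map_on real_line UNIV P ?e" by (rule smooth_J_comp[OF smooth_atlas_real_line _ cd c(1)]) simp
  have "(g z, snd (f z)) = f z" using z by (auto simp: graph_def prod_eq_iff)
  then have e0: "?e 0 = z" using c(3) d(3) Jfg[OF zP] by simp
  have M: "(c s, d s) \<in> points M" for s using c(2) L_points[OF d(2)] by simp
  have fe: "(\<lambda>s. f (?e s)) = (\<lambda>s. (c s, d s))" and ge: "(\<lambda>s. g (?e s)) = c"
    using fJ[OF M c(2)] gJ[OF M c(2)] by auto
  have d12: "d1 z (velocity P UNIV ?e 0) = dg z v" "d2 z (velocity P UNIV ?e 0) = d2 z v" "dg z (velocity P UNIV ?e 0) = dg z v"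
    using velocity_f1[OF e, of 0] velocity_f2[OF e, of 0] velocity_g[OF e, of 0] e0 c d fe ge
    by (simp_all add: fun_eq_iff)
  have "velocity P UNIV ?e 0 = v"
  proof (rule tangent_P_eqI[OF zP velocity_tangent _ _ d12(3)])
    show "df z (velocity P UNIV ?e 0) = df z v"
      using d12 v by (intro tangent_eqI[OF f_points[OF zP] differential_tangent differential_tangent]) (simp_all add: d1_def d2_def)
  qed (use v in simp)
  moreover have "velocity P UNIV ?e 0 \<in> sub_tangent P graph (?e 0)"
    by (rule sub_tangentI[OF e J_graph[OF c(2) d(2)]])
  ultimately show "v \<in> sub_tangent P graph z" using e0 by simp
qed

text \<open>With the minus sign, \<open>(u, b, u')\<close> paired with \<open>(a, 0, a)\<close>
  gives the value of \<open>\<omega>\<^sub>1\<close> on \<open>u - u'\<close> and \<open>a\<close>,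
  so nondegeneracy forces \<open>u = u'\<close>; vectors \<open>(0, b, 0)\<close> handle
  \<open>L\<close>. Conversely, on vectors tangent to the graph the two \<open>M\<^sub>1\<close>
  terms cancel.\<close>

lemma complement_graph:
  assumes z: "z \<in> graph"
  shows "symplectic_complement P \<omega>\<^sub>P graph z = sub_tangent P graph z"
proof (intro equalityI subsetI)
  note zP = graph_points[OF z]
  have l: "snd (f z) \<in> L" and fg: "fst (f z) = g z" using z by (auto simp: graph_def)
  {
    fix v assume v: "v \<in> symplectic_complement P \<omega>\<^sub>P graph z"
    then have vE: "v \<in> Espace (mdim P)" and v0: "\<And>w. w \<in> sub_tangent P graph z \<Longrightarrow> \<omega>\<^sub>P z v w = 0"
      by (auto simp: symplectic_complement_def tangent_space_def)
    have "\<omega>\<^sub>1 (g z) (\<lambda>i. d1 z v i - dg z v i) a = 0" if a: "a \<in> Espace (mdim M\<^sub>1)" for a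
    proof -
      obtain w where w: "w \<in> Espace (mdim P)" "d1 z w = a" "d2 z w = (\<lambda>_. 0)" "dg z w = a"
        by (rule tangent_P_exists3[OF zP a zero_Espace a]) (rule that)
      then have "w \<in> sub_tangent P graph z" using zero_sub_tangent_L[OF l] by (simp add: sub_tangent_graph[OF z])
      from v0[OF this] have "\<omega>\<^sub>1 (g z) (d1 z v) a - \<omega>\<^sub>1 (g z) (dg z v) a = 0"
        unfolding form_P_eq[OF zP vE w(1)] w fg by (simp add: form_zero_right[OF form2 L_points[OF l] d2_tangent])
      then show ?thesis
        by (simp add: form_diff_left[OF form1 g_points[OF zP] d1_tangent differential_tangent a])
    qed
    then have "(\<lambda>i. d1 z v i - dg z v i) = (\<lambda>_. 0)"
      using d1_tangent[of z v] differential_tangent[of P M\<^sub>1 g z v]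
      by (intro nondegenerate1[OF g_points[OF zP]]) (auto simp: mem_Espace)
    then have 1: "d1 z v = dg z v" by (simp add: fun_eq_iff)
    have "d2 z v \<in> sub_tangent M\<^sub>2 L (snd (f z))"
    proof (rule coisotropic_L[OF l d2_tangent])
      fix b assume b: "b \<in> sub_tangent M\<^sub>2 L (snd (f z))"
      obtain w where w: "w \<in> Espace (mdim P)" "d1 z w = (\<lambda>_. 0)" "d2 z w = b" "dg z w = (\<lambda>_. 0)"
        by (rule tangent_P_exists3[OF zP zero_Espace sub_tangent_Espace[OF b] zero_Espace]) (rule that)
      then have "w \<in> sub_tangent P graph z" using b by (simp add: sub_tangent_graph[OF z])
      from v0[OF this] show "\<omega>\<^sub>2 (snd (f z)) (d2 z v) b = 0"
        unfolding form_P_eq[OF zP vE w(1)] w fg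
        by (simp add: form_zero_right[OF form1 g_points[OF zP] d1_tangent]
            form_zero_right[OF form1 g_points[OF zP] differential_tangent])
    qed
    then show "v \<in> sub_tangent P graph z" using vE 1 by (simp add: sub_tangent_graph[OF z])
  next
    fix v assume v: "v \<in> sub_tangent P graph z"
    have "\<omega>\<^sub>P z v w = 0" if w: "w \<in> sub_tangent P graph z" for w
      using v w isotropic_L[OF l] by (simp add: sub_tangent_graph[OF z] form_P_eq[OF zP] fg)
    then show "v \<in> symplectic_complement P \<omega>\<^sub>P graph z"
      using sub_tangent_Espace[OF v] by (simp add: symplectic_complement_def tangent_space_def)
  }
qed

text \<open>Since the graph is Lagrangian, its leaves also move in the \<open>M\<^sub>1\<close>
  directions. The \<open>L\<close> part of an isotropic path is still tangent to \<open>L\<close>,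
  hence isotropic there.\<close>

lemma isotropic_leaf_graph:
  assumes q: "q \<in> isotropic_leaf P \<omega>\<^sub>P graph z"
  shows "q \<in> graph" and "snd (f q) \<in> isotropic_leaf M\<^sub>2 \<omega>\<^sub>2 L (snd (f z))"
proof -
  obtain y where y: "q = y 1" "smooth_path P graph y" "y 0 = z"
    "\<forall>t\<in>{0..1}. velocity P {0..1} y t \<in> symplectic_complement P \<omega>\<^sub>P graph (y t)"
    using q by (auto simp: isotropic_leaf_def)
  have ys: "smooth_map_on real_line {0..1} P y" and yG: "\<And>t. t \<in> {0..1} \<Longrightarrow> y t \<in> graph"
    using y(2) unfolding smooth_path_def by blast+
  show "q \<in> graph" using yG[of 1] y(1) by simp
  let ?c = "\<lambda>t. snd (f (y t))"
  have "smooth_map_on real_line {0..1} M\<^sub>2 ?c"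
    by (intro smooth_snd_comp smooth_f_comp ys smooth_atlas_real_line) simp
  then have "smooth_path M\<^sub>2 L ?c" using yG by (auto simp: smooth_path_def graph_def)
  moreover have "velocity M\<^sub>2 {0..1} ?c t \<in> symplectic_complement M\<^sub>2 \<omega>\<^sub>2 L (?c t)" if t: "t \<in> {0..1}" for t
  proof -
    have "velocity P {0..1} y t \<in> sub_tangent P graph (y t)"
      using bspec[OF y(4) t] complement_graph[OF yG[OF t]] by simp
    moreover have "?c t \<in> L" using yG[OF t] by (simp add: graph_def)
    ultimately show ?thesis
      using velocity_f2[OF ys t at_within_unit_interval[OF t]]
      by (simp add: sub_tangent_graph[OF yG[OF t]] complement_L)
  qed
  ultimately show "snd (f q) \<in> isotropic_leaf M\<^sub>2 \<omega>\<^sub>2 L (snd (f z))"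
    unfolding isotropic_leaf_def using y by (intro CollectI exI[of _ ?c]) auto
qed

section \<open>Fixed points and non-degeneracy of the lifted map\<close>

context
  fixes \<phi> :: "'a \<times> 'b \<Rightarrow> 'a \<times> 'b"
  assumes \<phi>: "smooth_map_on M (points M) M \<phi>"
begin

lemma \<phi>_points: "p \<in> points M \<Longrightarrow> \<phi> p \<in> points M"
  using smooth_map_onD_points[OF \<phi>] .

lemma f_lift: "z \<in> points P \<Longrightarrow> f (lift \<phi> z) = \<phi> (f z)"
  unfolding lift_def by (intro fJ \<phi>_points f_points g_points)

lemma g_lift: "z \<in> points P \<Longrightarrow> g (lift \<phi> z) = g z"
  unfolding lift_def by (intro gJ \<phi>_points f_points g_points)

lemma smooth_lift: "smooth_map_on P (points P) P (lift \<phi>)"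
  unfolding lift_def
  by (intro smooth_J_comp[OF atlas_P subset_refl _ gs] smooth_map_on_compose[OF atlas_P atlas_M fs \<phi>] f_points)

text \<open>On the graph \<open>g\<close> is determined by \<open>f\<close>, whence injectivity. For
  the inclusion, the end point of the leaf path lies on the graph and \<open>lift\<close> preserves
  \<open>g\<close>, so the first coordinate returns, while the \<open>L\<close> parts lie in one
  leaf of \<open>L\<close>.\<close>

lemma leafwise_fixed_points_lift:
  "inj_on f (leafwise_fixed_points P \<omega>\<^sub>P graph (lift \<phi>))"
  "f ` leafwise_fixed_points P \<omega>\<^sub>P graph (lift \<phi>) \<subseteq> leafwise_fixed_points M \<Omega> N \<phi>"
proof -
  show "inj_on f (leafwise_fixed_points P \<omega>\<^sub>P graph (lift \<phi>))"
    by (rule inj_onI) (auto simp: leafwise_fixed_points_def graph_def intro: J_eqI)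
  show "f ` leafwise_fixed_points P \<omega>\<^sub>P graph (lift \<phi>) \<subseteq> leafwise_fixed_points M \<Omega> N \<phi>"
  proof
    fix p assume "p \<in> f ` leafwise_fixed_points P \<omega>\<^sub>P graph (lift \<phi>)"
    then obtain z where z: "z \<in> graph" "lift \<phi> z \<in> isotropic_leaf P \<omega>\<^sub>P graph z" "p = f z"
      by (auto simp: leafwise_fixed_points_def)
    note zP = graph_points[OF z(1)]
    note leaf = isotropic_leaf_graph[OF z(2)]
    have "fst (\<phi> (f z)) = fst (f z)"
      using leaf(1) z(1) f_lift[OF zP] g_lift[OF zP] by (simp add: graph_def)
    moreover have "(fst (f z), snd (\<phi> (f z))) \<in> isotropic_leaf M \<Omega> N (fst (f z), snd (f z))"
      using leaf(2) f_lift[OF zP] by (intro isotropic_leaf_N_I f1_points zP) simp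
    ultimately have "\<phi> (f z) \<in> isotropic_leaf M \<Omega> N (f z)" by (metis prod.collapse)
    then show "p \<in> leafwise_fixed_points M \<Omega> N \<phi>"
      using graph_f[OF z(1)] z(3) by (simp add: leafwise_fixed_points_def)
  qed
qed

lemma cardinality_leafwise_fixed_points_lift:
  "cardinality (leafwise_fixed_points P \<omega>\<^sub>P graph (lift \<phi>)) \<le> cardinality (leafwise_fixed_points M \<Omega> N \<phi>)"
proof (cases "finite (leafwise_fixed_points M \<Omega> N \<phi>)")
  case True
  then have "finite (leafwise_fixed_points P \<omega>\<^sub>P graph (lift \<phi>))"
    using leafwise_fixed_points_lift finite_imageD finite_subset by metis
  moreover have "card (leafwise_fixed_points P \<omega>\<^sub>P graph (lift \<phi>)) \<le> card (leafwise_fixed_points M \<Omega> N \<phi>)"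
    by (rule card_inj_on_le[OF leafwise_fixed_points_lift True])
  ultimately show ?thesis using True by (simp add: cardinality_def)
qed (simp add: cardinality_def)

text \<open>For a Lagrangian, non-degeneracy amounts to transversality. A nonzero common tangent
  vector \<open>v\<close> would give a vector of \<open>N\<close> on which holonomy and the
  differential of \<phi> agree; hence the assumptions on \<open>v\<close> are contradictory.\<close>

lemma nondegenerate_pair_lift:
  assumes nd: "nondegenerate_pair M \<Omega> N \<phi>"
  shows "nondegenerate_pair P \<omega>\<^sub>P graph (lift \<phi>)"
  unfolding nondegenerate_pair_def
proof (intro ballI allI impI, elim conjE)
  fix F x v
  assume F: "F \<in> isotropic_leaf P \<omega>\<^sub>P graph ` graph" and x: "smooth_path P F x" "lift \<phi> (x 0) = x 1"
    and v: "v \<in> sub_tangent P graph (x 0) \<inter> sub_tangent P {z \<in> points P. lift \<phi> z \<in> graph} (x 0)" "v \<noteq> (\<lambda>_. 0)"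
  obtain z where z: "z \<in> graph" "F = isotropic_leaf P \<omega>\<^sub>P graph z" using F by blast
  have xs: "smooth_map_on real_line {0..1} P x" and xF: "\<And>t. t \<in> {0..1} \<Longrightarrow> x t \<in> isotropic_leaf P \<omega>\<^sub>P graph z"
    using x(1) z(2) unfolding smooth_path_def by blast+
  have xG: "x t \<in> graph" and xl: "snd (f (x t)) \<in> isotropic_leaf M\<^sub>2 \<omega>\<^sub>2 L (snd (f z))" if "t \<in> {0..1}" for t
    using isotropic_leaf_graph[OF xF[OF that]] by auto
  \<comment> \<open>The path \<open>f (x t)\<close> may wander in \<open>M\<^sub>1\<close>, so it is
    not isotropic in \<open>N\<close> in general. Its end points share the first coordinate
    \<open>a\<close>, because \<open>lift\<close> preserves \<open>g\<close>; freezing that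
    coordinate yields a path in a leaf of \<open>N\<close>.\<close>
  define a where "a = g (x 0)"
  define b where "b t = snd (f (x t))" for t
  have x0G: "x 0 \<in> graph" and x1G: "x 1 \<in> graph" using xG by auto
  note x0P = graph_points[OF x0G] and x1P = graph_points[OF x1G]
  have a: "a \<in> points M\<^sub>1" unfolding a_def by (rule g_points[OF x0P])
  have fx0: "f (x 0) = (a, b 0)" using x0G by (simp add: graph_def a_def b_def prod_eq_iff)
  have "g (x 1) = a" using g_lift[OF x0P] x(2) by (simp add: a_def)
  then have fx1: "f (x 1) = (a, b 1)" using x1G by (simp add: graph_def b_def prod_eq_iff)
  have \<phi>ab: "\<phi> (a, b 0) = (a, b 1)" using f_lift[OF x0P] x(2) fx0 fx1 by simp
  have bs: "smooth_map_on real_line {0..1} M\<^sub>2 b"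
    unfolding b_def by (intro smooth_snd_comp smooth_f_comp xs smooth_atlas_real_line) simp
  have bL: "b t \<in> L" if "t \<in> {0..1}" for t using xG[OF that] by (simp add: b_def graph_def)
  have path_b: "smooth_path M\<^sub>2 L b" using bs bL by (auto simp: smooth_path_def)
  have l: "snd (f z) \<in> L" using z(1) by (simp add: graph_def)
  \<comment> \<open>The base point \<open>z\<close> of the given leaf may have another first
    coordinate than \<open>a\<close>, so the leaf of \<open>N\<close> is based at the corrected
    point.\<close>
  let ?F' = "isotropic_leaf M \<Omega> N (a, snd (f z))"
  have F': "?F' \<in> isotropic_leaf M \<Omega> N ` N" using a l by auto
  have "smooth_map_on real_line {0..1} M (\<lambda>t. (a, b t))"
    by (rule smooth_pair[OF atlas1 atlas2 smooth_map_on_const[OF smooth_atlas_real_line a] bs])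
  moreover have "(a, b t) \<in> ?F'" if "t \<in> {0..1}" for t
    using xl[OF that] by (intro isotropic_leaf_N_I[OF a]) (simp add: b_def)
  ultimately have path: "smooth_path M ?F' (\<lambda>t. (a, b t))" by (auto simp: smooth_path_def)
  define v' where "v' = df (x 0) v"
  have vT: "v \<in> Espace (mdim P)" "d1 (x 0) v = dg (x 0) v" "d2 (x 0) v \<in> sub_tangent M\<^sub>2 L (b 0)"
    using v(1) by (auto simp: sub_tangent_graph[OF x0G] b_def)
  have pN: "(a, b 0) \<in> N" "(a, b 1) \<in> N" using a bL by auto
  have v'N: "v' \<in> sub_tangent M N (a, b 0)"
    using vT(3) fx0 by (simp add: sub_tangent_N[OF pN(1)] v'_def d2_def differential_tangent flip: prod_manifold_simps)
  \<comment> \<open>Tangency to the graph ties the third component of \<open>v\<close> to the first,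
    so nothing is lost in applying \<open>df\<close>.\<close>
  have v'0: "v' \<noteq> (\<lambda>_. 0)"
  proof
    assume "v' = (\<lambda>_. 0)"
    then have "df (x 0) v = (\<lambda>_. 0)" "dg (x 0) v = (\<lambda>_. 0)" using vT(2) by (simp_all add: v'_def d1_def)
    then show False using tangent_P_zero[OF x0P vT(1)] v(2) by simp
  qed
  have "v \<in> sub_tangent P {z \<in> points P. lift \<phi> z \<in> graph} (x 0)" using v(1) by simp
  then obtain c where c: "smooth_map_on real_line UNIV P c" "\<And>s. c s \<in> {z \<in> points P. lift \<phi> z \<in> graph}" "c 0 = x 0" "velocity P UNIV c 0 = v"
    by (rule sub_tangentE) (rule that)
  have cP: "c s \<in> points P" and cG: "lift \<phi> (c s) \<in> graph" for s using c(2) by auto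
  have fc: "smooth_map_on real_line UNIV M (\<lambda>s. f (c s))"
    by (rule smooth_f_comp[OF smooth_atlas_real_line _ c(1)]) simp
  have vf: "velocity M UNIV (\<lambda>s. f (c s)) 0 = v'" using velocity_f[OF c(1), of 0] c by (simp add: v'_def)
  \<comment> \<open>That the lifted curve stays on the graph says two things. The first makes the
    image vector tangent to \<open>N\<close>; the second shows that the differential of \<phi>
    preserves the \<open>M\<^sub>1\<close> part of \<open>v'\<close>, as
    \<open>linear_holonomy_N\<close> requires.\<close>
  have \<phi>c: "\<phi> (f (c s)) \<in> N" "fst (\<phi> (f (c s))) = g (c s)" for s
    using graph_f[OF cG[of s]] cG[of s] f_lift[OF cP[of s]] g_lift[OF cP[of s]] by (auto simp: graph_def)
  have "velocity M UNIV (\<lambda>s. f (c s)) 0 \<in> sub_tangent M {p \<in> points M. \<phi> p \<in> N} (f (c 0))"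
    by (rule sub_tangentI[OF fc]) (use \<phi>c(1) f_points[OF cP] in blast)
  then have v'\<phi>: "v' \<in> sub_tangent M {p \<in> points M. \<phi> p \<in> N} (a, b 0)" using vf c(3) fx0 by simp
  define w where "w = differential M M \<phi> (a, b 0) v'"
  have \<phi>fc: "smooth_map_on real_line UNIV M (\<lambda>s. \<phi> (f (c s)))"
    by (rule smooth_map_on_compose[OF smooth_atlas_real_line atlas_M fc \<phi> f_points[OF cP]])
  have w: "velocity M UNIV (\<lambda>s. \<phi> (f (c s))) 0 = w"
    using differential_velocity[OF atlas_M atlas_M \<phi> openin_topspace fc f_points[OF cP]] vf c(3) fx0 by (simp add: w_def)
  have "velocity M UNIV (\<lambda>s. \<phi> (f (c s))) 0 \<in> sub_tangent M N (\<phi> (f (c 0)))"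
    by (rule sub_tangentI[OF \<phi>fc \<phi>c(1)])
  then have wN: "w \<in> sub_tangent M N (a, b 1)" using w c(3) fx0 \<phi>ab by simp
  have "dfst (a, b 1) w = velocity M\<^sub>1 UNIV (\<lambda>s. fst (\<phi> (f (c s)))) 0"
    using velocity_fst[OF \<phi>fc, of 0] w c(3) fx0 \<phi>ab by simp
  also have "\<dots> = velocity M\<^sub>1 UNIV (\<lambda>s. g (c s)) 0" by (simp only: \<phi>c(2))
  also have "\<dots> = dfst (a, b 0) v'"
    using velocity_g[OF c(1), of 0] c vT(2) fx0 by (simp add: d1_def v'_def)
  finally have "dfst (a, b 1) w = dfst (a, b 0) v'" .
  from linear_holonomy_N[OF a path_b v'N wN this]
  have "linear_holonomy M \<Omega> N (\<lambda>t. (a, b t)) (normal_proj M \<Omega> N (a, b 0) v') = normal_proj M \<Omega> N (a, b 1) (differential M M \<phi> (a, b 0) v')"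
    by (simp add: w_def)
  moreover have "linear_holonomy M \<Omega> N (\<lambda>t. (a, b t)) (normal_proj M \<Omega> N (a, b 0) v') \<noteq> normal_proj M \<Omega> N (a, b 1) (differential M M \<phi> (a, b 0) v')"
    using nd[unfolded nondegenerate_pair_def, rule_format, OF F', of "\<lambda>t. (a, b t)" v'] path \<phi>ab v'N v'\<phi> v'0 by simp
  ultimately show "linear_holonomy P \<omega>\<^sub>P graph x (normal_proj P \<omega>\<^sub>P graph (x 0) v)
      \<noteq> normal_proj P \<omega>\<^sub>P graph (x 1) (differential P P (lift \<phi>) (x 0) v)" by simp
qed

end

lemma diffeomorphism_lift:
  assumes \<phi>: "diffeomorphism M M \<phi>"
  shows "diffeomorphism P P (lift \<phi>)"
proof -
  obtain \<phi>' where \<phi>': "smooth_map_on M (points M) M \<phi>'" "\<And>x. x \<in> points M \<Longrightarrow> \<phi>' (\<phi> x) = x" "\<And>y. y \<in> points M \<Longrightarrow> \<phi> (\<phi>' y) = y"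
    using \<phi> unfolding diffeomorphism_def by metis
  have \<phi>s: "smooth_map_on M (points M) M \<phi>" using \<phi> by (simp add: diffeomorphism_def)
  have "lift \<phi>' (lift \<phi> z) = z" if z: "z \<in> points P" for z
    using \<phi>'(2)[OF f_points[OF z]] Jfg[OF z] by (simp add: lift_def[of \<phi>'] f_lift[OF \<phi>s z] g_lift[OF \<phi>s z])
  moreover have "lift \<phi> (lift \<phi>' z) = z" if z: "z \<in> points P" for z
    using \<phi>'(3)[OF f_points[OF z]] Jfg[OF z] by (simp add: lift_def[of \<phi>] f_lift[OF \<phi>'(1) z] g_lift[OF \<phi>'(1) z])
  ultimately show ?thesis
    unfolding diffeomorphism_def using smooth_lift[OF \<phi>s] smooth_lift[OF \<phi>'(1)] by blast
qed

text \<open>The Hamiltonian is composed with \<open>f\<close>. Its vector field has components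
  \<open>X\<close> and 0, because the form on \<open>P\<close> is a sum of terms in
  \<open>df\<close> and \<open>dg\<close>, and its flow moves the \<open>f\<close> component
  only.\<close>

lemma Ham_lift:
  assumes \<phi>: "\<phi> \<in> Ham M \<Omega>"
  shows "lift \<phi> \<in> Ham P \<omega>\<^sub>P"
proof -
  let ?RM = "prod_manifold real_line M" and ?RP = "prod_manifold real_line P"
  note RM = smooth_atlas_prod[OF smooth_atlas_real_line atlas_M]
  note RP = smooth_atlas_prod[OF smooth_atlas_real_line atlas_P]
  have dif: "diffeomorphism M M \<phi>" using \<phi> by (simp add: Ham_def)
  obtain H X \<Phi> where H: "smooth_map_on ?RM ({0..1} \<times> points M) real_line (\<lambda>p. H (fst p) (snd p))"
    and X: "\<And>t. t \<in> {0..1} \<Longrightarrow> hamiltonian_vector_field M \<Omega> (H t) (X t)"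
    and \<Phi>: "smooth_map_on ?RM ({0..1} \<times> points M) M (\<lambda>p. \<Phi> (fst p) (snd p))"
    and \<Phi>0: "\<And>x. x \<in> points M \<Longrightarrow> \<Phi> 0 x = x"
    and \<Phi>v: "\<And>x t. x \<in> points M \<Longrightarrow> t \<in> {0..1} \<Longrightarrow> velocity M {0..1} (\<lambda>s. \<Phi> s x) t = X t (\<Phi> t x)"
    and \<Phi>1: "\<And>x. x \<in> points M \<Longrightarrow> \<phi> x = \<Phi> 1 x"
    using \<phi> unfolding Ham_def by blast
  have \<Phi>p: "\<Phi> t x \<in> points M" if "t \<in> {0..1}" "x \<in> points M" for t x
    using smooth_map_onD_points[OF \<Phi>, of "(t, x)"] that by simp
  \<comment> \<open>The vector with components \<open>X t (f z)\<close> and 0: it exists by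
    \<open>tangent_P_exists\<close> and is determined by these components.\<close>
  define X' where "X' t z = (SOME v. v \<in> Espace (mdim P) \<and> df z v = X t (f z) \<and> dg z v = (\<lambda>_. 0))" for t z
  have X': "X' t z \<in> Espace (mdim P) \<and> df z (X' t z) = X t (f z) \<and> dg z (X' t z) = (\<lambda>_. 0)"
    if t: "t \<in> {0..1}" and z: "z \<in> points P" for t z
  proof -
    have "X t (f z) \<in> Espace (mdim M)"
      using X[OF t] f_points[OF z] unfolding hamiltonian_vector_field_def tangent_space_def by blast
    then obtain v where "v \<in> Espace (mdim P)" "df z v = X t (f z)" "dg z v = (\<lambda>_. 0)"
      by (rule tangent_P_exists[OF z _ zero_Espace]) (rule that)
    then show ?thesis
      unfolding X'_def by (intro someI[where P = "\<lambda>v. v \<in> Espace (mdim P) \<and> df z v = X t (f z) \<and> dg z v = (\<lambda>_. 0)"]) simp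
  qed
  have pr: "smooth_map_on ?RP ({0..1} \<times> points P) ?RM (\<lambda>p. (fst p, f (snd p)))"
    using smooth_snd[OF smooth_atlas_real_line atlas_P]
    by (intro smooth_pair[OF smooth_atlas_real_line atlas_M smooth_fst[OF smooth_atlas_real_line atlas_P]] smooth_f_comp[OF RP]) auto
  have slice: "smooth_map_on M (points M) ?RM (\<lambda>x. (t, x))" for t
    by (intro smooth_pair smooth_map_on_const smooth_map_on_id atlas_M smooth_atlas_real_line) simp
  have "smooth_map_on ?RP ({0..1} \<times> points P) real_line (\<lambda>p. H (fst p) (f (snd p)))"
    using smooth_map_on_compose[OF RP RM pr H] f_points by auto
  moreover have "hamiltonian_vector_field P \<omega>\<^sub>P (\<lambda>z. H t (f z)) (X' t)" if t: "t \<in> {0..1}" for t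
    unfolding hamiltonian_vector_field_def tangent_space_def
  proof (intro ballI conjI)
    fix z assume z: "z \<in> points P"
    note X'z = X'[OF t z]
    show "X' t z \<in> Espace (mdim P)" using X'z by simp
    fix w assume w: "w \<in> Espace (mdim P)"
    have Ht: "smooth_map_on M (points M) real_line (H t)"
      using smooth_map_on_compose[OF atlas_M RM slice[of t] H] t by auto
    have "differential P real_line (\<lambda>z. H t (f z)) z w 0 = differential M real_line (H t) (f z) (df z w) 0"
      by (simp only: differential_chain[OF atlas_P atlas_M smooth_atlas_real_line fs openin_topspace Ht openin_topspace f_points z w])
    also have "\<dots> = \<Omega> (f z) (X t (f z)) (df z w)"
      using X[OF t] f_points[OF z] differential_tangent[of P M f z w]
      unfolding hamiltonian_vector_field_def tangent_space_def by blast
    also have "\<dots> = \<omega>\<^sub>P z (X' t z) w"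
      using X'z w form_zero_left[OF form1 g_points[OF z] differential_tangent[of P M\<^sub>1 g z w]]
      by (simp add: form_P[OF z])
    finally show "differential P real_line (\<lambda>z. H t (f z)) z w 0 = \<omega>\<^sub>P z (X' t z) w" .
  qed
  moreover have "smooth_map_on ?RP ({0..1} \<times> points P) P (\<lambda>p. J (\<Phi> (fst p) (f (snd p)), g (snd p)))"
  proof (rule smooth_J_comp[OF RP])
    show "smooth_map_on ?RP ({0..1} \<times> points P) M (\<lambda>p. \<Phi> (fst p) (f (snd p)))"
      using smooth_map_on_compose[OF RP RM pr \<Phi>] f_points by auto
    show "smooth_map_on ?RP ({0..1} \<times> points P) M\<^sub>1 (\<lambda>p. g (snd p))"
      by (rule smooth_g_comp[OF RP _ smooth_snd[OF smooth_atlas_real_line atlas_P]]) auto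
  qed auto
  moreover have "J (\<Phi> 0 (f z), g z) = z" if z: "z \<in> points P" for z
    using \<Phi>0[OF f_points[OF z]] Jfg[OF z] by simp
  moreover have "velocity P {0..1} (\<lambda>s. J (\<Phi> s (f z), g z)) t = X' t (J (\<Phi> t (f z), g z))"
    if z: "z \<in> points P" and t: "t \<in> {0..1}" for z t
  proof -
    let ?c = "\<lambda>s. J (\<Phi> s (f z), g z)"
    note nt = at_within_unit_interval[OF t]
    have "smooth_map_on real_line {0..1} ?RM (\<lambda>s. (s, f z))"
      by (intro smooth_pair smooth_map_on_const smooth_map_on_id atlas_M smooth_atlas_real_line f_points z)
    from smooth_map_on_compose[OF smooth_atlas_real_line RM this \<Phi>] f_points[OF z]
    have \<Phi>z: "smooth_map_on real_line {0..1} M (\<lambda>s. \<Phi> s (f z))" by auto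
    have cs: "smooth_map_on real_line {0..1} P ?c"
      by (intro smooth_J_comp[OF smooth_atlas_real_line _ \<Phi>z] smooth_map_on_const smooth_atlas_real_line g_points z) simp
    have fc: "f (?c s) = \<Phi> s (f z)" and gc: "g (?c s) = g z" and cP: "?c s \<in> points P" if "s \<in> {0..1}" for s
      using fJ gJ J_points \<Phi>p[OF that f_points[OF z]] g_points[OF z] by auto
    have "df (?c t) (velocity P {0..1} ?c t) = velocity M {0..1} (\<lambda>s. f (?c s)) t"
      by (rule velocity_f[OF cs t nt, symmetric])
    \<comment> \<open>The equation behind this, \<open>f (?c s) = \<Phi> s (f z)\<close>, is known
      for times in \<open>[0,1]\<close> only; velocities within the interval respect it.\<close>
    also have "\<dots> = velocity M {0..1} (\<lambda>s. \<Phi> s (f z)) t"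
      by (rule velocity_cong[OF atlas_M \<Phi>z t nt fc[symmetric]])
    also have "\<dots> = X t (f (?c t))" using \<Phi>v[OF f_points[OF z] t] fc[OF t] by simp
    finally have 1: "df (?c t) (velocity P {0..1} ?c t) = df (?c t) (X' t (?c t))"
      using X'[OF t cP[OF t]] by simp
    have "dg (?c t) (velocity P {0..1} ?c t) = velocity M\<^sub>1 {0..1} (\<lambda>s. g (?c s)) t"
      by (rule velocity_g[OF cs t nt, symmetric])
    also have "\<dots> = velocity M\<^sub>1 {0..1} (\<lambda>s. g z) t"
      by (rule velocity_cong[OF atlas1 smooth_map_on_const[OF smooth_atlas_real_line g_points[OF z]] t nt gc[symmetric]])
    also have "\<dots> = (\<lambda>_. 0)" by (rule velocity_const[OF nt])
    finally have 2: "dg (?c t) (velocity P {0..1} ?c t) = dg (?c t) (X' t (?c t))"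
      using X'[OF t cP[OF t]] by simp
    show ?thesis
      using X'[OF t cP[OF t]] by (intro tangent_P_eqI[OF cP[OF t] velocity_tangent _ 1 2]) simp
  qed
  moreover have "lift \<phi> z = J (\<Phi> 1 (f z), g z)" if z: "z \<in> points P" for z
    using \<Phi>1[OF f_points[OF z]] by (simp add: lift_def)
  ultimately show ?thesis
    unfolding Ham_def using diffeomorphism_lift[OF dif]
    by (intro CollectI conjI exI[of _ "\<lambda>t z. H t (f z)"] exI[of _ X'] exI[of _ "\<lambda>t z. J (\<Phi> t (f z), g z)"]) auto
qed

lemma graph_homeomorphic:
  "homeomorphic_maps (subtopology (mtop P) graph) (subtopology (mtop M) N) f (\<lambda>p. J (p, fst p))"
  unfolding homeomorphic_maps_def
proof (intro conjI ballI)
  show "continuous_map (subtopology (mtop P) graph) (subtopology (mtop M) N) f"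
    unfolding continuous_map_in_subtopology
    using fs graph_f by (auto simp: smooth_map_on_def intro: continuous_map_from_subtopology simp del: prod_manifold_simps)
  have "smooth_map_on M (points M) P (\<lambda>p. J (p, fst p))"
    by (intro smooth_J_comp atlas_M subset_refl smooth_map_on_id smooth_fst atlas1 atlas2)
  then have "continuous_map (mtop M) (mtop P) (\<lambda>p. J (p, fst p))" by (rule smooth_map_continuous)
  moreover have "J (p, fst p) \<in> graph" if "p \<in> N" for p
    using that J_graph[of "fst p" "snd p"] by auto
  ultimately show "continuous_map (subtopology (mtop M) N) (subtopology (mtop P) graph) (\<lambda>p. J (p, fst p))"
    unfolding continuous_map_in_subtopology by (auto intro: continuous_map_from_subtopology simp del: prod_manifold_simps)
  show "J (f z, fst (f z)) = z" if "z \<in> topspace (subtopology (mtop P) graph)" for z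
    using that Jfg[of z] by (auto simp: graph_def)
  show "f (J (p, fst p)) = p" if "p \<in> topspace (subtopology (mtop M) N)" for p
    using that N_points[of p] by (intro fJ) auto
qed

end

text \<open>An adapted chart uses the coordinates of the first copy of \<open>M\<^sub>1\<close>,
  coordinates of \<open>M\<^sub>2\<close> adapted to \<open>L\<close>, and the difference of the
  coordinates of the two copies of \<open>M\<^sub>1\<close>.\<close>

lemma (in graph_construction) embedded_graph:
  assumes dim: "mdim P = mdim M + mdim M\<^sub>1"
  shows "embedded_submanifold P (mdim M\<^sub>1 + k) graph"
  unfolding embedded_submanifold_def
proof (intro conjI ballI)
  let ?m = "mdim M\<^sub>1" and ?n = "mdim M\<^sub>2" and ?d = "mdim P"
  have embL: "embedded_submanifold M\<^sub>2 k L" using lagrangian_L by (simp add: lagrangian_submanifold_def)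
  then have k: "k \<le> ?n" by (simp add: embedded_submanifold_def)
  have d: "?d = ?m + (?n + ?m)" using dim by simp
  show "graph \<subseteq> points P" using graph_points by auto
  show "?m + k \<le> ?d" using k d by simp
  fix z0 assume z0: "z0 \<in> graph"
  note z0P = graph_points[OF z0]
  \<comment> \<open>A single chart serves both copies of \<open>M\<^sub>1\<close>, since
    \<open>fst (f z0) = g z0\<close>; only so do coordinate differences detect equality.\<close>
  obtain C1 where C1: "C1 \<in> atlas M\<^sub>1" "g z0 \<in> fst C1" using atlas_cover[OF atlas1 g_points[OF z0P]] by blast
  have "snd (f z0) \<in> L" using z0 by (simp add: graph_def)
  then obtain C2 where C2: "C2 \<in> maximal_atlas M\<^sub>2" "snd (f z0) \<in> fst C2"
    "snd C2 ` (fst C2 \<inter> L) = snd C2 ` fst C2 \<inter> Espace k"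
    using embL unfolding embedded_submanifold_def by blast
  note C1m = maximal_atlasD[OF atlas1 atlas_maximal[OF atlas1 C1(1)]] and C2m = maximal_atlasD[OF atlas2 C2(1)]
  note t1 = C1m(1) and t2 = C2m(1)
  \<comment> \<open>The order of the blocks matters: with the difference last, the graph is where
    all coordinates from \<open>?m + k\<close> on vanish.\<close>
  define \<kappa> where "\<kappa> z = vec_append ?m (snd C1 (fst (f z)))
    (vec_append ?n (snd C2 (snd (f z))) (\<lambda>i. snd C1 (g z) i - snd C1 (fst (f z)) i))" for z
  define D where "D = {z \<in> points P. fst (f z) \<in> fst C1} \<inter> {z \<in> points P. snd (f z) \<in> fst C2} \<inter> {z \<in> points P. g z \<in> fst C1}"
  define K where "K = (D, \<kappa>)"
  define y1 where "y1 y = vec_take ?m y" for y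
  define y2 where "y2 y = vec_take ?n (vec_drop ?m y)" for y
  \<comment> \<open>The last block stores a difference, so the first block is added back to recover
    the coordinates of the second copy.\<close>
  define y3 where "y3 y = (\<lambda>i. vec_drop ?n (vec_drop ?m y) i + vec_take ?m y i)" for y
  define \<eta> where "\<eta> y = J ((chart_inv C1 (y1 y), chart_inv C2 (y2 y)), chart_inv C1 (y3 y))" for y
  define W where "W = {y \<in> Espace ?d. y1 y \<in> snd C1 ` fst C1} \<inter> {y \<in> Espace ?d. y2 y \<in> snd C2 ` fst C2}
    \<inter> {y \<in> Espace ?d. y3 y \<in> snd C1 ` fst C1}"
  have f1s: "smooth_map_on P U M\<^sub>1 (\<lambda>z. fst (f z))" and f2s: "smooth_map_on P U M\<^sub>2 (\<lambda>z. snd (f z))"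
    and gs': "smooth_map_on P U M\<^sub>1 g" if "U \<subseteq> points P" for U
    using smooth_fst_comp[OF atlas_P smooth_map_on_subset[OF fs that]] smooth_snd_comp[OF atlas_P smooth_map_on_subset[OF fs that]]
      smooth_map_on_subset[OF gs that] by auto
  have ys: "smooth_map_on (vec_manifold ?d) U (vec_manifold ?m) y1"
    "smooth_map_on (vec_manifold ?d) U (vec_manifold ?n) y2"
    "smooth_map_on (vec_manifold ?d) U (vec_manifold ?m) y3" if U: "U \<subseteq> Espace ?d" for U
  proof -
    show "smooth_map_on (vec_manifold ?d) U (vec_manifold ?m) y1"
      by (rule smooth_vecI[OF smooth_atlas_vec_manifold]) (use U in \<open>auto simp: y1_def vec_take_def mem_Espace intro: smooth_coord\<close>)
    show "smooth_map_on (vec_manifold ?d) U (vec_manifold ?n) y2"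
      by (rule smooth_vecI[OF smooth_atlas_vec_manifold])
        (use U in \<open>auto simp: y2_def vec_take_def vec_drop_def mem_Espace intro: smooth_coord\<close>)
    show "smooth_map_on (vec_manifold ?d) U (vec_manifold ?m) y3"
    proof (rule smooth_vecI[OF smooth_atlas_vec_manifold])
      show "y3 y \<in> Espace ?m" if "y \<in> U" for y
        using that U by (auto simp: y3_def vec_take_def vec_drop_def mem_Espace d)
      show "smooth_map_on (vec_manifold ?d) U real_line (\<lambda>y. y3 y i)" if "i < ?m" for i
        using that U unfolding y3_def vec_take_def vec_drop_def
        by (auto intro!: smooth_real_add smooth_atlas_vec_manifold smooth_coord)
    qed
  qed
  have W: "openin (Euclidean_space ?d) W"
    unfolding W_def using ys[OF subset_refl, THEN smooth_map_continuous[where K = "vec_manifold ?d", simplified]]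
      chart_open(2)[OF t1] chart_open(2)[OF t2]
    by (intro openin_Int openin_continuous_map_preimage) auto
  have WE: "W \<subseteq> Espace ?d" by (auto simp: W_def)
  have Dp: "D \<subseteq> points P" by (auto simp: D_def)
  have Dopen: "openin (mtop P) D"
    unfolding D_def
    using f1s[OF subset_refl, THEN smooth_map_continuous] f2s[OF subset_refl, THEN smooth_map_continuous] smooth_map_continuous[OF gs]
      chart_open(1)[OF t1] chart_open(1)[OF t2]
    by (intro openin_Int openin_continuous_map_preimage) auto
  have E1: "snd C1 (fst (f z)) \<in> Espace ?m" and E2: "snd C2 (snd (f z)) \<in> Espace ?n" and E3: "snd C1 (g z) \<in> Espace ?m"
    if "z \<in> D" for z
    using that chart_in_Espace[OF t1] chart_in_Espace[OF t2] by (auto simp: D_def)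
  have \<kappa>E: "\<kappa> z \<in> Espace ?d" if "z \<in> D" for z
    unfolding \<kappa>_def d using E1[OF that] E3[OF that] by (intro vec_append_Espace) (simp add: mem_Espace)
  have y\<kappa>: "y1 (\<kappa> z) = snd C1 (fst (f z))" "y2 (\<kappa> z) = snd C2 (snd (f z))" "y3 (\<kappa> z) = snd C1 (g z)" if "z \<in> D" for z
    using E1[OF that] E2[OF that] by (simp_all add: y1_def y2_def y3_def \<kappa>_def vec_take_append)
  have \<kappa>W: "\<kappa> z \<in> W" if "z \<in> D" for z
    using \<kappa>E[OF that] y\<kappa>[OF that] that by (auto simp: W_def D_def)
  have \<eta>\<kappa>: "\<eta> (\<kappa> z) = z" if "z \<in> D" for z
    using that Jfg[of z] unfolding \<eta>_def y\<kappa>[OF that] by (auto simp: D_def chart_inv_left[OF t1] chart_inv_left[OF t2])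
  have f\<eta>: "f (\<eta> y) = (chart_inv C1 (y1 y), chart_inv C2 (y2 y))" "g (\<eta> y) = chart_inv C1 (y3 y)" "\<eta> y \<in> D" if "y \<in> W" for y
  proof -
    have in1: "chart_inv C1 (y1 y) \<in> fst C1" and in2: "chart_inv C2 (y2 y) \<in> fst C2" and in3: "chart_inv C1 (y3 y) \<in> fst C1"
      using that chart_inv_into[OF t1] chart_inv_into[OF t2] by (auto simp: W_def)
    then have p: "(chart_inv C1 (y1 y), chart_inv C2 (y2 y)) \<in> points M" "chart_inv C1 (y3 y) \<in> points M\<^sub>1"
      using chart_in_points[OF t1] chart_in_points[OF t2] by auto
    show 1: "f (\<eta> y) = (chart_inv C1 (y1 y), chart_inv C2 (y2 y))" and 2: "g (\<eta> y) = chart_inv C1 (y3 y)"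
      unfolding \<eta>_def by (rule fJ[OF p] gJ[OF p])+
    have "\<eta> y \<in> points P" unfolding \<eta>_def by (rule J_points[OF p])
    then show "\<eta> y \<in> D" using 1 2 in1 in2 in3 by (simp add: D_def)
  qed
  have \<kappa>\<eta>: "\<kappa> (\<eta> y) = y" if y: "y \<in> W" for y
  proof -
    have "y1 y \<in> snd C1 ` fst C1" "y2 y \<in> snd C2 ` fst C2" "y3 y \<in> snd C1 ` fst C1" using y by (auto simp: W_def)
    then have "\<kappa> (\<eta> y) = vec_append ?m (y1 y) (vec_append ?n (y2 y) (\<lambda>i. y3 y i - y1 y i))"
      unfolding \<kappa>_def f\<eta>[OF y] by (simp add: chart_inv_right[OF t1] chart_inv_right[OF t2])
    also have "(\<lambda>i. y3 y i - y1 y i) = vec_drop ?n (vec_drop ?m y)" by (simp add: y3_def y1_def)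
    finally show ?thesis by (simp add: y1_def y2_def)
  qed
  have range: "snd K ` fst K = W"
    using \<kappa>W \<kappa>\<eta> f\<eta>(3) by (force simp: K_def)
  have Ks: "smooth_map_on P D (vec_manifold ?d) \<kappa>"
  proof (rule smooth_vecI[OF atlas_P \<kappa>E])
    have c1: "smooth_map_on P D real_line (\<lambda>z. snd C1 (fst (f z)) i)" for i
      by (rule smooth_vec_component[OF atlas_P smooth_map_on_compose[OF atlas_P atlas1 f1s[OF Dp] C1m(2)] Dp]) (simp add: D_def)
    have c2: "smooth_map_on P D real_line (\<lambda>z. snd C2 (snd (f z)) i)" for i
      by (rule smooth_vec_component[OF atlas_P smooth_map_on_compose[OF atlas_P atlas2 f2s[OF Dp] C2m(2)] Dp]) (simp add: D_def)
    have c3: "smooth_map_on P D real_line (\<lambda>z. snd C1 (g z) i)" for i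
      by (rule smooth_vec_component[OF atlas_P smooth_map_on_compose[OF atlas_P atlas1 gs'[OF Dp] C1m(2)] Dp]) (simp add: D_def)
    show "smooth_map_on P D real_line (\<lambda>z. \<kappa> z i)" for i
      using c1 c2 smooth_real_add[OF atlas_P c3 smooth_real_minus[OF atlas_P c1]]
      by (cases "i < ?m"; cases "i - ?m < ?n"; simp add: \<kappa>_def vec_append_def)
  qed auto
  have \<eta>s: "smooth_map_on (vec_manifold ?d) W P \<eta>"
    unfolding \<eta>_def
    by (intro smooth_J_comp[OF smooth_atlas_vec_manifold] smooth_pair[OF atlas1 atlas2]
        smooth_map_on_compose[OF smooth_atlas_vec_manifold smooth_atlas_vec_manifold ys(1)[OF WE] C1m(3)]
        smooth_map_on_compose[OF smooth_atlas_vec_manifold smooth_atlas_vec_manifold ys(2)[OF WE] C2m(3)]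
        smooth_map_on_compose[OF smooth_atlas_vec_manifold smooth_atlas_vec_manifold ys(3)[OF WE] C1m(3)])
      (use WE in \<open>auto simp: W_def\<close>)
  have tK: "topological_chart (mtop P) ?d K"
  proof (rule topological_chartI[where h = \<eta>])
    show "openin (mtop P) (fst K)" using Dopen by (simp add: K_def)
    show "openin (Euclidean_space ?d) (snd K ` fst K)" using W by (simp add: range)
    show "continuous_map (subtopology (mtop P) (fst K)) (Euclidean_space ?d) (snd K)"
      using Ks by (simp add: smooth_map_on_def K_def)
    show "continuous_map (subtopology (Euclidean_space ?d) (snd K ` fst K)) (mtop P) \<eta>"
      using \<eta>s by (simp add: smooth_map_on_def range)
    show "\<eta> (snd K x) = x" if "x \<in> fst K" for x using that \<eta>\<kappa> by (simp add: K_def)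
  qed
  have inv: "chart_inv K y = \<eta> y" if "y \<in> W" for y
    by (rule chart_inv_eqI[OF chart_inj[OF tK]]) (use f\<eta>(3)[OF that] \<kappa>\<eta>[OF that] in \<open>simp_all add: K_def\<close>)
  have "K \<in> maximal_atlas P"
  proof (rule maximal_atlasI[OF atlas_P tK])
    show "smooth_map_on P (fst K) (vec_manifold ?d) (snd K)" using Ks by (simp add: K_def)
    show "smooth_map_on (vec_manifold ?d) (snd K ` fst K) P (chart_inv K)"
      unfolding range by (rule smooth_map_on_cong[OF \<eta>s _ smooth_atlas_vec_manifold]) (simp add: inv)
  qed
  moreover have "z0 \<in> fst K"
    using C1(2) C2(2) z0 z0P by (simp add: K_def D_def graph_def)
  moreover have "snd K ` (fst K \<inter> graph) = snd K ` fst K \<inter> Espace (?m + k)"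
  proof -
    have "\<kappa> z \<in> Espace (?m + k) \<longleftrightarrow> z \<in> graph" if z: "z \<in> D" for z
    proof -
      have zD: "fst (f z) \<in> fst C1" "snd (f z) \<in> fst C2" "g z \<in> fst C1" "z \<in> points P" using z by (auto simp: D_def)
      have L_iff: "snd C2 (snd (f z)) \<in> Espace k \<longleftrightarrow> snd (f z) \<in> L"
      proof
        assume "snd C2 (snd (f z)) \<in> Espace k"
        then have "snd C2 (snd (f z)) \<in> snd C2 ` (fst C2 \<inter> L)" using C2(3) zD(2) by blast
        then show "snd (f z) \<in> L" using chart_inj[OF t2] zD(2) by (auto dest: inj_onD)
      next
        assume "snd (f z) \<in> L"
        then show "snd C2 (snd (f z)) \<in> Espace k" using C2(3) zD(2) by blast
      qed
      have fg_iff: "snd C1 (g z) = snd C1 (fst (f z)) \<longleftrightarrow> fst (f z) = g z"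
        using chart_inj[OF t1] zD(1,3) by (auto dest: inj_onD)
      have "\<kappa> z \<in> Espace (?m + k) \<longleftrightarrow> snd C2 (snd (f z)) \<in> Espace k \<and> snd C1 (g z) = snd C1 (fst (f z))"
      proof
        assume \<kappa>: "\<kappa> z \<in> Espace (?m + k)"
        have "snd C2 (snd (f z)) i = 0" if "k \<le> i" for i
        proof (cases "i < ?n")
          case True
          then show ?thesis using EspaceD[OF \<kappa>, of "?m + i"] that by (simp add: \<kappa>_def vec_append_def)
        next
          case False
          then show ?thesis using E2[OF z] by (simp add: mem_Espace)
        qed
        \<comment> \<open>As \<open>k\<close> is at most the dimension of \<open>M\<^sub>2\<close>,
          the whole difference block lies at or beyond index \<open>?m + k\<close>.\<close>
        moreover have "snd C1 (g z) i = snd C1 (fst (f z)) i" for i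
          using EspaceD[OF \<kappa>, of "?m + (?n + i)"] k by (simp add: \<kappa>_def vec_append_def)
        ultimately show "snd C2 (snd (f z)) \<in> Espace k \<and> snd C1 (g z) = snd C1 (fst (f z))"
          by (auto simp: mem_Espace)
      next
        assume "snd C2 (snd (f z)) \<in> Espace k \<and> snd C1 (g z) = snd C1 (fst (f z))"
        then show "\<kappa> z \<in> Espace (?m + k)" by (auto simp: mem_Espace \<kappa>_def vec_append_def)
      qed
      then show ?thesis using L_iff fg_iff zD(4) by (simp add: graph_def)
    qed
    then show ?thesis by (auto simp: K_def)
  qed
  ultimately show "\<exists>C\<in>maximal_atlas P. z0 \<in> fst C \<and> snd C ` (fst C \<inter> graph) = snd C ` fst C \<inter> Espace (?m + k)"
    by blast
qed

lemma (in graph_construction) lagrangian_graph: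
  "mdim P = mdim M + mdim M\<^sub>1 \<Longrightarrow> lagrangian_submanifold P \<omega>\<^sub>P (mdim M\<^sub>1 + k) graph"
  unfolding lagrangian_submanifold_def by (intro conjI ballI embedded_graph complement_graph)

lemma (in graph_construction) compact_graph:
  assumes "compact_space (mtop M\<^sub>1)" "compactin (mtop M\<^sub>2) L"
  shows "compactin (mtop P) graph"
proof -
  have "compactin (mtop M) N" using assms by (simp add: compactin_Times compact_space_def)
  then have "compactin (subtopology (mtop M) N) N" by (simp add: compactin_subtopology)
  moreover have cont: "continuous_map (subtopology (mtop M) N) (subtopology (mtop P) graph) (\<lambda>p. J (p, fst p))"
    using graph_homeomorphic unfolding homeomorphic_maps_def by blast
  ultimately have "compactin (subtopology (mtop P) graph) ((\<lambda>p. J (p, fst p)) ` N)" by (rule image_compactin)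
  moreover have "(\<lambda>p. J (p, fst p)) ` N = graph"
  proof (intro equalityI subsetI)
    fix z assume z: "z \<in> graph"
    then have "z = J (f z, fst (f z))" using Jfg[of z] by (simp add: graph_def)
    then show "z \<in> (\<lambda>p. J (p, fst p)) ` N" by (rule image_eqI[OF _ graph_f[OF z]])
  next
    fix z assume "z \<in> (\<lambda>p. J (p, fst p)) ` N"
    then show "z \<in> graph" using J_graph by auto
  qed
  ultimately show ?thesis by (simp add: compactin_subtopology)
qed

definition (in graph_construction) reflection :: "('b \<Rightarrow> 'b) \<Rightarrow> 'p \<Rightarrow> 'p" where
  "reflection \<psi> z = J ((g z, \<psi> (snd (f z))), fst (f z))"

text \<open>The exchange of the two \<open>M\<^sub>1\<close> components swaps two terms of opposite
  sign, and \<open>\<psi>\<close> changes the sign of the middle term, so the form is negated. A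
  point is fixed when its \<open>M\<^sub>1\<close> components agree and \<psi> fixes its middle
  component.\<close>

lemma (in graph_construction) reflection:
  assumes \<psi>: "antisymplectic_involution M\<^sub>2 \<omega>\<^sub>2 \<psi>"
  shows "antisymplectic_involution P \<omega>\<^sub>P (reflection \<psi>)"
    and "{x \<in> points M\<^sub>2. \<psi> x = x} = L \<Longrightarrow> {z \<in> points P. reflection \<psi> z = z} = graph"
proof -
  have \<psi>s: "smooth_map_on M\<^sub>2 (points M\<^sub>2) M\<^sub>2 \<psi>" and \<psi>2: "\<And>x. x \<in> points M\<^sub>2 \<Longrightarrow> \<psi> (\<psi> x) = x"
    and \<psi>form: "\<And>x v w. x \<in> points M\<^sub>2 \<Longrightarrow> v \<in> Espace (mdim M\<^sub>2) \<Longrightarrow> w \<in> Espace (mdim M\<^sub>2) \<Longrightarrow>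
      \<omega>\<^sub>2 (\<psi> x) (differential M\<^sub>2 M\<^sub>2 \<psi> x v) (differential M\<^sub>2 M\<^sub>2 \<psi> x w) = - \<omega>\<^sub>2 x v w"
    using \<psi> unfolding antisymplectic_involution_def diffeomorphism_def tangent_space_def by blast+
  note \<psi>p = smooth_map_onD_points[OF \<psi>s]
  have pts: "(g z, \<psi> (snd (f z))) \<in> points M" if "z \<in> points P" for z
    using g_points[OF that] \<psi>p f2_points[OF that] by simp
  have fr: "f (reflection \<psi> z) = (g z, \<psi> (snd (f z)))" and gr: "g (reflection \<psi> z) = fst (f z)"
    and rP: "reflection \<psi> z \<in> points P" if "z \<in> points P" for z
    unfolding reflection_def using pts[OF that] f1_points[OF that] by (intro fJ gJ J_points; simp)+
  have rs: "smooth_map_on P (points P) P (reflection \<psi>)"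
    unfolding reflection_def
    by (intro smooth_J_comp[OF atlas_P subset_refl] smooth_pair[OF atlas1 atlas2] gs smooth_fst_comp[OF atlas_P fs]
        smooth_map_on_compose[OF atlas_P atlas2 smooth_snd_comp[OF atlas_P fs] \<psi>s] f2_points)
  have rr: "reflection \<psi> (reflection \<psi> z) = z" if z: "z \<in> points P" for z
  proof (rule J_eqI[OF rP[OF rP[OF z]] z])
    show "f (reflection \<psi> (reflection \<psi> z)) = f z"
      using fr[OF rP[OF z]] fr[OF z] gr[OF z] \<psi>2 f2_points[OF z] by (simp add: prod_eq_iff)
    show "g (reflection \<psi> (reflection \<psi> z)) = g z"
      using gr[OF rP[OF z]] fr[OF z] by simp
  qed
  have "diffeomorphism P P (reflection \<psi>)"
    unfolding diffeomorphism_def using rs rr by blast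
  moreover have "\<omega>\<^sub>P (reflection \<psi> z) (differential P P (reflection \<psi>) z v) (differential P P (reflection \<psi>) z w) = - \<omega>\<^sub>P z v w"
    if z: "z \<in> points P" and v: "v \<in> Espace (mdim P)" and w: "w \<in> Espace (mdim P)" for z v w
  proof -
    let ?r = "differential P P (reflection \<psi>) z"
    \<comment> \<open>The differential is read off along a curve, on which the reflection exchanges
      the two \<open>M\<^sub>1\<close> components and applies \<psi> to the third.\<close>
    have parts: "d1 (reflection \<psi> z) (?r v) = dg z v" "d2 (reflection \<psi> z) (?r v) = differential M\<^sub>2 M\<^sub>2 \<psi> (snd (f z)) (d2 z v)"
      "dg (reflection \<psi> z) (?r v) = d1 z v" if v: "v \<in> Espace (mdim P)" for v
    proof -
      obtain c where c: "smooth_map_on real_line UNIV P c" "\<And>s. c s \<in> points P" "c 0 = z" "velocity P UNIV c 0 = v"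
        by (rule exists_curve[OF atlas_P openin_topspace z v]) (rule that)
      let ?e = "\<lambda>s. reflection \<psi> (c s)"
      have e: "smooth_map_on real_line UNIV P ?e"
        by (rule smooth_map_on_compose[OF smooth_atlas_real_line atlas_P c(1) rs c(2)])
      have ve: "velocity P UNIV ?e 0 = ?r v"
        using differential_velocity[OF atlas_P atlas_P rs openin_topspace c(1) c(2)] c(3,4) by simp
      have "(\<lambda>s. fst (f (?e s))) = (\<lambda>s. g (c s))" "(\<lambda>s. g (?e s)) = (\<lambda>s. fst (f (c s)))"
        "(\<lambda>s. snd (f (?e s))) = (\<lambda>s. \<psi> (snd (f (c s))))"
        using fr[OF c(2)] gr[OF c(2)] by auto
      note eqs = this
      show "d1 (reflection \<psi> z) (?r v) = dg z v"
        using velocity_f1[OF e, of 0] velocity_g[OF c(1), of 0] ve c(3,4) eqs(1) by simp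
      show "dg (reflection \<psi> z) (?r v) = d1 z v"
        using velocity_g[OF e, of 0] velocity_f1[OF c(1), of 0] ve c(3,4) eqs(2) by simp
      have f2c: "smooth_map_on real_line UNIV M\<^sub>2 (\<lambda>s. snd (f (c s)))"
        by (intro smooth_snd_comp smooth_f_comp c(1) smooth_atlas_real_line) simp
      show "d2 (reflection \<psi> z) (?r v) = differential M\<^sub>2 M\<^sub>2 \<psi> (snd (f z)) (d2 z v)"
        using velocity_f2[OF e, of 0] velocity_f2[OF c(1), of 0] ve c(3,4) eqs(3)
          differential_velocity[OF atlas2 atlas2 \<psi>s openin_topspace f2c f2_points[OF c(2)]] by simp
    qed
    show ?thesis
      unfolding form_P_eq[OF rP[OF z] differential_tangent differential_tangent] form_P_eq[OF z v w] parts[OF v] parts[OF w]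
      using \<psi>form[OF f2_points[OF z] d2_tangent d2_tangent, of z v z w] by (simp add: fr[OF z] gr[OF z])
  qed
  ultimately show "antisymplectic_involution P \<omega>\<^sub>P (reflection \<psi>)"
    using rr by (simp add: antisymplectic_involution_def tangent_space_def)
  assume L: "{x \<in> points M\<^sub>2. \<psi> x = x} = L"
  show "{z \<in> points P. reflection \<psi> z = z} = graph"
  proof (intro equalityI subsetI)
    fix z assume "z \<in> {z \<in> points P. reflection \<psi> z = z}"
    then have z: "z \<in> points P" "reflection \<psi> z = z" by auto
    have "f z = (g z, \<psi> (snd (f z)))" using fr[OF z(1)] z(2) by simp
    then have "fst (f z) = g z" "\<psi> (snd (f z)) = snd (f z)" by (metis fst_conv, metis snd_conv)
    then show "z \<in> graph" using z f2_points[OF z(1)] L by (auto simp: graph_def)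
  next
    fix z assume z: "z \<in> graph"
    then have "\<psi> (snd (f z)) = snd (f z)" "fst (f z) = g z" using L by (auto simp: graph_def)
    then show "z \<in> {z \<in> points P. reflection \<psi> z = z}"
      using fr[OF graph_points[OF z]] gr[OF graph_points[OF z]] graph_points[OF z]
      by (auto intro!: J_eqI rP simp: prod_eq_iff)
  qed
qed

text \<open>The Lagrangian conjecture speaks of a product with a point. Thus the real copy
  \<open>T\<close> takes the place of the second factor and carries the Lagrangian and the
  involution, while the map, its flow and the fixed points belong to \<open>?P\<close>; this is why
  both need the graph construction.\<close>

lemma AG_inequality_reduction:
  fixes M\<^sub>1 :: "'a manifold" and M\<^sub>2 :: "'b manifold"
  assumes LAG: "Lagrangian_Arnold_Givental TYPE(real) TYPE(real)"
    and data: "AG_data M\<^sub>1 \<omega>\<^sub>1 M\<^sub>2 \<omega>\<^sub>2 k L \<psi> \<phi>"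
  shows "AG_inequality M\<^sub>1 \<omega>\<^sub>1 M\<^sub>2 \<omega>\<^sub>2 k L \<phi>"
proof -
  from data have symplectic1: "symplectic_manifold M\<^sub>1 \<omega>\<^sub>1" and cM1: "compact_space (mtop M\<^sub>1)"
    and symplectic2: "symplectic_manifold M\<^sub>2 \<omega>\<^sub>2" and lagrangian_L: "lagrangian_submanifold M\<^sub>2 \<omega>\<^sub>2 k L" and cL: "compactin (mtop M\<^sub>2) L"
    and \<psi>: "antisymplectic_involution M\<^sub>2 \<omega>\<^sub>2 \<psi>" and fixL: "{x \<in> points M\<^sub>2. \<psi> x = x} = L"
    and \<phi>: "\<phi> \<in> Ham (prod_manifold M\<^sub>1 M\<^sub>2) (prod_form M\<^sub>1 \<omega>\<^sub>1 M\<^sub>2 \<omega>\<^sub>2)"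
    and nd: "nondegenerate_pair (prod_manifold M\<^sub>1 M\<^sub>2) (prod_form M\<^sub>1 \<omega>\<^sub>1 M\<^sub>2 \<omega>\<^sub>2) (points M\<^sub>1 \<times> L) \<phi>"
    by (simp_all add: AG_data_def closed_manifold_def)
  interpret lagrangian_factor M\<^sub>1 \<omega>\<^sub>1 M\<^sub>2 \<omega>\<^sub>2 k L
    using symplectic1 symplectic2 lagrangian_L by unfold_locales
  let ?Q = "prod_manifold M M\<^sub>1" and ?\<Omega>Q = "prod_form M \<Omega> M\<^sub>1 (\<lambda>x v w. - \<omega>\<^sub>1 x v w)"
  have symplectic_Q: "symplectic_manifold ?Q ?\<Omega>Q"
    by (rule symplectic_manifold_prod[OF symplectic_M symplectic_manifold_uminus[OF symplectic1]])
  then have "second_countable (mtop ?Q)" "Hausdorff_space (mtop ?Q)" and atlas_Q: "smooth_atlas ?Q"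
    by (auto simp: symplectic_manifold_def smooth_manifold_iff)
  then obtain e :: "('a \<times> 'b) \<times> 'a \<Rightarrow> real" where e: "inj_on e (points ?Q)"
    using second_countable_Hausdorff_inj_real by blast
  define T where "T = transport e ?Q"
  define \<omega>T where "\<omega>T = transport_form e ?Q ?\<Omega>Q"
  define h where "h = inv_into (points ?Q) e"
  have symplectic_T: "symplectic_manifold T \<omega>T"
    unfolding T_def \<omega>T_def by (rule symplectic_manifold_transport[OF e symplectic_Q])
  then have atlas_T: "smooth_atlas T" by (simp add: symplectic_manifold_def smooth_manifold_iff)
  have hs: "smooth_map_on T (points T) ?Q h"
    unfolding T_def h_def by (rule smooth_transport_inv[OF e atlas_Q])
  have es: "smooth_map_on ?Q (points ?Q) T e"
    unfolding T_def by (rule smooth_transport[OF e atlas_Q subset_refl])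
  have he: "h (e p) = p" if "p \<in> points ?Q" for p
    unfolding h_def by (rule e_inv_left[OF e that])
  have eh: "e (h z) = z" if "z \<in> points T" for z
    using that he by (auto simp: T_def points_transport[OF e])
  have dimT: "mdim T = mdim M + mdim M\<^sub>1"
    by (simp add: T_def transport_simps[OF e])
  note hp = smooth_map_onD_points[OF hs]
  have f_h: "smooth_map_on T (points T) M (\<lambda>z. fst (h z))" and g_h: "smooth_map_on T (points T) M\<^sub>1 (\<lambda>z. snd (h z))"
    by (rule smooth_map_on_compose[OF atlas_T atlas_Q hs smooth_fst[OF atlas_M atlas1, of "points ?Q"] hp]
        smooth_map_on_compose[OF atlas_T atlas_Q hs smooth_snd[OF atlas_M atlas1, of "points ?Q"] hp], assumption+)+
  have T: "graph_construction M\<^sub>1 \<omega>\<^sub>1 M\<^sub>2 \<omega>\<^sub>2 k L T \<omega>T (\<lambda>z. fst (h z)) (\<lambda>z. snd (h z)) e"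
  proof unfold_locales
    show "fst (h (e (x, y))) = x" "snd (h (e (x, y))) = y" if "x \<in> points M" "y \<in> points M\<^sub>1" for x y
      using he[of "(x, y)"] that by auto
    show "e (fst (h z), snd (h z)) = z" if "z \<in> points T" for z using eh[OF that] by simp
    fix z v w assume z: "z \<in> points T" and vw: "v \<in> Espace (mdim T)" "w \<in> Espace (mdim T)"
    have 1: "differential T M (\<lambda>z. fst (h z)) z u = differential ?Q M fst (h z) (differential T ?Q h z u)"
      and 2: "differential T M\<^sub>1 (\<lambda>z. snd (h z)) z u = differential ?Q M\<^sub>1 snd (h z) (differential T ?Q h z u)"
      if "u \<in> Espace (mdim T)" for u
      by (rule differential_chain[OF atlas_T atlas_Q atlas_M hs openin_topspace smooth_fst[OF atlas_M atlas1] openin_topspace hp z that]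
          differential_chain[OF atlas_T atlas_Q atlas1 hs openin_topspace smooth_snd[OF atlas_M atlas1] openin_topspace hp z that], assumption+)+
    have "\<omega>T z v w = ?\<Omega>Q (h z) (differential T ?Q h z v) (differential T ?Q h z w)"
      by (simp add: \<omega>T_def transport_form_def T_def h_def)
    also have "\<dots> = \<Omega> (fst (h z)) (differential T M (\<lambda>z. fst (h z)) z v) (differential T M (\<lambda>z. fst (h z)) z w)
        - \<omega>\<^sub>1 (snd (h z)) (differential T M\<^sub>1 (\<lambda>z. snd (h z)) z v) (differential T M\<^sub>1 (\<lambda>z. snd (h z)) z w)"
      unfolding 1[OF vw(1)] 1[OF vw(2)] 2[OF vw(1)] 2[OF vw(2)] prod_form_def[of M] by simp
    finally show "\<omega>T z v w = \<Omega> (fst (h z)) (differential T M (\<lambda>z. fst (h z)) z v) (differential T M (\<lambda>z. fst (h z)) z w)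
        - \<omega>\<^sub>1 (snd (h z)) (differential T M\<^sub>1 (\<lambda>z. snd (h z)) z v) (differential T M\<^sub>1 (\<lambda>z. snd (h z)) z w)" .
  qed (use atlas_T f_h g_h es in auto)
  interpret T: graph_construction M\<^sub>1 \<omega>\<^sub>1 M\<^sub>2 \<omega>\<^sub>2 k L T \<omega>T "\<lambda>z. fst (h z)" "\<lambda>z. snd (h z)" e
    by (rule T)
  let ?P = "prod_manifold point_manifold T" and ?\<omega>P = "prod_form point_manifold (\<lambda>_ _ _. 0) T \<omega>T"
  have atlas_point: "smooth_atlas point_manifold"
    using symplectic_point_manifold by (simp add: symplectic_manifold_def smooth_manifold_iff)
  note atlas_P = smooth_atlas_prod[OF atlas_point atlas_T]
  note sP = smooth_snd[OF atlas_point atlas_T]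
  have sndP: "snd z \<in> points T" if "z \<in> points ?P" for z using that by auto
  have P: "graph_construction M\<^sub>1 \<omega>\<^sub>1 M\<^sub>2 \<omega>\<^sub>2 k L ?P ?\<omega>P (\<lambda>z. fst (h (snd z))) (\<lambda>z. snd (h (snd z))) (\<lambda>p. (0, e p))"
  proof unfold_locales
    show "smooth_atlas ?P" by (rule atlas_P)
    show "smooth_map_on ?P (points ?P) M (\<lambda>z. fst (h (snd z)))" "smooth_map_on ?P (points ?P) M\<^sub>1 (\<lambda>z. snd (h (snd z)))"
      by (rule smooth_map_on_compose[OF atlas_P atlas_T sP f_h sndP] smooth_map_on_compose[OF atlas_P atlas_T sP g_h sndP], assumption)+
    show "smooth_map_on ?Q (points ?Q) ?P (\<lambda>p. (0, e p))"
      by (intro smooth_pair[OF atlas_point atlas_T] smooth_map_on_const[OF atlas_Q] es) simp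
    show "fst (h (snd (0, e (x, y)))) = x" "snd (h (snd (0, e (x, y)))) = y" if "x \<in> points M" "y \<in> points M\<^sub>1" for x y
      using T.fJ[OF that] T.gJ[OF that] by auto
    show "(0, e (fst (h (snd z)), snd (h (snd z)))) = z" if "z \<in> points ?P" for z
      using that eh[OF sndP[OF that]] by (auto simp: prod_eq_iff)
    fix z v w assume z: "z \<in> points ?P" and vw: "v \<in> Espace (mdim ?P)" "w \<in> Espace (mdim ?P)"
    have 1: "differential ?P M (\<lambda>z. fst (h (snd z))) z u = differential T M (\<lambda>z. fst (h z)) (snd z) (differential ?P T snd z u)"
      and 2: "differential ?P M\<^sub>1 (\<lambda>z. snd (h (snd z))) z u = differential T M\<^sub>1 (\<lambda>z. snd (h z)) (snd z) (differential ?P T snd z u)"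
      if "u \<in> Espace (mdim ?P)" for u
      by (rule differential_chain[OF atlas_P atlas_T atlas_M sP openin_topspace f_h openin_topspace sndP z that]
          differential_chain[OF atlas_P atlas_T atlas1 sP openin_topspace g_h openin_topspace sndP z that], assumption+)+
    have "?\<omega>P z v w = \<omega>T (snd z) (differential ?P T snd z v) (differential ?P T snd z w)"
      by (simp add: prod_form_def)
    also have "\<dots> = \<Omega> (fst (h (snd z))) (differential ?P M (\<lambda>z. fst (h (snd z))) z v) (differential ?P M (\<lambda>z. fst (h (snd z))) z w)
        - \<omega>\<^sub>1 (snd (h (snd z))) (differential ?P M\<^sub>1 (\<lambda>z. snd (h (snd z))) z v) (differential ?P M\<^sub>1 (\<lambda>z. snd (h (snd z))) z w)"
      unfolding 1[OF vw(1)] 1[OF vw(2)] 2[OF vw(1)] 2[OF vw(2)]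
      by (rule T.form_P[OF sndP[OF z] differential_tangent differential_tangent])
    finally show "?\<omega>P z v w = \<Omega> (fst (h (snd z))) (differential ?P M (\<lambda>z. fst (h (snd z))) z v) (differential ?P M (\<lambda>z. fst (h (snd z))) z w)
        - \<omega>\<^sub>1 (snd (h (snd z))) (differential ?P M\<^sub>1 (\<lambda>z. snd (h (snd z))) z v) (differential ?P M\<^sub>1 (\<lambda>z. snd (h (snd z))) z w)" .
  qed
  interpret P: graph_construction M\<^sub>1 \<omega>\<^sub>1 M\<^sub>2 \<omega>\<^sub>2 k L ?P ?\<omega>P "\<lambda>z. fst (h (snd z))" "\<lambda>z. snd (h (snd z))" "\<lambda>p. (0, e p)"
    by (rule P)
  \<comment> \<open>Brings the graph in \<open>?P\<close> into the product form that
    \<open>AG_data\<close> prescribes for the submanifold.\<close>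
  have graph: "P.graph = points point_manifold \<times> T.graph"
    by (auto simp: P.graph_def T.graph_def)
  have \<phi>s: "smooth_map_on M (points M) M \<phi>" using \<phi> by (simp add: Ham_def diffeomorphism_def)
  have "AG_data point_manifold (\<lambda>_ _ _. 0) T \<omega>T (mdim M\<^sub>1 + k) T.graph (T.reflection \<psi>) (P.lift \<phi>)"
    unfolding AG_data_def
  proof (intro conjI)
    show "closed_manifold point_manifold"
      using symplectic_point_manifold by (simp add: closed_manifold_def symplectic_manifold_def compact_space_discrete_topology)
    show "nondegenerate_pair ?P ?\<omega>P (points point_manifold \<times> T.graph) (P.lift \<phi>)"
      using P.nondegenerate_pair_lift[OF \<phi>s nd] by (simp only: graph)
  qed (intro symplectic_point_manifold symplectic_T T.lagrangian_graph[OF dimT] T.compact_graph[OF cM1 cL] T.reflection[OF \<psi>] fixL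
      P.Ham_lift[OF \<phi>])+
  moreover have "\<exists>p. points point_manifold = {p}" by simp
  ultimately have "AG_inequality point_manifold (\<lambda>_ _ _. 0) T \<omega>T (mdim M\<^sub>1 + k) T.graph (P.lift \<phi>)"
    using LAG unfolding Lagrangian_Arnold_Givental_def by blast
  \<comment> \<open>The point has dimension 0, so the sum has the same range as the one for
    \<open>N\<close>.\<close>
  then have "(\<Sum>i\<le>mdim M\<^sub>1 + k. mod2_betti i (subtopology (mtop ?P) P.graph))
      \<le> cardinality (leafwise_fixed_points ?P ?\<omega>P P.graph (P.lift \<phi>))"
    unfolding AG_inequality_def graph by (simp del: prod_manifold_simps)
  moreover have "(\<Sum>i\<le>mdim M\<^sub>1 + k. mod2_betti i (subtopology (mtop M) N))
      \<le> (\<Sum>i\<le>mdim M\<^sub>1 + k. mod2_betti i (subtopology (mtop ?P) P.graph))"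
    by (intro sum_mono mod2_betti_le[OF P.graph_homeomorphic])
  moreover note P.cardinality_leafwise_fixed_points_lift[OF \<phi>s]
  ultimately show ?thesis unfolding AG_inequality_def by (meson order_trans)
qed

text \<open>The point types in the conclusion are arbitrary, whereas the hypothesis concerns
  manifolds of real numbers; the transport to \<open>real\<close> bridges the two.\<close>

theorem proposition4:
  assumes "Lagrangian_Arnold_Givental TYPE(real) TYPE(real)"
  shows "coisotropic_Arnold_Givental TYPE('a) TYPE('b)"
  unfolding coisotropic_Arnold_Givental_def using AG_inequality_reduction[OF assms] by blast

end
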